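(* Let $l,m\geq2$ be integers with $1/l+1/m<1$, $\lambda\in\mathbb{C}\setminus\{0\}$ and $f_\lambda(z)=z^m+\lambda/z^l$. Suppose that the free critical points of $f_\lambda$ are escaping (attracted to $\infty$) and that the Julia set $J_\lambda$ is a Sierpiński carpet. Let $\{\gamma_i\}_{i\in\mathbb{N}}$ be the collection of the boundaries of all the Fatou components of $f_\lambda$. Then there exists a constant $K\geq1$ such that every $\gamma_i$ is a $K$-quasicircle, and $\{\gamma_i\}_{i\in\mathbb{N}}$ is uniformly relatively separated.
   Context: The free critical points of $f_\lambda$ are $\omega_j=e^{2\pi ij/(l+m)}(\lambda l/m)^{1/(l+m)}$, $0\le j<l+m$. A Sierpiński carpet is a connected, locally connected compact set $S\subset\overline{\mathbb{C}}$ with empty interior of the form $\overline{\mathbb{C}}\setminus\bigcup_iD_i$ with $D_i$ Jordan regions, $\partial D_i\cap\partial D_j=\emptyset$ for $i\ne j$, spherical diameters of $\partial D_i$ tending to $0$. A Jordan curve is a $K$-quasicircle if it is the image of the unit circle under a $K$-quasiconformal homeomorphism of $\overline{\mathbb{C}}$. A family of Jordan curves $\{\gamma_i\}$ is uniformly relatively separated if there is $s>0$ with $\mathrm{dist}(\gamma_i,\gamma_j)/\min\{\mathrm{diam}(\gamma_i),\mathrm{diam}(\gamma_j)\}\ge s$ for all $i\ne j$ (spherical metric). *)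

theory Defs
  imports "HOL-Analysis.Analysis"
begin

definition S2 :: "(real^3) set" where
  "S2 = sphere 0 1"

definition Npole :: "real^3" where
  "Npole = vector [0, 0, 1]"

text \<open>Inverse stereographic projection C -> S2 (infinity corresponds to Npole).\<close>
definition stereo :: "complex \<Rightarrow> real^3" where
  "stereo z = vector [2 * Re z / (1 + (cmod z)^2), 2 * Im z / (1 + (cmod z)^2),
                      ((cmod z)^2 - 1) / ((cmod z)^2 + 1)]"

definition unstereo :: "real^3 \<Rightarrow> complex" where
  "unstereo p = Complex (p$1 / (1 - p$3)) (p$2 / (1 - p$3))"

definition sdist :: "real^3 \<Rightarrow> real^3 \<Rightarrow> real" where
  "sdist p q = 2 * arcsin (dist p q / 2)"

definition sdiam :: "(real^3) set \<Rightarrow> real" where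
  "sdiam A = Sup {sdist x y | x y. x \<in> A \<and> y \<in> A}"

text \<open>Boundary (relative to S2) of a set open in S2.\<close>
definition sbdry :: "(real^3) set \<Rightarrow> (real^3) set" where
  "sbdry U = closure U - U"

definition flam :: "complex \<Rightarrow> nat \<Rightarrow> nat \<Rightarrow> real^3 \<Rightarrow> real^3" where
  "flam lam l m p =
     (if p = Npole then Npole
      else (let z = unstereo p in
            if z = 0 then Npole else stereo (z ^ m + lam / z ^ l)))"

text \<open>A family of maps indexed by nat is normal on U if every sequence from the family
  has a subsequence converging locally uniformly on U (chordal metric, which is uniformly
  equivalent to the spherical metric on S2).\<close>
definition normal_family :: "(nat \<Rightarrow> real^3 \<Rightarrow> real^3) \<Rightarrow> (real^3) set \<Rightarrow> bool" where
  "normal_family F U \<longleftrightarrow>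
     (\<forall>k :: nat \<Rightarrow> nat. \<exists>r g. strict_mono r \<and>
        (\<forall>K. compact K \<and> K \<subseteq> U \<longrightarrow> uniform_limit K (\<lambda>j. F (k (r j))) g sequentially))"

definition fatou_set :: "(real^3 \<Rightarrow> real^3) \<Rightarrow> (real^3) set" where
  "fatou_set f = {p \<in> S2. \<exists>U. openin (top_of_set S2) U \<and> p \<in> U \<and>
                              normal_family (\<lambda>n. f ^^ n) U}"

definition julia_set :: "(real^3 \<Rightarrow> real^3) \<Rightarrow> (real^3) set" where
  "julia_set f = S2 - fatou_set f"

definition fatou_components :: "(real^3 \<Rightarrow> real^3) \<Rightarrow> (real^3) set set" where
  "fatou_components f = components (fatou_set f)"

definition jordan_curve :: "(real^3) set \<Rightarrow> bool" where
  "jordan_curve C \<longleftrightarrow> C \<subseteq> S2 \<and>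
     (\<exists>g. simple_path g \<and> pathfinish g = pathstart g \<and> path_image g = C)"

definition jordan_region :: "(real^3) set \<Rightarrow> bool" where
  "jordan_region D \<longleftrightarrow> (\<exists>C. jordan_curve C \<and> D \<in> components (S2 - C))"

definition sierpinski_carpet :: "(real^3) set \<Rightarrow> bool" where
  "sierpinski_carpet S \<longleftrightarrow>
     S \<subseteq> S2 \<and> compact S \<and> connected S \<and> locally connected S \<and>
     (top_of_set S2) interior_of S = {} \<and>
     (\<exists>D :: nat \<Rightarrow> (real^3) set.
        (\<forall>i. jordan_region (D i)) \<and>
        S = S2 - (\<Union>i. D i) \<and>
        (\<forall>i j. i \<noteq> j \<longrightarrow> sbdry (D i) \<inter> sbdry (D j) = {}) \<and>
        (\<lambda>i. sdiam (sbdry (D i))) \<longlonglongrightarrow> 0)"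

text \<open>Metric (circular) dilatation bound: limsup_{r->0+} L(x,r)/l(x,r) \<le> H, where
  L(x,r) = sup{d(phi y, phi x) : d(y,x) = r}, l(x,r) = inf{d(phi z, phi x) : d(z,x) = r},
  spherical metric d.\<close>
definition dilat_le :: "real \<Rightarrow> (real^3 \<Rightarrow> real^3) \<Rightarrow> real^3 \<Rightarrow> bool" where
  "dilat_le H \<phi> x \<longleftrightarrow>
     (\<forall>\<epsilon>>0. \<exists>\<delta>>0. \<forall>r y z. 0 < r \<and> r < \<delta> \<and> y \<in> S2 \<and> z \<in> S2 \<and>
        sdist y x = r \<and> sdist z x = r \<longrightarrow>
        sdist (\<phi> y) (\<phi> x) \<le> (H + \<epsilon>) * sdist (\<phi> z) (\<phi> x))"

text \<open>K-quasiconformal homeomorphism of the sphere (metric characterisation: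
  dilatation finite everywhere and at most K almost everywhere; null sets on the sphere
  are taken via the stereographic chart).\<close>
definition quasiconformal :: "real \<Rightarrow> (real^3 \<Rightarrow> real^3) \<Rightarrow> bool" where
  "quasiconformal K \<phi> \<longleftrightarrow>
     (\<exists>\<psi>. homeomorphism S2 S2 \<phi> \<psi>) \<and>
     (\<forall>x\<in>S2. \<exists>H. dilat_le H \<phi> x) \<and>
     negligible {z :: complex. \<not> dilat_le K \<phi> (stereo z)}"

definition quasicircle :: "real \<Rightarrow> (real^3) set \<Rightarrow> bool" where
  "quasicircle K C \<longleftrightarrow>
     (\<exists>\<phi>. quasiconformal K \<phi> \<and> C = \<phi> ` (stereo ` sphere (0::complex) 1))"

end

theory Submission
  imports Defs "HOL-Complex_Analysis.Complex_Analysis" "HOL-Computational_Algebra.Fundamental_Theorem_Algebra"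
begin

text \<open>By a criterion of Ahlfors, the first claim follows once the boundary curves have bounded turning with a
 common constant C: two points x, y of a curve lie in a connected part of it of diameter at most C |x - y|.
 To prove the criterion, send a point of the curve to infinity and take the Riemann maps of a half-plane onto the two
 complementary domains. The length-area method extends them to the boundary and shows that the induced
 homeomorphism of the real line is quasisymmetric; precomposing one of them with its Beurling-Ahlfors extension makes
 the two maps agree on the line, and the result is a homeomorphism with bounded circular dilatation at every point.

 The uniform constants come from the dynamics. The free critical points escape, so the Julia set has a neighbourhood
 of uniform size free of postcritical points, on which all inverse branches are defined and satisfy the Koebe distortion
 bounds. Hence some iterate maps a given small disc centred on the Julia set to definite size with bounded distortion.
 At that scale only finitely many boundary curves are not small, so local connectivity and mutual distance of the
 curves are uniform there; pulling back by the inverse branch gives bounded turning and relative separation at all scales.\<close>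

text \<open>An iterate reaches definite size only if the derivatives of the iterates are unbounded
  at every point of the Julia set. This is obtained without a hyperbolic metric, from Koebe
  distortion and a Montel limit of inverse branches. A pulled-back arc must not leave its boundary
  curve. Only finitely many components map into a given one, and their boundaries are disjoint
  closed sets, so a connected set that maps into one boundary curve cannot pass from one curve to
  another. The same fact gives separation: two large curves that come too close are elevated into
  one curve, and the short arc between the two image points, pulled back, would join both original
  points inside the first curve. Quasiconformality is meant metrically. One dilatation bound is
  proved at every point, also on the curve and at infinity, so the exceptional null set is empty.
  The Julia set is handled in the plane, as the set of points whose orbits stay in an annulus that
  avoids the pole and infinity.\<close>

unbundle no fps_syntax

section \<open>The length-area method\<close>

text \<open>Holomorphic functions live on \<open>complex\<close>, Jacobian determinants on
  \<open>real^2\<close>; these linear maps carry the area computation from one to the other.\<close>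

definition r2c :: "real^2 => complex" where "r2c v = Complex (v$1) (v$2)"
definition c2r :: "complex => real^2" where "c2r z = vector [Re z, Im z]"

lemma c2r_nth [simp]: "c2r z $ 1 = Re z" "c2r z $ 2 = Im z" by (simp_all add: c2r_def)

lemma r2c_c2r [simp]: "r2c (c2r z) = z" by (simp add: r2c_def)

lemma c2r_r2c [simp]: "c2r (r2c v) = v" by (simp add: r2c_def vec_eq_iff forall_2)

lemma linear_r2c: "linear r2c" by (rule linearI) (auto simp: r2c_def complex_eq_iff)

lemma linear_c2r: "linear c2r" by (rule linearI) (auto simp: vec_eq_iff forall_2)

lemma r2c_has_derivative: "(r2c has_derivative r2c) F" by (intro linear_imp_has_derivative linear_r2c)

lemma c2r_has_derivative: "(c2r has_derivative c2r) F" by (intro linear_imp_has_derivative linear_c2r)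

lemma continuous_on_r2c: "continuous_on S r2c" by (simp add: linear_continuous_on linear_conv_bounded_linear[symmetric] linear_r2c)

lemma continuous_on_c2r: "continuous_on S c2r" by (simp add: linear_continuous_on linear_conv_bounded_linear[symmetric] linear_c2r)

lemma continuous_on_c2r_Complex: "continuous_on S (%(x,y). c2r (Complex x y))"
proof -
 have "continuous_on S (%p. of_real (fst p) + \<i> * of_real (snd p))" by (intro continuous_intros)
 hence "continuous_on S (%p. c2r (of_real (fst p) + \<i> * of_real (snd p)))" by (rule continuous_on_compose2[OF continuous_on_c2r[of UNIV]]) auto
 thus ?thesis by (simp add: split_def Complex_eq)
qed

lemma Basis_vec2: "(Basis :: (real^2) set) = {axis 1 1, axis 2 1}" by (auto simp: Basis_vec_def UNIV_2)

text \<open>Lebesgue measure is determined by the volumes of boxes, and a box pulls back to a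
  product of intervals. Through this identification Fubini applies to areas in
  \<open>real^2\<close>.\<close>

lemma lborel_vec2: "distr (lborel \<Otimes>\<^sub>M lborel) borel (%(x,y). c2r (Complex x y)) = (lborel :: (real^2) measure)"
proof (rule lborel_eqI[symmetric])
 let ?s = "%(x,y). c2r (Complex x y)"
 have c: "continuous_on UNIV ?s" by (rule continuous_on_c2r_Complex)
 have m: "?s \<in> borel_measurable (lborel \<Otimes>\<^sub>M lborel)" unfolding lborel_prod using borel_measurable_continuous_onI[OF c] by simp
 fix l u :: "real^2"
 assume lu: "!!b. b \<in> Basis ==> l \<bullet> b <= u \<bullet> b"
 have l1: "l$1 <= u$1" "l$2 <= u$2" using lu[of "axis 1 1"] lu[of "axis 2 1"] by (auto simp: Basis_vec2 inner_axis)
 have pre: "?s -` box l u \<inter> space (lborel \<Otimes>\<^sub>M lborel) = {l$1<..<u$1} \<times> {l$2<..<u$2}" by (auto simp: mem_box_cart space_pair_measure forall_2)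
 have "emeasure (distr (lborel \<Otimes>\<^sub>M lborel) borel ?s) (box l u) = emeasure (lborel \<Otimes>\<^sub>M lborel) ({l$1<..<u$1} \<times> {l$2<..<u$2})"
  by (subst emeasure_distr[OF m]) (simp_all add: pre)
 also have "\<dots> = emeasure lborel {l$1<..<u$1} * emeasure lborel {l$2<..<u$2}" by (rule lborel.emeasure_pair_measure_Times) auto
 also have "\<dots> = ennreal ((u$1 - l$1) * (u$2 - l$2))" using l1 by (simp add: ennreal_mult)
 also have "\<dots> = ennreal (\<Prod>b\<in>Basis. (u - l) \<bullet> b)"
 proof -
  have "axis (1::2) (1::real) ~= axis 2 1" by (simp add: axis_eq_axis)
  thus ?thesis by (simp add: Basis_vec2 inner_axis)
 qed
 finally show "emeasure (distr (lborel \<Otimes>\<^sub>M lborel) borel ?s) (box l u) = ennreal (\<Prod>b\<in>Basis. (u - l) \<bullet> b)" .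
qed simp

lemma nn_integral_vec2:
 assumes "h \<in> borel_measurable borel"
 shows "(\<integral>\<^sup>+v. h v \<partial>(lborel :: (real^2) measure)) = (\<integral>\<^sup>+x. \<integral>\<^sup>+y. h (c2r (Complex x y)) \<partial>lborel \<partial>lborel)"
proof -
 have c: "continuous_on UNIV (%(x,y). c2r (Complex x y))" by (rule continuous_on_c2r_Complex)
 hence m: "(%(x,y). c2r (Complex x y)) \<in> borel_measurable (lborel \<Otimes>\<^sub>M lborel)" unfolding lborel_prod using borel_measurable_continuous_onI[OF c] by simp
 have "(\<integral>\<^sup>+v. h v \<partial>(lborel :: (real^2) measure)) = (\<integral>\<^sup>+p. h ((%(x,y). c2r (Complex x y)) p) \<partial>(lborel \<Otimes>\<^sub>M lborel))"
  by (subst lborel_vec2[symmetric], subst nn_integral_distr[OF m]) (use assms in auto)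
 also have "\<dots> = (\<integral>\<^sup>+x. \<integral>\<^sup>+y. h (c2r (Complex x y)) \<partial>lborel \<partial>lborel)"
  using measurable_compose[OF m, of h borel] assms by (subst lborel.nn_integral_fst[symmetric]) (auto simp: split_def)
 finally show ?thesis .
qed

lemma det_complex_mult: "det (matrix (%v. c2r (d * r2c v))) = (cmod d)\<^sup>2" by (simp add: det_2 matrix_def r2c_def axis_def cmod_power2) (simp add: power2_eq_square)

lemma borel_indicator_open:
 fixes g :: "'a::euclidean_space => real"
 assumes "open T" "continuous_on T g"
 shows "(%x. indicator T x * g x) \<in> borel_measurable borel" "(%x. indicator T x * ennreal (g x)) \<in> borel_measurable borel"
proof -
 have "(%x. indicator T x *\<^sub>R g x) \<in> borel_measurable borel" using assms by (intro borel_measurable_continuous_on_indicator) auto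
 thus 1: "(%x. indicator T x * g x) \<in> borel_measurable borel" by simp
 have "(%x. indicator T x * ennreal (g x)) = (%x. ennreal (indicator T x * g x))" by (auto simp: fun_eq_iff indicator_def)
 thus "(%x. indicator T x * ennreal (g x)) \<in> borel_measurable borel" using 1 by simp
qed

text \<open>By injectivity the integral is the area of the image, since the Jacobian of a
  holomorphic map is the squared modulus of its derivative. The disc is replaced by its
  circumscribed square, hence 4 instead of pi.\<close>

lemma area_injective:
 assumes "open S" and hol: "Q holomorphic_on S" and inj: "inj_on Q S" and im: "Q ` S <= ball w \<rho>"
 shows "(\<integral>\<^sup>+x. \<integral>\<^sup>+y. indicator S (Complex x y) * ennreal ((cmod (deriv Q (Complex x y)))\<^sup>2) \<partial>lborel \<partial>lborel) <= ennreal (4 * \<rho>\<^sup>2)"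
proof (cases "S = {}")
 case True thus ?thesis by simp
next
 case False
 hence rho: "\<rho> > 0" using im by (metis ball_empty image_is_empty linorder_not_le subset_empty)
 define S' where "S' = r2c -` S"
 define q where "q = c2r \<circ> Q \<circ> r2c"
 have oS': "open S'" unfolding S'_def using continuous_on_r2c[of UNIV] \<open>open S\<close> by (simp add: continuous_on_open_vimage)
 have der: "(q has_derivative (%v. c2r (deriv Q (r2c x) * r2c v))) (at x within S')" if "x \<in> S'" for x
 proof -
  have "(Q has_field_derivative deriv Q (r2c x)) (at (r2c x))" using that hol \<open>open S\<close> by (auto simp: S'_def holomorphic_derivI)
  hence "(Q has_derivative (*) (deriv Q (r2c x))) (at (r2c x))" by (simp add: has_field_derivative_def)
  hence "(c2r \<circ> Q \<circ> r2c has_derivative c2r \<circ> ((*) (deriv Q (r2c x))) \<circ> r2c) (at x)" by (intro diff_chain_at r2c_has_derivative c2r_has_derivative)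
  thus ?thesis by (auto simp: q_def o_def intro: has_derivative_at_withinI)
 qed
 have injq: "inj_on q S'" using inj unfolding q_def S'_def inj_on_def by (metis (mono_tags, lifting) c2r_r2c comp_apply r2c_c2r vimage_eq)
 have sub: "q ` S' <= cbox (c2r w - vector [\<rho>,\<rho>]) (c2r w + vector [\<rho>,\<rho>])"
 proof clarify
  fix v assume "v \<in> S'"
  hence "dist w (Q (r2c v)) < \<rho>" using im by (auto simp: S'_def)
  hence "\<bar>Re w - Re (Q (r2c v))\<bar> < \<rho>" "\<bar>Im w - Im (Q (r2c v))\<bar> < \<rho>"
   by (metis abs_Re_le_cmod dist_complex_def le_less_trans minus_complex.sel(1))
     (metis \<open>dist w (Q (r2c v)) < \<rho>\<close> abs_Im_le_cmod dist_complex_def le_less_trans minus_complex.sel(2))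
  thus "q v \<in> cbox (c2r w - vector [\<rho>,\<rho>]) (c2r w + vector [\<rho>,\<rho>])" by (auto simp: mem_box_cart forall_2 q_def)
 qed
 have contdq: "continuous_on S' (%x. deriv Q (r2c x))"
 proof (rule continuous_on_compose2[of S "deriv Q" S' r2c])
  show "continuous_on S (deriv Q)" using hol \<open>open S\<close> by (intro holomorphic_on_imp_continuous_on holomorphic_deriv)
  show "r2c ` S' <= S" by (auto simp: S'_def)
 qed (rule continuous_on_r2c)
 have contq: "continuous_on S' q" by (rule has_derivative_continuous_on[OF der])
 have "open (q ` S')" using invariance_of_domain[OF contq oS' injq] .
 hence meas: "q ` S' \<in> lmeasurable" using bounded_set_imp_lmeasurable[OF bounded_subset[OF bounded_cbox sub]] by auto
 let ?J = "%x. \<bar>det (matrix (%v. c2r (deriv Q (r2c x) * r2c v)))\<bar>"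
 have int: "(?J has_integral measure lebesgue (q ` S')) S'" using has_measure_differentiable_image[OF _ der injq] oS' meas by auto
 have le: "measure lebesgue (q ` S') <= 4 * \<rho>\<^sup>2"
 proof -
  have "measure lebesgue (q ` S') <= measure lebesgue (cbox (c2r w - vector [\<rho>,\<rho>]) (c2r w + vector [\<rho>,\<rho>]))"
   using sub meas by (intro measure_mono_fmeasurable) auto
  also have "\<dots> = 4 * \<rho>\<^sup>2" using rho by (simp add: measure_completion content_cbox_cart interval_ne_empty_cart forall_2 UNIV_2 power2_eq_square)
  finally show ?thesis .
 qed
 have "continuous_on S' ?J" unfolding det_complex_mult by (intro continuous_intros contdq)
 note m = borel_indicator_open[OF oS' this]
 have "(\<integral>\<^sup>+x. \<integral>\<^sup>+y. indicator S (Complex x y) * ennreal ((cmod (deriv Q (Complex x y)))\<^sup>2) \<partial>lborel \<partial>lborel)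
   = (\<integral>\<^sup>+x. \<integral>\<^sup>+y. (%v. indicator S' v * ennreal (?J v)) (c2r (Complex x y)) \<partial>lborel \<partial>lborel)"
  by (simp add: det_complex_mult S'_def indicator_def)
 also have "\<dots> = (\<integral>\<^sup>+v. indicator S' v * ennreal (?J v) \<partial>lborel)" by (rule nn_integral_vec2[OF m(2), symmetric])
 also have "\<dots> = (\<integral>\<^sup>+v. ennreal (indicator S' v * ?J v) \<partial>lborel)" by (intro nn_integral_cong) (auto simp: indicator_def)
 also have "\<dots> = ennreal (measure lebesgue (q ` S'))"
 proof (rule nn_integral_has_integral_lborel)
  show "(%v. indicator S' v * ?J v) \<in> borel_measurable borel" by (rule m(1))
  show "((%v. indicator S' v * ?J v) has_integral measure lebesgue (q ` S')) UNIV"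
  proof -
   have "((%v. if v \<in> S' then ?J v else 0) has_integral measure lebesgue (q ` S')) UNIV" using int by (simp only: has_integral_restrict_UNIV)
   thus ?thesis by (rule has_integral_eq[rotated]) auto
  qed
 qed (simp add: indicator_def)
 also have "\<dots> <= ennreal (4 * \<rho>\<^sup>2)" using le by (simp add: ennreal_leI)
 finally show ?thesis .
qed

lemma vertical_length:
 assumes "open U" "Q holomorphic_on U" "v1 <= v2" "!!v. v1 <= v ==> v <= v2 ==> Complex u v \<in> U"
 shows "ennreal (cmod (Q (Complex u v2) - Q (Complex u v1)))
  <= (\<integral>\<^sup>+v. indicator {v1..v2} v * ennreal (cmod (deriv Q (Complex u v))) \<partial>lborel)"
proof -
 define g where "g = (%v. cmod (deriv Q (Complex u v)))"
 have cC: "continuous_on {v1..v2} (Complex u)" unfolding Complex_eq by (intro continuous_intros)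
 have "continuous_on U (deriv Q)" using assms by (intro holomorphic_on_imp_continuous_on holomorphic_deriv)
 hence cd: "continuous_on {v1..v2} (%v. deriv Q (Complex u v))" by (rule continuous_on_compose2[OF _ cC]) (use assms in auto)
 have cg: "continuous_on {v1..v2} g" unfolding g_def by (intro continuous_intros cd)
 have "((%v. Q (Complex u v)) has_vector_derivative \<i> * deriv Q (Complex u v)) (at v within {v1..v2})" if "v \<in> {v1..v2}" for v
 proof -
  have "(Q has_field_derivative deriv Q (Complex u v)) (at (Complex u v))" using that assms by (auto intro: holomorphic_derivI)
  moreover have "(Complex u has_vector_derivative \<i>) (at v within {v1..v2})" unfolding Complex_eq[abs_def] by (auto intro!: derivative_eq_intros)
  ultimately show ?thesis using field_vector_diff_chain_within[of "Complex u" \<i> v "{v1..v2}" Q "deriv Q (Complex u v)"]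
   by (auto simp: o_def has_field_derivative_at_within)
 qed
 hence "((%v. \<i> * deriv Q (Complex u v)) has_integral (Q (Complex u v2) - Q (Complex u v1))) {v1..v2}" by (intro fundamental_theorem_of_calculus assms)
 moreover have g: "g integrable_on {v1..v2}" using cg by (rule integrable_continuous_real)
 ultimately have le: "cmod (Q (Complex u v2) - Q (Complex u v1)) <= integral {v1..v2} g"
  by (metis (mono_tags, lifting) g_def has_integral_integrable integral_norm_bound_integral integral_unique mult.left_neutral norm_ii norm_mult order_refl)
 have "(\<integral>\<^sup>+v. indicator {v1..v2} v * ennreal (g v) \<partial>lborel) = (\<integral>\<^sup>+v. ennreal (indicator {v1..v2} v *\<^sub>R g v) \<partial>lborel)"
  by (intro nn_integral_cong) (auto simp: indicator_def)
 also have "\<dots> = ennreal (integral {v1..v2} g)"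
 proof (rule nn_integral_has_integral_lborel)
  show "(%v. indicator {v1..v2} v *\<^sub>R g v) \<in> borel_measurable borel" by (intro borel_measurable_continuous_on_indicator cg) auto
  show "((%v. indicator {v1..v2} v *\<^sub>R g v) has_integral integral {v1..v2} g) UNIV"
  proof -
   have "(g has_integral integral {v1..v2} g) {v1..v2}" using g by (rule integrable_integral)
   hence "((%v. if v \<in> {v1..v2} then g v else 0) has_integral integral {v1..v2} g) UNIV" by (simp only: has_integral_restrict_UNIV)
   thus ?thesis by (rule has_integral_eq[rotated]) auto
  qed
 qed (simp add: g_def indicator_def)
 finally show ?thesis using le by (simp add: g_def ennreal_leI)
qed

text \<open>A vertical line spends total length at most pi in the disjoint sets \<open>S j\<close>,
  and its image has length at least \<open>l j\<close> in each of them. The inequality 2 a b <= a^2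
  + b^2, integrated along the line, plays the role of Cauchy-Schwarz; integration over
  \<open>u\<close> and \<open>area_injective\<close> finish. Disjointness is what gains the factor
  \<open>N\<close> over a single set.\<close>

lemma length_area:
 fixes N :: nat
 assumes U: "U = {z. u1 < Re z & Re z < u2 & 0 < Im z & Im z < pi}" and "u1 < u2" and "N > 0"
  and Q: "Q holomorphic_on U" "inj_on Q U"
  and S: "!!j. j < N ==> open (S j)" "!!j. j < N ==> S j <= U" "disjoint_family_on S {..<N}"
    "!!j. j < N ==> Q ` S j <= ball w (\<rho> j)"
  and l: "!!j. j < N ==> 0 < l j" "!!j. j < N ==> (\<rho> j)\<^sup>2 <= K * (l j)\<^sup>2"
  and cross: "!!u j. [|u1 < u; u < u2; j < N|] ==> \<exists>v1 v2. 0 < v1 & v1 <= v2 & v2 < pi &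
    (\<forall>v. v1 < v --> v < v2 --> Complex u v \<in> S j) & l j <= cmod (Q (Complex u v2) - Q (Complex u v1))"
 shows "(u2 - u1) * N <= 4 * pi * K"
proof -
 have oU: "open U"
 proof -
  have "U = {z. u1 < Re z} \<inter> {z. Re z < u2} \<inter> {z. 0 < Im z} \<inter> {z. Im z < pi}" using U by auto
  thus ?thesis by (auto intro!: open_Int open_halfspace_Re_gt open_halfspace_Re_lt open_halfspace_Im_gt open_halfspace_Im_lt)
 qed
 define D where "D = (%u v. cmod (deriv Q (Complex u v)))"
 have contD: "continuous_on U (deriv Q)" using Q oU by (intro holomorphic_on_imp_continuous_on holomorphic_deriv)
 have cC: "continuous_on UNIV (Complex u)" for u unfolding Complex_eq[abs_def] by (intro continuous_intros)
 define T where "T = (%j u. Complex u -` S j)"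
 have oT: "open (T j u)" if "j < N" for j u unfolding T_def using S(1)[OF that] cC by (simp add: continuous_on_open_vimage)
 have mD: "(%v. indicator (T j u) v * ennreal (D u v ^ k)) \<in> borel_measurable borel" if "j < N" for j u k
 proof -
  have "continuous_on (T j u) (%v. deriv Q (Complex u v))"
   by (rule continuous_on_compose2[OF contD]) (insert S(2)[OF that], auto simp: T_def intro: continuous_on_subset[OF cC])
  hence "continuous_on (T j u) (%v. D u v ^ k)" unfolding D_def by (intro continuous_intros)
  thus ?thesis by (rule borel_indicator_open[OF oT[OF that]])
 qed
 \<comment> \<open>The weight that maximises 2 t N - t^2 pi; the maximum is N^2 / pi.\<close>
 define t where "t = real N / pi"
 have t0: "t > 0" using \<open>N > 0\<close> by (simp add: t_def)
 define b where "b = (%j u. \<integral>\<^sup>+v. indicator (T j u) v * ennreal (D u v ^ 2) \<partial>lborel)"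
 have line: "ennreal (real N ^ 2 / pi) <= (\<Sum>j<N. ennreal (1 / (l j)\<^sup>2) * b j u)" if u: "u1 < u" "u < u2" for u
 proof -
  have one: "ennreal (2 * t) <= ennreal (1 / (l j)\<^sup>2) * b j u + ennreal (t^2) * (\<integral>\<^sup>+v. indicator (T j u) v \<partial>lborel)"
   if j: "j < N" for j
  proof -
   obtain v1 v2 where v: "0 < v1" "v1 <= v2" "v2 < pi" "!!v. v1 < v ==> v < v2 ==> Complex u v \<in> S j"
     "l j <= cmod (Q (Complex u v2) - Q (Complex u v1))" using cross[OF u j] by metis
   have "ennreal (l j) <= ennreal (cmod (Q (Complex u v2) - Q (Complex u v1)))" using v by (simp add: ennreal_leI)
   also have "\<dots> <= (\<integral>\<^sup>+v. indicator {v1..v2} v * ennreal (D u v) \<partial>lborel)"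
    unfolding D_def by (rule vertical_length[OF oU Q(1) v(2)]) (use v u U in auto)
   also have "\<dots> = (\<integral>\<^sup>+v. indicator {v1<..<v2} v * ennreal (D u v) \<partial>lborel)"
   proof (rule nn_integral_cong_AE)
    have "AE v in lborel. v ~= v1 & v ~= v2" using AE_lborel_singleton[of v1] AE_lborel_singleton[of v2] by eventually_elim auto
    thus "AE v in lborel. indicator {v1..v2} v * ennreal (D u v) = indicator {v1<..<v2} v * ennreal (D u v)" by eventually_elim (auto simp: indicator_def)
   qed
   also have "\<dots> <= (\<integral>\<^sup>+v. indicator (T j u) v * ennreal (D u v) \<partial>lborel)"
    by (intro nn_integral_mono) (insert v, auto simp: indicator_def T_def)
   finally have a: "ennreal (l j) <= (\<integral>\<^sup>+v. indicator (T j u) v * ennreal (D u v) \<partial>lborel)" .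
   have lj: "l j > 0" using l j by auto
   have "ennreal (2 * t) = ennreal (2 * t / l j) * ennreal (l j)" using lj t0 by (simp add: ennreal_mult[symmetric])
   also have "\<dots> <= ennreal (2 * t / l j) * (\<integral>\<^sup>+v. indicator (T j u) v * ennreal (D u v) \<partial>lborel)" by (intro mult_left_mono a) auto
   also have "\<dots> = (\<integral>\<^sup>+v. ennreal (2 * t / l j) * (indicator (T j u) v * ennreal (D u v)) \<partial>lborel)"
    using mD[OF j, of u 1] by (subst nn_integral_cmult) auto
   also have "\<dots> <= (\<integral>\<^sup>+v. ennreal (1 / (l j)\<^sup>2) * (indicator (T j u) v * ennreal (D u v ^ 2)) + ennreal (t^2) * indicator (T j u) v \<partial>lborel)"
   proof (intro nn_integral_mono)
    fix v
    have "2 * t / l j * D u v <= 1 / (l j)\<^sup>2 * D u v ^ 2 + t^2"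
    proof -
     have "0 <= (D u v / l j - t)\<^sup>2" by simp
     thus ?thesis by (simp add: power2_diff power_divide mult_ac)
    qed
    thus "ennreal (2 * t / l j) * (indicator (T j u) v * ennreal (D u v)) <= ennreal (1 / (l j)\<^sup>2) * (indicator (T j u) v * ennreal (D u v ^ 2)) + ennreal (t^2) * indicator (T j u) v"
     using t0 lj by (auto simp: indicator_def ennreal_mult[symmetric] D_def simp flip: ennreal_plus intro!: ennreal_leI)
   qed
   also have "\<dots> = ennreal (1 / (l j)\<^sup>2) * b j u + ennreal (t^2) * (\<integral>\<^sup>+v. indicator (T j u) v \<partial>lborel)"
    unfolding b_def using mD[OF j, of u 2] oT[OF j, of u] by (subst nn_integral_add) (auto simp: nn_integral_cmult)
   finally show ?thesis .
  qed
  have "ennreal (2 * t * N) = (\<Sum>j<N. ennreal (2 * t))" using t0 by (simp add: ennreal_mult' ennreal_of_nat_eq_real_of_nat mult.commute)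
  also have "\<dots> <= (\<Sum>j<N. ennreal (1 / (l j)\<^sup>2) * b j u + ennreal (t^2) * (\<integral>\<^sup>+v. indicator (T j u) v \<partial>lborel))"
   using one by (intro sum_mono) auto
  also have "\<dots> = (\<Sum>j<N. ennreal (1 / (l j)\<^sup>2) * b j u) + ennreal (t^2) * (\<Sum>j<N. (\<integral>\<^sup>+v. indicator (T j u) v \<partial>lborel))"
   by (simp add: sum.distrib sum_distrib_left)
  also have "(\<Sum>j<N. (\<integral>\<^sup>+v. indicator (T j u) v \<partial>lborel)) <= ennreal pi"
  proof -
   have "(\<Sum>j<N. (\<integral>\<^sup>+v. indicator (T j u) v \<partial>lborel)) = (\<Sum>j<N. emeasure lborel (T j u))" using oT by (intro sum.cong) auto
   also have "\<dots> = emeasure lborel (\<Union>j<N. T j u)"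
   proof (rule sum_emeasure)
    show "disjoint_family_on (%j. T j u) {..<N}" using S(3) unfolding disjoint_family_on_def T_def by blast
   qed (use oT in auto)
   also have "\<dots> <= emeasure lborel {0..pi}"
   proof (rule emeasure_mono)
    show "(\<Union>j<N. T j u) <= {0..pi}" using S(2) unfolding T_def U by fastforce
   qed auto
   finally show ?thesis by simp
  qed
  finally have "ennreal (2 * t * N) <= (\<Sum>j<N. ennreal (1 / (l j)\<^sup>2) * b j u) + ennreal (t^2 * pi)" by (simp add: ennreal_mult add_left_mono mult_left_mono)
  moreover have "2 * t * N = real N ^ 2 / pi + t^2 * pi" by (simp add: t_def power2_eq_square field_simps)
  ultimately have "ennreal (real N ^ 2 / pi) + ennreal (t^2 * pi) <= (\<Sum>j<N. ennreal (1 / (l j)\<^sup>2) * b j u) + ennreal (t^2 * pi)" by (simp flip: ennreal_plus)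
  hence "ennreal (t^2 * pi) + ennreal (real N ^ 2 / pi) <= ennreal (t^2 * pi) + (\<Sum>j<N. ennreal (1 / (l j)\<^sup>2) * b j u)" by (simp only: add.commute)
  thus ?thesis unfolding ennreal_add_left_cancel_le by simp
 qed
 have mb: "(%u. b j u) \<in> borel_measurable borel" if "j < N" for j
 proof -
  have "continuous_on UNIV (%p. of_real (fst p) + \<i> * of_real (snd p) :: complex)" by (intro continuous_intros)
  hence mC: "(%(u,v). Complex u v) \<in> borel_measurable (lborel \<Otimes>\<^sub>M lborel)"
   unfolding lborel_prod using borel_measurable_continuous_onI by (simp add: split_def Complex_eq)
  have "continuous_on (S j) (%z. (cmod (deriv Q z))\<^sup>2)" by (intro continuous_intros continuous_on_subset[OF contD S(2)[OF that]])
  hence "(%z. indicator (S j) z *\<^sub>R (cmod (deriv Q z))\<^sup>2) \<in> borel_measurable borel"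
   using S(1)[OF that] by (intro borel_measurable_continuous_on_indicator) auto
  hence "(%z. ennreal (indicator (S j) z *\<^sub>R (cmod (deriv Q z))\<^sup>2)) \<in> borel_measurable borel" by simp
  from measurable_compose[OF mC this]
  have "(%(u,v). ennreal (indicator (S j) (Complex u v) *\<^sub>R (cmod (deriv Q (Complex u v)))\<^sup>2)) \<in> borel_measurable (lborel \<Otimes>\<^sub>M lborel)"
   by (simp add: split_def)
  hence "(%u. \<integral>\<^sup>+v. ennreal (indicator (S j) (Complex u v) *\<^sub>R (cmod (deriv Q (Complex u v)))\<^sup>2) \<partial>lborel) \<in> borel_measurable lborel"
   by (rule lborel.borel_measurable_nn_integral)
  also have "(%u. \<integral>\<^sup>+v. ennreal (indicator (S j) (Complex u v) *\<^sub>R (cmod (deriv Q (Complex u v)))\<^sup>2) \<partial>lborel) = b j"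
   unfolding b_def fun_eq_iff by (intro allI nn_integral_cong) (auto simp: indicator_def T_def D_def)
  finally show ?thesis by simp
 qed
 have K0: "K >= 0"
 proof -
  have "0 <= K * (l 0)\<^sup>2" using order_trans[OF zero_le_power2 l(2)[OF \<open>N > 0\<close>]] .
  moreover have "0 < (l 0)\<^sup>2" using l(1)[OF \<open>N > 0\<close>] by simp
  ultimately show ?thesis by (simp add: zero_le_mult_iff)
 qed
 have "ennreal ((u2 - u1) * (real N ^ 2 / pi)) = (\<integral>\<^sup>+u. ennreal (real N ^ 2 / pi) * indicator {u1<..<u2} u \<partial>lborel)"
  using \<open>u1 < u2\<close> by (subst nn_integral_cmult_indicator) (auto simp: ennreal_mult[symmetric] mult.commute)
 also have "\<dots> <= (\<integral>\<^sup>+u. (\<Sum>j<N. ennreal (1 / (l j)\<^sup>2) * b j u) \<partial>lborel)"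
  using line by (intro nn_integral_mono) (auto simp: indicator_def)
 also have "\<dots> = (\<Sum>j<N. ennreal (1 / (l j)\<^sup>2) * (\<integral>\<^sup>+u. b j u \<partial>lborel))"
  using mb by (subst nn_integral_sum) (auto simp: nn_integral_cmult)
 also have "\<dots> <= (\<Sum>j<N. ennreal (4 * K))"
 proof (intro sum_mono)
  fix j assume "j \<in> {..<N}"
  hence j: "j < N" by simp
  have "(\<integral>\<^sup>+u. b j u \<partial>lborel) <= ennreal (4 * (\<rho> j)\<^sup>2)" unfolding b_def D_def T_def
   using area_injective[OF S(1)[OF j] holomorphic_on_subset[OF Q(1) S(2)[OF j]] inj_on_subset[OF Q(2) S(2)[OF j]] S(4)[OF j]] by (simp add: indicator_def vimage_def)
  hence "ennreal (1 / (l j)\<^sup>2) * (\<integral>\<^sup>+u. b j u \<partial>lborel) <= ennreal (1 / (l j)\<^sup>2) * ennreal (4 * (\<rho> j)\<^sup>2)"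
   by (intro mult_left_mono) auto
  also have "\<dots> = ennreal (1 / (l j)\<^sup>2 * (4 * (\<rho> j)\<^sup>2))" by (rule ennreal_mult[symmetric]) auto
  also have "\<dots> <= ennreal (4 * K)" using l(1)[OF j] l(2)[OF j] by (intro ennreal_leI) (simp add: field_simps)
  finally show "ennreal (1 / (l j)\<^sup>2) * (\<integral>\<^sup>+u. b j u \<partial>lborel) <= ennreal (4 * K)" .
 qed
 also have "\<dots> = ennreal (4 * K * N)" using K0 by (subst sum_ennreal) (auto simp: mult_ac)
 finally have "ennreal ((u2 - u1) * (real N ^ 2 / pi)) <= ennreal (4 * K * N)" .
 hence "(u2 - u1) * (real N ^ 2 / pi) <= 4 * K * N" using K0 by (subst (asm) ennreal_le_iff) auto
 hence "real N * ((u2 - u1) * N) <= real N * (4 * pi * K)" by (simp add: field_simps power2_eq_square)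
 thus ?thesis using \<open>N > 0\<close> by (simp only: mult_le_cancel_left_pos of_nat_0_less_iff)
qed

lemma compact_level_set:
 fixes g :: "real => real"
 assumes "continuous_on {a..b} g"
 shows "compact {v \<in> {a..b}. g v = \<beta>}"
proof -
 have "closed {v \<in> {a..b}. g v = \<beta>}" using continuous_closed_preimage_constant[OF assms] by simp
 moreover have "bounded {v \<in> {a..b}. g v = \<beta>}" by (rule bounded_subset[OF bounded_closed_interval[of a b]]) auto
 ultimately show ?thesis by (simp add: compact_eq_bounded_closed)
qed

text \<open>Take the first time at which \<beta> is reached and then the last time before it at
  which \<alpha> is taken; in between the intermediate value theorem confines the function. The
  descending case follows by negation.\<close>

lemma crossing_interval:
 fixes f :: "real => real"
 assumes "a <= b" and c: "continuous_on {a..b} f" and lo: "(f a <= \<alpha> & \<beta> <= f b) \<or> (f b <= \<alpha> & \<beta> <= f a)" and "\<alpha> < \<beta>"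
 shows "\<exists>v1 v2. a <= v1 & v1 <= v2 & v2 <= b & (\<forall>v. v1 < v --> v < v2 --> \<alpha> < f v & f v < \<beta>)
   & ((f v1 = \<alpha> & f v2 = \<beta>) \<or> (f v1 = \<beta> & f v2 = \<alpha>))"
proof -
 have gen: "\<exists>v1 v2. a <= v1 & v1 <= v2 & v2 <= b & (\<forall>v. v1 < v --> v < v2 --> \<alpha> < g v & g v < \<beta>)
   & (g v1 = \<alpha> & g v2 = \<beta>)"
  if "a <= b" "continuous_on {a..b} g" "g a <= \<alpha>" "\<beta> <= g b" "\<alpha> < \<beta>" for g :: "real => real" and a b \<alpha> \<beta> :: real
 proof -
  define A where "A = {v \<in> {a..b}. g v = \<beta>}"
  have cA: "compact A" unfolding A_def by (rule compact_level_set[OF that(2)])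
  have "A ~= {}" using IVT'[of g a \<beta> b] that by (auto simp: A_def)
  then obtain v2 where v2: "v2 \<in> A" "!!v. v \<in> A ==> v2 <= v" using compact_attains_inf[OF cA] by blast
  have v2': "a <= v2" "v2 <= b" "g v2 = \<beta>" using v2 by (auto simp: A_def)
  have c2: "continuous_on {a..v2} g" by (rule continuous_on_subset[OF that(2)]) (use v2' in auto)
  define B where "B = {v \<in> {a..v2}. g v = \<alpha>}"
  have cB: "compact B" unfolding B_def by (rule compact_level_set[OF c2])
  have "B ~= {}" using IVT'[of g a \<alpha> v2] that v2' c2 by (auto simp: B_def)
  then obtain v1 where v1: "v1 \<in> B" "!!v. v \<in> B ==> v <= v1" using compact_attains_sup[OF cB] by blast
  have v1': "a <= v1" "v1 <= v2" "g v1 = \<alpha>" using v1 by (auto simp: B_def)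
  have "\<alpha> < g v & g v < \<beta>" if v: "v1 < v" "v < v2" for v
  proof
   show "\<alpha> < g v"
   proof (rule ccontr)
    assume "\<not> \<alpha> < g v"
    then obtain x where "v <= x" "x <= v2" "g x = \<alpha>"
     using IVT'[of g v \<alpha> v2] v v1' v2' \<open>\<alpha> < \<beta>\<close> continuous_on_subset[OF c2, of "{v..v2}"] by fastforce
    hence "x \<in> B" using v v1' by (auto simp: B_def)
    thus False using v1(2)[of x] v \<open>v <= x\<close> by auto
   qed
   show "g v < \<beta>"
   proof (rule ccontr)
    assume "\<not> g v < \<beta>"
    then obtain x where "v1 <= x" "x <= v" "g x = \<beta>"
     using IVT'[of g v1 \<beta> v] v v1' v2' \<open>\<alpha> < \<beta>\<close> continuous_on_subset[OF c2, of "{v1..v}"] by fastforce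
    hence "x \<in> A" using v v1' v2' by (auto simp: A_def)
    thus False using v2(2)[of x] v \<open>x <= v\<close> by auto
   qed
  qed
  thus ?thesis using v1' v2' by blast
 qed
 from lo show ?thesis
 proof
  assume "f a <= \<alpha> & \<beta> <= f b"
  thus ?thesis using gen[OF \<open>a <= b\<close> c _ _ \<open>\<alpha> < \<beta>\<close>] by blast
 next
  assume A: "f b <= \<alpha> & \<beta> <= f a"
  have "continuous_on {a..b} (%x. - f x)" using c by (intro continuous_intros)
  from gen[OF \<open>a <= b\<close> this, of "-\<beta>" "-\<alpha>"] A \<open>\<alpha> < \<beta>\<close>
  obtain v1 v2 where "a <= v1" "v1 <= v2" "v2 <= b" "\<forall>v. v1 < v --> v < v2 --> -\<beta> < - f v & - f v < - \<alpha>"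
   "- f v1 = - \<beta>" "- f v2 = - \<alpha>" by auto
  thus ?thesis by force
 qed
qed

section \<open>Semicircles in the half-plane as vertical segments\<close>

definition \<H> :: "complex set" where "\<H> = {z. Im z > 0}"

text \<open>Under z -> c + exp z this rectangle becomes the upper half of the annulus r1 < |w - c| <
  r2, and its vertical segments become semicircles about the real point c.\<close>

definition polar_strip :: "real => real => complex set" where
 "polar_strip r1 r2 = {z. ln r1 < Re z & Re z < ln r2 & 0 < Im z & Im z < pi}"

lemma open_polar_strip: "open (polar_strip r1 r2)"
proof -
 have "polar_strip r1 r2 = {z. ln r1 < Re z} \<inter> {z. Re z < ln r2} \<inter> {z. 0 < Im z} \<inter> {z. Im z < pi}" by (auto simp: polar_strip_def)
 thus ?thesis by (auto intro!: open_Int open_halfspace_Re_gt open_halfspace_Re_lt open_halfspace_Im_gt open_halfspace_Im_lt)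
qed

lemma polar_holomorphic:
 assumes "\<psi> holomorphic_on \<H>" "inj_on \<psi> \<H>"
 shows "(%z. \<psi> (of_real c + exp z)) holomorphic_on polar_strip r1 r2"
  and "inj_on (%z. \<psi> (of_real c + exp z)) (polar_strip r1 r2)"
  and "!!z. z \<in> polar_strip r1 r2 ==> of_real c + exp z \<in> \<H>"
proof -
 show im: "of_real c + exp z \<in> \<H>" if "z \<in> polar_strip r1 r2" for z using that by (auto simp: \<H>_def polar_strip_def Im_exp sin_gt_zero)
 show "(%z. \<psi> (of_real c + exp z)) holomorphic_on polar_strip r1 r2"
 proof -
  have "(%z. of_real c + exp z) holomorphic_on polar_strip r1 r2" by (intro holomorphic_intros)
  from holomorphic_on_compose_gen[OF this assms(1)] im show ?thesis by (auto simp: o_def)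
 qed
 show "inj_on (%z. \<psi> (of_real c + exp z)) (polar_strip r1 r2)"
 proof (rule inj_onI)
  fix x y assume xy: "x \<in> polar_strip r1 r2" "y \<in> polar_strip r1 r2" "\<psi> (of_real c + exp x) = \<psi> (of_real c + exp y)"
  hence "exp x = exp y" using assms(2) im by (auto dest: inj_onD)
  thus "x = y" by (rule exp_complex_eqI[rotated]) (insert xy, auto simp: polar_strip_def)
 qed
qed

lemma semicircle_polar:
 assumes "cmod (z - of_real c) = exp u" "z \<in> \<H>"
 obtains v where "0 < v" "v < pi" "z = of_real c + exp (Complex u v)"
proof
 let ?v = "Arg (z - of_real c)"
 have nz: "z - of_real c ~= 0" using assms by auto
 have i: "Im (z - of_real c) > 0" using assms by (simp add: \<H>_def)
 show "0 < ?v" "?v < pi" using i Arg_lt_pi[of "z - of_real c"] by auto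
 have "z - of_real c = of_real (cmod (z - of_real c)) * exp (\<i> * ?v)" using Arg_eq[OF nz] by (simp add: mult.commute)
 thus "z = of_real c + exp (Complex u ?v)" using assms by (simp add: Complex_eq exp_add algebra_simps flip: exp_of_real)
qed

lemma polar_path_continuous:
 assumes "\<psi> holomorphic_on \<H>" "0 < a" "b < pi"
 shows "continuous_on {a..b} (%v. \<psi> (of_real c + exp (Complex u v)))"
proof (rule continuous_on_compose2[OF holomorphic_on_imp_continuous_on[OF assms(1)]])
 show "continuous_on {a..b} (%v. of_real c + exp (Complex u v))" unfolding Complex_eq[abs_def] by (intro continuous_intros)
 show "(%v. of_real c + exp (Complex u v)) ` {a..b} <= \<H>" using assms by (auto simp: \<H>_def Im_exp sin_gt_zero)
qed

text \<open>The case \<open>N = 1\<close> of \<open>length_area\<close>, known as Wolff's lemma: if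
  all images lie in one disc, only an annulus of bounded modulus can consist of semicircles with
  long images.\<close>

lemma length_area_ball:
 assumes \<psi>: "\<psi> holomorphic_on \<H>" "inj_on \<psi> \<H>" and r: "0 < r1" "r1 < r2"
  and im: "!!z. [|z \<in> \<H>; r1 < cmod (z - of_real c); cmod (z - of_real c) < r2|] ==> \<psi> z \<in> ball w \<rho>"
  and "l > 0"
  and two: "!!s. [|r1 < s; s < r2|] ==> \<exists>z1\<in>\<H>. \<exists>z2\<in>\<H>. cmod (z1 - of_real c) = s & cmod (z2 - of_real c) = s
    & l <= cmod (\<psi> z1 - \<psi> z2)"
 shows "ln (r2 / r1) * l\<^sup>2 <= 4 * pi * \<rho>\<^sup>2"
proof -
 define Q where "Q = (%z. \<psi> (of_real c + exp z))"
 note P = polar_holomorphic[OF \<psi>, where c = c and ?r1.0 = r1 and ?r2.0 = r2, folded Q_def]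
 have "(ln r2 - ln r1) * real 1 <= 4 * pi * (\<rho>\<^sup>2 / l\<^sup>2)"
 proof (rule length_area[where Q = Q and S = "%_. polar_strip r1 r2" and w = w and \<rho> = "%_. \<rho>" and l = "%_. l"])
  show "polar_strip r1 r2 = {z. ln r1 < Re z & Re z < ln r2 & 0 < Im z & Im z < pi}" by (simp add: polar_strip_def)
  show "Q ` polar_strip r1 r2 <= ball w \<rho>"
  proof clarify
   fix z assume z: "z \<in> polar_strip r1 r2"
   hence "r1 < exp (Re z)" "exp (Re z) < r2" using r by (auto simp: polar_strip_def) (metis exp_less_mono exp_ln , metis exp_less_mono exp_ln order.strict_trans)
   thus "Q z \<in> ball w \<rho>" unfolding Q_def using im P(3)[OF z] by simp
  qed
  fix u j assume u: "ln r1 < u" "u < ln r2"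
  hence s: "r1 < exp u" "exp u < r2" using r by (metis exp_less_mono exp_ln, metis exp_less_mono exp_ln order.strict_trans u(2))
  from two[OF s] obtain z1 z2 where z: "z1 \<in> \<H>" "z2 \<in> \<H>" "cmod (z1 - of_real c) = exp u" "cmod (z2 - of_real c) = exp u"
    "l <= cmod (\<psi> z1 - \<psi> z2)" by blast
  obtain a where a: "0 < a" "a < pi" "z1 = of_real c + exp (Complex u a)" using semicircle_polar[OF z(3,1)] .
  obtain b where b: "0 < b" "b < pi" "z2 = of_real c + exp (Complex u b)" using semicircle_polar[OF z(4,2)] .
  have "l <= cmod (Q (Complex u (max a b)) - Q (Complex u (min a b)))" using z(5) a(3) b(3) by (auto simp: Q_def max_def min_def norm_minus_commute)
  thus "\<exists>v1 v2. 0 < v1 & v1 <= v2 & v2 < pi & (\<forall>v. v1 < v --> v < v2 --> Complex u v \<in> polar_strip r1 r2)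
    & l <= cmod (Q (Complex u v2) - Q (Complex u v1))" using a b u by (intro exI[of _ "min a b"] exI[of _ "max a b"]) (auto simp: polar_strip_def)
 qed (use r \<open>l > 0\<close> P open_polar_strip in \<open>auto simp: disjoint_family_on_def\<close>)
 thus ?thesis using r \<open>l > 0\<close> by (simp add: ln_div field_simps)
qed

text \<open>The disjoint sets are the preimages of the N dyadic shells \<rho> 2^j < |w' - w| <
  \<rho> 2^(j+1). Every semicircle crosses each shell, with an image of length at least \<rho> 2^j
  inside a disc of twice that radius, so K = 4.\<close>

lemma length_area_log:
 assumes \<psi>: "\<psi> holomorphic_on \<H>" "inj_on \<psi> \<H>" and r: "0 < r1" "r1 < r2"
  and "\<rho> > 0"
  and two: "!!s. [|r1 < s; s < r2|] ==> \<exists>z1\<in>\<H>. \<exists>z2\<in>\<H>. cmod (z1 - of_real c) = s & cmod (z2 - of_real c) = s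
    & cmod (\<psi> z1 - w) <= \<rho> & \<rho> * 2 ^ N <= cmod (\<psi> z2 - w)"
 shows "ln (r2 / r1) * N <= 16 * pi"
proof (cases "N = 0")
 case True
 thus ?thesis by simp
next
 case False
 define Q where "Q = (%z. \<psi> (of_real c + exp z))"
 note P = polar_holomorphic[OF \<psi>, where c = c and ?r1.0 = r1 and ?r2.0 = r2, folded Q_def]
 define S where "S = (%j::nat. {z \<in> polar_strip r1 r2. \<rho> * 2 ^ j < cmod (Q z - w) & cmod (Q z - w) < \<rho> * 2 ^ Suc j})"
 have mono: "\<rho> * 2 ^ Suc i <= \<rho> * 2 ^ j" if "i < j" for i j :: nat using that \<open>\<rho> > 0\<close> by (intro mult_left_mono power_increasing) auto
 have "(ln r2 - ln r1) * real N <= 4 * pi * 4"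
 proof (rule length_area[where Q = Q and S = S and w = w and \<rho> = "%j. \<rho> * 2 ^ Suc j" and l = "%j. \<rho> * 2 ^ j"])
  show "polar_strip r1 r2 = {z. ln r1 < Re z & Re z < ln r2 & 0 < Im z & Im z < pi}" by (simp add: polar_strip_def)
  show "open (S j)" for j
  proof -
   have "continuous_on (polar_strip r1 r2) (%z. cmod (Q z - w))" by (intro continuous_intros holomorphic_on_imp_continuous_on P)
   from continuous_open_preimage[OF this open_polar_strip, of "{\<rho> * 2 ^ j<..<\<rho> * 2 ^ Suc j}"]
   show ?thesis by (rule back_subst[of "open"]) (auto simp: S_def)
  qed
  show "S j <= polar_strip r1 r2" for j by (auto simp: S_def)
  show "disjoint_family_on S {..<N}"
  proof -
   have "False" if "z \<in> S i" "z \<in> S j" "i < j" for z i j using mono[OF that(3)] that(1,2) by (simp add: S_def)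
   thus ?thesis unfolding disjoint_family_on_def by (metis disjoint_iff nat_neq_iff)
  qed
  show "Q ` S j <= ball w (\<rho> * 2 ^ Suc j)" for j by (auto simp: S_def dist_norm norm_minus_commute)
  show "(\<rho> * 2 ^ Suc j)\<^sup>2 <= 4 * (\<rho> * 2 ^ j)\<^sup>2" for j by (simp add: power_mult_distrib)
  fix u j assume u: "ln r1 < u" "u < ln r2" and j: "j < N"
  hence s: "r1 < exp u" "exp u < r2" using r by (metis exp_less_mono exp_ln, metis exp_less_mono exp_ln order.strict_trans u(2))
  from two[OF s] obtain z1 z2 where z: "z1 \<in> \<H>" "z2 \<in> \<H>" "cmod (z1 - of_real c) = exp u" "cmod (z2 - of_real c) = exp u"
    "cmod (\<psi> z1 - w) <= \<rho>" "\<rho> * 2 ^ N <= cmod (\<psi> z2 - w)" by blast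
  obtain a where a: "0 < a" "a < pi" "z1 = of_real c + exp (Complex u a)" using semicircle_polar[OF z(3,1)] .
  obtain b where b: "0 < b" "b < pi" "z2 = of_real c + exp (Complex u b)" using semicircle_polar[OF z(4,2)] .
  let ?f = "%v. cmod (Q (Complex u v) - w)"
  have fa: "?f a <= \<rho> * 2 ^ j" using z(5) a \<open>\<rho> > 0\<close> unfolding Q_def by (smt (verit) mult_le_cancel_left1 one_le_power)
  have fb: "\<rho> * 2 ^ Suc j <= ?f b" using z(6) b mono[OF j] unfolding Q_def by simp
  have "continuous_on {min a b..max a b} ?f" unfolding Q_def by (intro continuous_intros polar_path_continuous \<psi>) (use a b in auto)
  from crossing_interval[OF _ this, of "\<rho> * 2 ^ j" "\<rho> * 2 ^ Suc j"] fa fb \<open>\<rho> > 0\<close>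
  obtain v1 v2 where v: "min a b <= v1" "v1 <= v2" "v2 <= max a b" "!!v. v1 < v ==> v < v2 ==> \<rho> * 2 ^ j < ?f v & ?f v < \<rho> * 2 ^ Suc j"
   "(?f v1 = \<rho> * 2 ^ j & ?f v2 = \<rho> * 2 ^ Suc j) \<or> (?f v1 = \<rho> * 2 ^ Suc j & ?f v2 = \<rho> * 2 ^ j)" by (fastforce simp: min_def max_def)
  have "\<rho> * 2 ^ j <= cmod (Q (Complex u v2) - Q (Complex u v1))" using v(5) norm_triangle_ineq3[of "Q (Complex u v2) - w" "Q (Complex u v1) - w"] by auto
  thus "\<exists>v1 v2. 0 < v1 & v1 <= v2 & v2 < pi & (\<forall>v. v1 < v --> v < v2 --> Complex u v \<in> S j)
    & \<rho> * 2 ^ j <= cmod (Q (Complex u v2) - Q (Complex u v1))"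
   using v a b u by (intro exI[of _ v1] exI[of _ v2]) (auto simp: S_def polar_strip_def min_def max_def split: if_splits)
 qed (use r \<open>\<rho> > 0\<close> P False in auto)
 thus ?thesis using r by (simp add: ln_div)
qed

section \<open>Koebe distortion\<close>

text \<open>Schottky's bound exp (pi exp (pi (2 + 2 r + 12 t / (1 - t)))) for r = 1 and t =
  5/8.\<close>

definition schottky_const :: real where "schottky_const = exp (pi * exp (24 * pi))"

text \<open>As w is omitted, 1 - g / w has a holomorphic square root k without zeros. Moreover k
  never equals -1: that would force g z = 0, hence z = 0, where k = 1. So -k omits 0 and 1 and
  Schottky's theorem bounds it.\<close>

lemma univalent_omit_sqrt:
 assumes g: "g holomorphic_on ball 0 1" "inj_on g (ball 0 1)" "g 0 = 0" and w: "w \<notin> g ` ball 0 1"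
 obtains k where "k holomorphic_on ball 0 1" "k 0 = 1" "!!z. cmod z < 1 ==> (k z)\<^sup>2 = 1 - g z / w"
  "!!z. cmod z <= 1/2 ==> cmod (k z) <= schottky_const"
proof -
 have w0: "w ~= 0" using w g(3) by force
 have hol: "(%z. 1 - g z / w) holomorphic_on ball 0 1" using g w0 by (intro holomorphic_intros) auto
 have nz: "1 - g z / w ~= 0" if "z \<in> ball 0 1" for z using that w w0 by (auto simp: image_iff)
 have "\<exists>k0. k0 holomorphic_on ball 0 1 & (\<forall>z\<in>ball 0 1. 1 - g z / w = (k0 z)\<^sup>2)"
  by (rule contractible_imp_holomorphic_sqrt[OF hol convex_imp_contractible[OF convex_ball] nz]) blast+
 then obtain k0 where k0: "k0 holomorphic_on ball 0 1" "!!z. z \<in> ball 0 1 ==> 1 - g z / w = (k0 z)\<^sup>2" by blast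
 define k where "k = (%z. k0 z * k0 0)"
 have k00: "(k0 0)\<^sup>2 = 1" using k0(2)[of 0] g(3) by simp
 have k: "k holomorphic_on ball 0 1" unfolding k_def by (intro holomorphic_intros k0)
 have k1: "k 0 = 1" using k00 by (simp add: k_def power2_eq_square)
 have k2: "(k z)\<^sup>2 = 1 - g z / w" if "cmod z < 1" for z using k0(2)[of z] that k00 by (simp add: k_def power_mult_distrib)
 have km1: "k z ~= - 1" if "cmod z < 1" for z
 proof
  assume "k z = - 1"
  hence "g z = 0" using k2[OF that] w0 by simp
  hence "z = 0" using g(2,3) that by (metis inj_onD mem_ball_0 norm_zero zero_less_one)
  thus False using k1 \<open>k z = -1\<close> by simp
 qed
 have kn0: "k z ~= 0" if "cmod z < 1" for z using k2[OF that] w w0 that by (auto simp: image_iff)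
 \<comment> \<open>The factor 4/5 makes F holomorphic on the closed unit disc; points with |z| <=
   1/2 then correspond to |5/4 z| <= 5/8.\<close>
 define F where "F = (%z. - k (4/5 * z))"
 have "cmod (k z) <= schottky_const" if z: "cmod z <= 1/2" for z
 proof -
  have "F holomorphic_on cball 0 1" unfolding F_def by (intro holomorphic_intros holomorphic_on_compose_gen[OF _ k, of "%z. 4/5*z", unfolded o_def]) auto
  moreover have "\<not> (F z = 0 \<or> F z = 1)" if "z \<in> cball 0 1" for z
  proof -
   have c: "cmod (4/5*z) < 1" using that by (simp add: norm_mult)
   show ?thesis using km1[OF c] kn0[OF c] unfolding F_def by (metis add.inverse_inverse neg_equal_0_iff_equal)
  qed
  moreover have "cmod (F 0) <= 1" "cmod (5/4*z) <= 5/8" using k1 z by (auto simp: F_def norm_mult)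
  ultimately have "cmod (F (5/4*z)) <= exp (pi * exp (pi * (2 + 2 * 1 + 12 * (5/8) / (1 - 5/8))))" using Schottky[of F 1 "5/8" "5/4*z"] by auto
  thus ?thesis by (simp add: F_def schottky_const_def mult.commute)
 qed
 thus ?thesis using that k k1 k2 by blast
qed

lemma schottky_const_ge1: "schottky_const >= 1" by (simp add: schottky_const_def)

text \<open>A weak form of the Koebe quarter theorem: differentiating k^2 = 1 - g / w at 0 gives 2
  k'(0) = -1 / w, and the Cauchy estimate on the disc of radius 1/2 bounds k'(0).\<close>

lemma univalent_quarter:
 assumes g: "g holomorphic_on ball 0 1" "inj_on g (ball 0 1)" "g 0 = 0" "deriv g 0 = 1" and w: "w \<notin> g ` ball 0 1"
 shows "1 / (4 * schottky_const) <= cmod w"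
proof -
 have w0: "w ~= 0" using w g(3) by force
 obtain k where k: "k holomorphic_on ball 0 1" "k 0 = 1" "!!z. cmod z < 1 ==> (k z)\<^sup>2 = 1 - g z / w"
  "!!z. cmod z <= 1/2 ==> cmod (k z) <= schottky_const" using univalent_omit_sqrt[OF g(1-3) w] by metis
 have dk: "(k has_field_derivative deriv k 0) (at 0)" using k(1) by (auto intro: holomorphic_derivI)
 have dg: "(g has_field_derivative 1) (at 0)" using g by (metis centre_in_ball holomorphic_derivI open_ball zero_less_one)
 have d1: "((%z. (k z)\<^sup>2) has_field_derivative 2 * deriv k 0) (at 0)" using k(2) by (auto intro!: derivative_eq_intros dk)
 have d2: "((%z. 1 - g z / w) has_field_derivative - 1 / w) (at 0)" using w0 by (auto intro!: derivative_eq_intros dg)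
 have "((%z. 1 - g z / w) has_field_derivative 2 * deriv k 0) (at 0)" by (rule has_field_derivative_transform_within_open[OF d1, of "ball 0 1"]) (use k(3) in auto)
 hence e: "2 * deriv k 0 = - 1 / w" using d2 DERIV_unique by blast
 have "norm ((deriv ^^ 1) k 0) <= fact 1 * schottky_const / (1/2) ^ 1"
 proof (rule Cauchy_inequality)
  show "k holomorphic_on ball 0 (1/2)" using k(1) by (rule holomorphic_on_subset) auto
  show "continuous_on (cball 0 (1/2)) k" by (rule continuous_on_subset[OF holomorphic_on_imp_continuous_on[OF k(1)]]) auto
 qed (insert k(4), auto simp: norm_minus_commute)
 hence "cmod (2 * deriv k 0) <= 4 * schottky_const" by (simp add: norm_mult)
 moreover have "cmod w * cmod (2 * deriv k 0) = 1" using e w0 by (simp add: norm_divide)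
 ultimately have "1 <= cmod w * (4 * schottky_const)" by (metis mult_left_mono norm_ge_zero)
 thus ?thesis using schottky_const_ge1 by (simp add: field_simps)
qed

text \<open>Some w with |w| < 2 is omitted. Otherwise the inverse map would be defined on the disc
  of radius 2 with values in the unit disc and derivative 1 at 0, while the Cauchy estimate on
  radius 3/2 allows only 2/3. Then g = w (1 - k^2) is bounded, and Cauchy bounds its
  derivative.\<close>

lemma univalent_growth:
 assumes g: "g holomorphic_on ball 0 1" "inj_on g (ball 0 1)" "g 0 = 0" "deriv g 0 = 1" and z: "cmod z <= 1/4"
 shows "cmod (deriv g z) <= 8 * (1 + schottky_const\<^sup>2)"
proof -
 have "\<exists>w. w \<notin> g ` ball 0 1 & cmod w < 2"
 proof (rule ccontr)
  assume "\<not> ?thesis"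
  hence sub: "ball 0 2 <= g ` ball 0 1" by auto
  obtain h where h: "h holomorphic_on g ` ball 0 1" "!!z. z \<in> ball 0 1 ==> deriv g z * deriv h (g z) = 1" "!!z. z \<in> ball 0 1 ==> h (g z) = z"
   using holomorphic_has_inverse[OF g(1) open_ball g(2)] by metis
  have "norm ((deriv ^^ 1) h 0) <= fact 1 * 1 / (3/2) ^ 1"
  proof (rule Cauchy_inequality)
   show "h holomorphic_on ball 0 (3/2)" using h(1) sub by (elim holomorphic_on_subset) force
   show "continuous_on (cball 0 (3/2)) h" using sub by (intro continuous_on_subset[OF holomorphic_on_imp_continuous_on[OF h(1)]]) force
   fix x :: complex assume "cmod (0 - x) = 3/2"
   hence "x \<in> ball 0 2" by auto
   then obtain z where "z \<in> ball 0 1" "x = g z" using sub by blast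
   thus "cmod (h x) <= 1" using h(3)[of z] by auto
  qed auto
  thus False using h(2)[of 0] g by simp
 qed
 then obtain w where w: "w \<notin> g ` ball 0 1" "cmod w < 2" by blast
 have w0: "w ~= 0" using w g(3) by force
 obtain k where k: "k holomorphic_on ball 0 1" "k 0 = 1" "!!z. cmod z < 1 ==> (k z)\<^sup>2 = 1 - g z / w"
  "!!z. cmod z <= 1/2 ==> cmod (k z) <= schottky_const" using univalent_omit_sqrt[OF g(1-3) w(1)] by metis
 have bd: "cmod (g z) <= 2 * (1 + schottky_const\<^sup>2)" if "cmod z <= 1/2" for z
 proof -
  have "g z = w * (1 - (k z)\<^sup>2)" using k(3)[of z] that w0 by (simp add: field_simps)
  hence "cmod (g z) <= cmod w * (1 + (cmod (k z))\<^sup>2)" by (metis mult_left_mono norm_ge_zero norm_mult norm_one norm_power norm_triangle_ineq4)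
  also have "\<dots> <= 2 * (1 + schottky_const\<^sup>2)" using w(2) k(4)[OF that] by (intro mult_mono add_mono power_mono) auto
  finally show ?thesis .
 qed
 have "norm ((deriv ^^ 1) g z) <= fact 1 * (2 * (1 + schottky_const\<^sup>2)) / (1/4) ^ 1"
 proof (rule Cauchy_inequality)
  show "g holomorphic_on ball z (1/4)" using z by (intro holomorphic_on_subset[OF g(1)]) (simp add: ball_subset_ball_iff)
  show "continuous_on (cball z (1/4)) g" using z by (intro continuous_on_subset[OF holomorphic_on_imp_continuous_on[OF g(1)]]) (simp add: cball_subset_ball_iff)
  fix x assume "cmod (z - x) = 1/4"
  hence "cmod x <= 1/2" using z norm_triangle_ineq2[of x z] by (simp add: norm_minus_commute)
  thus "cmod (g x) <= 2 * (1 + schottky_const\<^sup>2)" by (rule bd)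
 qed auto
 thus ?thesis by simp
qed

lemma univalent_scaled:
 assumes g: "g holomorphic_on ball y \<delta>" "inj_on g (ball y \<delta>)" and "\<delta> > 0"
 shows "deriv g y ~= 0"
  and "w \<notin> g ` ball y \<delta> ==> \<delta> * cmod (deriv g y) / (4 * schottky_const) <= cmod (w - g y)"
  and "cmod (z - y) <= \<delta> / 4 ==> cmod (deriv g z) <= 8 * (1 + schottky_const\<^sup>2) * cmod (deriv g y)"
proof -
 show d0: "deriv g y ~= 0" using holomorphic_injective_imp_regular[OF g(1) open_ball g(2), of y] \<open>\<delta> > 0\<close> by simp
 define d where "d = deriv g y"
 define h where "h = (%\<zeta>. (g (y + of_real \<delta> * \<zeta>) - g y) / (of_real \<delta> * d))"
 have in_ball: "y + of_real \<delta> * \<zeta> \<in> ball y \<delta> \<longleftrightarrow> \<zeta> \<in> ball 0 1" for \<zeta>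
  using \<open>\<delta> > 0\<close> by (simp add: dist_norm norm_mult)
 have nz: "of_real \<delta> * d ~= 0" using d0 \<open>\<delta> > 0\<close> by (simp add: d_def)
 have gg: "(%\<zeta>. g (y + of_real \<delta> * \<zeta>)) holomorphic_on ball 0 1"
  by (intro holomorphic_on_compose_gen[OF _ g(1), unfolded o_def] holomorphic_intros) (use in_ball in auto)
 have h1: "h holomorphic_on ball 0 1" unfolding h_def using nz by (intro holomorphic_intros gg)
 have h2: "inj_on h (ball 0 1)"
 proof (rule inj_onI)
  fix u v assume uv: "u \<in> ball 0 1" "v \<in> ball 0 1" "h u = h v"
  hence "g (y + of_real \<delta> * u) = g (y + of_real \<delta> * v)" using nz by (simp add: h_def)
  hence "y + of_real \<delta> * u = y + of_real \<delta> * v" using g(2) uv in_ball by (metis inj_onD)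
  thus "u = v" using \<open>\<delta> > 0\<close> by simp
 qed
 have dh: "deriv h \<zeta> = deriv g (y + of_real \<delta> * \<zeta>) / d" if "\<zeta> \<in> ball 0 1" for \<zeta>
 proof -
  have "(g has_field_derivative deriv g (y + of_real \<delta> * \<zeta>)) (at (y + of_real \<delta> * \<zeta>))"
   using that in_ball g(1) by (intro holomorphic_derivI[OF g(1)]) auto
  moreover have "((%\<zeta>. y + of_real \<delta> * \<zeta>) has_field_derivative of_real \<delta>) (at \<zeta>)" by (auto intro!: derivative_eq_intros)
  ultimately have "((%\<zeta>. g (y + of_real \<delta> * \<zeta>)) has_field_derivative deriv g (y + of_real \<delta> * \<zeta>) * of_real \<delta>) (at \<zeta>)"
   by (rule DERIV_chain2)
  hence "(h has_field_derivative deriv g (y + of_real \<delta> * \<zeta>) * of_real \<delta> / (of_real \<delta> * d)) (at \<zeta>)"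
   unfolding h_def using nz by (auto intro!: derivative_eq_intros)
  thus ?thesis using nz by (auto dest!: DERIV_imp_deriv)
 qed
 have h3: "h 0 = 0" by (simp add: h_def)
 have h4: "deriv h 0 = 1" using dh[of 0] d0 by (simp add: d_def)
 show "\<delta> * cmod (deriv g y) / (4 * schottky_const) <= cmod (w - g y)" if w: "w \<notin> g ` ball y \<delta>"
 proof -
  have "(w - g y) / (of_real \<delta> * d) \<notin> h ` ball 0 1"
  proof
   assume "(w - g y) / (of_real \<delta> * d) \<in> h ` ball 0 1"
   then obtain \<zeta> where "\<zeta> \<in> ball 0 1" "w = g (y + of_real \<delta> * \<zeta>)" using nz by (auto simp: h_def)
   thus False using w in_ball by blast
  qed
  from univalent_quarter[OF h1 h2 h3 h4 this]
  have "1 / (4 * schottky_const) <= cmod (w - g y) / (\<delta> * cmod d)" using \<open>\<delta> > 0\<close> by (simp add: norm_divide norm_mult)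
  moreover have "\<delta> * cmod d > 0" using nz \<open>\<delta> > 0\<close> by simp
  ultimately show ?thesis using schottky_const_ge1 by (simp add: d_def field_simps)
 qed
 show "cmod (deriv g z) <= 8 * (1 + schottky_const\<^sup>2) * cmod (deriv g y)" if z: "cmod (z - y) <= \<delta> / 4"
 proof -
  define \<zeta> where "\<zeta> = (z - y) / of_real \<delta>"
  have c: "cmod \<zeta> <= 1/4" using z \<open>\<delta> > 0\<close> by (simp add: \<zeta>_def norm_divide field_simps)
  have zz: "y + of_real \<delta> * \<zeta> = z" using \<open>\<delta> > 0\<close> by (simp add: \<zeta>_def)
  have "cmod (deriv h \<zeta>) <= 8 * (1 + schottky_const\<^sup>2)" by (rule univalent_growth[OF h1 h2 h3 h4 c])
  moreover have "deriv h \<zeta> = deriv g z / d" using dh[of \<zeta>] c zz by auto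
  ultimately show ?thesis using d0 by (simp add: d_def norm_divide field_simps)
 qed
qed

text \<open>The upper bound integrates the derivative bound. The lower bound exchanges the roles of
  y and z and applies the quarter theorem at z.\<close>

theorem koebe_distortion:
 "\<exists>\<kappa>\<ge>1. \<forall>g y \<delta>. \<delta> > 0 --> g holomorphic_on ball y \<delta> --> inj_on g (ball y \<delta>) -->
   ball (g y) (\<delta> * cmod (deriv g y) / \<kappa>) <= g ` ball y \<delta> &
   (\<forall>z. cmod (z - y) <= \<delta> / 8 --> cmod (z - y) * cmod (deriv g y) / \<kappa> <= cmod (g z - g y) &
     cmod (g z - g y) <= \<kappa> * cmod (z - y) * cmod (deriv g y))"
proof -
 define A where "A = 4 * schottky_const"
 define B where "B = 8 * (1 + schottky_const\<^sup>2)"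
 have A1: "A >= 1" using schottky_const_ge1 by (simp add: A_def)
 have B1: "B >= 1" by (simp add: B_def)
 show ?thesis
 proof (intro exI[of _ "A * B"] conjI allI impI)
  show "1 <= A * B" using mult_mono[OF A1 B1] A1 by simp
  have AB: "A <= A * B" "B <= A * B" using A1 B1 by (simp_all add: mult_le_cancel_left1 mult_le_cancel_right1)
  fix g :: "complex => complex" and y \<delta>
  assume d: "(\<delta>::real) > 0" and g: "g holomorphic_on ball y \<delta>" "inj_on g (ball y \<delta>)"
  note U = univalent_scaled[OF g d, folded A_def B_def]
  show "ball (g y) (\<delta> * cmod (deriv g y) / (A * B)) <= g ` ball y \<delta>"
  proof
   fix w assume w: "w \<in> ball (g y) (\<delta> * cmod (deriv g y) / (A * B))"
   have "\<delta> * cmod (deriv g y) / (A * B) <= \<delta> * cmod (deriv g y) / A" using AB A1 d by (intro divide_left_mono mult_nonneg_nonneg mult_pos_pos) auto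
   thus "w \<in> g ` ball y \<delta>" using w U(2)[of w] by (force simp: dist_norm norm_minus_commute)
  qed
  fix z assume z: "cmod (z - y) <= \<delta> / 8"
  show "cmod (z - y) * cmod (deriv g y) / (A * B) <= cmod (g z - g y)"
  proof (cases "z = y")
   case False
   have sub: "ball z (\<delta>/2) <= ball y \<delta>" using z d by (simp add: ball_subset_ball_iff dist_norm)
   have sub2: "ball z (cmod (z - y)) <= ball y \<delta>" using z d by (simp add: ball_subset_ball_iff dist_norm)
   \<comment> \<open>Distortion with centre z: y lies at distance at most \<delta> / 8, a quarter of
     the radius \<delta> / 2.\<close>
   have 1: "cmod (deriv g y) <= B * cmod (deriv g z)" unfolding B_def by (rule univalent_scaled(3)[of g z "\<delta>/2"])
     (insert z d sub, auto simp: norm_minus_commute intro: holomorphic_on_subset[OF g(1)] inj_on_subset[OF g(2)])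
   \<comment> \<open>The open disc about z through y does not contain y, so by injectivity g y is an
     omitted value there.\<close>
   have "g y \<notin> g ` ball z (cmod (z - y))"
   proof
    assume "g y \<in> g ` ball z (cmod (z - y))"
    then obtain u where u: "u \<in> ball z (cmod (z - y))" and "g y = g u" by blast
    moreover have "u \<in> ball y \<delta>" "y \<in> ball y \<delta>" using u sub2 d by auto
    ultimately have "y = u" using g(2) by (auto dest: inj_onD)
    thus False using u by (simp add: dist_norm)
   qed
   hence 2: "cmod (z - y) * cmod (deriv g z) / A <= cmod (g y - g z)"
    unfolding A_def by (intro univalent_scaled(2) holomorphic_on_subset[OF g(1)] inj_on_subset[OF g(2)] sub2) (use False in auto)
   have "cmod (z - y) * cmod (deriv g y) / (A * B) <= cmod (z - y) * (B * cmod (deriv g z)) / (A * B)" using 1 A1 B1 by (intro divide_right_mono mult_left_mono) auto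
   also have "\<dots> = cmod (z - y) * cmod (deriv g z) / A" using B1 by simp
   finally show ?thesis using 2 by (simp add: norm_minus_commute)
  qed simp
  have "cmod (g z - g y) <= B * cmod (deriv g y) * cmod (z - y)"
  proof (rule field_differentiable_bound[of "cball y (\<delta>/8)"])
   fix x assume x: "x \<in> cball y (\<delta>/8)"
   hence "x \<in> ball y \<delta>" using d by auto
   thus "(g has_field_derivative deriv g x) (at x within cball y (\<delta>/8))" using holomorphic_derivI[OF g(1) open_ball] has_field_derivative_at_within by blast
   show "cmod (deriv g x) <= B * cmod (deriv g y)" using U(3)[of x] x d by (auto simp: dist_norm norm_minus_commute)
  qed (insert z d, auto simp: dist_norm norm_minus_commute)
  also have "\<dots> <= (A * B) * cmod (deriv g y) * cmod (z - y)" using AB by (intro mult_right_mono) auto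
  finally show "cmod (g z - g y) <= A * B * cmod (z - y) * cmod (deriv g y)" by (simp add: mult_ac)
 qed
qed

section \<open>Boundary estimates for conformal maps of the half-plane\<close>

definition closed_half :: "complex set" where "closed_half = {z. Im z >= 0}"

lemma upper_subset_closed: "\<H> <= closed_half" by (auto simp: \<H>_def closed_half_def)

lemma of_real_closed_half [simp]: "complex_of_real x \<in> closed_half" by (simp add: closed_half_def)

lemma closed_half_real [simp]: "complex_of_real a + complex_of_real b \<in> closed_half"
 "complex_of_real a - complex_of_real b \<in> closed_half" by (simp_all add: closed_half_def)

lemma closed_half_cases: "z \<in> closed_half ==> z \<in> \<H> \<or> z = of_real (Re z)" by (auto simp: closed_half_def \<H>_def complex_eq_iff)

lemma open_upper_half: "open \<H>" by (simp add: \<H>_def open_halfspace_Im_gt)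

lemma closed_closed_half: "closed closed_half" by (simp add: closed_half_def closed_halfspace_Im_ge)

lemma ln2_ge_half: "ln 2 >= (1/2::real)"
proof -
 have "(exp (1/2::real))\<^sup>2 = exp 1" by (simp add: power2_eq_square flip: exp_add)
 hence "(exp (1/2::real))\<^sup>2 <= 2\<^sup>2" using exp_le by simp
 hence "exp (1/2::real) <= 2" by (rule power2_le_imp_le) simp
 thus ?thesis by (metis exp_ln exp_le_cancel_iff zero_less_numeral)
qed

text \<open>The exponent 200 exceeds 16 pi / ln 2, the largest number of dyadic shells that can be crossed on all semicircles with radii between r1 and 2 r1.\<close>
lemma no_fat_crossing:
 assumes "\<psi> holomorphic_on \<H>" "inj_on \<psi> \<H>" "0 < r1" "2 * r1 <= r2" "\<rho> > 0"
 shows "\<exists>s. r1 < s & s < r2 & ((\<forall>z\<in>\<H>. cmod (z - of_real c) = s --> \<rho> < cmod (\<psi> z - w)) \<or>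
   (\<forall>z\<in>\<H>. cmod (z - of_real c) = s --> cmod (\<psi> z - w) < \<rho> * 2 ^ 200))"
proof (rule ccontr)
 assume A: "\<not> ?thesis"
 have "ln (r2 / r1) * real 200 <= 16 * pi"
 proof (rule length_area_log[OF assms(1,2), where c = c and w = w and \<rho> = \<rho>])
  fix s assume "r1 < s" "s < r2"
  thus "\<exists>z1\<in>\<H>. \<exists>z2\<in>\<H>. cmod (z1 - of_real c) = s & cmod (z2 - of_real c) = s
    & cmod (\<psi> z1 - w) <= \<rho> & \<rho> * 2 ^ 200 <= cmod (\<psi> z2 - w)" using A by (meson not_less)
 qed (use assms in auto)
 moreover have "ln 2 <= ln (r2 / r1)" using assms by (intro ln_mono) (auto simp: field_simps)
 ultimately show False using ln2_ge_half pi_less_4 by simp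
qed

text \<open>The crossing estimates see only interior points of a semicircle; this transfers
  information from its real endpoint p to nearby interior points.\<close>

lemma semicircle_near:
 assumes "continuous_on closed_half \<psi>" "open T" "\<psi> (of_real p) \<in> T" "p ~= c"
 shows "\<exists>z\<in>\<H>. cmod (z - of_real c) = \<bar>p - c\<bar> & \<psi> z \<in> T"
proof -
 \<comment> \<open>With this sign the arc that starts at p turns into the upper half-plane,
   whichever side of c the point p is on.\<close>
 define \<sigma> where "\<sigma> = sgn (p - c)"
 define g where "g = (%v::real. of_real c + of_real (p - c) * cis (\<sigma> * v))"
 have s: "(p - c) * \<sigma> = \<bar>p - c\<bar>" "\<bar>\<sigma>\<bar> = 1" using assms(4) by (auto simp: \<sigma>_def sgn_if)
 have im: "Im (g v) = \<bar>p - c\<bar> * sin v" for v using s by (auto simp: g_def \<sigma>_def sgn_if algebra_simps)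
 have cg: "continuous_on {0..pi} g" unfolding g_def cis_conv_exp by (intro continuous_intros)
 have gH: "g ` {0..pi} <= closed_half" using im by (auto simp: closed_half_def sin_ge_zero)
 have "continuous_on {0..pi} (%v. \<psi> (g v))" by (rule continuous_on_compose2[OF assms(1) cg gH])
 hence "((%v. \<psi> (g v)) \<longlongrightarrow> \<psi> (g 0)) (at 0 within {0..pi})" by (simp add: continuous_on)
 moreover have "g 0 = of_real p" by (simp add: g_def)
 ultimately have "eventually (%v. \<psi> (g v) \<in> T) (at 0 within {0..pi})" using assms(2,3) by (simp add: topological_tendstoD)
 then obtain d where d: "d > 0" "!!v. [|v \<in> {0..pi}; v ~= 0; dist v 0 < d|] ==> \<psi> (g v) \<in> T" unfolding eventually_at by blast
 define v where "v = min (d/2) (pi/2)"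
 have v: "0 < v" "v < pi" "v < d" using d by (auto simp: v_def min_def)
 have "g v \<in> \<H>" using im v assms(4) by (simp add: \<H>_def sin_gt_zero)
 moreover have "cmod (g v - of_real c) = \<bar>p - c\<bar>" unfolding g_def by (simp only: add_diff_cancel_left' norm_mult norm_cis norm_of_real mult_1_right)
 moreover have "\<psi> (g v) \<in> T" using d(2)[of v] v by auto
 ultimately show ?thesis by blast
qed

text \<open>The image of the real line is a Jordan curve through infinity. \<open>bt\<close> is
  Ahlfors' three-point condition for it, and \<open>proper\<close> says that infinity is mapped to
  infinity.\<close>

locale half_plane_embedding =
 fixes \<psi> :: "complex => complex" and C :: real
 assumes hol: "\<psi> holomorphic_on \<H>" and cont: "continuous_on closed_half \<psi>"
  and inj: "inj_on \<psi> closed_half" and C1: "C >= 1"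
  and bt: "!!a b c. (a <= b & b <= c) \<or> (c <= b & b <= a) ==>
    cmod (\<psi> (of_real b) - \<psi> (of_real a)) <= C * cmod (\<psi> (of_real c) - \<psi> (of_real a))"
  and proper: "!!B. \<exists>R. \<forall>z\<in>closed_half. R <= cmod z --> B <= cmod (\<psi> z)"
begin

abbreviation "br \<equiv> (%x::real. \<psi> (of_real x))"

lemma injU: "inj_on \<psi> \<H>" using inj upper_subset_closed by (rule inj_on_subset)

lemma ne: "[|x \<in> closed_half; y \<in> closed_half; x ~= y|] ==> 0 < cmod (\<psi> x - \<psi> y)" using inj by (auto dest: inj_onD)

text \<open>The shell factor 2^200 of \<open>no_fat_crossing\<close>, one C from each of two uses of
  \<open>bt\<close>, a factor 2 as strict margin, and one more factor 2 of slack.\<close>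

definition H1 :: real where "H1 = 4 * C\<^sup>2 * 2 ^ 200"

lemma H1_ge1: "H1 >= 1"
proof -
 have "C\<^sup>2 >= 1" using C1 by simp
 thus ?thesis by (simp add: H1_def)
qed

text \<open>Semicircles about c = a - e / 2 with radius s between |e| / 2 and 3 |e| / 2 have one
  endpoint p between a and a + e and the other endpoint q beyond a - e. By \<open>bt\<close> the
  image of p is close to w, so the first alternative of \<open>no_fat_crossing\<close> fails; hence
  some semicircle, and with it q, has image within \<rho> 2^200 of w. A further use of
  \<open>bt\<close> passes from q to a - e.\<close>

lemma opposite: "cmod (br (a - e) - br a) <= H1 * cmod (br (a + e) - br a)"
proof (cases "e = 0")
 case False
 define d where "d = cmod (br (a + e) - br a)"
 define w where "w = br a"
 have d0: "d > 0" unfolding d_def using False by (intro ne) auto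
 define c where "c = a - e / 2"
 define \<rho> where "\<rho> = 2 * C * d"
 have rho: "\<rho> > 0" using d0 C1 by (simp add: \<rho>_def)
 obtain s where s: "\<bar>e\<bar>/2 < s" "s < 3 * \<bar>e\<bar> / 2" and alt: "(\<forall>z\<in>\<H>. cmod (z - of_real c) = s --> \<rho> < cmod (\<psi> z - w)) \<or>
   (\<forall>z\<in>\<H>. cmod (z - of_real c) = s --> cmod (\<psi> z - w) < \<rho> * 2 ^ 200)"
  using no_fat_crossing[OF hol injU _ _ rho, of "\<bar>e\<bar>/2" "3 * \<bar>e\<bar>/2" c w] False by auto
 define p where "p = c + sgn e * s"
 define q where "q = c - sgn e * s"
 have se: "\<bar>sgn e\<bar> = 1" using False by (simp add: sgn_if)
 have s0: "s > 0" using s by linarith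
 hence pq: "p ~= c" "q ~= c" "\<bar>p - c\<bar> = s" "\<bar>q - c\<bar> = s" using se False by (auto simp: p_def q_def abs_mult sgn_zero_iff)
 have "cmod (br p - w) <= C * d" unfolding w_def d_def by (rule bt) (insert s False, auto simp: p_def c_def sgn_if split: if_splits)
 moreover have "C * d < \<rho>" using d0 C1 by (simp add: \<rho>_def)
 ultimately have pT: "\<psi> (of_real p) \<in> ball w \<rho>" by (simp add: dist_norm norm_minus_commute)
 have "\<exists>z\<in>\<H>. cmod (z - of_real c) = \<bar>p - c\<bar> & \<psi> z \<in> ball w \<rho>" by (rule semicircle_near[OF cont _ pT]) (use pq in auto)
 hence "\<not> (\<forall>z\<in>\<H>. cmod (z - of_real c) = s --> \<rho> < cmod (\<psi> z - w))" using pq by (auto simp: dist_norm norm_minus_commute)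
 with alt have small: "!!z. z \<in> \<H> ==> cmod (z - of_real c) = s ==> cmod (\<psi> z - w) < \<rho> * 2 ^ 200" by blast
 have "cmod (br q - w) <= \<rho> * 2 ^ 200"
 proof (rule ccontr)
  assume "\<not> ?thesis"
  hence "\<psi> (of_real q) \<in> - cball w (\<rho> * 2^200)" by (simp add: dist_norm norm_minus_commute)
  hence "\<exists>z\<in>\<H>. cmod (z - of_real c) = \<bar>q - c\<bar> & \<psi> z \<in> - cball w (\<rho> * 2^200)"
   by (intro semicircle_near[OF cont]) (use pq in auto)
  then obtain z where "z \<in> \<H>" "cmod (z - of_real c) = s" "\<rho> * 2^200 < cmod (\<psi> z - w)" using pq by (auto simp: dist_norm norm_minus_commute)
  thus False using small[of z] by simp
 qed
 moreover have "cmod (br (a - e) - w) <= C * cmod (br q - w)" unfolding w_def by (rule bt) (insert s False, auto simp: q_def c_def sgn_if split: if_splits)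
 ultimately have "cmod (br (a - e) - w) <= C * (\<rho> * 2 ^ 200)" using C1 by (meson mult_left_mono order_trans zero_le_one)
 also have "\<dots> = 2 * (C\<^sup>2 * 2 ^ 200 * d)" by (simp only: \<rho>_def power2_eq_square mult_ac)
 also have "\<dots> <= 4 * (C\<^sup>2 * 2 ^ 200 * d)" using d0 by (intro mult_right_mono) auto
 also have "\<dots> = H1 * d" by (simp only: H1_def mult_ac)
 finally show ?thesis by (simp add: d_def w_def)
qed simp

lemma doubling: "cmod (br (a + 2 * e) - br a) <= (1 + H1) * cmod (br (a + e) - br a)"
proof -
 have "cmod (br ((a + e) - (- e)) - br (a + e)) <= H1 * cmod (br ((a + e) + (- e)) - br (a + e))" by (rule opposite)
 hence "cmod (br (a + 2 * e) - br (a + e)) <= H1 * cmod (br (a + e) - br a)" by (simp add: norm_minus_commute algebra_simps)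
 moreover have "cmod (br (a + 2 * e) - br a) <= cmod (br (a + 2 * e) - br (a + e)) + cmod (br (a + e) - br a)"
  using norm_triangle_ineq[of "br (a + 2 * e) - br (a + e)" "br (a + e) - br a"] by simp
 ultimately show ?thesis by (simp add: algebra_simps)
qed

lemma doubling_pow: "cmod (br (a + 2 ^ k * e) - br a) <= (1 + H1) ^ k * cmod (br (a + e) - br a)"
proof (induction k)
 case (Suc k)
 have "cmod (br (a + 2 ^ Suc k * e) - br a) <= (1 + H1) * cmod (br (a + 2 ^ k * e) - br a)" using doubling[of a "2 ^ k * e"] by (simp add: mult.assoc)
 also have "\<dots> <= (1 + H1) * ((1 + H1) ^ k * cmod (br (a + e) - br a))" using Suc H1_ge1 by (intro mult_left_mono) auto
 finally show ?case by (simp add: mult.assoc)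
qed simp

lemma real_inner_bound:
 assumes "\<bar>t - a\<bar> <= \<bar>e\<bar>"
 shows "cmod (br t - br a) <= C * H1 * cmod (br (a + e) - br a)"
proof -
 have 1: "cmod (br t - br a) <= C * cmod (br (a + e) - br a) \<or> cmod (br t - br a) <= C * cmod (br (a - e) - br a)"
 proof (cases "(a <= t) = (0 <= e)")
  case True
  hence "(a <= t & t <= a + e) \<or> (a + e <= t & t <= a)" using assms by (auto simp: abs_if split: if_splits)
  thus ?thesis using bt[of a t "a + e"] by simp
 next
  case False
  hence "(a <= t & t <= a - e) \<or> (a - e <= t & t <= a)" using assms by (auto simp: abs_if split: if_splits)
  thus ?thesis using bt[of a t "a - e"] by simp
 qed
 have 2: "C * cmod (br (a - e) - br a) <= C * (H1 * cmod (br (a + e) - br a))" using opposite C1 by (intro mult_left_mono) auto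
 have 3: "C * cmod (br (a + e) - br a) <= C * (H1 * cmod (br (a + e) - br a))" using H1_ge1 C1 by (intro mult_left_mono) (auto simp: mult_le_cancel_right1)
 show ?thesis using 1 2 3 by (auto simp: mult.assoc)
qed

text \<open>The product in parentheses controls real points up to twice the distance, see
  \<open>real_inner_double\<close>; 2 * 2 ^ 200 is the strict margin times the loss in
  \<open>no_fat_crossing\<close>.\<close>

definition H2 :: real where "H2 = 2 * 2 ^ 200 * (C * H1 * (1 + H1))"

lemma H2_ge1: "H2 >= 1"
proof -
 have "1 * 1 <= C * H1" using C1 H1_ge1 by (intro mult_mono) auto
 moreover have "1 * 1 <= (C * H1) * (1 + H1)" using calculation H1_ge1 by (intro mult_mono) auto
 ultimately show ?thesis by (simp add: H2_def)
qed

lemma real_inner_double: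
 assumes "\<bar>t - a\<bar> <= 2 * \<bar>e\<bar>"
 shows "cmod (br t - br a) <= C * H1 * (1 + H1) * cmod (br (a + e) - br a)"
proof -
 have "cmod (br t - br a) <= C * H1 * cmod (br (a + 2 * e) - br a)" by (rule real_inner_bound) (insert assms, simp add: abs_mult)
 also have "\<dots> <= C * H1 * ((1 + H1) * cmod (br (a + e) - br a))" using doubling C1 H1_ge1 by (intro mult_left_mono) auto
 finally show ?thesis by (simp add: mult.assoc)
qed

text \<open>Some semicircle of radius between r and 2 r is mapped into the disc of radius \<rho>
  2^200, because its real endpoint is mapped into the disc of radius \<rho>. The real diameter is
  controlled by \<open>real_inner_double\<close>, so the maximum principle applies on the
  half-disc.\<close>

lemma upper_bound:
 assumes x: "x \<in> closed_half" "cmod (x - of_real a) <= \<bar>e\<bar>" and "e ~= 0"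
 shows "cmod (\<psi> x - br a) <= H2 * cmod (br (a + e) - br a)"
proof -
 define d where "d = cmod (br (a + e) - br a)"
 define w where "w = br a"
 define r where "r = \<bar>e\<bar>"
 have r0: "r > 0" using assms by (simp add: r_def)
 have d0: "d > 0" unfolding d_def using assms by (intro ne) auto
 define \<rho> where "\<rho> = 2 * (C * H1 * (1 + H1) * d)"
 have cc: "0 < C * H1 * (1 + H1) * d" using C1 H1_ge1 d0 by simp
 have rho: "\<rho> > 0" using cc by (simp add: \<rho>_def)
 have realb: "cmod (br t - w) < \<rho>" if "\<bar>t - a\<bar> <= 2 * r" for t using real_inner_double[of t a e] that cc by (simp add: \<rho>_def r_def d_def w_def)
 obtain s where s: "r < s" "s < 2 * r" and alt: "(\<forall>z\<in>\<H>. cmod (z - of_real a) = s --> \<rho> < cmod (\<psi> z - w)) \<or>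
   (\<forall>z\<in>\<H>. cmod (z - of_real a) = s --> cmod (\<psi> z - w) < \<rho> * 2 ^ 200)" using no_fat_crossing[OF hol injU r0 _ rho, of "2*r" a w] by auto
 have "\<exists>z\<in>\<H>. cmod (z - of_real a) = \<bar>(a + s) - a\<bar> & \<psi> z \<in> ball w \<rho>"
  by (rule semicircle_near[OF cont]) (insert s r0 realb[of "a + s"], auto simp: dist_norm norm_minus_commute)
 hence "\<not> (\<forall>z\<in>\<H>. cmod (z - of_real a) = s --> \<rho> < cmod (\<psi> z - w))" using s r0 by (auto simp: dist_norm norm_minus_commute)
 with alt have small: "!!z. z \<in> \<H> ==> cmod (z - of_real a) = s ==> cmod (\<psi> z - w) < \<rho> * 2 ^ 200" by blast
 have big: "\<rho> <= \<rho> * 2 ^ 200" using rho by simp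
 have "cmod (\<psi> x - w) <= \<rho> * 2 ^ 200"
 proof (cases "x \<in> \<H>")
  case False
  hence "x = of_real (Re x)" using x closed_half_cases by blast
  hence e: "x = of_real (Re x)" .
  hence "\<bar>Re x - a\<bar> <= r" using x(2) unfolding r_def by (metis norm_of_real of_real_diff)
  hence "cmod (br (Re x) - w) < \<rho>" using r0 by (intro realb) auto
  thus ?thesis unfolding e[symmetric] using big by linarith
 next
  case True
  define S where "S = ball (of_real a) s \<inter> \<H>"
  have cl: "closure S <= cball (of_real a) s \<inter> closed_half"
   unfolding S_def using upper_subset_closed by (intro closure_minimal) (auto intro!: closed_Int closed_closed_half)
  have oS: "open S" unfolding S_def using open_upper_half by auto
  show ?thesis
  proof (rule maximum_modulus_frontier[of "%z. \<psi> z - w" S])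
   show "(%z. \<psi> z - w) holomorphic_on interior S" unfolding interior_open[OF oS] by (intro holomorphic_intros holomorphic_on_subset[OF hol]) (auto simp: S_def)
   show "continuous_on (closure S) (%z. \<psi> z - w)" using cl by (intro continuous_intros continuous_on_subset[OF cont]) auto
   show "bounded S" by (auto simp: S_def)
   show "x \<in> S" using True x s by (simp add: S_def dist_norm norm_minus_commute r_def)
   fix z assume z: "z \<in> frontier S"
   hence z1: "z \<in> closure S" "z \<notin> S" using oS by (auto simp: frontier_def interior_open)
   hence z2: "cmod (z - of_real a) <= s" "z \<in> closed_half" using cl by (auto simp: dist_norm norm_minus_commute)
   show "cmod (\<psi> z - w) <= \<rho> * 2 ^ 200"
   proof (cases "z \<in> \<H>")
    case True
    hence "cmod (z - of_real a) = s" using z1 z2 by (auto simp: S_def dist_norm norm_minus_commute)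
    thus ?thesis using small True by force
   next
    case False
    hence e: "z = of_real (Re z)" using z2 closed_half_cases by blast
    hence "\<bar>Re z - a\<bar> <= s" using z2(1) by (metis norm_of_real of_real_diff)
    hence "cmod (br (Re z) - w) < \<rho>" using s by (intro realb) auto
    thus ?thesis unfolding e[symmetric] using big by linarith
   qed
  qed
 qed
 also have "\<rho> * 2 ^ 200 = H2 * d" by (simp only: \<rho>_def H2_def mult_ac)
 finally show ?thesis by (simp only: d_def w_def)
qed

text \<open>The maximum principle for 1 / (\<psi> - w), which has its only singularity at a. The
  domain is a large half-disc without a small one; \<open>no_fat_crossing\<close> controls the inner
  arc, \<open>proper\<close> the outer one, and \<open>real_inner_double\<close> the real
  segments.\<close>

lemma lower_bound:
 assumes y: "y \<in> closed_half" "\<bar>e\<bar> <= cmod (y - of_real a)" and "e ~= 0"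
 shows "cmod (br (a + e) - br a) <= H2 * C * cmod (\<psi> y - br a)"
proof -
 define d where "d = cmod (br (a + e) - br a)"
 define w where "w = br a"
 define r where "r = \<bar>e\<bar>"
 have r0: "r > 0" using assms by (simp add: r_def)
 have d0: "d > 0" unfolding d_def using assms by (intro ne) auto
 define \<rho>0 where "\<rho>0 = d / (C * H1 * (1 + H1))"
 have cc: "0 < C * H1 * (1 + H1)" using C1 H1_ge1 by simp
 have rho0: "\<rho>0 > 0" using cc d0 by (simp add: \<rho>0_def)
 define \<rho> where "\<rho> = \<rho>0 / 2 / 2 ^ 200"
 have rho: "\<rho> > 0" using rho0 by (simp add: \<rho>_def)
 have realb: "\<rho>0 <= cmod (br t - w)" if "r / 2 <= \<bar>t - a\<bar>" for t
 proof -
  have "d <= C * H1 * (1 + H1) * cmod (br (a + (t - a)) - w)" unfolding d_def w_def by (rule real_inner_double) (insert that, simp add: r_def)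
  thus ?thesis using cc by (simp add: \<rho>0_def field_simps)
 qed
 obtain s where s: "r / 2 < s" "s < r" and alt: "(\<forall>z\<in>\<H>. cmod (z - of_real a) = s --> \<rho> < cmod (\<psi> z - w)) \<or>
   (\<forall>z\<in>\<H>. cmod (z - of_real a) = s --> cmod (\<psi> z - w) < \<rho> * 2 ^ 200)" using no_fat_crossing[OF hol injU _ _ rho, of "r/2" r a w] r0 by auto
 have "\<exists>z\<in>\<H>. cmod (z - of_real a) = \<bar>(a + s) - a\<bar> & \<psi> z \<in> - cball w (\<rho>0/2)"
  by (rule semicircle_near[OF cont]) (insert s r0 rho0 realb[of "a + s"], auto simp: dist_norm norm_minus_commute)
 hence "\<not> (\<forall>z\<in>\<H>. cmod (z - of_real a) = s --> cmod (\<psi> z - w) < \<rho> * 2 ^ 200)"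
  using s r0 by (force simp: dist_norm norm_minus_commute \<rho>_def)
 with alt have big: "!!z. z \<in> \<H> ==> cmod (z - of_real a) = s ==> \<rho> < cmod (\<psi> z - w)" by blast
 have le: "\<rho> <= \<rho>0" using rho0 by (simp add: \<rho>_def field_simps)
 obtain R where R: "!!z. z \<in> closed_half ==> R <= cmod z ==> cmod w + \<rho> <= cmod (\<psi> z)" using proper by metis
 have far: "\<rho> <= cmod (\<psi> z - w)" if "z \<in> closed_half" "R <= cmod z" for z using R[OF that] norm_triangle_ineq2[of "\<psi> z" w] by linarith
 have "\<rho> <= cmod (\<psi> y - w)"
 proof (cases "y \<in> \<H> & cmod y < R")
  case False
  hence "R <= cmod y \<or> y = of_real (Re y)" using closed_half_cases[OF y(1)] by (meson not_less)
  thus ?thesis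
  proof
   assume e: "y = of_real (Re y)"
   hence "r <= \<bar>Re y - a\<bar>" using y(2) unfolding r_def by (metis norm_of_real of_real_diff)
   hence "\<rho>0 <= cmod (br (Re y) - w)" using r0 by (intro realb) auto
   thus ?thesis unfolding e[symmetric] using le by linarith
  qed (use far y in auto)
 next
  case True
  define S where "S = (ball 0 R - cball (of_real a) s) \<inter> \<H>"
  have cl: "closure S <= (cball 0 R - ball (of_real a) s) \<inter> closed_half"
   unfolding S_def using upper_subset_closed by (intro closure_minimal) (auto intro!: closed_Int closed_closed_half closed_Diff)
  have oS: "open S" unfolding S_def using open_upper_half by auto
  have nz: "\<psi> z - w ~= 0" if "z \<in> closed_half" "z ~= of_real a" for z using ne[of z "of_real a"] that by (auto simp: w_def)
  have cl2: "z \<in> closed_half & z ~= of_real a" if "z \<in> closure S" for z using cl that s r0 by auto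
  have "cmod (inverse (\<psi> y - w)) <= inverse \<rho>"
  proof (rule maximum_modulus_frontier[of "%z. inverse (\<psi> z - w)" S])
   show "(%z. inverse (\<psi> z - w)) holomorphic_on interior S"
   proof -
    have "S <= \<H>" by (auto simp: S_def)
    moreover have "\<psi> z - w ~= 0" if "z \<in> S" for z using nz cl2[of z] closure_subset[of S] that by blast
    ultimately show ?thesis unfolding interior_open[OF oS] by (intro holomorphic_intros holomorphic_on_subset[OF hol]) auto
   qed
   show "continuous_on (closure S) (%z. inverse (\<psi> z - w))" using cl cl2 nz by (intro continuous_intros continuous_on_subset[OF cont]) auto
   show "bounded S" by (rule bounded_subset[of "ball 0 R"]) (auto simp: S_def)
   show "y \<in> S" using True y s by (simp add: S_def dist_norm norm_minus_commute r_def)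
   fix z assume z: "z \<in> frontier S"
   hence z1: "z \<in> closure S" "z \<notin> S" using oS by (auto simp: frontier_def interior_open)
   hence z2: "s <= cmod (z - of_real a)" "z \<in> closed_half" "cmod z <= R" using cl by (auto simp: dist_norm norm_minus_commute)
   have "\<rho> <= cmod (\<psi> z - w)"
   proof (cases "z \<in> \<H> & cmod z < R")
    case True
    hence "cmod (z - of_real a) = s" using z1 z2 by (auto simp: S_def dist_norm norm_minus_commute)
    thus ?thesis using big True by force
   next
    case False
    hence "R <= cmod z \<or> z = of_real (Re z)" using closed_half_cases[OF z2(2)] by (meson not_less)
    thus ?thesis
    proof
     assume e: "z = of_real (Re z)"
     hence "s <= \<bar>Re z - a\<bar>" using z2(1) by (metis norm_of_real of_real_diff)
     hence "\<rho>0 <= cmod (br (Re z) - w)" using s by (intro realb) auto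
     thus ?thesis unfolding e[symmetric] using le by linarith
    qed (use far z2 in auto)
   qed
   thus "cmod (inverse (\<psi> z - w)) <= inverse \<rho>" using rho by (simp add: norm_inverse le_imp_inverse_le)
  qed
  moreover have "\<psi> y - w ~= 0" by (rule nz) (use y r0 r_def in auto)
  ultimately show ?thesis using rho by (simp add: norm_inverse)
 qed
 hence "d <= 2 * 2 ^ 200 * (C * H1 * (1 + H1)) * cmod (\<psi> y - w)" using cc by (simp add: \<rho>_def \<rho>0_def field_simps)
 also have "\<dots> = H2 * cmod (\<psi> y - w)" by (simp only: H2_def)
 also have "\<dots> <= H2 * C * cmod (\<psi> y - w)" using C1 H2_ge1 by (intro mult_right_mono) (auto simp: mult_le_cancel_left1)
 finally show ?thesis by (simp add: d_def w_def)
qed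

lemma quasisymmetric_at_real:
 assumes "x \<in> closed_half" "y \<in> closed_half" "y ~= of_real a" "cmod (x - of_real a) <= 2 ^ k * cmod (y - of_real a)"
 shows "cmod (\<psi> x - br a) <= H2 * (1 + H1) ^ k * (H2 * C) * cmod (\<psi> y - br a)"
proof -
 define r where "r = cmod (y - of_real a)"
 have r: "r > 0" using assms by (simp add: r_def)
 have "cmod (\<psi> x - br a) <= H2 * cmod (br (a + 2 ^ k * r) - br a)" by (rule upper_bound) (insert assms r, auto simp: r_def)
 also have "\<dots> <= H2 * ((1 + H1) ^ k * cmod (br (a + r) - br a))" using doubling_pow H2_ge1 by (intro mult_left_mono) auto
 also have "\<dots> <= H2 * ((1 + H1) ^ k * (H2 * C * cmod (\<psi> y - br a)))"
  using H2_ge1 H1_ge1 lower_bound[of y r a] assms r by (intro mult_left_mono) (auto simp: r_def)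
 finally show ?thesis by (simp add: mult.assoc)
qed

text \<open>The converse direction, from image distances back to the line. Every semicircle about a
  with radius between |e| and |e'| has its image in one disc of radius comparable to d, and two uses
  of \<open>bt\<close> keep the images of its endpoints d / C^2 apart.
  \<open>length_area_ball\<close> then bounds the logarithmic width.\<close>

lemma boundary_growth:
 assumes "e ~= 0" "\<bar>e\<bar> < \<bar>e'\<bar>" and le: "cmod (br (a + e') - br a) <= D * cmod (br (a + e) - br a)"
 shows "ln (\<bar>e'\<bar> / \<bar>e\<bar>) <= 64 * pi * (H2 * D)\<^sup>2 * C ^ 4"
proof -
 define d where "d = cmod (br (a + e) - br a)"
 define w where "w = br a"
 have d0: "d > 0" unfolding d_def using assms by (intro ne) auto
 have D0: "D > 0"
 proof -
  have "0 < cmod (br (a + e') - br a)" using assms by (intro ne) auto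
  thus ?thesis using le d0 unfolding d_def by (smt (verit) mult_nonneg_nonneg mult_nonpos_nonneg)
 qed
 define \<rho> where "\<rho> = 2 * (H2 * D * d)"
 \<comment> \<open>Half of the endpoint separation d / C^2, so that interior points near the
   endpoints are still at distance l.\<close>
 define l where "l = d / (2 * C\<^sup>2)"
 have HD: "0 < H2 * D * d" using H2_ge1 D0 d0 by simp
 have l0: "l > 0" using d0 C1 by (simp add: l_def)
 have "ln (\<bar>e'\<bar> / \<bar>e\<bar>) * l\<^sup>2 <= 4 * pi * \<rho>\<^sup>2"
 proof (rule length_area_ball[OF hol injU])
  fix z assume z: "z \<in> \<H>" "cmod (z - of_real a) < \<bar>e'\<bar>"
  have "cmod (\<psi> z - br a) <= H2 * cmod (br (a + e') - br a)" by (rule upper_bound) (use z upper_subset_closed assms in auto)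
  also have "\<dots> <= H2 * (D * d)" using le H2_ge1 by (intro mult_left_mono) (auto simp: d_def)
  also have "\<dots> < \<rho>" using HD by (simp add: \<rho>_def mult_ac)
  finally show "\<psi> z \<in> ball w \<rho>" by (simp add: w_def dist_norm norm_minus_commute)
 next
  fix s assume s: "\<bar>e\<bar> < s" "s < \<bar>e'\<bar>"
  define p where "p = a + sgn e * s"
  define q where "q = a - sgn e * s"
  have se: "\<bar>sgn e\<bar> = 1" "s > 0" using assms s by (auto simp: sgn_if)
  have 1: "d <= C * cmod (br p - br a)" unfolding d_def by (rule bt) (insert s assms, auto simp: p_def sgn_if split: if_splits)
  have 2: "cmod (br a - br p) <= C * cmod (br q - br p)" by (rule bt) (insert s assms, auto simp: p_def q_def sgn_if split: if_splits)
  have "d <= C * (C * cmod (br q - br p))" using 1 2 C1 by (smt (verit) mult_left_mono norm_minus_commute)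
  hence lt: "l < cmod (br q - br p)" using d0 C1 by (simp add: l_def field_simps power2_eq_square)
  have pq: "\<bar>p - a\<bar> = s" "\<bar>q - a\<bar> = s" using se by (auto simp: p_def q_def abs_mult)
  define \<epsilon> where "\<epsilon> = (cmod (br q - br p) - l) / 2"
  have eps: "\<epsilon> > 0" using lt by (simp add: \<epsilon>_def)
  obtain z1 where z1: "z1 \<in> \<H>" "cmod (z1 - of_real a) = s" "\<psi> z1 \<in> ball (br p) \<epsilon>"
   using semicircle_near[OF cont, of "ball (br p) \<epsilon>" p a] eps se pq by fastforce
  obtain z2 where z2: "z2 \<in> \<H>" "cmod (z2 - of_real a) = s" "\<psi> z2 \<in> ball (br q) \<epsilon>"
   using semicircle_near[OF cont, of "ball (br q) \<epsilon>" q a] eps se pq by fastforce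
  have "cmod (br q - br p) <= cmod (\<psi> z1 - \<psi> z2) + cmod (\<psi> z1 - br p) + cmod (br q - \<psi> z2)"
   using norm_triangle_ineq4[of "(\<psi> z1 - br p) + (br q - \<psi> z2)" "\<psi> z1 - \<psi> z2"] norm_triangle_ineq[of "\<psi> z1 - br p" "br q - \<psi> z2"]
   by (simp add: algebra_simps)
  hence "l <= cmod (\<psi> z1 - \<psi> z2)" using z1 z2 by (simp add: \<epsilon>_def dist_norm norm_minus_commute field_simps)
  thus "\<exists>z1\<in>\<H>. \<exists>z2\<in>\<H>. cmod (z1 - of_real a) = s & cmod (z2 - of_real a) = s & l <= cmod (\<psi> z1 - \<psi> z2)"
   using z1 z2 by blast
 qed (use assms l0 in auto)
 hence "ln (\<bar>e'\<bar> / \<bar>e\<bar>) <= 4 * pi * \<rho>\<^sup>2 / l\<^sup>2" using l0 by (simp add: field_simps)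
 also have "\<dots> = 64 * pi * (H2 * D)\<^sup>2 * C ^ 4" using d0 C1 by (simp add: \<rho>_def l_def field_simps)
 finally show ?thesis .
qed

end

section \<open>The Beurling-Ahlfors extension\<close>

text \<open>\<open>qs1\<close> and \<open>qs2\<close> together are the M-condition of Beurling and
  Ahlfors.\<close>

locale quasisymmetric_line =
 fixes h :: "real => real" and M :: real
 assumes mono: "strict_mono h" and cont: "continuous_on UNIV h"
  and qs1: "!!x t. 0 < t ==> h (x + t) - h x <= M * (h x - h (x - t))"
  and qs2: "!!x t. 0 < t ==> h x - h (x - t) <= M * (h (x + t) - h x)"
  and M1: "M >= 1"
begin

lemma less: "x < y ==> h x < h y" using mono by (simp add: strict_monoD)
lemma leq: "x <= y ==> h x <= h y" using mono by (simp add: strict_mono_less_eq)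

definition al :: "complex => real" where "al z = integral {0..1} (%t. h (Re z + t * Im z))"
definition be :: "complex => real" where "be z = integral {0..1} (%t. h (Re z - t * Im z))"
text \<open>The Beurling-Ahlfors extension: with z = x + i y, \<open>al\<close> and
  \<open>be\<close> are the means of \<open>h\<close> over the adjacent intervals [x, x + y] and
  [x - y, x].\<close>

definition BA :: "complex => complex" where "BA z = Complex ((al z + be z) / 2) ((al z - be z) / 2)"

lemma cont_h: "continuous_on S g ==> continuous_on S (%x. h (g x))" by (rule continuous_on_compose2[OF cont]) auto

lemma int_h: "(%t. h (a + t * b)) integrable_on {0..1}" "(%t. h (a - t * b)) integrable_on {0..1}" by (auto intro!: integrable_continuous_real cont_h continuous_intros)

lemma continuous_al: "continuous_on UNIV al" and continuous_be: "continuous_on UNIV be"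
proof -
 have "continuous_on (UNIV \<times> cbox 0 1) (%(z, t). h (Re z + t * Im z))" unfolding split_def by (intro cont_h continuous_intros)
 from integral_continuous_on_param[OF this] show "continuous_on UNIV al" by (simp add: al_def[abs_def])
 have "continuous_on (UNIV \<times> cbox 0 1) (%(z, t). h (Re z - t * Im z))" unfolding split_def by (intro cont_h continuous_intros)
 from integral_continuous_on_param[OF this] show "continuous_on UNIV be" by (simp add: be_def[abs_def])
qed

lemma continuous_BA: "continuous_on UNIV BA" unfolding BA_def Complex_eq by (intro continuous_intros continuous_al continuous_be) auto

lemma BA_real [simp]: "BA (of_real x) = of_real (h x)" by (simp add: BA_def al_def be_def complex_eq_iff)

lemma al_bounds: "[|Im z >= 0; !!t. [|0 <= t; t <= 1|] ==> c <= h (Re z + t * Im z)|] ==> c <= al z"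
 unfolding al_def using integral_le[of "%_. c" "{0..1}" "%t. h (Re z + t * Im z)"] int_h by auto
lemma al_bounds': "[|Im z >= 0; !!t. [|0 <= t; t <= 1|] ==> h (Re z + t * Im z) <= c|] ==> al z <= c"
 unfolding al_def using integral_le[of "%t. h (Re z + t * Im z)" "{0..1}" "%_. c"] int_h by auto
lemma be_bounds: "[|Im z >= 0; !!t. [|0 <= t; t <= 1|] ==> c <= h (Re z - t * Im z)|] ==> c <= be z"
 unfolding be_def using integral_le[of "%_. c" "{0..1}" "%t. h (Re z - t * Im z)"] int_h by auto
lemma be_bounds': "[|Im z >= 0; !!t. [|0 <= t; t <= 1|] ==> h (Re z - t * Im z) <= c|] ==> be z <= c"
 unfolding be_def using integral_le[of "%t. h (Re z - t * Im z)" "{0..1}" "%_. c"] int_h by auto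

lemma integral_half_bound:
 fixes f :: "real => real"
 assumes "continuous_on {0..1} f" "!!t. [|0 <= t; t <= 1|] ==> 0 <= f t"
  and "(\<forall>t. 1/2 <= t --> t <= 1 --> c <= f t) \<or> (\<forall>t. 0 <= t --> t <= 1/2 --> c <= f t)"
 shows "c / 2 <= integral {0..1} f"
proof -
 have i: "f integrable_on {0..1}" "f integrable_on {0..1/2::real}" "f integrable_on {1/2..1::real}"
  using assms(1) by (auto intro!: integrable_continuous_real intro: continuous_on_subset)
 have s: "integral {0..1/2} f + integral {1/2..1} f = integral {0..1} f" using i by (intro Henstock_Kurzweil_Integration.integral_combine) auto
 have p: "0 <= integral {0..1/2} f" "0 <= integral {1/2..1} f" using assms(2) i by (auto intro!: integral_nonneg)
 from assms(3) show ?thesis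
 proof
  assume "\<forall>t. 1/2 <= t --> t <= 1 --> c <= f t"
  hence "integral {1/2..1::real} (%_. c) <= integral {1/2..1} f" using i by (intro integral_le) auto
  thus ?thesis using s p by simp
 next
  assume "\<forall>t. 0 <= t --> t <= 1/2 --> c <= f t"
  hence "integral {0..1/2::real} (%_. c) <= integral {0..1/2} f" using i by (intro integral_le) auto
  thus ?thesis using s p by simp
 qed
qed

lemma al_be_gap:
 assumes "Im z >= 0"
 shows "(h (Re z + Im z / 2) - h (Re z - Im z / 2)) / 2 <= al z - be z"
proof -
 have e: "al z - be z = integral {0..1} (%t. h (Re z + t * Im z) - h (Re z - t * Im z))" unfolding al_def be_def using int_h by (simp add: integral_diff)
 show ?thesis unfolding e
 proof (rule integral_half_bound)
  show "continuous_on {0..1} (%t. h (Re z + t * Im z) - h (Re z - t * Im z))" by (intro continuous_intros cont_h)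
  show "0 <= h (Re z + t * Im z) - h (Re z - t * Im z)" if "0 <= t" "t <= 1" for t using leq[of "Re z - t * Im z" "Re z + t * Im z"] that assms by simp
  have "h (Re z + Im z / 2) - h (Re z - Im z / 2) <= h (Re z + t * Im z) - h (Re z - t * Im z)" if "1/2 <= t" for t
  proof -
   have "Im z / 2 <= t * Im z" using that assms mult_right_mono[of "1/2" t "Im z"] by simp
   thus ?thesis using leq[of "Re z + Im z / 2" "Re z + t * Im z"] leq[of "Re z - t * Im z" "Re z - Im z / 2"] by simp
  qed
  thus "(\<forall>t. 1/2 <= t --> t <= 1 --> h (Re z + Im z / 2) - h (Re z - Im z / 2) <= h (Re z + t * Im z) - h (Re z - t * Im z)) \<or>
   (\<forall>t. 0 <= t --> t <= 1/2 --> h (Re z + Im z / 2) - h (Re z - Im z / 2) <= h (Re z + t * Im z) - h (Re z - t * Im z))" by blast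
 qed
qed

lemma Im_BA_pos: "Im z > 0 ==> Im (BA z) > 0" using al_be_gap[of z] less[of "Re z - Im z / 2" "Re z + Im z / 2"] by (simp add: BA_def)

lemma al_strict:
 assumes "Im z >= 0" "Im w >= 0" "Re z <= Re w" "Im z <= Im w" "z ~= w"
 shows "al z < al w"
proof -
 have "0 < integral {0..1} (%t. h (Re w + t * Im w) - h (Re z + t * Im z))"
 proof -
  let ?c = "h (Re w + Im w / 2) - h (Re z + Im z / 2)"
  define f where "f = (%t. h (Re w + t * Im w) - h (Re z + t * Im z))"
  have lt: "Re z + t * Im z < Re w + t * Im w" if "0 < t" for t
  proof (cases "Im z = Im w")
   case True thus ?thesis using assms by (auto simp: complex_eq_iff)
  next
   case False
   hence "t * Im z < t * Im w" using that assms by simp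
   thus ?thesis using assms by simp
  qed
  have le: "Re z + t * Im z <= Re w + t * Im w" if "0 <= t" for t using that assms by (intro add_mono mult_left_mono) auto
  have c: "continuous_on {1/2..1} f" unfolding f_def by (intro continuous_intros cont_h)
  then obtain t0 where t0: "t0 \<in> {1/2..1}" "!!t. t \<in> {1/2..1} ==> f t0 <= f t" using continuous_attains_inf[of "{1/2..1::real}" f] by auto
  have "f t0 > 0" unfolding f_def using less[OF lt[of t0]] t0 by auto
  moreover have "f t0 / 2 <= integral {0..1} f"
  proof (rule integral_half_bound)
   show "continuous_on {0..1} f" unfolding f_def by (intro continuous_intros cont_h)
   show "0 <= f t" if "0 <= t" for t unfolding f_def using leq[OF le[OF that]] by simp
  qed (use t0 in auto)
  ultimately show ?thesis unfolding f_def by simp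
 qed
 also have "\<dots> = al w - al z" unfolding al_def using int_h by (simp add: integral_diff)
 finally show ?thesis by simp
qed

lemma be_strict:
 assumes "Im z >= 0" "Im w >= 0" "Re z <= Re w" "Im w <= Im z" "z ~= w"
 shows "be z < be w"
proof -
 have "0 < integral {0..1} (%t. h (Re w - t * Im w) - h (Re z - t * Im z))"
 proof -
  define f where "f = (%t. h (Re w - t * Im w) - h (Re z - t * Im z))"
  have lt: "Re z - t * Im z < Re w - t * Im w" if "0 < t" for t
  proof (cases "Im z = Im w")
   case True thus ?thesis using assms by (auto simp: complex_eq_iff)
  next
   case False
   hence "t * Im w < t * Im z" using that assms by simp
   thus ?thesis using assms by simp
  qed
  have le: "Re z - t * Im z <= Re w - t * Im w" if "0 <= t" for t using that assms by (intro diff_mono mult_left_mono) auto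
  have c: "continuous_on {1/2..1} f" unfolding f_def by (intro continuous_intros cont_h)
  then obtain t0 where t0: "t0 \<in> {1/2..1}" "!!t. t \<in> {1/2..1} ==> f t0 <= f t" using continuous_attains_inf[of "{1/2..1::real}" f] by auto
  have "f t0 > 0" unfolding f_def using less[OF lt[of t0]] t0 by auto
  moreover have "f t0 / 2 <= integral {0..1} f"
  proof (rule integral_half_bound)
   show "continuous_on {0..1} f" unfolding f_def by (intro continuous_intros cont_h)
   show "0 <= f t" if "0 <= t" for t unfolding f_def using leq[OF le[OF that]] by simp
  qed (use t0 in auto)
  ultimately show ?thesis unfolding f_def by simp
 qed
 also have "\<dots> = be w - be z" unfolding be_def using int_h by (simp add: integral_diff)
 finally show ?thesis by simp
qed

text \<open>\<open>al\<close> increases in both coordinates, \<open>be\<close> increases in the real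
  and decreases in the imaginary part. If Re z <= Re w, then one of the two separates z from w,
  according to the order of the imaginary parts.\<close>

lemma inj_BA: "inj_on BA {z. Im z >= 0}"
proof -
 have "z = w" if "Im z >= 0" "Im w >= 0" "BA z = BA w" "Re z <= Re w" for z w
 proof -
  have a: "al z = al w" and b: "be z = be w" using that(3) by (auto simp: BA_def)
  show ?thesis
  proof (cases "Im z <= Im w")
   case True thus ?thesis using al_strict[of z w] that a by fastforce
  next
   case False thus ?thesis using be_strict[of z w] that b by fastforce
  qed
 qed
 thus ?thesis unfolding inj_on_def by (metis linear mem_Collect_eq)
qed

lemma triple:
 assumes "u < v" "v - u <= L" "L <= v - u"
 shows "h (v + L) - h (u - L) <= (1 + 2 * M) * (h v - h u)"
proof -
 have L: "L = v - u" using assms by simp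
 have "h (v + L) - h v <= M * (h v - h (v - L))" using assms by (intro qs1) auto
 moreover have "h u - h (u - L) <= M * (h (u + L) - h u)" using assms by (intro qs2) auto
 ultimately show ?thesis by (simp add: L algebra_simps)
qed

text \<open>Each use of \<open>triple\<close> enlarges the interval threefold about its centre, and
  two uses reach four lengths to either side.\<close>

lemma ninefold:
 assumes "u < v" "u - 4 * (v - u) <= a" "b <= v + 4 * (v - u)"
 shows "h b - h a <= (1 + 2 * M)\<^sup>2 * (h v - h u)"
proof -
 let ?L = "v - u"
 have 1: "h (v + ?L) - h (u - ?L) <= (1 + 2 * M) * (h v - h u)" using assms by (intro triple) auto
 have 2: "h ((v + ?L) + 3 * ?L) - h ((u - ?L) - 3 * ?L) <= (1 + 2 * M) * (h (v + ?L) - h (u - ?L))" using assms by (intro triple) auto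
 have "h b - h a <= h ((v + ?L) + 3 * ?L) - h ((u - ?L) - 3 * ?L)" using assms leq[of b "(v + ?L) + 3 * ?L"] leq[of "(u - ?L) - 3 * ?L" a] by (simp add: algebra_simps)
 also note 2
 also have "(1 + 2 * M) * (h (v + ?L) - h (u - ?L)) <= (1 + 2 * M) * ((1 + 2 * M) * (h v - h u))" using 1 M1 by (intro mult_left_mono) auto
 finally show ?thesis by (simp add: power2_eq_square mult.assoc)
qed

lemma BA_upper:
 assumes "Im z >= 0" "cmod (z - of_real a) <= r" "0 < r"
 shows "cmod (BA z - of_real (h a)) <= 2 * (1 + 2 * M)\<^sup>2 * (h (a + r) - h (a - r))"
proof -
 have x: "\<bar>Re z - a\<bar> <= r" "Im z <= r" using assms abs_Re_le_cmod[of "z - of_real a"] abs_Im_le_cmod[of "z - of_real a"] by auto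
 let ?D = "h (a + 2 * r) - h (a - 2 * r)"
 have tt: "t * Im z <= r" "0 <= t * Im z" if "0 <= t" "t <= 1" for t using that x assms mult_mono[of t 1 "Im z" r] by auto
 have pts: "Re z + t * Im z <= a + 2 * r & a - 2 * r <= Re z + t * Im z & Re z - t * Im z <= a + 2 * r & a - 2 * r <= Re z - t * Im z"
  if "0 <= t" "t <= 1" for t using tt[OF that] x by linarith
 have 1: "al z - h a <= ?D" "h a - al z <= ?D"
 proof -
  have "al z <= h (a + 2 * r)" using tt x assms(1) by (intro al_bounds' leq) (use pts in auto)
  moreover have "h (a - 2 * r) <= al z" using tt x assms(1) by (intro al_bounds leq) (use pts in auto)
  ultimately show "al z - h a <= ?D" "h a - al z <= ?D" using leq[of "a - 2*r" a] leq[of a "a + 2*r"] assms by auto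
 qed
 have 2: "be z - h a <= ?D" "h a - be z <= ?D"
 proof -
  have "be z <= h (a + 2 * r)" using tt x assms(1) by (intro be_bounds' leq) (use pts in auto)
  moreover have "h (a - 2 * r) <= be z" using tt x assms(1) by (intro be_bounds leq) (use pts in auto)
  ultimately show "be z - h a <= ?D" "h a - be z <= ?D" using leq[of "a - 2*r" a] leq[of a "a + 2*r"] assms by auto
 qed
 have "cmod (BA z - of_real (h a)) <= \<bar>Re (BA z - of_real (h a))\<bar> + \<bar>Im (BA z - of_real (h a))\<bar>" by (rule cmod_le)
 also have "\<dots> <= ?D + ?D"
 proof (intro add_mono abs_leI)
  show "Re (BA z - of_real (h a)) <= ?D" "- Re (BA z - of_real (h a)) <= ?D"
   "Im (BA z - of_real (h a)) <= ?D" "- Im (BA z - of_real (h a)) <= ?D" using 1 2 by (simp_all add: BA_def field_simps)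
 qed
 also have "?D + ?D = 2 * ?D" by simp
 also have "?D <= (1 + 2 * M)\<^sup>2 * (h (a + r) - h (a - r))" using assms by (intro ninefold) auto
 finally show ?thesis by simp
qed

text \<open>If the imaginary part dominates, \<open>al_be_gap\<close> sees the oscillation of
  \<open>h\<close> about Re z. Otherwise both means are taken on one side of a, and one of them over
  an interval at distance at least s / 2 from a; then the real part is large.\<close>

lemma BA_lower:
 assumes "Im z >= 0" "r <= cmod (z - of_real a)" "0 < r"
 shows "h (a + r) - h (a - r) <= 4 * (1 + 2 * M)\<^sup>2 * cmod (BA z - of_real (h a))"
proof -
 define s where "s = cmod (z - of_real a)"
 have s: "r <= s" using assms by (simp add: s_def)
 have s2: "s <= \<bar>Re z - a\<bar> + Im z" using cmod_le[of "z - of_real a"] assms by (simp add: s_def)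
 have mon: "h (a + r) - h (a - r) <= h (a + s) - h (a - s)" using leq[of "a + r" "a + s"] leq[of "a - s" "a - r"] s by simp
 have pos: "0 <= (1 + 2 * M)\<^sup>2" by simp
 show ?thesis
 proof (cases "Im z >= \<bar>Re z - a\<bar>")
  case True
  hence y: "Im z >= s / 2" using s2 by auto
  have x: "\<bar>Re z - a\<bar> <= s" using abs_Re_le_cmod[of "z - of_real a"] by (simp add: s_def)
  have "h (a + s) - h (a - s) <= (1 + 2 * M)\<^sup>2 * (h (Re z + Im z / 2) - h (Re z - Im z / 2))" by (rule ninefold) (use x y s \<open>0 < r\<close> in auto)
  also have "\<dots> <= (1 + 2 * M)\<^sup>2 * (4 * Im (BA z - of_real (h a)))" using al_be_gap[OF assms(1)] pos by (intro mult_left_mono) (auto simp: BA_def)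
  also have "\<dots> <= (1 + 2 * M)\<^sup>2 * (4 * cmod (BA z - of_real (h a)))" using pos abs_Im_le_cmod[of "BA z - of_real (h a)"] by (intro mult_left_mono) auto
  finally show ?thesis using mon by (simp add: mult_ac)
 next
  case False
  hence ge: "\<bar>Re z - a\<bar> >= s / 2" "Im z < \<bar>Re z - a\<bar>" using s2 by auto
  have ty: "0 <= t * Im z" "t * Im z <= Im z" if "0 <= t" "t <= 1" for t using that assms(1) mult_right_mono[of t 1 "Im z"] by auto
  have pts: "Re z - \<bar>Re z - a\<bar> <= Re z - t * Im z & Re z + t * Im z <= Re z + \<bar>Re z - a\<bar> & Re z - t * Im z <= Re z & Re z <= Re z + t * Im z"
   if "0 <= t" "t <= 1" for t using ty[OF that] ge by linarith
  have rb: "al z + be z - 2 * h a = 2 * Re (BA z - of_real (h a))" by (simp add: BA_def)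
  have rb1: "al z + be z - 2 * h a <= 2 * \<bar>Re (BA z - of_real (h a))\<bar>"
   "2 * h a - al z - be z <= 2 * \<bar>Re (BA z - of_real (h a))\<bar>"
   using rb abs_ge_self[of "Re (BA z - of_real (h a))"] abs_ge_minus_self[of "Re (BA z - of_real (h a))"] by (linarith, linarith)
  have "h (a + s) - h (a - s) <= (1 + 2 * M)\<^sup>2 * (2 * \<bar>Re (BA z - of_real (h a))\<bar>)"
  proof (cases "Re z > a")
   case True
   have 1: "h (a + s / 2) <= al z"
   proof (intro al_bounds leq assms)
    fix t :: real assume "0 <= t" "t <= 1"
    thus "a + s / 2 <= Re z + t * Im z" using pts[of t] True ge by linarith
   qed
   have 2: "h a <= be z"
   proof (intro be_bounds leq assms)
    fix t :: real assume "0 <= t" "t <= 1"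
    thus "a <= Re z - t * Im z" using pts[of t] True ge by linarith
   qed
   have "h (a + s) - h (a - s) <= (1 + 2 * M)\<^sup>2 * (h (a + s / 2) - h a)" by (rule ninefold) (use s \<open>0 < r\<close> in auto)
   also have "\<dots> <= (1 + 2 * M)\<^sup>2 * (2 * \<bar>Re (BA z - of_real (h a))\<bar>)" using 1 2 pos rb1 by (intro mult_left_mono) linarith+
   finally show ?thesis .
  next
   case F: False
   have 1: "be z <= h (a - s / 2)"
   proof (intro be_bounds' leq assms)
    fix t :: real assume "0 <= t" "t <= 1"
    thus "Re z - t * Im z <= a - s / 2" using pts[of t] F ge by linarith
   qed
   have 2: "al z <= h a"
   proof (intro al_bounds' leq assms)
    fix t :: real assume "0 <= t" "t <= 1"
    thus "Re z + t * Im z <= a" using pts[of t] F ge by linarith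
   qed
   have "h (a + s) - h (a - s) <= (1 + 2 * M)\<^sup>2 * (h a - h (a - s / 2))" by (rule ninefold) (use s \<open>0 < r\<close> in auto)
   also have "\<dots> <= (1 + 2 * M)\<^sup>2 * (2 * \<bar>Re (BA z - of_real (h a))\<bar>)" using 1 2 pos rb1 by (intro mult_left_mono) linarith+
   finally show ?thesis .
  qed
  also have "\<dots> <= (1 + 2 * M)\<^sup>2 * (4 * cmod (BA z - of_real (h a)))" using pos abs_Re_le_cmod[of "BA z - of_real (h a)"] by (intro mult_left_mono) auto
  finally show ?thesis using mon by (simp add: mult_ac)
 qed
qed

text \<open>The means are differentiable although \<open>h\<close> may not be, because they are
  difference quotients of an antiderivative \<open>HH\<close>. By the M-condition all four partial
  derivatives have modulus comparable to D = (h(x + y) - h(x - y)) / y, and their signs prevent the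
  derivative from degenerating.\<close>

lemma BA_derivative:
 assumes "Im z > 0"
 shows "\<exists>A m. (BA has_derivative A) (at z) & m > 0 & (\<forall>v. m * cmod v <= cmod (A v) & cmod (A v) <= 64 * (1 + M)\<^sup>2 * m * cmod v)"
proof -
 define x y where "x = Re z" and "y = Im z"
 have y: "y > 0" using assms by (simp add: y_def)
 \<comment> \<open>A base point for the antiderivative to the left of x - y, with room for small
   changes of z.\<close>
 define c0 where "c0 = x - 2 * y"
 define HH where "HH = (%u. integral {c0..u} h)"
 have dHH: "(HH has_real_derivative h u) (at u)" if "c0 < u" for u
 proof -
  have "(HH has_real_derivative h u) (at u within {c0..u+1})" unfolding HH_def using that by (intro integral_has_real_derivative continuous_on_subset[OF cont]) auto
  thus ?thesis using that by (simp add: at_within_Icc_at)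
 qed
 have ivl: "integral {a..b} h = HH b - HH a" if "c0 < a" "a <= b" for a b
 proof -
  have "integral {c0..a} h + integral {a..b} h = integral {c0..b} h"
   using that by (intro Henstock_Kurzweil_Integration.integral_combine integrable_continuous_real continuous_on_subset[OF cont]) auto
  thus ?thesis by (simp add: HH_def)
 qed
 have avg: "integral {0..1} (%t. h (a + t * b)) = (HH (a + b) - HH a) / b" if "b > 0" "c0 < a" for a b
 proof -
  have "(h has_integral integral {a..a+b} h) (cbox a (a+b))" using integrable_integral[OF integrable_continuous_real[OF continuous_on_subset[OF cont]]] by simp
  from has_integral_affinity[OF this, of b a] that
  have "((%t. h (b * t + a)) has_integral (1 / b) * integral {a..a+b} h) ((%t. (1/b) * t + - ((1/b) * a)) ` cbox a (a+b))" by simp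
  moreover have "(%t. (1/b) * t + - ((1/b) * a)) ` cbox a (a+b) = {0..1}"
   using that image_affinity_atLeastAtMost[of "1/b" "-((1/b)*a)" a "a+b"] by (simp add: field_simps)
  ultimately have "((%t. h (a + t * b)) has_integral (1 / b) * integral {a..a+b} h) {0..1}" by (simp add: algebra_simps)
  thus ?thesis using ivl[of a "a+b"] that by (simp add: integral_unique)
 qed
 have al_eq: "al w = (HH (Re w + Im w) - HH (Re w)) / Im w" if "Im w > 0" "c0 < Re w" for w unfolding al_def using avg[OF that] by simp
 have be_eq: "be w = (HH (Re w) - HH (Re w - Im w)) / Im w" if "Im w > 0" "c0 < Re w - Im w" for w
 proof -
  have "be w = integral {0..1} (%t. h ((Re w - Im w) + (1 - t) * Im w))" unfolding be_def by (simp add: algebra_simps)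
  also have "\<dots> = integral {0..1} (%t. h ((Re w - Im w) + t * Im w))"
  proof -
   have "((%t. h ((Re w - Im w) + t * Im w)) has_integral integral {0..1} (%t. h ((Re w - Im w) + t * Im w))) (cbox 0 1)" using int_h by (simp add: integrable_integral)
   from has_integral_affinity[OF this, of "-1" 1]
   have "((%t. h ((Re w - Im w) + (1 - t) * Im w)) has_integral integral {0..1} (%t. h ((Re w - Im w) + t * Im w))) ((%t. 1 - t) ` {0..1})" by (simp add: algebra_simps)
   moreover have "(%t. 1 - t) ` {0..1} = {0..1::real}" by (auto simp: image_iff intro!: bexI[of _ "1 - _"])
   ultimately show ?thesis by (simp add: integral_unique)
  qed
  finally show ?thesis using avg[of "Im w" "Re w - Im w"] that by simp
 qed
 define \<alpha> \<beta> where "\<alpha> = al z" and "\<beta> = be z"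
 \<comment> \<open>The partial derivatives in the x and y directions: p and q for \<open>al\<close>,
   s and -u for \<open>be\<close>.\<close>
 define p where "p = (h (x + y) - h x) / y"
 define q where "q = (h (x + y) - \<alpha>) / y"
 define s where "s = (h x - h (x - y)) / y"
 define u where "u = (\<beta> - h (x - y)) / y"
 have c0: "c0 < x - y" "c0 < x" "c0 < x + y" using y by (auto simp: c0_def)
 have O: "open {w. Im w > 0 & c0 < Re w - Im w}"
 proof -
  have "{w. Im w > 0 & c0 < Re w - Im w} = {w. Im w > 0} \<inter> {w. c0 < Re w - Im w}" by auto
  thus ?thesis by (auto intro!: open_Int open_halfspace_Im_gt open_Collect_less continuous_intros)
 qed
 have zO: "z \<in> {w. Im w > 0 & c0 < Re w - Im w}" using y c0 by (simp add: x_def y_def)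
 have dH: "((%w. HH (g w)) has_derivative (%v. g' v * h (g z))) (at z)" if "c0 < g z" "(g has_derivative g') (at z)" for g g' :: "complex => real"
  using DERIV_compose_FDERIV[OF dHH[OF that(1)] that(2)] by simp
 have dRe: "((%w. HH (Re w)) has_derivative (%v. Re v * h x)) (at z)" using dH[of Re Re] c0 has_derivative_Re[OF has_derivative_ident] by (simp add: x_def)
 have dp: "((%w. HH (Re w + Im w)) has_derivative (%v. (Re v + Im v) * h (x + y))) (at z)" using dH[of "%w. Re w + Im w" "%w. Re w + Im w"] c0
   has_derivative_add[OF has_derivative_Re[OF has_derivative_ident] has_derivative_Im[OF has_derivative_ident]] by (simp add: x_def y_def)
 have dm: "((%w. HH (Re w - Im w)) has_derivative (%v. (Re v - Im v) * h (x - y))) (at z)" using dH[of "%w. Re w - Im w" "%w. Re w - Im w"] c0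
   has_derivative_diff[OF has_derivative_Re[OF has_derivative_ident] has_derivative_Im[OF has_derivative_ident]] by (simp add: x_def y_def)
 have "((%w. (HH (Re w + Im w) - HH (Re w)) / Im w) has_derivative (%v. p * Re v + q * Im v)) (at z)"
 proof -
  have e: "HH (Re z + Im z) - HH (Re z) = \<alpha> * y" using al_eq[of z] y c0 by (simp add: \<alpha>_def x_def y_def)
  have "((%w. (HH (Re w + Im w) - HH (Re w)) / Im w) has_derivative
    (%v. - (HH (Re z + Im z) - HH (Re z)) * (inverse (Im z) * Im v * inverse (Im z)) + ((Re v + Im v) * h (x + y) - Re v * h x) / Im z)) (at z)"
   using y by (intro has_derivative_divide[OF has_derivative_diff[OF dp dRe]] has_derivative_Im has_derivative_ident) (simp add: y_def)
  also have "(%v. - (HH (Re z + Im z) - HH (Re z)) * (inverse (Im z) * Im v * inverse (Im z)) + ((Re v + Im v) * h (x + y) - Re v * h x) / Im z)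
    = (%v. p * Re v + q * Im v)" unfolding e using y by (simp add: fun_eq_iff p_def q_def y_def[symmetric] field_simps)
  finally show ?thesis .
 qed
 hence dal: "(al has_derivative (%v. p * Re v + q * Im v)) (at z)" by (rule has_derivative_transform_within_open[OF _ O zO]) (insert y, auto simp: al_eq)
 have "((%w. (HH (Re w) - HH (Re w - Im w)) / Im w) has_derivative (%v. s * Re v - u * Im v)) (at z)"
 proof -
  have e: "HH (Re z) - HH (Re z - Im z) = \<beta> * y" using be_eq[of z] y c0 by (simp add: \<beta>_def x_def y_def)
  have "((%w. (HH (Re w) - HH (Re w - Im w)) / Im w) has_derivative
    (%v. - (HH (Re z) - HH (Re z - Im z)) * (inverse (Im z) * Im v * inverse (Im z)) + (Re v * h x - (Re v - Im v) * h (x - y)) / Im z)) (at z)"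
   using y by (intro has_derivative_divide[OF has_derivative_diff[OF dRe dm]] has_derivative_Im has_derivative_ident) (simp add: y_def)
  also have "(%v. - (HH (Re z) - HH (Re z - Im z)) * (inverse (Im z) * Im v * inverse (Im z)) + (Re v * h x - (Re v - Im v) * h (x - y)) / Im z)
    = (%v. s * Re v - u * Im v)" unfolding e using y by (simp add: fun_eq_iff s_def u_def y_def[symmetric] field_simps)
  finally show ?thesis .
 qed
 hence dbe: "(be has_derivative (%v. s * Re v - u * Im v)) (at z)" by (rule has_derivative_transform_within_open[OF _ O zO]) (insert y, auto simp: be_eq)
 define A where "A = (%v. Complex ((p * Re v + q * Im v + (s * Re v - u * Im v)) / 2) ((p * Re v + q * Im v - (s * Re v - u * Im v)) / 2))"
 have dBA: "(BA has_derivative A) (at z)" unfolding BA_def[abs_def] A_def Complex_eq by (auto intro!: derivative_eq_intros dal dbe simp: fun_eq_iff)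
 define D where "D = (h (x + y) - h (x - y)) / y"
 have Dpos: "D > 0" using less[of "x - y" "x + y"] y by (simp add: D_def)
 define k where "k = 1 / (2 * (1 + M)\<^sup>2)"
 have k: "k > 0" using M1 by (simp add: k_def)
 \<comment> \<open>The numbers q and u involve means, so their lower bounds need the M-condition at
   the half step y / 2 in addition to the full step.\<close>
 have half1: "h (x + y) - h x <= (1 + M) * (h (x + y) - h (x + y / 2))" using qs2[of "y/2" "x + y/2"] y by (simp add: algebra_simps)
 have half2: "h x - h (x - y) <= (1 + M) * (h (x - y / 2) - h (x - y))" using qs1[of "y/2" "x - y/2"] y by (simp add: algebra_simps)
 have full1: "h (x + y) - h (x - y) <= (1 + M) * (h (x + y) - h x)" using qs2[of y x] y by (simp add: algebra_simps)
 have full2: "h (x + y) - h (x - y) <= (1 + M) * (h x - h (x - y))" using qs1[of y x] y by (simp add: algebra_simps)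
 have qint: "(h (x + y) - h (x + y / 2)) / 2 <= h (x + y) - \<alpha>"
 proof -
  have e: "h (x + y) - \<alpha> = integral {0..1} (%t. h (x + y) - h (x + t * y))" unfolding \<alpha>_def al_def x_def y_def by (subst integral_diff) (auto intro: int_h)
  show ?thesis unfolding e
  proof (rule integral_half_bound)
   show "continuous_on {0..1} (%t. h (x + y) - h (x + t * y))" by (intro continuous_intros cont_h)
   show "0 <= h (x + y) - h (x + t * y)" if "0 <= t" "t <= 1" for t using leq[of "x + t * y" "x + y"] that y by simp
   have "h (x + y) - h (x + y / 2) <= h (x + y) - h (x + t * y)" if "t <= 1/2" for t using leq[of "x + t * y" "x + y / 2"] that y mult_right_mono[of t "1/2" y] by simp
   thus "(\<forall>t. 1/2 <= t --> t <= 1 --> h (x + y) - h (x + y / 2) <= h (x + y) - h (x + t * y)) \<or>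
     (\<forall>t. 0 <= t --> t <= 1/2 --> h (x + y) - h (x + y / 2) <= h (x + y) - h (x + t * y))" by blast
  qed
 qed
 have uint: "(h (x - y / 2) - h (x - y)) / 2 <= \<beta> - h (x - y)"
 proof -
  have e: "\<beta> - h (x - y) = integral {0..1} (%t. h (x - t * y) - h (x - y))" unfolding \<beta>_def be_def x_def y_def by (subst integral_diff) (auto intro: int_h)
  show ?thesis unfolding e
  proof (rule integral_half_bound)
   show "continuous_on {0..1} (%t. h (x - t * y) - h (x - y))" by (intro continuous_intros cont_h)
   show "0 <= h (x - t * y) - h (x - y)" if "0 <= t" "t <= 1" for t using leq[of "x - y" "x - t * y"] that y by simp
   have "h (x - y / 2) - h (x - y) <= h (x - t * y) - h (x - y)" if "t <= 1/2" for t using leq[of "x - y / 2" "x - t * y"] that y mult_right_mono[of t "1/2" y] by simp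
   thus "(\<forall>t. 1/2 <= t --> t <= 1 --> h (x - y / 2) - h (x - y) <= h (x - t * y) - h (x - y)) \<or>
     (\<forall>t. 0 <= t --> t <= 1/2 --> h (x - y / 2) - h (x - y) <= h (x - t * y) - h (x - y))" by blast
  qed
 qed
 have low: "k * D <= P / y" if "h (x + y) - h (x - y) <= (1 + M) * ((1 + M) * (2 * P))" for P
 proof -
  have "(h (x + y) - h (x - y)) <= 2 * (1 + M)\<^sup>2 * P" using that by (simp add: power2_eq_square mult_ac)
  hence "k * (h (x + y) - h (x - y)) <= P" using M1 by (simp add: k_def field_simps)
  thus ?thesis using y by (simp add: D_def divide_right_mono)
 qed
 have pq: "k * D <= p" "k * D <= q" "k * D <= s" "k * D <= u"
 proof -
  have P1: "(1 + M) * X <= (1 + M) * ((1 + M) * (2 * X))" if "X >= 0" for X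
  proof -
   have "X <= (1 + M) * (2 * X)" using that M1 mult_mono[of 1 "1 + M" X "2 * X"] by simp
   thus ?thesis using M1 by (intro mult_left_mono) auto
  qed
  show "k * D <= p" unfolding p_def using full1 P1[of "h (x + y) - h x"] leq[of x "x + y"] y by (intro low) linarith
  show "k * D <= s" unfolding s_def using full2 P1[of "h x - h (x - y)"] leq[of "x - y" x] y by (intro low) linarith
  have "(1 + M) * (h (x + y) - h (x + y / 2)) <= (1 + M) * (2 * (h (x + y) - \<alpha>))" using qint M1 by (intro mult_left_mono) auto
  with half1 have "h (x + y) - h x <= (1 + M) * (2 * (h (x + y) - \<alpha>))" by (rule order_trans)
  hence "(1 + M) * (h (x + y) - h x) <= (1 + M) * ((1 + M) * (2 * (h (x + y) - \<alpha>)))" using M1 by (intro mult_left_mono) auto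
  thus "k * D <= q" unfolding q_def using full1 by (intro low) linarith
  have "(1 + M) * (h (x - y / 2) - h (x - y)) <= (1 + M) * (2 * (\<beta> - h (x - y)))" using uint M1 by (intro mult_left_mono) auto
  with half2 have "h x - h (x - y) <= (1 + M) * (2 * (\<beta> - h (x - y)))" by (rule order_trans)
  hence "(1 + M) * (h x - h (x - y)) <= (1 + M) * ((1 + M) * (2 * (\<beta> - h (x - y))))" using M1 by (intro mult_left_mono) auto
  thus "k * D <= u" unfolding u_def using full2 by (intro low) linarith
 qed
 have hx: "h (x - y) <= h x" "h x <= h (x + y)" using leq y by auto
 have aa: "h x <= \<alpha>" unfolding \<alpha>_def using y by (intro al_bounds leq) (auto simp: x_def y_def)
 have bb: "\<beta> <= h x" unfolding \<beta>_def using y by (intro be_bounds' leq) (auto simp: x_def y_def)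
 have up: "p <= D" "q <= D" "s <= D" "u <= D" unfolding p_def q_def s_def u_def D_def using hx aa bb y by (auto intro!: divide_right_mono)
 have kD: "0 < k * D" using k Dpos by simp
 have "k * D / 4 * cmod v <= cmod (A v) & cmod (A v) <= 64 * (1 + M)\<^sup>2 * (k * D / 4) * cmod v" for v
 proof
  define a b where "a = p * Re v + q * Im v" and "b = s * Re v - u * Im v"
  have Av: "A v = Complex ((a + b) / 2) ((a - b) / 2)" by (simp add: A_def a_def b_def)
  have cv: "cmod v <= \<bar>Re v\<bar> + \<bar>Im v\<bar>" by (rule cmod_le)
  \<comment> \<open>If Re v and Im v have the same sign, the two terms of a add up; otherwise those
    of b do.\<close>
  have "k * D * (\<bar>Re v\<bar> + \<bar>Im v\<bar>) <= \<bar>a\<bar> \<or> k * D * (\<bar>Re v\<bar> + \<bar>Im v\<bar>) <= \<bar>b\<bar>"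
  proof -
   have "(Re v >= 0 & Im v >= 0) \<or> (Re v <= 0 & Im v <= 0) \<or> (Re v >= 0 & Im v <= 0) \<or> (Re v <= 0 & Im v >= 0)" by linarith
   thus ?thesis
   proof (elim disjE conjE)
    assume "Re v >= 0" "Im v >= 0"
    hence "k * D * Re v + k * D * Im v <= a" unfolding a_def using pq by (intro add_mono mult_right_mono) auto
    hence "k * D * (\<bar>Re v\<bar> + \<bar>Im v\<bar>) <= a" using \<open>Re v >= 0\<close> \<open>Im v >= 0\<close> by (simp add: distrib_left)
    thus ?thesis by linarith
   next
    assume v: "Re v <= 0" "Im v <= 0"
    hence "k * D * (- Re v) + k * D * (- Im v) <= p * (- Re v) + q * (- Im v)" using pq by (intro add_mono mult_right_mono) auto
    hence "k * D * (\<bar>Re v\<bar> + \<bar>Im v\<bar>) <= - a" using v by (simp add: a_def distrib_left right_diff_distrib)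
    thus ?thesis by linarith
   next
    assume v: "Re v >= 0" "Im v <= 0"
    hence "k * D * (Re v) + k * D * (- Im v) <= s * (Re v) + u * (- Im v)" using pq by (intro add_mono mult_right_mono) auto
    hence "k * D * (\<bar>Re v\<bar> + \<bar>Im v\<bar>) <= b" using v by (simp add: b_def distrib_left right_diff_distrib)
    thus ?thesis by linarith
   next
    assume v: "Re v <= 0" "Im v >= 0"
    hence "k * D * (- Re v) + k * D * (Im v) <= s * (- Re v) + u * (Im v)" using pq by (intro add_mono mult_right_mono) auto
    hence "k * D * (\<bar>Re v\<bar> + \<bar>Im v\<bar>) <= - b" using v by (simp add: b_def distrib_left right_diff_distrib)
    thus ?thesis by linarith
   qed
  qed
  moreover have "\<bar>a\<bar> <= 2 * cmod (A v)" "\<bar>b\<bar> <= 2 * cmod (A v)"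
   using abs_Re_le_cmod[of "A v"] abs_Im_le_cmod[of "A v"] unfolding Av by (auto simp: abs_le_iff)
  moreover have "k * D * cmod v <= k * D * (\<bar>Re v\<bar> + \<bar>Im v\<bar>)" using cv kD by (intro mult_left_mono) auto
  moreover have "0 <= cmod (A v)" by simp
  ultimately have "k * D * cmod v <= 2 * cmod (A v)" "0 <= cmod (A v)" by (meson order_trans)+
  moreover have "k * D / 4 * cmod v = (k * D * cmod v) / 4" by simp
  ultimately show "k * D / 4 * cmod v <= cmod (A v)" by linarith
  have a': "\<bar>a\<bar> <= D * \<bar>Re v\<bar> + D * \<bar>Im v\<bar>"
  proof -
   have "\<bar>a\<bar> <= p * \<bar>Re v\<bar> + q * \<bar>Im v\<bar>" unfolding a_def using pq kD by (intro order_trans[OF abs_triangle_ineq]) (simp add: abs_mult)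
   also have "\<dots> <= D * \<bar>Re v\<bar> + D * \<bar>Im v\<bar>" using up by (intro add_mono mult_right_mono) auto
   finally show ?thesis .
  qed
  have b': "\<bar>b\<bar> <= D * \<bar>Re v\<bar> + D * \<bar>Im v\<bar>"
  proof -
   have "\<bar>b\<bar> <= s * \<bar>Re v\<bar> + u * \<bar>Im v\<bar>" unfolding b_def using pq kD by (intro order_trans[OF abs_triangle_ineq4]) (simp add: abs_mult)
   also have "\<dots> <= D * \<bar>Re v\<bar> + D * \<bar>Im v\<bar>" using up by (intro add_mono mult_right_mono) auto
   finally show ?thesis .
  qed
  have "cmod (A v) <= \<bar>a\<bar> + \<bar>b\<bar>" using cmod_le[of "A v"] abs_triangle_ineq[of a b] abs_triangle_ineq4[of a b] unfolding Av by simp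
  also have "\<dots> <= 4 * (D * cmod v)"
  proof -
   have "D * \<bar>Re v\<bar> <= D * cmod v" "D * \<bar>Im v\<bar> <= D * cmod v" using Dpos abs_Re_le_cmod abs_Im_le_cmod by (auto intro!: mult_left_mono)
   thus ?thesis using a' b' by linarith
  qed
  also have "\<dots> <= 64 * (1 + M)\<^sup>2 * (k * D / 4) * cmod v"
  proof -
   have e: "64 * (1 + M)\<^sup>2 * (k * D / 4) * cmod v = 8 * (D * cmod v)" using M1 by (simp add: k_def field_simps)
   have "0 <= D * cmod v" using Dpos by simp
   thus ?thesis unfolding e by linarith
  qed
  finally show "cmod (A v) <= 64 * (1 + M)\<^sup>2 * (k * D / 4) * cmod v" .
 qed
 thus ?thesis using dBA kD by (intro exI[of _ A] exI[of _ "k * D / 4"]) simp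
qed

end

section \<open>Boundary extension of Riemann maps\<close>

locale jordan_loop =
 fixes c :: "real => complex"
 assumes sp: "simple_path c" and loop: "pathfinish c = pathstart c"
begin

definition G :: "complex set" where "G = path_image c"
definition I :: "complex set" where "I = inside G"

lemma compact_G: "compact G" unfolding G_def using sp by (simp add: compact_simple_path_image)

lemma I_props: "I ~= {}" "open I" "connected I" "bounded I" "frontier I = G" "I \<inter> G = {}" "closure I = I \<union> G"
proof -
 note J = Jordan_inside_outside[OF sp loop, folded G_def, folded I_def]
 show "I ~= {}" "open I" "connected I" "bounded I" "frontier I = G" using J by auto
 thus "I \<inter> G = {}" by (metis Diff_disjoint frontier_def interior_open Int_commute)
 show "closure I = I \<union> G" using \<open>frontier I = G\<close> closure_Un_frontier by blast
qed

lemma circle_param: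
 assumes "\<epsilon> > 0"
 obtains k k' d where "homeomorphism (sphere (0::complex) 1) G k k'" "d > 0"
  "\<forall>s\<in>sphere 0 1. \<forall>t\<in>sphere 0 1. dist s t < d --> dist (k s) (k t) < \<epsilon>"
proof -
 have "sphere (0::complex) 1 homeomorphic G" using homeomorphic_simple_path_image_circle[OF sp loop zero_less_one, of 0] homeomorphic_sym unfolding G_def by blast
 then obtain k k' where k: "homeomorphism (sphere (0::complex) 1) G k k'" unfolding homeomorphic_def by blast
 hence ck: "continuous_on (sphere 0 1) k" by (simp add: homeomorphism_def)
 then obtain d where d: "d > 0" "\<forall>s\<in>sphere 0 1. \<forall>t\<in>sphere 0 1. dist t s < d --> dist (k t) (k s) < \<epsilon>"
  using compact_uniformly_continuous[OF ck compact_sphere] assms unfolding uniformly_continuous_on_def by meson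
 show ?thesis by (rule that[OF k d(1)]) (use d(2) in blast)
qed

lemma connected_inside:
 assumes "connected U" "U \<inter> G = {}" "z \<in> U" "z \<in> I" shows "U <= I"
proof (rule ccontr)
 assume "\<not> U <= I"
 hence "U \<inter> frontier I ~= {}" using assms by (intro connected_Int_frontier) auto
 thus False using assms I_props by auto
qed

lemma circle_cis:
 assumes "cmod s = 1" "cmod t = 1"
 shows "s = t * cis (Arg (s / t))" "cmod (s / t - 1) = dist s t"
proof -
 have t: "t ~= 0" using assms by auto
 have n: "cmod (s / t) = 1" using assms by (simp add: norm_divide)
 hence "s / t = cis (Arg (s / t))" using rcis_cmod_Arg[of "s / t"] by (simp add: rcis_def)
 thus "s = t * cis (Arg (s / t))" using t by (metis nonzero_mult_div_cancel_left times_divide_eq_right)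
 have "cmod (s / t - 1) = cmod ((s - t) / t)" using t by (simp add: diff_divide_distrib)
 thus "cmod (s / t - 1) = dist s t" using assms by (simp add: norm_divide dist_norm)
qed

text \<open>Uniform local connectedness of a Jordan curve. Close points of the curve have close
  parameters on the circle, and the image of a short circular arc about one of them contains the
  others.\<close>

lemma small_arc:
 assumes "\<epsilon> > 0"
 shows "\<exists>\<eta>>0. \<forall>T\<subseteq>G. T ~= {} --> (\<forall>x\<in>T. \<forall>y\<in>T. dist x y <= \<eta>) -->
   (\<exists>b\<subseteq>G. connected b & compact b & T <= b & (\<forall>x\<in>b. \<forall>y\<in>b. dist x y < \<epsilon>))"
proof -
 obtain k k' d where k: "homeomorphism (sphere (0::complex) 1) G k k'" and d': "d > 0"
  "\<forall>s\<in>sphere 0 1. \<forall>t\<in>sphere 0 1. dist s t < d --> dist (k s) (k t) < \<epsilon>" using circle_param[OF assms] .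
 have ck: "continuous_on (sphere 0 1) k" "continuous_on G k'" "k ` sphere 0 1 = G" "k' ` G = sphere 0 1"
  "!!x. x \<in> sphere 0 1 ==> k' (k x) = x" "!!y. y \<in> G ==> k (k' y) = y" using k by (auto simp: homeomorphism_def)
 note d = d'(1) d'(2)[rule_format]
 have "isCont cis 0" unfolding cis_conv_exp[abs_def] by (intro continuous_intros)
 then obtain \<theta> where th: "\<theta> > 0" "!!x. \<bar>x\<bar> < \<theta> ==> dist (cis x) 1 < d / 2"
  unfolding continuous_at_eps_delta using d(1) by (metis cis_zero dist_0_norm dist_commute half_gt_zero real_norm_def)
 have "isCont Arg 1" by (rule continuous_at_Arg) auto
 then obtain \<mu> where mu: "\<mu> > 0" "!!u. cmod (u - 1) < \<mu> ==> \<bar>Arg u\<bar> < \<theta> / 2"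
  unfolding continuous_at_eps_delta using th(1) by (metis Arg_1 dist_norm half_gt_zero diff_zero real_norm_def)
 obtain \<eta> where eta: "\<eta> > 0" "!!x y. [|x \<in> G; y \<in> G; dist x y < \<eta>|] ==> dist (k' x) (k' y) < \<mu>"
  using compact_uniformly_continuous[OF ck(2) compact_G] mu(1) unfolding uniformly_continuous_on_def by (metis dist_commute)
 show ?thesis
 proof (intro exI[of _ "\<eta> / 2"] conjI allI impI)
  fix T assume T: "T <= G" "T ~= {}" "\<forall>x\<in>T. \<forall>y\<in>T. dist x y <= \<eta> / 2"
  then obtain x0 where x0: "x0 \<in> T" by blast
  define t where "t = k' x0"
  have "t \<in> sphere 0 1" using x0 T(1) ck(4) unfolding t_def by blast
  hence t1: "cmod t = 1" by simp
  define arc where "arc = (%v. t * cis v) ` {-(\<theta>/2)..\<theta>/2}"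
  have arc1: "arc <= sphere 0 1" using t1 by (auto simp: arc_def norm_mult)
  have ca: "continuous_on {-(\<theta>/2)..\<theta>/2} (%v. t * cis v)" unfolding cis_conv_exp by (intro continuous_intros)
  have arc2: "connected arc" "compact arc" unfolding arc_def by (auto intro!: connected_continuous_image compact_continuous_image ca)
  have arc3: "dist u t < d / 2" if uarc: "u \<in> arc" for u
  proof -
   obtain v where v: "u = t * cis v" "v \<in> {-(\<theta>/2)..\<theta>/2}" using uarc unfolding arc_def by blast
   hence "\<bar>v\<bar> < \<theta>" using th(1) by auto
   have "dist u t = cmod (t * (cis v - 1))" by (simp add: v dist_norm algebra_simps)
   also have "\<dots> = dist (cis v) 1" using t1 by (simp add: norm_mult dist_norm)
   finally show ?thesis using th(2)[of v] \<open>\<bar>v\<bar> < \<theta>\<close> by simp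
  qed
  show "\<exists>b\<subseteq>G. connected b & compact b & T <= b & (\<forall>x\<in>b. \<forall>y\<in>b. dist x y < \<epsilon>)"
  proof (intro exI[of _ "k ` arc"] conjI ballI)
   show "k ` arc <= G" using arc1 ck(3) by blast
   show "connected (k ` arc)" "compact (k ` arc)" using arc2 continuous_on_subset[OF ck(1) arc1] by (auto intro: connected_continuous_image compact_continuous_image)
   show "T <= k ` arc"
   proof
    fix x assume x: "x \<in> T"
    hence "dist x x0 < \<eta>" "x \<in> G" "x0 \<in> G" proof -
     have "dist x x0 <= \<eta> / 2" using T(3) x x0 by blast
     thus "dist x x0 < \<eta>" using eta(1) by linarith
    qed (use x x0 T(1) in blast)+
    hence "dist (k' x) t < \<mu>" unfolding t_def by (intro eta(2))
    moreover have "cmod (k' x) = 1"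
    proof -
     have "k' x \<in> sphere 0 1" using \<open>x \<in> G\<close> ck(4) by blast
     thus ?thesis by simp
    qed
    ultimately have e: "k' x = t * cis (Arg (k' x / t))" "\<bar>Arg (k' x / t)\<bar> < \<theta> / 2" using circle_cis[of "k' x" t] t1 mu(2)[of "k' x / t"] by auto
    hence "k' x \<in> arc" unfolding arc_def by (intro image_eqI[of _ _ "Arg (k' x / t)"]) auto
    thus "x \<in> k ` arc" using ck(6)[of x] x T(1) by (metis image_eqI subsetD)
   qed
   fix x y assume "x \<in> k ` arc" "y \<in> k ` arc"
   then obtain u v where uv: "u \<in> arc" "v \<in> arc" "x = k u" "y = k v" by blast
   have "dist u v < d" using arc3[OF uv(1)] arc3[OF uv(2)] dist_triangle2[of u v t] by simp
   moreover have "u \<in> sphere 0 1" "v \<in> sphere 0 1" using uv arc1 by auto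
   ultimately show "dist x y < \<epsilon>" unfolding uv(3,4) by (intro d(2))
  qed
 qed (use eta in auto)
qed

text \<open>Janiszewski's theorem with K the complement of the \<epsilon>-ball together with the arc
  A of the curve away from w. The curve leaves the ball only along A, so G and K meet in the
  connected set A; points that are joined off G and joined off K are therefore joined off
  both.\<close>

lemma locally_connected_at_boundary:
 assumes "w \<in> G" "\<epsilon> > 0"
 shows "\<exists>\<eta>>0. \<forall>z1\<in>I \<inter> ball w \<eta>. \<forall>z2\<in>I \<inter> ball w \<eta>. \<exists>U. connected U & U <= I \<inter> ball w \<epsilon> & z1 \<in> U & z2 \<in> U"
proof -
 obtain k k' d where k: "homeomorphism (sphere (0::complex) 1) G k k'" and d': "d > 0"
  "\<forall>s\<in>sphere 0 1. \<forall>t\<in>sphere 0 1. dist s t < d --> dist (k s) (k t) < \<epsilon>" using circle_param[OF assms(2)] .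
 have ck: "continuous_on (sphere 0 1) k" "continuous_on G k'" "k ` sphere 0 1 = G" "k' ` G = sphere 0 1"
  "!!x. x \<in> sphere 0 1 ==> k' (k x) = x" "!!y. y \<in> G ==> k (k' y) = y" using k by (auto simp: homeomorphism_def)
 note d = d'(1) d'(2)[rule_format]
 have "isCont cis 0" unfolding cis_conv_exp[abs_def] by (intro continuous_intros)
 then obtain \<theta>0 where th0: "\<theta>0 > 0" "!!x. \<bar>x\<bar> < \<theta>0 ==> dist (cis x) 1 < d"
  unfolding continuous_at_eps_delta using d(1) by (metis cis_zero dist_0_norm dist_commute real_norm_def)
 define \<theta> where "\<theta> = min \<theta>0 pi"
 have th: "\<theta> > 0" "\<theta> <= pi" "!!x. \<bar>x\<bar> < \<theta> ==> dist (cis x) 1 < d" using th0 by (auto simp: \<theta>_def)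
 define t where "t = k' w"
 have t1: "cmod t = 1" using assms ck(4) unfolding t_def by (metis image_eqI mem_sphere_0)
 have kt: "k t = w" using ck(6) assms by (simp add: t_def)
 \<comment> \<open>The complementary arc, parametrised from \<theta> to 2 pi - \<theta> so that it
   is visibly connected.\<close>
 define A where "A = k ` (%v. t * cis v) ` {\<theta>..2*pi - \<theta>}"
 have arc1: "(%v. t * cis v) ` {\<theta>..2*pi - \<theta>} <= sphere 0 1" using t1 by (auto simp: norm_mult)
 have ca: "continuous_on {\<theta>..2*pi - \<theta>} (%v. t * cis v)" unfolding cis_conv_exp by (intro continuous_intros)
 have A1: "connected A" "compact A" unfolding A_def by (auto intro!: connected_continuous_image compact_continuous_image ca continuous_on_subset[OF ck(1) arc1])
 have AG: "A <= G" using arc1 ck(3) unfolding A_def by blast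
 have wA: "w \<notin> A"
 proof
  assume "w \<in> A"
  then obtain v where v: "\<theta> <= v" "v <= 2*pi - \<theta>" "w = k (t * cis v)" by (auto simp: A_def)
  have "t * cis v \<in> sphere 0 1" using t1 by (simp add: norm_mult)
  hence "t = t * cis v" using v(3) ck(5) t_def by metis
  moreover have "t ~= 0" using t1 by auto
  ultimately have "cis v = 1" by simp
  then obtain n :: int where "v = of_int (2 * n) * pi" by (auto simp: cis_conv_exp exp_eq_1)
  hence "v = 2 * (of_int n * pi)" by simp
  hence "0 < of_int n * pi" "of_int n * pi < 1 * pi" using v th(1) by linarith+
  hence "0 < (of_int n :: real)" "of_int n < (1::real)" unfolding zero_less_mult_iff mult_less_cancel_right_pos[OF pi_gt_zero] by auto
  hence "0 < n" "n < 1" by auto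
  thus False by simp
 qed
 have near: "x \<in> ball w \<epsilon>" if "x \<in> G" "x \<notin> A" for x
 proof -
  define s where "s = k' x"
  have s1: "cmod s = 1" using that ck(4) unfolding s_def by (metis image_eqI mem_sphere_0)
  have xs: "x = k s" using ck(6) that by (simp add: s_def)
  define \<alpha> where "\<alpha> = Arg (s / t)"
  have e: "s = t * cis \<alpha>" unfolding \<alpha>_def by (rule circle_cis(1)[OF s1 t1])
  have "\<bar>\<alpha>\<bar> < \<theta>"
  proof (rule ccontr)
   assume n: "\<not> \<bar>\<alpha>\<bar> < \<theta>"
   have b: "- pi < \<alpha>" "\<alpha> <= pi" unfolding \<alpha>_def by (auto simp: mpi_less_Arg Arg_le_pi)
   have "s \<in> (%v. t * cis v) ` {\<theta>..2*pi - \<theta>}"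
   proof (cases "\<alpha> >= 0")
    case True
    thus ?thesis using e n b th(2) by (intro image_eqI[of _ _ \<alpha>]) auto
   next
    case False
    have "cis (\<alpha> + 2 * pi) = cis (\<alpha>)" by (simp add: cis.ctr)
    thus ?thesis using e n b th(2) False by (intro image_eqI[of _ _ "\<alpha> + 2 * pi"]) auto
   qed
   thus False using that(2) xs by (auto simp: A_def)
  qed
  hence "dist (cis (\<alpha>)) 1 < d" by (rule th(3))
  moreover have "dist s t = cmod (t * (cis (\<alpha>) - 1))" by (subst e) (simp add: dist_norm algebra_simps)
  ultimately have "dist s t < d" using t1 by (simp add: norm_mult dist_norm)
  hence "dist (k s) (k t) < \<epsilon>" using s1 t1 d(2) by simp
  thus ?thesis using xs kt by (simp add: dist_commute)
 qed
 obtain \<eta>0 where eta0: "\<eta>0 > 0" "ball w \<eta>0 <= - A" using wA A1(2) by (metis ComplI compact_imp_closed open_Compl open_contains_ball)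
 define \<eta> where "\<eta> = min \<eta>0 \<epsilon>"
 have eta: "\<eta> > 0" "ball w \<eta> <= - A" "\<eta> <= \<epsilon>" using eta0 assms by (auto simp: \<eta>_def)
 define K where "K = (- ball w \<epsilon>) \<union> A"
 have clK: "closed K" unfolding K_def by (intro closed_Un compact_imp_closed[OF A1(2)]) (simp add: closed_Compl)
 have GK: "G \<inter> K = A" using AG near unfolding K_def by blast
 show ?thesis
 proof (intro exI[of _ \<eta>] conjI ballI)
  fix z1 z2 assume z: "z1 \<in> I \<inter> ball w \<eta>" "z2 \<in> I \<inter> ball w \<eta>"
  have "connected_component (- (G \<union> K)) z1 z2"
  proof (rule Janiszewski[OF compact_G clK])
   show "connected (G \<inter> K)" using A1 GK by simp
   show "connected_component (- G) z1 z2" unfolding connected_component_def using z I_props by (intro exI[of _ I]) auto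
   show "connected_component (- K) z1 z2" unfolding connected_component_def using z eta by (intro exI[of _ "ball w \<eta>"]) (auto simp: K_def)
  qed
  then obtain U where U: "connected U" "U <= - (G \<union> K)" "z1 \<in> U" "z2 \<in> U" by (auto simp: connected_component_def)
  have "U <= I" using U z by (intro connected_inside[of U z1]) auto
  moreover have "U <= ball w \<epsilon>" using U by (auto simp: K_def)
  ultimately show "\<exists>U. connected U & U <= I \<inter> ball w \<epsilon> & z1 \<in> U & z2 \<in> U" using U by blast
 qed (use eta in auto)
qed

end

section \<open>Boundary behaviour of conformal maps from the half-plane\<close>

lemma upper_half_mobius:
 assumes "z \<in> \<H>"
 shows "of_real a - 1 / z \<in> \<H>" and "1 / (of_real a - z) \<in> \<H>"
proof -
 have nz: "z ~= 0" "of_real a - z ~= 0" using assms by (auto simp: \<H>_def)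
 have "Im (of_real a - 1 / z) = Im z / (cmod z)\<^sup>2" using nz by (simp add: Im_divide cmod_power2)
 thus "of_real a - 1 / z \<in> \<H>" using assms nz by (simp add: \<H>_def)
 have "Im (1 / (of_real a - z)) = Im z / (cmod (of_real a - z))\<^sup>2" using nz by (simp add: Im_divide cmod_power2)
 thus "1 / (of_real a - z) \<in> \<H>" using assms nz by (simp add: \<H>_def)
qed

lemma real_minus_upper: "y \<in> \<H> ==> of_real a - y ~= 0"
proof
 assume "y \<in> \<H>" "of_real a - y = 0"
 hence "y = of_real a" by simp
 thus False using \<open>y \<in> \<H>\<close> by (simp add: \<H>_def)
qed

lemma upper_half_trivial_limit:
 assumes "y \<in> closed_half"
 shows "at y within \<H> ~= bot"
proof -
 have "y islimpt \<H>" unfolding islimpt_approachable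
 proof (intro allI impI)
  fix e :: real assume "e > 0"
  thus "\<exists>x'\<in>\<H>. x' ~= y & dist x' y < e"
   using assms by (intro bexI[of _ "y + \<i> * of_real (e/2)"]) (auto simp: \<H>_def closed_half_def dist_norm norm_mult)
 qed
 thus ?thesis by (simp add: trivial_limit_within)
qed

lemma connected_at_distance:
 fixes S :: "'a::metric_space set"
 assumes "connected S" "continuous_on S g" "a \<in> S" "b \<in> S" "dist x (g a) <= r" "r <= dist x (g b)"
 shows "\<exists>w\<in>S. dist x (g w) = r"
proof -
 have "connected ((%w. dist x (g w)) ` S)" by (intro connected_continuous_image continuous_intros assms(1,2))
 hence "{dist x (g a)..dist x (g b)} <= (%w. dist x (g w)) ` S" using assms(3,4) by (intro connected_contains_Icc) auto
 hence "r \<in> (%w. dist x (g w)) ` S" using assms(5,6) by auto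
 thus ?thesis by auto
qed

locale half_plane_riemann = jordan_loop c for c +
 fixes \<psi> \<tau> :: "complex => complex"
 assumes hol: "\<psi> holomorphic_on \<H>" and im: "\<psi> ` \<H> = I"
  and cont_inv: "continuous_on I \<tau>" and inv: "!!z. z \<in> \<H> ==> \<tau> (\<psi> z) = z"
begin

lemma injU: "inj_on \<psi> \<H>" using inv by (metis inj_onI)
lemma tau_in: "u \<in> I ==> \<tau> u \<in> \<H> & \<psi> (\<tau> u) = u" using im inv by (metis imageE)

lemma boundary_limit:
 assumes "!!n. z n \<in> \<H>" "z \<longlonglongrightarrow> x" "x \<notin> \<H>" "(%n. \<psi> (z n)) \<longlonglongrightarrow> w"
 shows "w \<in> G"
proof -
 have "\<psi> (z n) \<in> closure I" for n using assms(1) im closure_subset[of I] by blast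
 hence "w \<in> closure I" by (rule closed_sequentially[OF closed_closure _ assms(4)])
 moreover have "w \<notin> I"
 proof
  assume w: "w \<in> I"
  have "\<psi> (z n) \<in> I" for n using assms(1) im by blast
  hence "(%n. \<tau> (\<psi> (z n))) \<longlonglongrightarrow> \<tau> w" by (intro continuous_on_tendsto_compose[OF cont_inv assms(4) w]) auto
  hence "z \<longlonglongrightarrow> \<tau> w" using inv assms(1) by simp
  hence "\<tau> w = x" using assms(2) LIMSEQ_unique by blast
  thus False using tau_in[OF w] assms(3) by simp
 qed
 ultimately show ?thesis using I_props by auto
qed

text \<open>By Wolff's lemma some semicircle about x has a short image. Its closure \<open>a\<close>
  meets the curve in a set of small diameter, which lies in a small arc \<open>b\<close> of the
  curve. Together they cut the image of the inner half-disc off from the base point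
  \<open>q0\<close>, so that image stays small.\<close>

lemma oscillation:
 fixes x :: real
 assumes "\<epsilon> > 0"
 shows "\<exists>\<delta>>0. \<forall>z\<in>\<H>. \<forall>z'\<in>\<H>. cmod (z - of_real x) < \<delta> --> cmod (z' - of_real x) < \<delta> --> dist (\<psi> z) (\<psi> z') < \<epsilon>"
proof -
 define q0 where "q0 = \<psi> (of_real x + \<i>)"
 have xi: "of_real x + \<i> \<in> \<H>" by (simp add: \<H>_def)
 have "q0 \<in> I" using im xi by (auto simp: q0_def)
 then obtain d0 where d0: "d0 > 0" "ball q0 d0 <= I" using I_props(2) open_contains_ball by blast
 \<comment> \<open>The bound by d0 / 2 keeps \<open>q0\<close> out of the \<epsilon>1-disc about a
   curve point, which makes \<open>q0\<close> a reference point outside the cut-off part.\<close>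
 define \<epsilon>1 where "\<epsilon>1 = min (d0/2) (\<epsilon>/3)"
 have e1: "\<epsilon>1 > 0" "\<epsilon>1 < d0" "2 * \<epsilon>1 < \<epsilon>" using d0 assms by (auto simp: \<epsilon>1_def)
 obtain \<eta> where eta: "\<eta> > 0" "!!T. T <= G ==> T ~= {} ==> (\<forall>x\<in>T. \<forall>y\<in>T. dist x y <= \<eta>) ==>
   (\<exists>b\<subseteq>G. connected b & compact b & T <= b & (\<forall>x\<in>b. \<forall>y\<in>b. dist x y < \<epsilon>1))" using small_arc[OF e1(1)] by metis
 define l where "l = min \<eta> \<epsilon>1"
 have l: "l > 0" "l <= \<eta>" "l <= \<epsilon>1" using eta e1 by (auto simp: l_def)
 obtain \<rho> where rho: "\<rho> > 0" "I <= ball 0 \<rho>" using bounded_subset_ballD[OF I_props(4)] by blast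
 \<comment> \<open>With this L, semicircles of radius between exp (-L) and 1 cannot all have images
   of diameter at least l. Radius below 1 leaves x + i outside the semicircle.\<close>
 define L where "L = 4 * pi * \<rho>\<^sup>2 / l\<^sup>2 + 1"
 have L: "L > 0" unfolding L_def by (intro add_nonneg_pos) auto
 have "\<exists>s. exp (-L) < s & s < 1 & (\<forall>z1\<in>\<H>. \<forall>z2\<in>\<H>. cmod (z1 - of_real x) = s --> cmod (z2 - of_real x) = s --> cmod (\<psi> z1 - \<psi> z2) < l)"
 proof (rule ccontr)
  assume n: "\<not> ?thesis"
  have "ln (1 / exp (-L)) * l\<^sup>2 <= 4 * pi * \<rho>\<^sup>2"
  proof (rule length_area_ball[OF hol injU, where c = x and w = 0])
   fix z assume "z \<in> \<H>" thus "\<psi> z \<in> ball 0 \<rho>" using im rho by blast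
  next
   fix s assume "exp (-L) < s" "s < 1"
   thus "\<exists>z1\<in>\<H>. \<exists>z2\<in>\<H>. cmod (z1 - of_real x) = s & cmod (z2 - of_real x) = s & l <= cmod (\<psi> z1 - \<psi> z2)"
    using n by (meson not_less)
  qed (use l L in auto)
  hence "L * l\<^sup>2 <= 4 * pi * \<rho>\<^sup>2" by (simp add: ln_div)
  moreover have "L * l\<^sup>2 = 4 * pi * \<rho>\<^sup>2 + l\<^sup>2" using l by (simp add: L_def field_simps)
  ultimately show False using l by simp
 qed
 then obtain s where s: "exp (-L) < s" "s < 1" and small: "!!z1 z2. [|z1 \<in> \<H>; z2 \<in> \<H>; cmod (z1 - of_real x) = s; cmod (z2 - of_real x) = s|] ==> cmod (\<psi> z1 - \<psi> z2) < l"
  by blast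
 have s0: "s > 0" using s(1) by (meson exp_gt_zero less_trans)
 define Y where "Y = {z \<in> \<H>. cmod (z - of_real x) = s}"
 define X where "X = \<psi> ` Y"
 define par where "par = (%v. of_real x + of_real s * cis v)"
 have Yp: "Y = par ` {0<..<pi}"
 proof
  show "par ` {0<..<pi} <= Y" using s0 by (auto simp: Y_def par_def \<H>_def norm_mult sin_gt_zero)
  show "Y <= par ` {0<..<pi}"
  proof
   fix z assume z: "z \<in> Y"
   hence "cmod (z - of_real x) = exp (ln s)" "z \<in> \<H>" using s0 by (auto simp: Y_def)
   then obtain v where "0 < v" "v < pi" "z = of_real x + exp (Complex (ln s) v)" by (rule semicircle_polar)
   thus "z \<in> par ` {0<..<pi}" using s0 by (intro image_eqI[of _ _ v]) (auto simp: par_def exp_eq_polar)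
  qed
 qed
 have "continuous_on {0<..<pi} par" unfolding par_def cis_conv_exp by (intro continuous_intros)
 hence cY: "connected Y" unfolding Yp by (intro connected_continuous_image) auto
 have YH: "Y <= \<H>" by (auto simp: Y_def)
 have cX: "connected X" unfolding X_def by (intro connected_continuous_image[OF _ cY] continuous_on_subset[OF holomorphic_on_imp_continuous_on[OF hol] YH])
 have XI: "X <= I" using im YH by (auto simp: X_def)
 define a where "a = closure X"
 have dX: "dist u v <= l" if "u \<in> X" "v \<in> X" for u v using that small by (auto simp: X_def Y_def dist_norm less_imp_le)
 have da: "dist u v <= l" if "u \<in> a" "v \<in> a" for u v
 proof -
  have "a <= cball v' l" if "v' \<in> X" for v' unfolding a_def using dX that by (intro closure_minimal) auto
  hence "X <= cball u l" using that(1) by (metis dist_commute mem_cball subsetD subsetI)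
  hence "a <= cball u l" unfolding a_def by (intro closure_minimal) auto
  thus ?thesis using that(2) by auto
 qed
 have acl: "compact a" unfolding a_def compact_closure using I_props(4) XI bounded_subset by blast
 have ac: "connected a" unfolding a_def using cX by (rule connected_imp_connected_closure)
 \<comment> \<open>Move along the semicircle to its real endpoint: the images accumulate in
   \<open>a\<close>, and by \<open>boundary_limit\<close> on the curve.\<close>
 have "a \<inter> G ~= {}"
 proof -
  define z where "z = (%n::nat. par (1 / real (Suc n)))"
  have "1 / real (Suc n) < pi" for n using pi_gt3 by (smt (verit) divide_le_eq_1 of_nat_Suc of_nat_0_le_iff)
  hence zY: "z n \<in> Y" for n unfolding Yp z_def by auto
  have "isCont par 0" unfolding par_def cis_conv_exp by (intro continuous_intros)
  hence zl: "z \<longlonglongrightarrow> par 0" unfolding z_def using isCont_tendsto_compose[OF _ LIMSEQ_inverse_real_of_nat] by (simp only: inverse_eq_divide)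
  have "\<forall>n. \<psi> (z n) \<in> a" using zY closure_subset unfolding a_def X_def by blast
  then obtain w r where wr: "w \<in> a" "strict_mono r" "((%n. \<psi> (z n)) \<circ> r) \<longlonglongrightarrow> w"
   by (rule seq_compactE[OF compact_imp_seq_compact[OF acl]])
  have "w \<in> G"
  proof (rule boundary_limit[of "z \<circ> r" "par 0"])
   show "(z \<circ> r) n \<in> \<H>" for n using zY YH by auto
   show "(z \<circ> r) \<longlonglongrightarrow> par 0" using zl wr(2) by (rule LIMSEQ_subseq_LIMSEQ)
   show "par 0 \<notin> \<H>" by (simp add: par_def \<H>_def)
   show "(%n. \<psi> ((z \<circ> r) n)) \<longlonglongrightarrow> w" using wr(3) by (simp add: o_def)
  qed
  thus ?thesis using wr by blast
 qed
 moreover have "\<forall>x\<in>a \<inter> G. \<forall>y\<in>a \<inter> G. dist x y <= \<eta>" using da l by fastforce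
 ultimately obtain b where b: "b <= G" "connected b" "compact b" "a \<inter> G <= b" "\<forall>x\<in>b. \<forall>y\<in>b. dist x y < \<epsilon>1"
  using eta(2)[of "a \<inter> G"] by (metis inf_le2)
 obtain x0 where x0: "x0 \<in> a" "x0 \<in> b" "x0 \<in> G" using \<open>a \<inter> G ~= {}\<close> b by blast
 have ab: "a \<union> b <= cball x0 \<epsilon>1" using x0 b(5) da l by fastforce
 have q0x0: "q0 \<notin> cball x0 \<epsilon>1"
 proof
  assume "q0 \<in> cball x0 \<epsilon>1"
  hence "x0 \<in> ball q0 d0" using e1 by (simp add: dist_commute)
  thus False using d0 x0 I_props by blast
 qed
 \<comment> \<open>Otherwise Janiszewski joins \<psi> z to \<open>q0\<close> inside I without
   meeting \<open>a\<close>. Pulled back by \<tau>, this connected set runs from inside the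
   semicircle to x + i and must cross it, which contradicts X <= a.\<close>
 have main: "\<psi> z \<in> cball x0 \<epsilon>1" if z: "z \<in> \<H>" "cmod (z - of_real x) < s" for z
 proof (rule ccontr)
  assume nz: "\<psi> z \<notin> cball x0 \<epsilon>1"
  have "connected_component (- (G \<union> (a \<union> b))) (\<psi> z) q0"
  proof (rule Janiszewski[OF compact_G])
   show "closed (a \<union> b)" using acl b by (intro closed_Un compact_imp_closed)
   have "G \<inter> (a \<union> b) = b" using b by blast
   thus "connected (G \<inter> (a \<union> b))" using b by simp
   show "connected_component (- G) (\<psi> z) q0" unfolding connected_component_def using z xi im I_props by (intro exI[of _ I]) (auto simp: q0_def)
   have "connected (- cball x0 \<epsilon>1)" by (rule connected_complement_bounded_convex) auto
   thus "connected_component (- (a \<union> b)) (\<psi> z) q0" unfolding connected_component_def using ab nz q0x0 by (intro exI[of _ "- cball x0 \<epsilon>1"]) auto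
  qed
  then obtain U where U: "connected U" "U <= - (G \<union> (a \<union> b))" "\<psi> z \<in> U" "q0 \<in> U" by (auto simp: connected_component_def)
  have UI: "U <= I" using U \<open>q0 \<in> I\<close> by (intro connected_inside[of U q0]) auto
  have "\<exists>u\<in>U. dist (of_real x) (\<tau> u) = s" by (rule connected_at_distance[OF U(1) continuous_on_subset[OF cont_inv UI] U(3,4)])
    (insert inv z inv[OF xi] s, auto simp: q0_def dist_norm norm_minus_commute)
  then obtain u where u: "u \<in> U" "cmod (\<tau> u - of_real x) = s" by (auto simp: dist_norm norm_minus_commute)
  have "u \<in> X" unfolding X_def using u tau_in[of u] UI by (intro image_eqI[of _ _ "\<tau> u"]) (auto simp: Y_def)
  hence "u \<in> a" using closure_subset a_def by blast
  thus False using u U by blast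
 qed
 show ?thesis
 proof (intro exI[of _ s] conjI ballI impI)
  fix z z' assume "z \<in> \<H>" "z' \<in> \<H>" "cmod (z - of_real x) < s" "cmod (z' - of_real x) < s"
  hence "dist x0 (\<psi> z) <= \<epsilon>1" "dist x0 (\<psi> z') <= \<epsilon>1" using main by auto
  thus "dist (\<psi> z) (\<psi> z') < \<epsilon>" using dist_triangle3[of "\<psi> z" "\<psi> z'" x0] e1 by linarith
 qed (rule s0)
qed

lemma limit_exists:
 fixes x :: real
 shows "\<exists>l. (\<psi> \<longlongrightarrow> l) (at (of_real x) within \<H>)"
proof -
 define z where "z = (%n. of_real x + \<i> * of_real (1 / real (Suc n)) :: complex)"
 have zH: "z n \<in> \<H>" for n by (simp add: z_def \<H>_def)
 have zd: "cmod (z n - of_real x) = 1 / real (Suc n)" for n unfolding z_def by (simp only: add_diff_cancel_left' norm_mult norm_of_real norm_ii) simp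
 have "Cauchy (%n. \<psi> (z n))"
 proof (rule metric_CauchyI)
  fix e :: real assume "e > 0"
  then obtain d where d: "d > 0" "\<forall>z\<in>\<H>. \<forall>z'\<in>\<H>. cmod (z - of_real x) < d --> cmod (z' - of_real x) < d --> dist (\<psi> z) (\<psi> z') < e"
   using oscillation by blast
  obtain N where N: "1 / real (Suc N) < d" using d(1) nat_approx_posE by blast
  have "1 / real (Suc n) < d" if "n >= N" for n using N that by (smt (verit) frac_le of_nat_0_less_iff of_nat_le_iff Suc_le_mono zero_less_Suc)
  thus "\<exists>M. \<forall>m\<ge>M. \<forall>n\<ge>M. dist (\<psi> (z m)) (\<psi> (z n)) < e" using d zH zd by (intro exI[of _ N]) auto
 qed
 then obtain l where l: "(%n. \<psi> (z n)) \<longlonglongrightarrow> l" by (auto simp: Cauchy_convergent_iff convergent_def)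
 show ?thesis
 proof (intro exI[of _ l] tendstoI)
  fix e :: real assume "e > 0"
  then obtain d where d: "d > 0" "\<forall>z\<in>\<H>. \<forall>z'\<in>\<H>. cmod (z - of_real x) < d --> cmod (z' - of_real x) < d --> dist (\<psi> z) (\<psi> z') < e / 2"
   using oscillation half_gt_zero by metis
  obtain N where N: "!!n. n >= N ==> dist (\<psi> (z n)) l < e / 2" using l \<open>e > 0\<close> unfolding lim_sequentially by (meson half_gt_zero)
  obtain N' where N': "1 / real (Suc N') < d" using d(1) nat_approx_posE by blast
  define n where "n = max N N'"
  have "1 / real (Suc n) < d" using N' unfolding n_def by (smt (verit) frac_le of_nat_0_less_iff of_nat_le_iff Suc_le_mono zero_less_Suc max.cobounded2)
  hence "dist (\<psi> y) l < e" if "y \<in> \<H>" "dist y (of_real x) < d" for y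
   using d(2) that zH[of n] zd[of n] N[of n] dist_triangle_half_r[of "\<psi> (z n)" "\<psi> y" e l] unfolding n_def
   by (simp add: dist_norm dist_commute norm_minus_commute)
  thus "\<forall>\<^sub>F y in at (of_real x) within \<H>. dist (\<psi> y) l < e" unfolding eventually_at using d(1) by blast
 qed
qed

definition ext :: "complex => complex" where
 "ext z = (if z \<in> \<H> then \<psi> z else Lim (at z within \<H>) \<psi>)"

lemma ext_upper: "z \<in> \<H> ==> ext z = \<psi> z" by (simp add: ext_def)

lemma ext_limit:
 assumes "y \<in> closed_half"
 shows "(\<psi> \<longlongrightarrow> ext y) (at y within \<H>)"
proof (cases "y \<in> \<H>")
 case True
 hence "isCont \<psi> y" using hol open_upper_half by (metis continuous_on_eq_continuous_at holomorphic_on_imp_continuous_on)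
 thus ?thesis using True by (simp add: ext_def isCont_def tendsto_within_subset[of _ _ _ UNIV])
next
 case False
 hence "y = of_real (Re y)" using closed_half_cases[OF assms] by blast
 then obtain l where "(\<psi> \<longlongrightarrow> l) (at y within \<H>)" using limit_exists[of "Re y"] by metis
 moreover have "at y within \<H> ~= bot" by (rule upper_half_trivial_limit[OF assms])
 ultimately show ?thesis using False by (simp add: ext_def tendsto_Lim)
qed

lemma ext_near:
 assumes "open B" "y \<in> closed_half" "y \<in> B" "!!z. z \<in> B \<inter> \<H> ==> dist v (\<psi> z) <= e"
 shows "dist v (ext y) <= e"
proof -
 have "ext y \<in> cball v e"
 proof (rule Lim_in_closed_set[OF closed_cball _ upper_half_trivial_limit[OF assms(2)] ext_limit[OF assms(2)]])
  have "\<forall>\<^sub>F x in at y within \<H>. x \<in> B & x \<in> \<H>" using assms(1,3) by (auto simp: eventually_at_topological)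
  thus "\<forall>\<^sub>F x in at y within \<H>. \<psi> x \<in> cball v e" by eventually_elim (use assms(4) in auto)
 qed
 thus ?thesis by simp
qed

lemma continuous_ext: "continuous_on closed_half ext" unfolding continuous_on_iff
proof (intro ballI allI impI)
 fix x :: complex and e :: real assume x: "x \<in> closed_half" and e: "e > 0"
 from ext_limit[OF x] e have "\<forall>\<^sub>F z in at x within \<H>. dist (\<psi> z) (ext x) < e / 2" by (metis tendstoD half_gt_zero)
 then obtain d where d: "d > 0" "!!z. [|z \<in> \<H>; z ~= x; dist z x < d|] ==> dist (\<psi> z) (ext x) < e / 2" unfolding eventually_at by blast
 have d': "dist (ext x) (\<psi> z) <= e / 2" if "z \<in> ball x d \<inter> \<H>" for z
 proof (cases "z = x")
  case True thus ?thesis using that e ext_upper[of x] by auto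
 next
  case False thus ?thesis using d(2)[of z] that by (simp add: dist_commute less_imp_le)
 qed
 have "dist (ext y) (ext x) < e" if "y \<in> closed_half" "dist y x < d" for y
  using ext_near[of "ball x d" y "ext x" "e/2", OF _ that(1) _ d'] that e by (simp add: dist_commute)
 thus "\<exists>d>0. \<forall>x'\<in>closed_half. dist x' x < d --> dist (ext x') (ext x) < e" using d(1) by blast
qed

lemma ext_real_in_G: "ext (of_real x) \<in> G"
proof -
 define z where "z = (%n. of_real x + \<i> * of_real (inverse (real (Suc n))) :: complex)"
 have zH: "z n \<in> \<H>" for n by (simp add: z_def \<H>_def)
 have "z \<longlonglongrightarrow> of_real x + \<i> * of_real 0" unfolding z_def by (intro tendsto_intros LIMSEQ_inverse_real_of_nat)
 hence zl: "z \<longlonglongrightarrow> of_real x" by simp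
 have zn: "z n ~= of_real x" for n
 proof
  assume "z n = of_real x"
  thus False using zH[of n] by (simp add: \<H>_def)
 qed
 have "(%n. \<psi> (z n)) \<longlonglongrightarrow> ext (of_real x)" by (rule filterlim_compose[OF ext_limit]) (insert zl zH zn, auto simp: filterlim_at)
 thus ?thesis by (intro boundary_limit[OF zH zl]) (simp add: \<H>_def)
qed

text \<open>If two real points had the same boundary value w, a connected set near w would pull back
  to one that crosses every semicircle about x1 in a range of radii, with values near w. The same
  semicircles cross a vertical segment on which \<psi> stays away from w, against
  \<open>no_fat_crossing\<close>.\<close>

lemma boundary_values_distinct:
 fixes x1 x2 :: real
 assumes "(\<psi> \<longlongrightarrow> w) (at (of_real x1) within \<H>)" "(\<psi> \<longlongrightarrow> w) (at (of_real x2) within \<H>)"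
 shows "x1 = x2"
proof (rule ccontr)
 assume ne: "x1 ~= x2"
 have "w = ext (of_real x1)" by (rule tendsto_unique[OF upper_half_trivial_limit assms(1) ext_limit]) auto
 hence wG: "w \<in> G" using ext_real_in_G by simp
 define \<delta> where "\<delta> = \<bar>x2 - x1\<bar> / 2"
 have d: "\<delta> > 0" using ne by (simp add: \<delta>_def)
 define f where "f = (%s. cmod (\<psi> (of_real x1 + \<i> * of_real s) - w))"
 have "continuous_on {\<delta>/2..\<delta>} f" unfolding f_def
  by (intro continuous_intros continuous_on_compose2[OF holomorphic_on_imp_continuous_on[OF hol]]) (insert d, auto simp: \<H>_def)
 then obtain s0 where s0: "s0 \<in> {\<delta>/2..\<delta>}" "!!s. s \<in> {\<delta>/2..\<delta>} ==> f s0 <= f s"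
  using continuous_attains_inf[of "{\<delta>/2..\<delta>}" f] d by auto
 have "\<psi> (of_real x1 + \<i> * of_real s0) \<in> I" using im s0 d by (auto simp: \<H>_def)
 hence "f s0 > 0" using wG I_props by (auto simp: f_def)
 \<comment> \<open>Then \<rho> 2^200 is the minimal distance to w on the vertical segment, which
   defeats the second alternative of \<open>no_fat_crossing\<close>.\<close>
 define \<rho> where "\<rho> = f s0 / 2 ^ 200"
 have rho: "\<rho> > 0" using \<open>f s0 > 0\<close> by (simp add: \<rho>_def)
 obtain \<eta> where eta: "\<eta> > 0" "!!z1 z2. z1 \<in> I \<inter> ball w \<eta> ==> z2 \<in> I \<inter> ball w \<eta> ==> \<exists>U. connected U & U <= I \<inter> ball w \<rho> & z1 \<in> U & z2 \<in> U"
  using locally_connected_at_boundary[OF wG rho] by metis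
 have pick: "\<exists>z\<in>\<H>. cmod (z - of_real x) < \<delta> / 2 & \<psi> z \<in> ball w \<eta>" if "(\<psi> \<longlongrightarrow> w) (at (of_real x) within \<H>)" for x :: real
 proof -
  have "\<forall>\<^sub>F z in at (of_real x) within \<H>. dist (\<psi> z) w < \<eta>" using that eta(1) by (rule tendstoD)
  then obtain d' where d': "d' > 0" "!!z. [|z \<in> \<H>; z ~= of_real x; dist z (of_real x) < d'|] ==> dist (\<psi> z) w < \<eta>" unfolding eventually_at by blast
  define m where "m = min d' (\<delta>/2) / 2"
  have m: "0 < m" "m < d'" "m < \<delta> / 2" using d' d by (auto simp: m_def min_def)
  have "dist (\<psi> (of_real x + \<i> * of_real m)) w < \<eta>" using m by (intro d'(2)) (auto simp: \<H>_def dist_norm norm_mult)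
  thus ?thesis using m by (intro bexI[of _ "of_real x + \<i> * of_real m"]) (auto simp: \<H>_def norm_mult dist_commute)
 qed
 obtain z1 where z1: "z1 \<in> \<H>" "cmod (z1 - of_real x1) < \<delta> / 2" "\<psi> z1 \<in> ball w \<eta>" using pick[OF assms(1)] by blast
 obtain z2 where z2: "z2 \<in> \<H>" "cmod (z2 - of_real x2) < \<delta> / 2" "\<psi> z2 \<in> ball w \<eta>" using pick[OF assms(2)] by blast
 obtain U where U: "connected U" "U <= I \<inter> ball w \<rho>" "\<psi> z1 \<in> U" "\<psi> z2 \<in> U" using eta(2)[of "\<psi> z1" "\<psi> z2"] z1 z2 im by blast
 have big: "cmod (z2 - of_real x1) > \<delta>"
 proof -
  have "2 * \<delta> = cmod (of_real x2 - of_real x1 :: complex)" unfolding \<delta>_def by (metis norm_of_real of_real_diff nonzero_mult_div_cancel_left times_divide_eq_right zero_neq_numeral)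
  also have "\<dots> <= cmod (z2 - of_real x1) + cmod (z2 - of_real x2)" using norm_triangle_ineq4[of "z2 - of_real x1" "z2 - of_real x2"] by simp
  finally show ?thesis using z2 d by simp
 qed
 have hit: "\<exists>z\<in>\<H>. cmod (z - of_real x1) = s & cmod (\<psi> z - w) < \<rho>" if "\<delta>/2 < s" "s < \<delta>" for s
 proof -
  have UI: "U <= I" using U(2) by blast
  have "\<exists>u\<in>U. dist (of_real x1) (\<tau> u) = s" by (rule connected_at_distance[OF U(1) continuous_on_subset[OF cont_inv UI] U(3,4)])
    (insert inv z1 z2 that big, auto simp: dist_norm norm_minus_commute)
  then obtain u where u: "u \<in> U" "s = cmod (\<tau> u - of_real x1)" by (auto simp: dist_norm norm_minus_commute)
  hence "u \<in> I" "dist w u < \<rho>" using U(2) by auto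
  thus ?thesis using tau_in[of u] u by (intro bexI[of _ "\<tau> u"]) (auto simp: dist_norm norm_minus_commute)
 qed
 obtain s where s: "\<delta>/2 < s" "s < \<delta>" and alt: "(\<forall>z\<in>\<H>. cmod (z - of_real x1) = s --> \<rho> < cmod (\<psi> z - w)) \<or>
   (\<forall>z\<in>\<H>. cmod (z - of_real x1) = s --> cmod (\<psi> z - w) < \<rho> * 2 ^ 200)"
  using no_fat_crossing[OF hol injU _ _ rho, of "\<delta>/2" \<delta> x1 w] d by auto
 have "\<rho> * 2 ^ 200 <= cmod (\<psi> (of_real x1 + \<i> * of_real s) - w)" using s0(2)[of s] s by (simp add: \<rho>_def f_def)
 moreover have "of_real x1 + \<i> * of_real s \<in> \<H>" "cmod (of_real x1 + \<i> * of_real s - of_real x1) = s" using s d by (auto simp: \<H>_def norm_mult)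
 ultimately show False using alt hit[OF s] by (meson less_asym not_less)
qed

text \<open>The map z -> a - 1/z preserves the half-plane, sends 0 to infinity and infinity to a.
  Thus statements at infinity reduce to statements at a real point.\<close>

lemma mobius_change: "half_plane_riemann c (%z. \<psi> (of_real a - 1 / z)) (%w. 1 / (of_real a - \<tau> w))"
proof unfold_locales
 have "(%z. of_real a - 1 / z) holomorphic_on \<H>" by (intro holomorphic_intros) (auto simp: \<H>_def)
 from holomorphic_on_compose_gen[OF this hol] upper_half_mobius(1)
 show "(%z. \<psi> (of_real a - 1 / z)) holomorphic_on \<H>" by (auto simp: o_def)
 have inv1: "of_real a - 1 / (1 / (of_real a - z)) = z" for z :: complex by simp
 show "(%z. \<psi> (of_real a - 1 / z)) ` \<H> = I"
 proof
  show "(%z. \<psi> (of_real a - 1 / z)) ` \<H> <= I" using upper_half_mobius(1) im by auto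
  show "I <= (%z. \<psi> (of_real a - 1 / z)) ` \<H>"
  proof
   fix u assume "u \<in> I"
   hence "\<tau> u \<in> \<H>" "\<psi> (\<tau> u) = u" using tau_in by auto
   thus "u \<in> (%z. \<psi> (of_real a - 1 / z)) ` \<H>"
    using upper_half_mobius(2)[of "\<tau> u" a] by (intro image_eqI[of _ _ "1 / (of_real a - \<tau> u)"]) (auto simp: inv1)
  qed
 qed
 have "of_real a - \<tau> w ~= 0" if "w \<in> I" for w using tau_in[OF that] real_minus_upper by blast
 thus "continuous_on I (%w. 1 / (of_real a - \<tau> w))" by (intro continuous_intros cont_inv) auto
 show "1 / (of_real a - \<tau> (\<psi> (of_real a - 1 / z))) = z" if "z \<in> \<H>" for z using inv[OF upper_half_mobius(1)[OF that]] by simp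
qed

lemma limit_at_infinity: "\<exists>p. \<forall>\<epsilon>>0. \<exists>R. \<forall>z\<in>closed_half. R <= cmod z --> dist p (ext z) <= \<epsilon>"
proof -
 interpret m: half_plane_riemann c "%z. \<psi> (of_real 0 - 1 / z)" "%w. 1 / (of_real 0 - \<tau> w)" by (rule mobius_change)
 obtain p where p: "((%z. \<psi> (of_real 0 - 1 / z)) \<longlongrightarrow> p) (at (of_real 0) within \<H>)" using m.limit_exists by blast
 show ?thesis
 proof (intro exI[of _ p] allI impI)
  fix \<epsilon> :: real assume "\<epsilon> > 0"
  with p obtain d where d: "d > 0" "!!z. [|z \<in> \<H>; z ~= 0; dist z 0 < d|] ==> dist (\<psi> (of_real 0 - 1 / z)) p < \<epsilon>"
   unfolding tendsto_iff eventually_at by (metis of_real_0)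
  have main: "dist p (\<psi> z) <= \<epsilon>" if z: "z \<in> \<H>" "1 / d < cmod z" for z
  proof -
   have nz: "z ~= 0" using z by (auto simp: \<H>_def)
   have "1 / (of_real 0 - z) \<in> \<H>" by (rule upper_half_mobius(2)[OF z(1)])
   moreover have "cmod (1 / (of_real 0 - z)) < d" using z d nz by (simp add: norm_divide field_simps)
   ultimately have "dist (\<psi> (of_real 0 - 1 / (1 / (of_real 0 - z)))) p < \<epsilon>" using nz by (intro d(2)) auto
   thus ?thesis by (simp add: dist_commute)
  qed
  have "dist p (ext z) <= \<epsilon>" if "z \<in> closed_half" "1 / d + 1 <= cmod z" for z by (rule ext_near[of "- cball 0 (1 / d)"]) (use that main in auto)
  thus "\<exists>R. \<forall>z\<in>closed_half. R <= cmod z --> dist p (ext z) <= \<epsilon>" by blast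
 qed
qed

end

lemma upper_half_cayley:
 assumes "z \<in> \<H>"
 shows "(z - \<i>) / (z + \<i>) \<in> ball 0 1" "z + \<i> ~= 0" "\<i> * (1 + (z - \<i>) / (z + \<i>)) / (1 - (z - \<i>) / (z + \<i>)) = z"
proof -
 show nz: "z + \<i> ~= 0" using assms by (auto simp: \<H>_def complex_eq_iff)
 have "(cmod (z - \<i>))\<^sup>2 < (cmod (z + \<i>))\<^sup>2" using assms by (simp add: cmod_power2 \<H>_def) (simp add: power2_eq_square algebra_simps)
 hence "cmod (z - \<i>) < cmod (z + \<i>)" by (rule power2_less_imp_less) simp
 thus "(z - \<i>) / (z + \<i>) \<in> ball 0 1" using nz by (simp add: norm_divide field_simps)
 have 1: "1 + (z - \<i>) / (z + \<i>) = 2 * z / (z + \<i>)" "1 - (z - \<i>) / (z + \<i>) = 2 * \<i> / (z + \<i>)" using nz by (auto simp: field_simps)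
 show "\<i> * (1 + (z - \<i>) / (z + \<i>)) / (1 - (z - \<i>) / (z + \<i>)) = z" unfolding 1 using nz by simp
qed

lemma ball_cayley:
 assumes "w \<in> ball (0::complex) 1"
 shows "\<i> * (1 + w) / (1 - w) \<in> \<H>" "(\<i> * (1 + w) / (1 - w) - \<i>) / (\<i> * (1 + w) / (1 - w) + \<i>) = w" "1 - w ~= 0"
proof -
 show nz: "1 - w ~= 0" using assms by auto
 have 1: "\<i> * (1 + w) / (1 - w) - \<i> = 2 * \<i> * w / (1 - w)" "\<i> * (1 + w) / (1 - w) + \<i> = 2 * \<i> / (1 - w)" using nz by (auto simp: field_simps)
 show "(\<i> * (1 + w) / (1 - w) - \<i>) / (\<i> * (1 + w) / (1 - w) + \<i>) = w" unfolding 1 using nz by simp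
 have "Im (\<i> * (1 + w) / (1 - w)) = (1 - (cmod w)\<^sup>2) / (cmod (1 - w))\<^sup>2" by (simp add: Im_divide cmod_power2) (simp add: power2_eq_square algebra_simps)
 moreover have "(cmod w)\<^sup>2 < 1" using assms by (simp add: abs_square_less_1)
 ultimately show "\<i> * (1 + w) / (1 - w) \<in> \<H>" using nz by (simp add: \<H>_def)
qed

lemma closed_half_seq:
 assumes "!!n::nat. y n \<in> \<H>" "y \<longlonglongrightarrow> x"
 shows "x \<in> closed_half"
proof -
 have "y n \<in> closed_half" for n using assms(1) upper_subset_closed by blast
 thus ?thesis by (rule closed_sequentially[OF closed_closed_half _ assms(2)])
qed

lemma (in jordan_loop) riemann_map_exists: "\<exists>\<psi> \<tau>. half_plane_riemann c \<psi> \<tau>"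
proof -
 have "simply_connected I" unfolding I_def G_def by (rule simply_connected_inside_simple_path[OF sp])
 moreover have "I ~= UNIV" using I_props(4) not_bounded_UNIV by metis
 ultimately obtain f g where fg: "f holomorphic_on I" "g holomorphic_on ball 0 1" "!!z. z \<in> I ==> f z \<in> ball 0 1 & g (f z) = z"
   "!!z. z \<in> ball 0 1 ==> g z \<in> I & f (g z) = z" using simply_connected_eq_biholomorphic_to_disc[OF I_props(2)] I_props(1) by metis
 define \<psi> where "\<psi> = (%z. g ((z - \<i>) / (z + \<i>)))"
 define \<tau> where "\<tau> = (%u. \<i> * (1 + f u) / (1 - f u))"
 have "half_plane_riemann c \<psi> \<tau>"
 proof unfold_locales
  have "(%z. (z - \<i>) / (z + \<i>)) holomorphic_on \<H>" using upper_half_cayley(2) by (intro holomorphic_intros) auto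
  moreover have "(%z. (z - \<i>) / (z + \<i>)) ` \<H> <= ball 0 1" using upper_half_cayley(1) by blast
  ultimately have "g \<circ> (%z. (z - \<i>) / (z + \<i>)) holomorphic_on \<H>" by (intro holomorphic_on_compose_gen[OF _ fg(2)])
  thus "\<psi> holomorphic_on \<H>" by (simp add: \<psi>_def o_def)
  show "\<psi> ` \<H> = I"
  proof
   show "\<psi> ` \<H> <= I" using upper_half_cayley(1) fg(4) by (auto simp: \<psi>_def)
   show "I <= \<psi> ` \<H>"
   proof
    fix u assume "u \<in> I"
    hence "f u \<in> ball 0 1" "g (f u) = u" using fg by auto
    thus "u \<in> \<psi> ` \<H>" using ball_cayley[of "f u"] by (intro image_eqI[of _ _ "\<i> * (1 + f u) / (1 - f u)"]) (auto simp: \<psi>_def)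
   qed
  qed
  show "continuous_on I \<tau>" unfolding \<tau>_def using ball_cayley(3) fg by (intro continuous_intros holomorphic_on_imp_continuous_on) auto
  show "\<tau> (\<psi> z) = z" if "z \<in> \<H>" for z using upper_half_cayley[OF that] fg(4) unfolding \<tau>_def \<psi>_def by auto
 qed
 thus ?thesis by blast
qed

text \<open>Carath\<e>odory's extension theorem, normalised so that a prescribed curve point p
  corresponds to infinity.\<close>

theorem (in jordan_loop) caratheodory_half_plane:
 assumes "p \<in> G"
 obtains \<psi> where "\<psi> holomorphic_on \<H>" "continuous_on closed_half \<psi>" "inj_on \<psi> closed_half"
  "\<psi> ` \<H> = I" "range (%x::real. \<psi> (of_real x)) = G - {p}"
  "!!\<epsilon>. \<epsilon> > 0 ==> \<exists>R. \<forall>z\<in>closed_half. R <= cmod z --> dist p (\<psi> z) <= \<epsilon>"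
proof -
 obtain \<psi>0 \<tau>0 where r0: "half_plane_riemann c \<psi>0 \<tau>0" using riemann_map_exists by (elim exE)
 interpret r0: half_plane_riemann c \<psi>0 \<tau>0 by (rule r0)
 have "p \<in> closure I" unfolding I_props(7) using assms by blast
 hence "\<exists>u. (\<forall>n. u n \<in> I) & u \<longlonglongrightarrow> p" by (simp only: closure_sequential)
 then obtain u where u': "\<forall>n. u n \<in> I" "u \<longlonglongrightarrow> p" by (elim exE conjE)
 note u = u'(1)[rule_format] u'(2)
 define z where "z = (%n. \<tau>0 (u n))"
 have z: "z n \<in> \<H>" "\<psi>0 (z n) = u n" for n using r0.tau_in[OF u(1)] by (auto simp: z_def)
 \<comment> \<open>Preimages of points tending to p either tend to infinity, or accumulate at some
   real x; in the second case a Moebius change moves x to infinity.\<close>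
 have ex: "\<exists>\<psi> \<tau> y. half_plane_riemann c \<psi> \<tau> & (\<forall>n. y n \<in> \<H>) & filterlim y at_infinity sequentially & (%n. \<psi> (y n)) \<longlonglongrightarrow> p"
 proof (cases "filterlim z at_infinity sequentially")
  case True
  thus ?thesis using r0 z u(2) by (intro exI[of _ \<psi>0] exI[of _ \<tau>0] exI[of _ z]) auto
 next
  case False
  then obtain B where B: "\<not> (\<forall>\<^sub>F n in sequentially. B <= cmod (z n))" "B > 0" unfolding filterlim_at_infinity[OF order_refl] by blast
  hence "\<exists>\<^sub>F n in sequentially. cmod (z n) < B" by (simp add: not_eventually not_le)
  hence "infinite {n. cmod (z n) < B}" by (simp add: frequently_cofinite flip: cofinite_eq_sequentially)
  from infinite_enumerate[OF this]
  obtain r :: "nat => nat" where r': "strict_mono r" "\<forall>n. r n \<in> {n. cmod (z n) < B}" by blast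
  hence r: "strict_mono r" "!!n. cmod (z (r n)) < B" by auto
  have "\<forall>n. (z \<circ> r) n \<in> cball 0 B" using r(2) by (auto simp: less_imp_le)
  then obtain x r' where x: "strict_mono r'" "((z \<circ> r) \<circ> r') \<longlonglongrightarrow> x" by (rule seq_compactE[OF compact_imp_seq_compact[OF compact_cball]])
  define y where "y = (z \<circ> r) \<circ> r'"
  have yH: "y n \<in> \<H>" for n using z by (simp add: y_def)
  have yp: "(%n. \<psi>0 (y n)) \<longlonglongrightarrow> p" using LIMSEQ_subseq_LIMSEQ[OF u(2) strict_mono_o[OF r(1) x(1)]] z by (simp add: y_def o_def)
  have "x \<in> closed_half" by (rule closed_half_seq[OF yH x(2)[folded y_def]])
  moreover have "x \<notin> \<H>"
  proof
   assume "x \<in> \<H>"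
   hence "(%n. \<psi>0 (y n)) \<longlonglongrightarrow> \<psi>0 x"
    using x(2) yH unfolding y_def[symmetric] by (intro continuous_on_tendsto_compose[OF holomorphic_on_imp_continuous_on[OF r0.hol]]) auto
   hence "p = \<psi>0 x" using yp LIMSEQ_unique by blast
   thus False using assms r0.im \<open>x \<in> \<H>\<close> I_props by blast
  qed
  ultimately have xr: "x = of_real (Re x)" using closed_half_cases by blast
  define v where "v = (%n. 1 / (of_real (Re x) - y n))"
  have vH: "v n \<in> \<H>" for n using upper_half_mobius(2)[OF yH] by (simp add: v_def)
  have "(%n. of_real (Re x) - y n) \<longlonglongrightarrow> of_real (Re x) - x" using x(2) unfolding y_def[symmetric] by (intro tendsto_intros)
  hence "(%n. of_real (Re x) - y n) \<longlonglongrightarrow> 0" using xr by simp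
  moreover have "of_real (Re x) - y n ~= 0" for n by (rule real_minus_upper[OF yH])
  ultimately have "filterlim (%n. of_real (Re x) - y n) (at 0) sequentially" by (simp add: filterlim_at)
  hence "filterlim v at_infinity sequentially" unfolding v_def using filterlim_compose[OF filterlim_inverse_at_infinity] by (simp add: divide_inverse)
  moreover have "(%n. \<psi>0 (of_real (Re x) - 1 / v n)) \<longlonglongrightarrow> p" using yp by (simp add: v_def)
  ultimately show ?thesis using r0.mobius_change[of "Re x"] vH by blast
 qed
 then obtain \<psi> \<tau> y where r: "half_plane_riemann c \<psi> \<tau>" and y: "!!n. y n \<in> \<H>" "filterlim y at_infinity sequentially" "(%n. \<psi> (y n)) \<longlonglongrightarrow> p"
  by blast
 interpret r: half_plane_riemann c \<psi> \<tau> by (rule r)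
 obtain p' where p': "!!\<epsilon>. \<epsilon> > 0 ==> \<exists>R. \<forall>z\<in>closed_half. R <= cmod z --> dist p' (r.ext z) <= \<epsilon>" using r.limit_at_infinity by blast
 have lim: "(%n. r.ext (w n)) \<longlonglongrightarrow> p'" if "!!n. w n \<in> closed_half" "filterlim w at_infinity sequentially" for w
 proof (rule metric_LIMSEQ_I)
  fix e :: real assume "e > 0"
  then obtain R where R: "\<forall>z\<in>closed_half. R <= cmod z --> dist p' (r.ext z) <= e / 2" using p'[of "e/2"] by auto
  have "\<forall>\<^sub>F n in sequentially. R <= cmod (w n)" using that(2) unfolding filterlim_at_infinity_conv_norm_at_top filterlim_at_top by blast
  then obtain N where "!!n. n >= N ==> R <= cmod (w n)" unfolding eventually_sequentially by blast
  hence "dist (r.ext (w n)) p' < e" if "n >= N" for n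
   using R \<open>!!n. w n \<in> closed_half\<close> that \<open>e > 0\<close> by (smt (verit) dist_commute field_sum_of_halves)
  thus "\<exists>no. \<forall>n\<ge>no. dist (r.ext (w n)) p' < e" by blast
 qed
 have "(%n. r.ext (y n)) \<longlonglongrightarrow> p'" by (rule lim) (use y upper_subset_closed in auto)
 hence "p' = p" using y r.ext_upper LIMSEQ_unique by simp
 note p' = p'[unfolded \<open>p' = p\<close>] and lim = lim[unfolded \<open>p' = p\<close>]
 \<comment> \<open>In the coordinate z -> x + 1 - 1/z the points x and infinity become 1 and 0. If
   both had boundary value p, \<open>boundary_values_distinct\<close> would give 1 = 0.\<close>
 have np: "r.ext (of_real x) ~= p" for x :: real
 proof
  assume e: "r.ext (of_real x) = p"
  interpret m: half_plane_riemann c "%z. \<psi> (of_real (x+1) - 1 / z)" "%w. 1 / (of_real (x+1) - \<tau> w)" by (rule r.mobius_change)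
  have nb: "at (of_real t) within \<H> ~= bot" for t by (rule upper_half_trivial_limit) simp
  have "m.ext (of_real 1) = p"
  proof -
   have "((%z. \<psi> (of_real (x+1) - 1 / z)) \<longlongrightarrow> r.ext (of_real x)) (at (of_real 1) within \<H>)"
   proof (rule filterlim_compose[OF r.ext_limit])
    have "((%z. of_real (x+1) - 1 / z) \<longlongrightarrow> of_real (x+1) - 1 / of_real 1) (at (of_real 1) within \<H>)" by (intro tendsto_intros) auto
    hence "((%z. of_real (x+1) - 1 / z) \<longlongrightarrow> of_real x) (at (of_real 1) within \<H>)" by simp
    moreover have "of_real (x+1) - 1 / z ~= of_real x" if "z \<in> \<H>" for z using real_minus_upper[OF upper_half_mobius(1)[OF that, of "x+1"], of x] by simp
    ultimately show "LIM z at (of_real 1) within \<H>. of_real (x + 1) - 1 / z :> at (of_real x) within \<H>"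
    proof -
     assume l: "((%z. of_real (x+1) - 1 / z) \<longlongrightarrow> of_real x) (at (of_real 1) within \<H>)"
      and n: "!!z. z \<in> \<H> ==> of_real (x+1) - 1 / z ~= of_real x"
     have "\<forall>\<^sub>F z in at (of_real 1) within \<H>. of_real (x+1) - 1 / z \<in> \<H> & of_real (x+1) - 1 / z ~= of_real x"
      unfolding eventually_at_filter using upper_half_mobius(1)[of _ "x+1"] n by (intro always_eventually) blast
     thus ?thesis unfolding filterlim_at using l by blast
    qed
   qed simp
   hence "r.ext (of_real x) = m.ext (of_real 1)" by (rule tendsto_unique[OF nb _ m.ext_limit[OF of_real_closed_half]])
   thus ?thesis using e by simp
  qed
  moreover have "m.ext (of_real 0) = p"
  proof -
   define a where "a = (%n. \<i> * of_real (inverse (real (Suc n))) :: complex)"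
   have aH: "a n \<in> \<H>" for n by (simp add: a_def \<H>_def)
   have "a \<longlonglongrightarrow> \<i> * of_real 0" unfolding a_def by (intro tendsto_intros LIMSEQ_inverse_real_of_nat)
   hence al: "a \<longlonglongrightarrow> 0" by simp
   have an: "a n ~= 0" for n
   proof
    assume "a n = 0"
    thus False using aH[of n] by (simp add: \<H>_def)
   qed
   have a0: "filterlim a (at 0) sequentially" unfolding filterlim_at using al an by simp
   have "(%n. m.ext (a n)) \<longlonglongrightarrow> m.ext (of_real 0)"
    by (rule continuous_on_tendsto_compose[OF m.continuous_ext _ of_real_closed_half always_eventually])
      (use al subsetD[OF upper_subset_closed aH] in simp_all)
   hence "(%n. \<psi> (of_real (x+1) - 1 / a n)) \<longlonglongrightarrow> m.ext (of_real 0)" using m.ext_upper aH by simp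
   moreover have "(%n. r.ext (of_real (x+1) - 1 / a n)) \<longlonglongrightarrow> p"
   proof (rule lim)
    show "of_real (x+1) - 1 / a n \<in> closed_half" for n using upper_half_mobius(1)[OF aH] upper_subset_closed by blast
    have "filterlim (%n. inverse (a n)) at_infinity sequentially" by (rule filterlim_compose[OF filterlim_inverse_at_infinity a0])
    hence "filterlim (%n. - inverse (a n)) at_infinity sequentially" by (simp add: filterlim_at_infinity_conv_norm_at_top)
    thus "filterlim (%n. of_real (x+1) - 1 / a n) at_infinity sequentially"
     using tendsto_add_filterlim_at_infinity[OF tendsto_const[of "of_real (x+1)"]] by (fastforce simp: divide_inverse)
   qed
   moreover have "r.ext (of_real (x+1) - 1 / a n) = \<psi> (of_real (x+1) - 1 / a n)" for n using upper_half_mobius(1)[OF aH] r.ext_upper by blast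
   ultimately show ?thesis using LIMSEQ_unique by simp
  qed
  ultimately have "(1::real) = 0" using m.ext_limit[OF of_real_closed_half[of 1]] m.ext_limit[OF of_real_closed_half[of 0]]
   by (intro m.boundary_values_distinct[of p]) (simp_all only:)
  thus False by simp
 qed
 show ?thesis
 proof (rule that[of r.ext])
  show "r.ext holomorphic_on \<H>" using r.hol by (rule holomorphic_transform) (simp add: r.ext_upper)
  show "continuous_on closed_half r.ext" by (rule r.continuous_ext)
  show im: "r.ext ` \<H> = I" using r.im r.ext_upper by auto
  show "inj_on r.ext closed_half"
  proof (rule inj_onI)
   fix a b assume ab: "a \<in> closed_half" "b \<in> closed_half" "r.ext a = r.ext b"
   have Ga: "r.ext a \<in> G" if "a \<in> closed_half" "a \<notin> \<H>" for a using r.ext_real_in_G[of "Re a"] closed_half_cases[OF that(1)] that(2) by metis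
   show "a = b"
   proof (cases "a \<in> \<H>")
    case True
    hence "r.ext a \<in> I" using im by blast
    hence "b \<in> \<H>" using Ga[OF ab(2)] ab(3) I_props(6) by force
    thus ?thesis using True ab r.injU by (simp add: r.ext_upper inj_on_def)
   next
    case False
    hence "r.ext b \<in> G" using Ga[OF ab(1)] ab(3) by simp
    hence "b \<notin> \<H>" using im I_props(6) by blast
    hence "a = of_real (Re a)" "b = of_real (Re b)" using False closed_half_cases ab by blast+
    moreover have "Re a = Re b"
    proof (rule r.boundary_values_distinct)
     show "(\<psi> \<longlongrightarrow> r.ext a) (at (of_real (Re a)) within \<H>)" using r.ext_limit[OF ab(1)] \<open>a = of_real (Re a)\<close> by metis
     show "(\<psi> \<longlongrightarrow> r.ext a) (at (of_real (Re b)) within \<H>)" using r.ext_limit[OF ab(2)] \<open>b = of_real (Re b)\<close> ab(3) by metis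
    qed
    ultimately show ?thesis by metis
   qed
  qed
  show "\<exists>R. \<forall>z\<in>closed_half. R <= cmod z --> dist p (r.ext z) <= \<epsilon>" if "\<epsilon> > 0" for \<epsilon> using p' that by blast
  show "range (%x::real. r.ext (of_real x)) = G - {p}"
  proof
   show "range (%x::real. r.ext (of_real x)) <= G - {p}" using r.ext_real_in_G np by auto
   show "G - {p} <= range (%x::real. r.ext (of_real x))"
   proof
    fix w assume w: "w \<in> G - {p}"
    hence "w \<in> closure I" unfolding I_props(7) by blast
    hence "\<exists>u. (\<forall>n. u n \<in> I) & u \<longlonglongrightarrow> w" by (simp only: closure_sequential)
    then obtain u where u': "\<forall>n. u n \<in> I" "u \<longlonglongrightarrow> w" by (elim exE conjE)
    note u = u'(1)[rule_format] u'(2)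
    define a where "a = (%n. \<tau> (u n))"
    have a: "a n \<in> \<H>" "r.ext (a n) = u n" for n using r.tau_in[OF u(1)] r.ext_upper by (auto simp: a_def)
    \<comment> \<open>Near infinity the map is close to p, so preimages of points close to w stay
      bounded and accumulate at a finite point.\<close>
    obtain R where R: "\<forall>z\<in>closed_half. R <= cmod z --> dist p (r.ext z) <= dist p w / 2" using p'[of "dist p w / 2"] w by auto
    obtain N where N: "!!n. n >= N ==> dist (u n) w < dist p w / 2" using u(2) w unfolding lim_sequentially by (metis DiffD2 half_gt_zero insertI1 zero_less_dist_iff)
    have "a (n + N) \<in> cball 0 R" for n
    proof (rule ccontr)
     assume "a (n + N) \<notin> cball 0 R"
     hence "dist p (u (n+N)) <= dist p w / 2" using R a[of "n+N"] upper_subset_closed by force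
     moreover have "dist (u (n+N)) w < dist p w / 2" by (rule N) simp
     ultimately show False using dist_triangle[of p w "u (n+N)"] by simp
    qed
    hence "\<forall>n. (%n. a (n + N)) n \<in> cball 0 R" by blast
    then obtain x r' where x: "strict_mono r'" "((%n. a (n + N)) \<circ> r') \<longlonglongrightarrow> x"
     by (rule seq_compactE[OF compact_imp_seq_compact[OF compact_cball]])
    have xc: "x \<in> closed_half" by (rule closed_half_seq[OF _ x(2)]) (simp add: a(1))
    have "(%n. r.ext (((%n. a (n + N)) \<circ> r') n)) \<longlonglongrightarrow> r.ext x"
     by (rule continuous_on_tendsto_compose[OF r.continuous_ext x(2) xc always_eventually])
       (simp add: subsetD[OF upper_subset_closed a(1)])
    moreover have "(%n. r.ext (((%n. a (n + N)) \<circ> r') n)) = (%n. u (n + N)) \<circ> r'" using a(2) by (simp add: fun_eq_iff)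
    moreover have "((%n. u (n + N)) \<circ> r') \<longlonglongrightarrow> w" using LIMSEQ_subseq_LIMSEQ[OF LIMSEQ_ignore_initial_segment[OF u(2)] x(1)] .
    ultimately have e: "w = r.ext x" using LIMSEQ_unique by (simp only:)
    have "x \<notin> \<H>" using e im w I_props(6) by blast
    hence "x = of_real (Re x)" using closed_half_cases xc by blast
    thus "w \<in> range (%x::real. r.ext (of_real x))" using e by (metis rangeI)
   qed
  qed
 qed
qed

section \<open>Conformal welding\<close>

text \<open>A form of bounded circular dilatation that is stable under a change of metric: the radii need only be comparable up to a factor 2.\<close>
definition qsat :: "real => (complex => complex) => complex => bool" where
 "qsat H F z \<longleftrightarrow> (\<exists>\<delta>>0. \<forall>x y. cmod (x - z) < \<delta> --> cmod (y - z) < \<delta> --> cmod (x - z) <= 2 * cmod (y - z) -->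
   cmod (F x - F z) <= H * cmod (F y - F z))"

lemma qsat_mono: "qsat H F z ==> H <= H' ==> qsat H' F z" unfolding qsat_def by (meson mult_right_mono norm_ge_zero order_trans)

lemma qsat_derivative:
 assumes der: "(F has_derivative A) (at z)" and m: "m > 0" and K: "K >= 1"
  and A: "!!v. m * cmod v <= cmod (A v) & cmod (A v) <= K * m * cmod v"
 shows "qsat (8 * K) F z"
proof -
 have "\<exists>d>0. \<forall>y. cmod (y - z) < d --> cmod (F y - F z - A (y - z)) <= (m / 2) * cmod (y - z)"
  using der m unfolding has_derivative_at_alt by (meson half_gt_zero)
 then obtain d where d: "d > 0" "!!y. cmod (y - z) < d ==> cmod (F y - F z - A (y - z)) <= (m / 2) * cmod (y - z)" by blast
 show ?thesis unfolding qsat_def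
 proof (intro exI[of _ d] conjI allI impI)
  fix x y assume xy: "cmod (x - z) < d" "cmod (y - z) < d" "cmod (x - z) <= 2 * cmod (y - z)"
  have "cmod (F x - F z) <= cmod (A (x - z)) + (m / 2) * cmod (x - z)" using d(2)[OF xy(1)] norm_triangle_sub[of "F x - F z" "A (x - z)"] by linarith
  also have "\<dots> <= K * m * cmod (x - z) + K * m * cmod (x - z)"
  proof (rule add_mono)
   show "cmod (A (x - z)) <= K * m * cmod (x - z)" using A by blast
   have "m / 2 <= K * m" using m K mult_right_mono[of 1 K m] by simp
   thus "m / 2 * cmod (x - z) <= K * m * cmod (x - z)" by (rule mult_right_mono) simp
  qed
  also have "\<dots> = 2 * K * m * cmod (x - z)" by simp
  also have "\<dots> <= 2 * K * m * (2 * cmod (y - z))" using xy(3) K m by (intro mult_left_mono) auto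
  also have "\<dots> = 8 * K * ((m / 2) * cmod (y - z))" by simp
  also have "\<dots> <= 8 * K * cmod (F y - F z)"
  proof (rule mult_left_mono)
   have "m * cmod (y - z) <= cmod (A (y - z))" using A by blast
   also have "\<dots> <= cmod (F y - F z) + (m / 2) * cmod (y - z)" using d(2)[OF xy(2)] norm_triangle_ineq3[of "F y - F z" "A (y - z)"] by linarith
   finally show "(m / 2) * cmod (y - z) <= cmod (F y - F z)" by simp
  qed (use K in auto)
  finally show "cmod (F x - F z) <= 8 * K * cmod (F y - F z)" .
 qed (rule d(1))
qed

text \<open>\<open>weld_M\<close> is the M-constant of the welding homeomorphism:
  \<open>boundary_growth\<close> with D = H1, exponentiated. A power of two with exponent
  \<open>weld_k\<close> exceeds the distortion of the extension on circles with real centre,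
  \<open>weld_Q\<close> is the constant of \<open>quasisymmetric_at_real\<close>, and the two terms
  of \<open>weld_H\<close> cover points on and off the real line.\<close>

definition weld_M :: "real => real" where
 "weld_M C = exp (64 * pi * (half_plane_embedding.H2 C * half_plane_embedding.H1 C)\<^sup>2 * C ^ 4)"

definition weld_k :: "real => nat" where
 "weld_k C = nat \<lceil>4 * (1 + 2 * weld_M C)\<^sup>2 * (1 + weld_M C)\<rceil>"

definition weld_Q :: "real => nat => real" where
 "weld_Q C k = half_plane_embedding.H2 C * (1 + half_plane_embedding.H1 C) ^ k * (half_plane_embedding.H2 C * C)"

definition weld_H :: "real => real" where
 "weld_H C = weld_Q C (weld_k C) * weld_Q C (weld_k C) * weld_Q C 1 + 8 * (64 * (1 + weld_M C)\<^sup>2)"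

locale welding = p1: half_plane_embedding \<psi>1 C + p2: half_plane_embedding \<psi>2 C for \<psi>1 \<psi>2 C +
 assumes same: "range (%x::real. \<psi>1 (of_real x)) = range (%x::real. \<psi>2 (of_real x))"
  and disj: "\<psi>1 ` \<H> \<inter> \<psi>2 ` \<H> = {}"
begin

lemma weld_M1: "weld_M C >= 1" by (simp add: weld_M_def p1.C1)

lemma weld_k: "4 * (1 + 2 * weld_M C)\<^sup>2 * (1 + weld_M C) <= 2 ^ weld_k C"
proof -
 have "4 * (1 + 2 * weld_M C)\<^sup>2 * (1 + weld_M C) <= real (weld_k C)" unfolding weld_k_def by linarith
 also have "\<dots> < 2 ^ weld_k C" by simp
 finally show ?thesis by simp
qed

lemma weld_Q1: "weld_Q C k >= 1"
proof -
 have "1 * 1 <= p1.H2 * (1 + p1.H1) ^ k" using p1.H2_ge1 p1.H1_ge1 by (intro mult_mono one_le_power) auto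
 moreover have "1 * 1 <= p1.H2 * C" using p1.H2_ge1 p1.C1 by (intro mult_mono) auto
 ultimately have "1 * 1 <= (p1.H2 * (1 + p1.H1) ^ k) * (p1.H2 * C)" by (intro mult_mono) auto
 thus ?thesis by (simp add: weld_Q_def)
qed

text \<open>The welding homeomorphism, the inverse boundary map of \<psi>1 after that of
  \<psi>2.\<close>

definition h0 :: "real => real" where "h0 t = (SOME s. \<psi>1 (of_real s) = \<psi>2 (of_real t))"

lemma h0: "\<psi>1 (of_real (h0 t)) = \<psi>2 (of_real t)"
proof -
 have "\<psi>2 (of_real t) \<in> range (%x::real. \<psi>1 (of_real x))" using same by blast
 hence "\<exists>s. \<psi>1 (of_real s) = \<psi>2 (of_real t)" by (metis rangeE)
 thus ?thesis unfolding h0_def by (rule someI_ex)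
qed

lemma inj_h0: "inj h0"
proof (rule injI)
 fix x y assume "h0 x = h0 y"
 hence "\<psi>2 (of_real x) = \<psi>2 (of_real y)" using h0 by metis
 thus "x = y" using p2.inj by (metis inj_onD of_real_closed_half of_real_eq_iff)
qed

text \<open>\<open>lower_bound\<close> for \<psi>1 says that close image points have close real
  parameters, which is continuity of the inverse boundary map.\<close>

lemma continuous_h0: "continuous_on UNIV h0" unfolding continuous_on_iff
proof (intro ballI allI impI)
 fix t e :: real assume e: "e > 0"
 define c where "c = cmod (\<psi>1 (of_real (h0 t + e)) - \<psi>1 (of_real (h0 t)))"
 have c: "c > 0" unfolding c_def using e by (intro p1.ne) auto
 define d where "d = c / (p1.H2 * C)"
 have HC: "p1.H2 * C > 0" using p1.H2_ge1 p1.C1 by simp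
 have d: "d > 0" using c HC by (simp add: d_def)
 have "\<exists>\<delta>>0. \<forall>z\<in>closed_half. dist z (of_real t) < \<delta> --> dist (\<psi>2 z) (\<psi>2 (of_real t)) < d"
  using p2.cont d unfolding continuous_on_iff using of_real_closed_half by blast
 then obtain \<delta> where del: "\<delta> > 0" "!!z. z \<in> closed_half ==> dist z (of_real t) < \<delta> ==> dist (\<psi>2 z) (\<psi>2 (of_real t)) < d" by blast
 have "dist (h0 t') (h0 t) < e" if "dist t' t < \<delta>" for t'
 proof (rule ccontr)
  assume "\<not> dist (h0 t') (h0 t) < e"
  hence "\<bar>e\<bar> <= cmod (of_real (h0 t') - of_real (h0 t))" using e by (simp only: dist_real_def norm_of_real flip: of_real_diff)
  hence "c <= p1.H2 * C * cmod (\<psi>1 (of_real (h0 t')) - \<psi>1 (of_real (h0 t)))" unfolding c_def using e by (intro p1.lower_bound) auto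
  moreover have "cmod (\<psi>1 (of_real (h0 t')) - \<psi>1 (of_real (h0 t))) < d"
   unfolding h0 using del(2)[of "of_real t'"] that by (simp add: dist_norm norm_minus_commute dist_real_def flip: of_real_diff)
  ultimately have "c < p1.H2 * C * d" using HC mult_strict_left_mono by (metis le_less_trans)
  moreover have "p1.H2 * C * d = c" unfolding d_def times_divide_eq_right by (rule nonzero_mult_div_cancel_left) (use HC in linarith)
  ultimately show False by simp
 qed
 thus "\<exists>d>0. \<forall>x'\<in>UNIV. dist x' t < d --> dist (h0 x') (h0 t) < e" using del(1) by blast
qed

lemma orientation: "\<exists>\<sigma>::real. (\<sigma> = 1 \<or> \<sigma> = -1) & strict_mono (%t. h0 (\<sigma> * t))"
proof -
 have "strict_mono_on UNIV h0 \<or> strict_antimono_on UNIV h0" using injective_eq_monotone_map[OF is_interval_univ continuous_h0] inj_h0 by simp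
 thus ?thesis
 proof
  assume "strict_mono_on UNIV h0"
  thus ?thesis by (intro exI[of _ 1]) simp
 next
  assume "strict_antimono_on UNIV h0"
  hence "strict_mono (%t. h0 (- 1 * t))" by (auto simp: strict_mono_def monotone_on_def)
  thus ?thesis by (intro exI[of _ "-1"]) auto
 qed
qed

text \<open>The orientations that the two charts induce on the curve are not computed. Instead
  \<sigma> makes the welding map increasing, and \<kappa> carries the lower to the upper half-plane
  by a reflection or a half-turn, with t -> \<sigma> t on the real line.\<close>

definition \<sigma> :: real where "\<sigma> = (SOME s. (s = 1 \<or> s = -1) & strict_mono (%t. h0 (s * t)))"
definition h :: "real => real" where "h t = h0 (\<sigma> * t)"
definition \<kappa> :: "complex => complex" where "\<kappa> z = (if \<sigma> = 1 then cnj z else - z)"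

lemma sigma: "\<sigma> = 1 \<or> \<sigma> = -1" and mono_h: "strict_mono h" using someI_ex[OF orientation] unfolding \<sigma>_def[symmetric] h_def[abs_def] by auto

lemma h_eq: "\<psi>1 (of_real (h t)) = \<psi>2 (of_real (\<sigma> * t))" by (simp add: h_def h0)

lemma kappa_real: "\<kappa> (of_real t) = of_real (\<sigma> * t)" using sigma by (auto simp: \<kappa>_def)
lemma kappa_norm: "cmod (\<kappa> z - \<kappa> w) = cmod (z - w)" by (simp add: \<kappa>_def norm_minus_commute flip: complex_cnj_diff)
lemma kappa_closed: "Im z <= 0 ==> \<kappa> z \<in> closed_half" by (simp add: \<kappa>_def closed_half_def)
lemma kappa_upper: "Im z < 0 ==> \<kappa> z \<in> \<H>" by (simp add: \<kappa>_def \<H>_def)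
lemma kappa_inj: "\<kappa> z = \<kappa> w ==> z = w" using kappa_norm[of z w] by simp
lemma continuous_kappa: "continuous_on S \<kappa>" unfolding \<kappa>_def by (cases "\<sigma> = 1") (auto intro!: continuous_intros)

text \<open>\<open>opposite\<close> for \<psi>2 compares chords of the common curve;
  \<open>boundary_growth\<close> for \<psi>1 turns the ratio of chords into a ratio of lengths on
  the line.\<close>

lemma h_quasisymmetric:
 assumes "e ~= 0"
 shows "\<bar>h (x + e) - h x\<bar> <= weld_M C * \<bar>h (x - e) - h x\<bar>"
proof (cases "\<bar>h (x + e) - h x\<bar> <= \<bar>h (x - e) - h x\<bar>")
 case True
 thus ?thesis using weld_M1 mult_right_mono[of 1 "weld_M C" "\<bar>h (x - e) - h x\<bar>"] by simp
next
 case False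
 define f' where "f' = h (x + e) - h x"
 define f where "f = h (x - e) - h x"
 have inj_h: "h a ~= h b" if "a ~= b" for a b using mono_h that by (metis linorder_neqE_linordered_idom strict_monoD order_less_irrefl)
 have f0: "f ~= 0" unfolding f_def using inj_h[of "x - e" x] assms by simp
 have "cmod (\<psi>2 (of_real (\<sigma> * x - (- (\<sigma> * e)))) - \<psi>2 (of_real (\<sigma> * x))) <= p2.H1 * cmod (\<psi>2 (of_real (\<sigma> * x + (- (\<sigma> * e)))) - \<psi>2 (of_real (\<sigma> * x)))"
  by (rule p2.opposite)
 hence "cmod (\<psi>1 (of_real (h (x + e))) - \<psi>1 (of_real (h x))) <= p2.H1 * cmod (\<psi>1 (of_real (h (x - e))) - \<psi>1 (of_real (h x)))"
  unfolding h_eq by (simp add: algebra_simps)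
 hence "cmod (\<psi>1 (of_real (h x + f')) - \<psi>1 (of_real (h x))) <= p2.H1 * cmod (\<psi>1 (of_real (h x + f)) - \<psi>1 (of_real (h x)))" by (simp add: f'_def f_def)
 from p1.boundary_growth[OF f0 _ this] False
 have "ln (\<bar>f'\<bar> / \<bar>f\<bar>) <= 64 * pi * (p1.H2 * p1.H1)\<^sup>2 * C ^ 4" by (simp add: f_def f'_def)
 hence "exp (ln (\<bar>f'\<bar> / \<bar>f\<bar>)) <= weld_M C" unfolding weld_M_def by simp
 moreover have "f' ~= 0" unfolding f'_def using inj_h[of "x + e" x] assms by simp
 ultimately show ?thesis using f0 by (simp add: f_def f'_def divide_le_eq)
qed

sublocale qs: quasisymmetric_line h "weld_M C"
proof unfold_locales
 show "strict_mono h" by (rule mono_h)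
 show "continuous_on UNIV h" unfolding h_def by (rule continuous_on_compose2[OF continuous_h0]) (auto intro!: continuous_intros)
 show "weld_M C >= 1" by (rule weld_M1)
 fix x t :: real assume t: "0 < t"
 have a: "h x < h (x + t)" "h (x - t) < h x" using mono_h t by (auto simp: strict_mono_def)
 show "h (x + t) - h x <= weld_M C * (h x - h (x - t))" using h_quasisymmetric[of t x] t a by simp
 show "h x - h (x - t) <= weld_M C * (h (x + t) - h x)" using h_quasisymmetric[of "-t" x] t a by simp
qed

definition \<Phi> :: "complex => complex" where "\<Phi> z = (if Im z >= 0 then \<psi>1 (qs.BA z) else \<psi>2 (\<kappa> z))"

lemma BA_closed: "Im z >= 0 ==> qs.BA z \<in> closed_half"
proof -
 assume "Im z >= 0"
 hence "Im z > 0 \<or> z = of_real (Re z)" by (auto simp: complex_eq_iff)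
 then consider "Im z > 0" | "z = of_real (Re z)" by blast
 thus ?thesis
 proof cases
  case 1 thus ?thesis using qs.Im_BA_pos[of z] by (simp add: closed_half_def)
 next
  case 2 thus ?thesis using qs.BA_real of_real_closed_half by metis
 qed
qed

lemma Phi_lower: "Im z <= 0 ==> \<Phi> z = \<psi>2 (\<kappa> z)"
proof (cases "Im z = 0")
 case True
 hence e: "z = of_real (Re z)" by (simp add: complex_eq_iff)
 have "\<Phi> z = \<psi>1 (qs.BA (of_real (Re z)))" using True e by (simp add: \<Phi>_def)
 also have "\<dots> = \<psi>2 (\<kappa> (of_real (Re z)))" by (simp only: qs.BA_real h_eq kappa_real)
 finally show ?thesis using e by simp
qed (simp add: \<Phi>_def)

lemma Phi_upper: "Im z >= 0 ==> \<Phi> z = \<psi>1 (qs.BA z)" by (simp add: \<Phi>_def)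

lemma Phi_real1: "\<Phi> (of_real t) = \<psi>1 (of_real (h t))" using Phi_upper[of "of_real t"] by simp
lemma Phi_real2: "\<Phi> (of_real t) = \<psi>2 (of_real (\<sigma> * t))" using Phi_lower[of "of_real t"] kappa_real by simp

lemma continuous_Phi: "continuous_on UNIV \<Phi>"
proof -
 have "continuous_on ({z. Im z >= 0} \<union> {z. Im z <= 0}) (%z. if Im z >= 0 then \<psi>1 (qs.BA z) else \<psi>2 (\<kappa> z))"
 proof (rule continuous_on_cases)
  show "closed {z. Im z >= 0}" "closed {z. Im z <= 0}" by (auto simp: closed_halfspace_Im_ge closed_halfspace_Im_le)
  show "continuous_on {z. Im z >= 0} (%z. \<psi>1 (qs.BA z))"
   by (rule continuous_on_compose2[OF p1.cont continuous_on_subset[OF qs.continuous_BA]]) (use BA_closed in auto)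
  show "continuous_on {z. Im z <= 0} (%z. \<psi>2 (\<kappa> z))" by (rule continuous_on_compose2[OF p2.cont continuous_kappa]) (use kappa_closed in auto)
  show "\<forall>z. z \<in> {z. Im z >= 0} & \<not> Im z >= 0 \<or> z \<in> {z. Im z <= 0} & Im z >= 0 --> \<psi>1 (qs.BA z) = \<psi>2 (\<kappa> z)"
   using Phi_lower Phi_upper by (metis mem_Collect_eq)
 qed
 moreover have "{z. Im z >= 0} \<union> {z. Im z <= 0} = UNIV" by auto
 ultimately show ?thesis unfolding \<Phi>_def[abs_def] by simp
qed

lemma inj_Phi: "inj \<Phi>"
proof -
 have mixed: "\<Phi> z ~= \<Phi> w" if "Im z >= 0" "Im w < 0" for z w
 proof
  assume e: "\<Phi> z = \<Phi> w"
  have w: "\<Phi> w = \<psi>2 (\<kappa> w)" "\<kappa> w \<in> \<H>" using that Phi_lower kappa_upper by auto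
  show False
  proof (cases "Im z = 0")
   case True
   hence "\<Phi> z = \<psi>2 (\<kappa> z)" "\<kappa> z \<in> closed_half" using Phi_lower kappa_closed by auto
   hence "\<kappa> z = \<kappa> w" using e w p2.inj upper_subset_closed by (metis inj_onD subsetD)
   hence "z = w" by (rule kappa_inj)
   thus False using that by simp
  next
   case False
   hence "\<Phi> z = \<psi>1 (qs.BA z)" "qs.BA z \<in> \<H>" using Phi_upper qs.Im_BA_pos[of z] that by (auto simp: \<H>_def)
   thus False using e w disj by (metis disjoint_iff image_eqI)
  qed
 qed
 show ?thesis
 proof (rule injI)
  fix z w assume e: "\<Phi> z = \<Phi> w"
  consider "Im z >= 0" "Im w >= 0" | "Im z < 0" "Im w < 0" using mixed[of z w] mixed[of w z] e by (metis not_le)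
  thus "z = w"
  proof cases
   case 1
   hence "qs.BA z = qs.BA w" using e Phi_upper BA_closed p1.inj by (metis inj_onD)
   thus ?thesis using qs.inj_BA 1 by (auto dest: inj_onD)
  next
   case 2
   hence "\<kappa> z = \<kappa> w" using e Phi_lower kappa_closed p2.inj by (metis inj_onD less_imp_le)
   thus ?thesis by (rule kappa_inj)
  qed
 qed
qed

text \<open>The real point a + r is a common gauge: both half-planes are compared with it, so points
  on different sides of the line become comparable.\<close>

lemma Phi_circle:
 assumes z: "cmod (z - of_real a) = r" and r: "r > 0"
 shows "cmod (\<Phi> z - \<Phi> (of_real a)) <= weld_Q C (weld_k C) * cmod (\<Phi> (of_real (a + r)) - \<Phi> (of_real a))"
  and "cmod (\<Phi> (of_real (a + r)) - \<Phi> (of_real a)) <= weld_Q C (weld_k C) * cmod (\<Phi> z - \<Phi> (of_real a))"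
proof -
 have "cmod (\<Phi> z - \<Phi> (of_real a)) <= weld_Q C (weld_k C) * cmod (\<Phi> (of_real (a + r)) - \<Phi> (of_real a)) &
  cmod (\<Phi> (of_real (a + r)) - \<Phi> (of_real a)) <= weld_Q C (weld_k C) * cmod (\<Phi> z - \<Phi> (of_real a))"
 proof (cases "Im z >= 0")
  case True
  define e where "e = h (a + r) - h a"
  define \<rho> where "\<rho> = cmod (qs.BA z - of_real (h a))"
  let ?M = "weld_M C"
  have e: "e > 0" unfolding e_def using qs.less r by simp
  have D: "h (a + r) - h (a - r) <= (1 + ?M) * e" using qs.qs2[of r a] r by (simp add: e_def algebra_simps)
  have D': "e <= h (a + r) - h (a - r)" using qs.less[of "a - r" a] r by (simp add: e_def)
  have "\<rho> <= 2 * (1 + 2 * ?M)\<^sup>2 * (h (a + r) - h (a - r))" unfolding \<rho>_def by (rule qs.BA_upper) (use True z r in auto)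
  also have "\<dots> <= 2 * (1 + 2 * ?M)\<^sup>2 * ((1 + ?M) * e)" using D by (intro mult_left_mono) auto
  also have "\<dots> = (2 * (1 + 2 * ?M)\<^sup>2 * (1 + ?M)) * e" by simp
  also have "\<dots> <= (4 * (1 + 2 * ?M)\<^sup>2 * (1 + ?M)) * e" using e weld_M1 by (intro mult_right_mono) auto
  also have "\<dots> <= 2 ^ weld_k C * e" using weld_k e by (intro mult_right_mono) auto
  finally have r1: "\<rho> <= 2 ^ weld_k C * e" .
  have "e <= 4 * (1 + 2 * ?M)\<^sup>2 * \<rho>" using D' qs.BA_lower[of z r a] True z r by (simp add: \<rho>_def)
  also have "\<dots> <= (4 * (1 + 2 * ?M)\<^sup>2 * (1 + ?M)) * \<rho>"
  proof (rule mult_right_mono)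
   show "4 * (1 + 2 * ?M)\<^sup>2 <= 4 * (1 + 2 * ?M)\<^sup>2 * (1 + ?M)" using weld_M1 mult_left_mono[of 1 "1 + ?M" "4 * (1 + 2 * ?M)\<^sup>2"] by simp
  qed (simp add: \<rho>_def)
  also have "\<dots> <= 2 ^ weld_k C * \<rho>" using weld_k by (intro mult_right_mono) (auto simp: \<rho>_def)
  finally have r2: "e <= 2 ^ weld_k C * \<rho>" .
  have ce: "cmod (of_real (h (a + r)) - of_real (h a)) = e" using e unfolding e_def by (metis abs_of_pos norm_of_real of_real_diff)
  have rho: "\<rho> > 0" using r2 e by (smt (verit) zero_less_mult_iff zero_less_power)
  have n1: "of_real (h (a + r)) ~= complex_of_real (h a)" using e by (simp add: e_def)
  have n2: "qs.BA z ~= of_real (h a)" using rho by (auto simp: \<rho>_def)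
  have 1: "cmod (\<psi>1 (qs.BA z) - \<psi>1 (of_real (h a))) <= weld_Q C (weld_k C) * cmod (\<psi>1 (of_real (h (a + r))) - \<psi>1 (of_real (h a)))"
   unfolding weld_Q_def by (rule p1.quasisymmetric_at_real) (insert BA_closed True n1 r1 ce, auto simp: \<rho>_def)
  have 2: "cmod (\<psi>1 (of_real (h (a + r))) - \<psi>1 (of_real (h a))) <= weld_Q C (weld_k C) * cmod (\<psi>1 (qs.BA z) - \<psi>1 (of_real (h a)))"
   unfolding weld_Q_def by (rule p1.quasisymmetric_at_real) (insert BA_closed True n2 r2 ce, auto simp: \<rho>_def)
  show ?thesis using 1 2 True unfolding Phi_real1 by (simp add: Phi_upper)
 next
  case False
  have c: "cmod (\<kappa> z - of_real (\<sigma> * a)) = r" using kappa_norm[of z "of_real a"] z by (simp add: kappa_real)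
  have c2: "cmod (of_real (\<sigma> * (a + r)) - of_real (\<sigma> * a)) = r" using sigma r by (auto simp: algebra_simps)
  have k1: "r <= 2 ^ weld_k C * r" using r mult_right_mono[of 1 "2 ^ weld_k C" r] by simp
  have n: "\<kappa> z ~= of_real (\<sigma> * a)" "complex_of_real (\<sigma> * (a + r)) ~= of_real (\<sigma> * a)" using c c2 r by auto
  have kc: "\<kappa> z \<in> closed_half" using False kappa_closed by simp
  have 1: "cmod (\<psi>2 (\<kappa> z) - \<psi>2 (of_real (\<sigma> * a))) <= weld_Q C (weld_k C) * cmod (\<psi>2 (of_real (\<sigma> * (a + r))) - \<psi>2 (of_real (\<sigma> * a)))"
   unfolding weld_Q_def by (rule p2.quasisymmetric_at_real[OF kc of_real_closed_half n(2)]) (simp only: c c2 k1)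
  have 2: "cmod (\<psi>2 (of_real (\<sigma> * (a + r))) - \<psi>2 (of_real (\<sigma> * a))) <= weld_Q C (weld_k C) * cmod (\<psi>2 (\<kappa> z) - \<psi>2 (of_real (\<sigma> * a)))"
   unfolding weld_Q_def by (rule p2.quasisymmetric_at_real[OF of_real_closed_half kc n(1)]) (simp only: c c2 k1)
  show ?thesis using 1 2 False unfolding Phi_real2 by (simp add: Phi_lower)
 qed
 thus "cmod (\<Phi> z - \<Phi> (of_real a)) <= weld_Q C (weld_k C) * cmod (\<Phi> (of_real (a + r)) - \<Phi> (of_real a))"
  "cmod (\<Phi> (of_real (a + r)) - \<Phi> (of_real a)) <= weld_Q C (weld_k C) * cmod (\<Phi> z - \<Phi> (of_real a))" by auto
qed

text \<open>Chain from x to the real point on its circle about a, from there to the real point on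
  the circle of y, and then to y. There is no bound on the radii, so with a = 0 the estimate also
  serves near infinity.\<close>

lemma Phi_real_global:
 assumes "cmod (x - of_real a) <= 2 * cmod (y - of_real a)"
 shows "cmod (\<Phi> x - \<Phi> (of_real a)) <= weld_H C * cmod (\<Phi> y - \<Phi> (of_real a))"
proof (cases "x = of_real a")
 case True
 have "0 <= weld_H C" unfolding weld_H_def using weld_Q1[of "weld_k C"] weld_Q1[of 1] by simp
 thus ?thesis using True by simp
next
 case False
 let ?Q = "weld_Q C (weld_k C)"
 define r s where "r = cmod (y - of_real a)" and "s = cmod (x - of_real a)"
 have rs: "0 < s" "s <= 2 * r" "0 < r" using False assms by (auto simp: r_def s_def)
 have "cmod (\<Phi> x - \<Phi> (of_real a)) <= ?Q * cmod (\<Phi> (of_real (a + s)) - \<Phi> (of_real a))" by (rule Phi_circle(1)) (use rs s_def in auto)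
 also have "\<dots> <= ?Q * (weld_Q C 1 * cmod (\<Phi> (of_real (a + r)) - \<Phi> (of_real a)))"
 proof (rule mult_left_mono)
  have c2: "cmod (of_real (\<sigma> * (a + t)) - of_real (\<sigma> * a)) = t" if "t > 0" for t using sigma that by (auto simp: algebra_simps)
  have n: "complex_of_real (\<sigma> * (a + r)) ~= of_real (\<sigma> * a)" using c2[OF rs(3)] rs by auto
  show "cmod (\<Phi> (of_real (a + s)) - \<Phi> (of_real a)) <= weld_Q C 1 * cmod (\<Phi> (of_real (a + r)) - \<Phi> (of_real a))" unfolding Phi_real2 weld_Q_def
   by (rule p2.quasisymmetric_at_real[OF of_real_closed_half of_real_closed_half n]) (use rs c2 in simp)
 qed (use weld_Q1[of "weld_k C"] in simp)
 also have "\<dots> <= ?Q * (weld_Q C 1 * (?Q * cmod (\<Phi> y - \<Phi> (of_real a))))"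
 proof -
  have "cmod (\<Phi> (of_real (a + r)) - \<Phi> (of_real a)) <= ?Q * cmod (\<Phi> y - \<Phi> (of_real a))" by (rule Phi_circle(2)) (use rs r_def in auto)
  thus ?thesis using weld_Q1[of "weld_k C"] weld_Q1[of 1] by (intro mult_left_mono) auto
 qed
 also have "\<dots> = (?Q * ?Q * weld_Q C 1) * cmod (\<Phi> y - \<Phi> (of_real a))" by (simp only: mult_ac)
 also have "\<dots> <= weld_H C * cmod (\<Phi> y - \<Phi> (of_real a))" by (rule mult_right_mono) (simp_all add: weld_H_def)
 finally show ?thesis .
qed

lemma Phi_qsat: "qsat (weld_H C) \<Phi> z"
proof -
 have KH: "8 * (64 * (1 + weld_M C)\<^sup>2) <= weld_H C" unfolding weld_H_def using weld_Q1[of "weld_k C"] weld_Q1[of 1] by simp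
 have KM: "1 <= 64 * (1 + weld_M C)\<^sup>2" using weld_M1 one_le_power[of "1 + weld_M C" 2] by linarith
 consider "Im z = 0" | "Im z > 0" | "Im z < 0" by linarith
 thus ?thesis
 proof cases
  case 1
  hence e: "z = of_real (Re z)" by (simp add: complex_eq_iff)
  show ?thesis unfolding qsat_def by (subst (1 2 3 4 5 6) e, intro exI[of _ 1]) (use Phi_real_global in auto)
 next
  case 2
  obtain A m where A: "(qs.BA has_derivative A) (at z)" "m > 0" "!!v. m * cmod v <= cmod (A v) & cmod (A v) <= 64 * (1 + weld_M C)\<^sup>2 * m * cmod v"
   using qs.BA_derivative[OF 2] by blast
  have u: "qs.BA z \<in> \<H>" using qs.Im_BA_pos[OF 2] by (simp add: \<H>_def)
  define d where "d = deriv \<psi>1 (qs.BA z)"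
  have d0: "d ~= 0" unfolding d_def using holomorphic_injective_imp_regular[OF p1.hol open_upper_half p1.injU u] .
  have "(\<psi>1 has_derivative (*) d) (at (qs.BA z))" unfolding d_def using holomorphic_derivI[OF p1.hol open_upper_half u] by (simp add: has_field_derivative_def)
  from diff_chain_at[OF A(1) this]
  have "((%z. \<psi>1 (qs.BA z)) has_derivative (%v. d * A v)) (at z)" by (simp add: o_def)
  hence der: "(\<Phi> has_derivative (%v. d * A v)) (at z)" by (rule has_derivative_transform_within_open[of _ _ _ _ "{z. Im z > 0}"])
     (insert 2, auto simp: open_halfspace_Im_gt Phi_upper)
  have "qsat (8 * (64 * (1 + weld_M C)\<^sup>2)) \<Phi> z"
  proof (rule qsat_derivative[OF der _ KM])
   show "0 < cmod d * m" using d0 A by simp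
   fix v
   show "cmod d * m * cmod v <= cmod (d * A v) & cmod (d * A v) <= 64 * (1 + weld_M C)\<^sup>2 * (cmod d * m) * cmod v"
   proof
    show "cmod d * m * cmod v <= cmod (d * A v)" using A(3)[of v] by (simp add: norm_mult mult.assoc mult_left_mono)
    have "cmod d * cmod (A v) <= cmod d * (64 * (1 + weld_M C)\<^sup>2 * m * cmod v)" using A(3)[of v] by (intro mult_left_mono) auto
    thus "cmod (d * A v) <= 64 * (1 + weld_M C)\<^sup>2 * (cmod d * m) * cmod v" by (simp add: norm_mult mult_ac)
   qed
  qed
  thus ?thesis using KH by (rule qsat_mono)
 next
  case 3
  have u: "\<kappa> z \<in> \<H>" using 3 kappa_upper by simp
  define d where "d = deriv \<psi>2 (\<kappa> z)"
  have d0: "d ~= 0" unfolding d_def using holomorphic_injective_imp_regular[OF p2.hol open_upper_half p2.injU u] .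
  have "(\<psi>2 has_derivative (*) d) (at (\<kappa> z))" unfolding d_def using holomorphic_derivI[OF p2.hol open_upper_half u] by (simp add: has_field_derivative_def)
  moreover have "(\<kappa> has_derivative \<kappa>) (at z)"
  proof (rule linear_imp_has_derivative)
   show "linear \<kappa>" unfolding \<kappa>_def by (rule linearI) auto
  qed
  ultimately have "((%z. \<psi>2 (\<kappa> z)) has_derivative (%v. d * \<kappa> v)) (at z)"
   using diff_chain_at[of \<kappa> \<kappa> z \<psi>2 "(*) d"] by (simp add: o_def)
  hence der: "(\<Phi> has_derivative (%v. d * \<kappa> v)) (at z)" by (rule has_derivative_transform_within_open[of _ _ _ _ "{z. Im z < 0}"])
     (insert 3, auto simp: open_halfspace_Im_lt Phi_lower)
  have kn: "cmod (\<kappa> v) = cmod v" for v by (simp add: \<kappa>_def)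
  have "qsat (8 * (64 * (1 + weld_M C)\<^sup>2)) \<Phi> z"
  proof (rule qsat_derivative[OF der _ KM])
   show "0 < cmod d" using d0 by simp
   fix v
   have "1 * (cmod d * cmod v) <= 64 * (1 + weld_M C)\<^sup>2 * (cmod d * cmod v)" using KM by (intro mult_right_mono) auto
   thus "cmod d * cmod v <= cmod (d * \<kappa> v) & cmod (d * \<kappa> v) <= 64 * (1 + weld_M C)\<^sup>2 * cmod d * cmod v" by (simp add: norm_mult kn mult.assoc)
  qed
  thus ?thesis using KH by (rule qsat_mono)
 qed
qed

lemma Phi_proper: "\<exists>R. \<forall>z. R <= cmod z --> B <= cmod (\<Phi> z)"
proof -
 let ?Q = "weld_Q C (weld_k C)"
 obtain R where R: "!!z. z \<in> closed_half ==> R <= cmod z ==> ?Q * (\<bar>B\<bar> + cmod (\<Phi> 0)) + cmod (\<Phi> 0) <= cmod (\<psi>2 z)" using p2.proper by metis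
 have "B <= cmod (\<Phi> z)" if z: "max R 1 <= cmod z" for z
 proof -
  define r where "r = cmod z"
  have r: "r > 0" "R <= r" using z by (auto simp: r_def)
  have sr: "R <= cmod (of_real (\<sigma> * r))" using sigma r by auto
  have "?Q * (\<bar>B\<bar> + cmod (\<Phi> 0)) + cmod (\<Phi> 0) <= cmod (\<Phi> (of_real r))" unfolding Phi_real2 by (rule R[OF of_real_closed_half sr])
  also have "\<dots> <= cmod (\<Phi> (of_real r) - \<Phi> 0) + cmod (\<Phi> 0)" using norm_triangle_sub[of "\<Phi> (of_real r)" "\<Phi> 0"] by simp
  also have "cmod (\<Phi> (of_real r) - \<Phi> 0) <= ?Q * cmod (\<Phi> z - \<Phi> 0)" using Phi_circle(2)[of z 0 r] r by (simp add: r_def)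
  finally have "?Q * (\<bar>B\<bar> + cmod (\<Phi> 0)) <= ?Q * cmod (\<Phi> z - \<Phi> 0)" by simp
  hence "\<bar>B\<bar> + cmod (\<Phi> 0) <= cmod (\<Phi> z - \<Phi> 0)" using weld_Q1[of "weld_k C"] by (simp add: mult_le_cancel_left)
  also have "\<dots> <= cmod (\<Phi> z) + cmod (\<Phi> 0)" by (rule norm_triangle_ineq4)
  finally show ?thesis by simp
 qed
 thus ?thesis by blast
qed

text \<open>The range is open by invariance of domain and closed because \<Phi> is proper.\<close>

lemma surj_Phi: "surj \<Phi>"
proof -
 have "open (\<Phi> ` UNIV)" by (rule invariance_of_domain[OF continuous_Phi open_UNIV inj_Phi])
 moreover have "closed (\<Phi> ` UNIV)"
 proof (rule closed_sequential_limits[THEN iffD2], intro allI impI, elim conjE)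
  fix u l assume u: "\<forall>n. u n \<in> range \<Phi>" "u \<longlonglongrightarrow> l"
  hence "\<forall>n. \<exists>x. u n = \<Phi> x" by blast
  then obtain x where x: "!!n. u n = \<Phi> (x n)" by metis
  have "Bseq u" using convergent_imp_Bseq[OF convergentI[OF u(2)]] .
  then obtain B where B: "!!n. cmod (u n) <= B" unfolding Bseq_def by blast
  obtain R where R: "\<forall>z. R <= cmod z --> B + 1 <= cmod (\<Phi> z)" using Phi_proper by blast
  have "x n \<in> cball 0 R" for n using R B[of n] x[of n] by (smt (verit) mem_cball_0)
  hence "\<forall>n. x n \<in> cball 0 R" by blast
  then obtain y r where y: "y \<in> cball 0 R" "strict_mono r" "(x \<circ> r) \<longlonglongrightarrow> y"
   by (rule seq_compactE[OF compact_imp_seq_compact[OF compact_cball]])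
  have "(%n. \<Phi> ((x \<circ> r) n)) \<longlonglongrightarrow> \<Phi> y" by (rule continuous_on_tendsto_compose[OF continuous_Phi y(3)]) auto
  moreover have "(%n. \<Phi> ((x \<circ> r) n)) \<longlonglongrightarrow> l" using LIMSEQ_subseq_LIMSEQ[OF u(2) y(2)] x by (simp add: o_def)
  ultimately show "l \<in> range \<Phi>" using LIMSEQ_unique by blast
 qed
 ultimately show ?thesis using clopen[of "range \<Phi>"] by blast
qed

end

theorem conformal_welding:
 assumes "half_plane_embedding \<psi>1 C" "half_plane_embedding \<psi>2 C"
  "range (%x::real. \<psi>1 (of_real x)) = range (%x::real. \<psi>2 (of_real x))"
  "\<psi>1 ` \<H> \<inter> \<psi>2 ` \<H> = {}"
 obtains \<Phi> where "continuous_on UNIV \<Phi>" "inj \<Phi>" "surj \<Phi>" "!!B. \<exists>R. \<forall>z. R <= cmod z --> B <= cmod (\<Phi> z)"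
  "range (%x::real. \<Phi> (of_real x)) = range (%x::real. \<psi>1 (of_real x))"
  "!!z. qsat (weld_H C) \<Phi> z"
  "!!x y. cmod x <= 2 * cmod y ==> cmod (\<Phi> x - \<Phi> 0) <= weld_H C * cmod (\<Phi> y - \<Phi> 0)"
proof -
 interpret welding \<psi>1 \<psi>2 C using assms by (simp add: welding_def welding_axioms_def)
 show ?thesis
 proof (rule that[of \<Phi>])
  show "range (%x::real. \<Phi> (of_real x)) = range (%x::real. \<psi>1 (of_real x))"
  proof
   show "range (%x::real. \<Phi> (of_real x)) <= range (%x::real. \<psi>1 (of_real x))" unfolding Phi_real1 by blast
   have "\<psi>2 (of_real x) = \<Phi> (of_real (\<sigma> * x))" for x unfolding Phi_real2 using sigma by auto
   thus "range (%x::real. \<psi>1 (of_real x)) <= range (%x::real. \<Phi> (of_real x))"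
    unfolding same using rangeI[of "%x::real. \<Phi> (of_real x)"] by (metis image_subsetI)
  qed
 qed (use continuous_Phi inj_Phi surj_Phi Phi_proper Phi_qsat Phi_real_global[of _ 0] in auto)
qed

section \<open>Bounded turning implies quasicircle\<close>

text \<open>Supplies closed pieces of a curve through p, parametrised by unbounded intervals, for
  the separation arguments below.\<close>

lemma closed_image_through_infinity:
 fixes \<pi> :: "real => complex"
 assumes cont: "continuous_on UNIV \<pi>" and lim: "!!\<epsilon>. \<epsilon> > 0 ==> \<exists>R. \<forall>t. R <= \<bar>t\<bar> --> dist p (\<pi> t) <= \<epsilon>" and "closed X"
 shows "closed (insert p (\<pi> ` X))"
 unfolding closed_def open_contains_ball
proof (intro ballI)
 fix y assume y: "y \<in> - insert p (\<pi> ` X)"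
 hence d: "dist p y > 0" by auto
 obtain R where R: "!!t. R <= \<bar>t\<bar> ==> dist p (\<pi> t) <= dist p y / 2" using lim[of "dist p y / 2"] d by auto
 have "compact (\<pi> ` (X \<inter> {-R..R}))" by (intro compact_continuous_image continuous_on_subset[OF cont]) (auto intro: closed_Int_compact assms)
 hence "open (- (\<pi> ` (X \<inter> {-R..R})))" by (simp add: compact_imp_closed open_Compl)
 moreover have "y \<in> - (\<pi> ` (X \<inter> {-R..R}))" using y by auto
 ultimately obtain e where e: "e > 0" "ball y e <= - (\<pi> ` (X \<inter> {-R..R}))" by (meson open_contains_ball)
 have "ball y (min e (dist p y / 2)) <= - insert p (\<pi> ` X)"
 proof
  fix z assume z: "z \<in> ball y (min e (dist p y / 2))"
  hence zd: "dist y z < dist p y / 2" "z \<in> ball y e" by auto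
  have pz: "dist p z > dist p y / 2" using zd dist_triangle[of p y z] by (simp add: dist_commute)
  show "z \<in> - insert p (\<pi> ` X)"
  proof (rule ccontr)
   assume "z \<notin> - insert p (\<pi> ` X)"
   then obtain t where t: "t \<in> X" "z = \<pi> t" using pz d by auto
   show False
   proof (cases "R <= \<bar>t\<bar>")
    case True thus False using R[of t] pz t by simp
   next
    case False hence "t \<in> X \<inter> {-R..R}" using t by auto
    thus False using e(2) zd(2) t(2) by blast
   qed
  qed
 qed
 thus "\<exists>e>0. ball y e <= - insert p (\<pi> ` X)" using e d by (metis half_gt_zero min_less_iff_conj)
qed

text \<open>The quotient of the two products is |b' - a'| / |c' - a'| for the images of the points
  under w -> 1 / (w - p), so this is the three-point condition after p is sent to infinity. The
  hypotheses record which points lie on short connected parts of the curve from A to C and from B to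
  p.\<close>

lemma bounded_turning_cross_ratio:
 fixes A B C p :: complex
 assumes C0: "C0 >= 1"
  and 1: "(dist B A <= C0 * dist A C & dist B C <= C0 * dist A C) \<or> (dist p A <= C0 * dist A C & dist p C <= C0 * dist A C)"
  and 2: "(dist A B <= C0 * dist B p & dist A p <= C0 * dist B p) \<or> (dist C B <= C0 * dist B p & dist C p <= C0 * dist B p)"
 shows "dist B A * dist C p <= (C0\<^sup>2 + C0) * (dist C A * dist B p)"
proof -
 define D E where "D = dist A C" and "E = dist B p"
 have DE: "0 <= D" "0 <= E" by (auto simp: D_def E_def)
 have mm: "x * y <= C0\<^sup>2 * (D * E)" if "x <= C0 * D" "y <= C0 * E" "0 <= x" "0 <= y" for x y
  using mult_mono[OF that(1,2)] that DE C0 by (simp add: power2_eq_square mult_ac)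
 have DE2: "0 <= C0 * (D * E)" "0 <= C0\<^sup>2 * (D * E)" using DE C0 by auto
 have "dist B A * dist C p <= C0\<^sup>2 * (D * E) + C0 * (D * E)" using 1
 proof
  assume a: "dist B A <= C0 * dist A C & dist B C <= C0 * dist A C"
  show ?thesis using 2
  proof
   assume b: "dist A B <= C0 * dist B p & dist A p <= C0 * dist B p"
   have "dist B A * dist C p <= dist B A * (dist C B + dist B p)" by (intro mult_left_mono dist_triangle) auto
   also have "\<dots> = dist C B * dist B A + dist B A * E" by (simp add: E_def algebra_simps)
   also have "\<dots> <= C0\<^sup>2 * (D * E) + (C0 * D) * E" using a b DE by (intro add_mono mm mult_right_mono) (auto simp: D_def E_def dist_commute)
   finally show ?thesis by (simp add: mult.assoc)
  next
   assume "dist C B <= C0 * dist B p & dist C p <= C0 * dist B p"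
   hence "dist B A * dist C p <= C0\<^sup>2 * (D * E)" using a by (intro mm) (auto simp: D_def E_def)
   thus ?thesis using DE2 by linarith
  qed
 next
  assume a: "dist p A <= C0 * dist A C & dist p C <= C0 * dist A C"
  show ?thesis using 2
  proof
   assume "dist A B <= C0 * dist B p & dist A p <= C0 * dist B p"
   hence "dist C p * dist B A <= C0\<^sup>2 * (D * E)" using a by (intro mm) (auto simp: D_def E_def dist_commute)
   thus ?thesis using DE2 by (simp add: mult.commute)
  next
   assume b: "dist C B <= C0 * dist B p & dist C p <= C0 * dist B p"
   have "dist B A * dist C p <= (dist B p + dist p A) * dist C p" by (intro mult_right_mono dist_triangle) auto
   also have "\<dots> = E * dist C p + dist p A * dist C p" by (simp add: E_def algebra_simps)
   also have "\<dots> <= E * (C0 * D) + C0\<^sup>2 * (D * E)" using a b DE by (intro add_mono mm mult_left_mono) (auto simp: D_def E_def dist_commute)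
   finally show ?thesis by (simp add: mult_ac)
  qed
 qed
 thus ?thesis by (simp add: D_def E_def dist_commute algebra_simps)
qed

definition bounded_turning :: "real => complex set => bool" where
 "bounded_turning C0 G \<longleftrightarrow> (\<forall>x\<in>G. \<forall>y\<in>G. \<exists>S. connected S & S <= G & x \<in> S & y \<in> S & (\<forall>u\<in>S. \<forall>v\<in>S. dist u v <= C0 * dist x y))"

text \<open>On the closed curve the pairs a, c and b, p separate each other. A connected part
  containing a and c must contain b or p, and one containing b and p must contain a or c.\<close>

lemma bounded_turning_between:
 fixes \<pi> :: "real => complex"
 assumes C0: "C0 >= 1" and cont: "continuous_on UNIV \<pi>" and inj: "inj \<pi>"
  and lim: "!!\<epsilon>. \<epsilon> > 0 ==> \<exists>R. \<forall>t. R <= \<bar>t\<bar> --> dist p (\<pi> t) <= \<epsilon>"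
  and rng: "range \<pi> = G - {p}" and p: "p \<in> G" and bt: "bounded_turning C0 G" and abc: "a < b" "b < c"
 shows "dist (\<pi> b) (\<pi> a) * dist (\<pi> c) p <= (C0\<^sup>2 + C0) * (dist (\<pi> c) (\<pi> a) * dist (\<pi> b) p)"
  and "dist (\<pi> b) (\<pi> c) * dist (\<pi> a) p <= (C0\<^sup>2 + C0) * (dist (\<pi> a) (\<pi> c) * dist (\<pi> b) p)"
proof -
 note cl = closed_image_through_infinity[OF cont lim]
 have np: "\<pi> t ~= p" "\<pi> t \<in> G" for t using rng by auto
 have G: "x = p \<or> (\<exists>t. x = \<pi> t)" if "x \<in> G" for x using rng that by (metis DiffI emptyE imageE insertE)
 have inj': "\<pi> s = \<pi> t \<longleftrightarrow> s = t" for s t using inj by (auto dest: injD)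
 obtain S where S: "connected S" "S <= G" "\<pi> a \<in> S" "\<pi> c \<in> S" "\<forall>u\<in>S. \<forall>v\<in>S. dist u v <= C0 * dist (\<pi> a) (\<pi> c)"
  using bt np unfolding bounded_turning_def by meson
 have sep1: "\<pi> b \<in> S \<or> p \<in> S"
 proof (rule ccontr)
  assume n: "\<not> ?thesis"
  define P Q where "P = insert p (\<pi> ` {..b})" and "Q = insert p (\<pi> ` {b..})"
  have "closed P" "closed Q" unfolding P_def Q_def by (auto intro!: cl)
  moreover have "S <= P \<union> Q"
  proof
   fix x assume "x \<in> S"
   then obtain t where t: "x = \<pi> t" using G S(2) n by blast
   show "x \<in> P \<union> Q" unfolding t P_def Q_def by (cases "t <= b") auto
  qed
  moreover have "P \<inter> Q \<inter> S = {}"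
  proof -
   have "P \<inter> Q <= {p, \<pi> b}" unfolding P_def Q_def using inj' by auto
   thus ?thesis using n by blast
  qed
  moreover have "\<pi> a \<in> P" "\<pi> c \<in> Q" using abc by (auto simp: P_def Q_def)
  ultimately show False using S(1,3,4) unfolding connected_closed by blast
 qed
 obtain T where T: "connected T" "T <= G" "\<pi> b \<in> T" "p \<in> T" "\<forall>u\<in>T. \<forall>v\<in>T. dist u v <= C0 * dist (\<pi> b) p"
  using bt np p unfolding bounded_turning_def by meson
 have sep2: "\<pi> a \<in> T \<or> \<pi> c \<in> T"
 proof (rule ccontr)
  assume n: "\<not> ?thesis"
  define P Q where "P = insert p (\<pi> ` ({..a} \<union> {c..}))" and "Q = \<pi> ` {a..c}"
  have "closed P" unfolding P_def by (auto intro!: cl closed_Un)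
  moreover have "closed Q" unfolding Q_def by (intro compact_imp_closed compact_continuous_image continuous_on_subset[OF cont]) auto
  moreover have "T <= P \<union> Q"
  proof
   fix x assume "x \<in> T"
   hence "x = p \<or> (\<exists>t. x = \<pi> t)" using G T(2) by blast
   thus "x \<in> P \<union> Q"
   proof
    assume "\<exists>t. x = \<pi> t"
    then obtain t where t: "x = \<pi> t" by blast
    show ?thesis unfolding t P_def Q_def by (cases "t \<in> {a..c}") auto
   qed (simp add: P_def)
  qed
  moreover have "P \<inter> Q \<inter> T = {}"
  proof -
   have "P \<inter> Q <= {\<pi> a, \<pi> c}"
   proof
    fix x assume x: "x \<in> P \<inter> Q"
    then obtain t where t: "t \<in> {a..c}" "x = \<pi> t" by (auto simp: Q_def)
    hence "\<pi> t \<in> \<pi> ` ({..a} \<union> {c..})" using x np by (auto simp: P_def)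
    hence "t \<in> {..a} \<union> {c..}" using inj' by auto
    hence "t = a \<or> t = c" using t by auto
    thus "x \<in> {\<pi> a, \<pi> c}" using t by auto
   qed
   thus ?thesis using n by blast
  qed
  moreover have "\<pi> b \<in> Q" "p \<in> P" using abc by (auto simp: P_def Q_def)
  ultimately show False using T(1,3,4) unfolding connected_closed by blast
 qed
 show "dist (\<pi> b) (\<pi> a) * dist (\<pi> c) p <= (C0\<^sup>2 + C0) * (dist (\<pi> c) (\<pi> a) * dist (\<pi> b) p)"
  by (rule bounded_turning_cross_ratio[OF C0]) (use sep1 sep2 S T in blast)+
 show "dist (\<pi> b) (\<pi> c) * dist (\<pi> a) p <= (C0\<^sup>2 + C0) * (dist (\<pi> a) (\<pi> c) * dist (\<pi> b) p)"
  by (rule bounded_turning_cross_ratio[OF C0]) (use sep1 sep2 S T in \<open>metis dist_commute\<close>)+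
qed

lemma bounded_turning_embedding:
 fixes \<xi> :: "complex => complex"
 assumes C0: "C0 >= 1" and bt: "bounded_turning C0 G" and p: "p \<in> G"
  and hol: "\<xi> holomorphic_on \<H>" and cont: "continuous_on closed_half \<xi>" and inj: "inj_on \<xi> closed_half"
  and nz: "!!x::real. \<xi> (of_real x) ~= 0"
  and proper: "!!B. \<exists>R. \<forall>z\<in>closed_half. R <= cmod z --> B <= cmod (\<xi> z)"
  and rng: "range (%x::real. p + 1 / \<xi> (of_real x)) = G - {p}"
 shows "half_plane_embedding \<xi> (C0\<^sup>2 + C0)"
proof
 show "\<xi> holomorphic_on \<H>" "continuous_on closed_half \<xi>" "inj_on \<xi> closed_half" by fact+
 show C1: "C0\<^sup>2 + C0 >= 1" using C0 by (smt (verit) zero_le_power2)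
 show "\<exists>R. \<forall>z\<in>closed_half. R <= cmod z --> B <= cmod (\<xi> z)" for B by (rule proper)
 define \<pi> where "\<pi> = (%x::real. p + 1 / \<xi> (of_real x))"
 have c\<pi>: "continuous_on UNIV \<pi>" unfolding \<pi>_def by (intro continuous_intros continuous_on_compose2[OF cont]) (use nz in auto)
 have i\<pi>: "inj \<pi>"
 proof (rule injI)
  fix x y assume "\<pi> x = \<pi> y"
  hence "\<xi> (of_real x) = \<xi> (of_real y)" using nz by (simp add: \<pi>_def field_simps)
  thus "x = y" using inj by (metis inj_onD of_real_closed_half of_real_eq_iff)
 qed
 have l\<pi>: "\<exists>R. \<forall>t. R <= \<bar>t\<bar> --> dist p (\<pi> t) <= \<epsilon>" if "\<epsilon> > 0" for \<epsilon>
 proof -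
  obtain R where R: "\<forall>z\<in>closed_half. R <= cmod z --> 1 / \<epsilon> <= cmod (\<xi> z)" using proper by blast
  have "dist p (\<pi> t) <= \<epsilon>" if t: "R <= \<bar>t\<bar>" for t
  proof -
   have "1 / \<epsilon> <= cmod (\<xi> (of_real t))" using R t by simp
   hence "1 / cmod (\<xi> (of_real t)) <= \<epsilon>" using \<open>\<epsilon> > 0\<close> nz[of t] by (simp add: field_simps)
   thus ?thesis by (simp add: \<pi>_def dist_norm norm_divide)
  qed
  thus ?thesis by blast
 qed
 have dd: "dist (\<pi> s) (\<pi> t) = cmod (\<xi> (of_real t) - \<xi> (of_real s)) / (cmod (\<xi> (of_real s)) * cmod (\<xi> (of_real t)))" for s t
 proof -
  have "\<pi> s - \<pi> t = (\<xi> (of_real t) - \<xi> (of_real s)) / (\<xi> (of_real s) * \<xi> (of_real t))"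
   unfolding \<pi>_def using nz[of s] nz[of t] by (simp add: field_simps)
  thus ?thesis by (simp add: dist_norm norm_divide norm_mult)
 qed
 have dp: "dist (\<pi> s) p = 1 / cmod (\<xi> (of_real s))" for s by (simp add: \<pi>_def dist_norm norm_divide)
 have key: "cmod (\<xi> (of_real b) - \<xi> (of_real a)) <= (C0\<^sup>2 + C0) * cmod (\<xi> (of_real c) - \<xi> (of_real a))"
  if "dist (\<pi> b) (\<pi> a) * dist (\<pi> c) p <= (C0\<^sup>2 + C0) * (dist (\<pi> c) (\<pi> a) * dist (\<pi> b) p)" for a b c
 proof -
  define na nb nc where "na = cmod (\<xi> (of_real a))" "nb = cmod (\<xi> (of_real b))" "nc = cmod (\<xi> (of_real c))"
  have pos: "na > 0" "nb > 0" "nc > 0" using nz by (auto simp: na_nb_nc_def)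
  have "cmod (\<xi> (of_real a) - \<xi> (of_real b)) / (nb * na) * (1 / nc) <= (C0\<^sup>2 + C0) * (cmod (\<xi> (of_real a) - \<xi> (of_real c)) / (nc * na) * (1 / nb))"
   using that unfolding dd dp na_nb_nc_def .
  hence "cmod (\<xi> (of_real a) - \<xi> (of_real b)) / (na * nb * nc) <= (C0\<^sup>2 + C0) * cmod (\<xi> (of_real a) - \<xi> (of_real c)) / (na * nb * nc)"
   by (simp add: mult_ac)
  thus ?thesis using pos by (simp add: divide_le_cancel norm_minus_commute)
 qed
 fix a b c :: real
 assume "(a <= b & b <= c) \<or> (c <= b & b <= a)"
 then consider "a = b" | "b = c" | "a < b" "b < c" | "c < b" "b < a" by linarith
 thus "cmod (\<xi> (of_real b) - \<xi> (of_real a)) <= (C0\<^sup>2 + C0) * cmod (\<xi> (of_real c) - \<xi> (of_real a))"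
 proof cases
  case 1 thus ?thesis using C1 by simp
 next
  case 2 thus ?thesis using C1 mult_right_mono[OF C1, of "cmod (\<xi> (of_real c) - \<xi> (of_real a))"] by simp
 next
  case 3 thus ?thesis by (intro key bounded_turning_between(1)[OF C0 c\<pi> i\<pi> l\<pi> rng[folded \<pi>_def] p bt]) auto
 next
  case 4 thus ?thesis by (intro key bounded_turning_between(2)[OF C0 c\<pi> i\<pi> l\<pi> rng[folded \<pi>_def] p bt]) auto
 qed
qed

section \<open>Charts of the inner and the outer domain\<close>

context jordan_loop
begin

text \<open>The function \<xi> = 1 / (\<psi> - p) is the Caratheodory map in a coordinate in which p
  is infinity.\<close>

lemma half_plane_chart:
 assumes "p \<in> G"
 obtains \<xi> where "\<xi> holomorphic_on \<H>" "continuous_on closed_half \<xi>" "inj_on \<xi> closed_half"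
  "!!z. z \<in> closed_half ==> \<xi> z ~= 0" "!!B. \<exists>R. \<forall>z\<in>closed_half. R <= cmod z --> B <= cmod (\<xi> z)"
  "!!z. z \<in> \<H> ==> p + 1 / \<xi> z \<in> I" "range (%x::real. p + 1 / \<xi> (of_real x)) = G - {p}"
proof -
 obtain \<psi> where \<psi>: "\<psi> holomorphic_on \<H>" "continuous_on closed_half \<psi>" "inj_on \<psi> closed_half"
  "\<psi> ` \<H> = I" "range (%x::real. \<psi> (of_real x)) = G - {p}"
  and lim: "!!\<epsilon>. \<epsilon> > 0 ==> \<exists>R. \<forall>z\<in>closed_half. R <= cmod z --> dist p (\<psi> z) <= \<epsilon>"
  using caratheodory_half_plane[OF assms] by blast
 have ne: "\<psi> z - p ~= 0" if "z \<in> closed_half" for z using closed_half_cases[OF that]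
 proof
  assume "z \<in> \<H>" thus ?thesis using \<psi>(4) I_props(6) assms by auto
 next
  assume "z = of_real (Re z)" thus ?thesis using \<psi>(5) by (metis DiffE insertI1 rangeI right_minus_eq)
 qed
 define \<xi> where "\<xi> = (%z. 1 / (\<psi> z - p))"
 have e: "p + 1 / \<xi> z = \<psi> z" for z by (simp add: \<xi>_def)
 show thesis
 proof (rule that[of \<xi>])
  show "\<xi> holomorphic_on \<H>" unfolding \<xi>_def using ne upper_subset_closed by (intro holomorphic_intros \<psi>(1)) auto
  show "continuous_on closed_half \<xi>" unfolding \<xi>_def using ne by (intro continuous_intros \<psi>(2)) auto
  show "inj_on \<xi> closed_half" by (rule inj_onI) (metis e \<psi>(3) inj_onD)
  show "\<xi> z ~= 0" if "z \<in> closed_half" for z using ne[OF that] by (simp add: \<xi>_def)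
  show "p + 1 / \<xi> z \<in> I" if "z \<in> \<H>" for z using that \<psi>(4) e by auto
  show "range (%x::real. p + 1 / \<xi> (of_real x)) = G - {p}" unfolding e by (rule \<psi>(5))
  show "\<exists>R. \<forall>z\<in>closed_half. R <= cmod z --> B <= cmod (\<xi> z)" for B
  proof -
   obtain R where R: "\<forall>z\<in>closed_half. R <= cmod z --> dist p (\<psi> z) <= 1 / (\<bar>B\<bar> + 1)"
    using lim[of "1 / (\<bar>B\<bar> + 1)"] by (metis abs_ge_zero add_nonneg_pos zero_less_divide_1_iff zero_less_one)
   have "B <= cmod (\<xi> z)" if z: "z \<in> closed_half" "R <= cmod z" for z
   proof -
    have d: "0 < cmod (\<psi> z - p)" "cmod (\<psi> z - p) <= 1 / (\<bar>B\<bar> + 1)" using ne[OF z(1)] R z by (auto simp: dist_norm norm_minus_commute)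
    hence "\<bar>B\<bar> + 1 <= 1 / cmod (\<psi> z - p)" by (simp add: field_simps)
    thus ?thesis by (simp add: \<xi>_def norm_divide)
   qed
   thus ?thesis by blast
  qed
 qed
qed

lemma inversion_loop:
 assumes "q \<in> I"
 shows "jordan_loop (%t. 1 / (c t - q))" "path_image (%t. 1 / (c t - q)) = (%w. 1 / (w - q)) ` G"
proof -
 have q: "q \<notin> G" using assms I_props(6) by auto
 show im: "path_image (%t. 1 / (c t - q)) = (%w. 1 / (w - q)) ` G" by (auto simp: path_image_def G_def)
 have ne: "c t - q ~= 0" if "t \<in> {0..1}" for t using q that by (auto simp: G_def path_image_def)
 show "jordan_loop (%t. 1 / (c t - q))"
 proof
  show "pathfinish (%t. 1 / (c t - q)) = pathstart (%t. 1 / (c t - q))" using loop by (simp add: pathfinish_def pathstart_def)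
  have "continuous_on {0..1} (%t. 1 / (c t - q))" using ne sp by (intro continuous_intros) (auto simp: simple_path_def path_def)
  thus "simple_path (%t. 1 / (c t - q))" using sp unfolding simple_path_def loop_free_def path_def by auto
 qed
qed

text \<open>An inversion at an inner point q makes the outer domain the inside of another Jordan
  curve, so the inner theory applies to it. Both charts are then expressed in the same coordinate 1
  / (w - p).\<close>

lemma complementary_charts:
 assumes C0: "C0 >= 1" and bt: "bounded_turning C0 G" and p: "p \<in> G"
 obtains \<psi>1 \<psi>2 where "half_plane_embedding \<psi>1 (C0\<^sup>2 + C0)" "half_plane_embedding \<psi>2 (C0\<^sup>2 + C0)"
  "range (%x::real. \<psi>1 (of_real x)) = range (%x::real. \<psi>2 (of_real x))"
  "\<psi>1 ` \<H> \<inter> \<psi>2 ` \<H> = {}"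
  "range (%x::real. p + 1 / \<psi>1 (of_real x)) = G - {p}" "!!x::real. \<psi>1 (of_real x) ~= 0"
proof -
 obtain q where q: "q \<in> I" using I_props(1) by blast
 have qG: "q \<notin> G" using q I_props(6) by auto
 interpret c': jordan_loop "%t. 1 / (c t - q)" using inversion_loop(1)[OF q] .
 define p' where "p' = 1 / (p - q)"
 have pq: "p ~= q" using p qG by auto
 have G': "c'.G = (%w. 1 / (w - q)) ` G" unfolding c'.G_def by (rule inversion_loop(2)[OF q])
 have p': "p' \<in> c'.G" using p by (auto simp: G' p'_def)
 obtain \<psi>1 where a: "\<psi>1 holomorphic_on \<H>" "continuous_on closed_half \<psi>1" "inj_on \<psi>1 closed_half"
  "!!z. z \<in> closed_half ==> \<psi>1 z ~= 0" "!!B. \<exists>R. \<forall>z\<in>closed_half. R <= cmod z --> B <= cmod (\<psi>1 z)"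
  "!!z. z \<in> \<H> ==> p + 1 / \<psi>1 z \<in> I" "range (%x::real. p + 1 / \<psi>1 (of_real x)) = G - {p}" using half_plane_chart[OF p] by blast
 obtain \<xi> where b: "\<xi> holomorphic_on \<H>" "continuous_on closed_half \<xi>" "inj_on \<xi> closed_half"
  "!!z. z \<in> closed_half ==> \<xi> z ~= 0" "!!B. \<exists>R. \<forall>z\<in>closed_half. R <= cmod z --> B <= cmod (\<xi> z)"
  "!!z. z \<in> \<H> ==> p' + 1 / \<xi> z \<in> c'.I" "range (%x::real. p' + 1 / \<xi> (of_real x)) = c'.G - {p'}" using c'.half_plane_chart[OF p'] by blast
 have p'0: "p' ~= 0" using pq by (simp add: p'_def)
 \<comment> \<open>With u = 1 / (w - q) = p' + 1 / \<xi>, solving for 1 / (w - p) gives -p' - p'^2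
   \<xi>.\<close>
 define \<psi>2 where "\<psi>2 = (%z. - p' - p'\<^sup>2 * \<xi> z)"
 have e2: "\<psi>2 z ~= 0 & p + 1 / \<psi>2 z = q + 1 / u" if "z \<in> closed_half" "u = p' + 1 / \<xi> z" "u ~= 0" for z u
 proof -
  have x: "\<xi> z ~= 0" "\<xi> z * u = p' * \<xi> z + 1" using b(4)[OF that(1)] that(2) by (auto simp: field_simps)
  have "\<psi>2 z = - p' * (\<xi> z * u)" unfolding x(2) by (simp add: \<psi>2_def power2_eq_square algebra_simps)
  hence n: "\<psi>2 z ~= 0" "1 / \<psi>2 z = - (1 / (p' * \<xi> z * u))" using x(1) that(3) p'0 by auto
  have "1 / u - 1 / p' = - (1 / (p' * \<xi> z * u))" using x(1) that(3) p'0 unfolding that(2) by (simp add: divide_simps)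
  moreover have "1 / p' = p - q" by (simp add: p'_def)
  ultimately have "1 / \<psi>2 z = 1 / u - (p - q)" using n(2) by simp
  thus ?thesis using n(1) by simp
 qed
 have u0: "p' + 1 / \<xi> (of_real x) \<in> c'.G - {p'}" for x :: real using b(7) by blast
 have G0: "0 \<notin> c'.G" using qG unfolding G' by auto
 have r0: "p' + 1 / \<xi> (of_real x) ~= 0" for x :: real using u0[of x] G0 by (metis DiffE)
 have nz2: "\<psi>2 (of_real x) ~= 0" and ex2: "p + 1 / \<psi>2 (of_real x) = q + 1 / (p' + 1 / \<xi> (of_real x))" for x :: real
  using e2[OF of_real_closed_half refl r0] by auto
 have "range (%x::real. p + 1 / \<psi>2 (of_real x)) = (%u. q + 1 / u) ` range (%x::real. p' + 1 / \<xi> (of_real x))" unfolding ex2 by (simp add: image_image)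
 also have "\<dots> = (%u. q + 1 / u) ` (%w. 1 / (w - q)) ` (G - {p})"
 proof -
  have "c'.G - {p'} = (%w. 1 / (w - q)) ` (G - {p})" unfolding G' p'_def using qG p by auto
  thus ?thesis unfolding b(7) by simp
 qed
 also have "\<dots> = G - {p}" by (simp add: image_image)
 finally have rng2: "range (%x::real. p + 1 / \<psi>2 (of_real x)) = G - {p}" .
 have he2: "half_plane_embedding \<psi>2 (C0\<^sup>2 + C0)"
 proof (rule bounded_turning_embedding[OF C0 bt p _ _ _ nz2 _ rng2])
  show "\<psi>2 holomorphic_on \<H>" unfolding \<psi>2_def by (intro holomorphic_intros b(1))
  show "continuous_on closed_half \<psi>2" unfolding \<psi>2_def by (intro continuous_intros b(2))
  show "inj_on \<psi>2 closed_half" unfolding \<psi>2_def using b(3) p'0 by (auto simp: inj_on_def)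
  fix B
  obtain R where R: "\<forall>z\<in>closed_half. R <= cmod z --> (B + cmod p') / (cmod p')\<^sup>2 <= cmod (\<xi> z)" using b(5) by blast
  have "B <= cmod (\<psi>2 z)" if "z \<in> closed_half" "R <= cmod z" for z
  proof -
   have "(B + cmod p') / (cmod p')\<^sup>2 <= cmod (\<xi> z)" using R that by blast
   hence "B + cmod p' <= cmod (p'\<^sup>2 * \<xi> z)" using p'0 by (simp add: norm_mult norm_power field_simps)
   also have "p'\<^sup>2 * \<xi> z = - \<psi>2 z - p'" by (simp add: \<psi>2_def)
   also have "cmod (- \<psi>2 z - p') <= cmod (\<psi>2 z) + cmod p'" using norm_triangle_ineq4[of "- \<psi>2 z" p'] by simp
   finally show ?thesis by simp
  qed
  thus "\<exists>R. \<forall>z\<in>closed_half. R <= cmod z --> B <= cmod (\<psi>2 z)" by blast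
 qed
 have he1: "half_plane_embedding \<psi>1 (C0\<^sup>2 + C0)" by (rule bounded_turning_embedding[OF C0 bt p a(1,2,3) _ a(5,7)]) (simp add: a(4))
 have "range (%x::real. \<psi>1 (of_real x)) = (%w. 1 / (w - p)) ` range (%x::real. p + 1 / \<psi>1 (of_real x))" by (simp add: image_image)
 also have "\<dots> = (%w. 1 / (w - p)) ` range (%x::real. p + 1 / \<psi>2 (of_real x))" by (simp only: a(7) rng2)
 also have "\<dots> = range (%x::real. \<psi>2 (of_real x))" by (simp add: image_image)
 finally have same: "range (%x::real. \<psi>1 (of_real x)) = range (%x::real. \<psi>2 (of_real x))" .
 \<comment> \<open>The inverted inner domain is connected, unbounded and disjoint from the inverted
   curve, hence lies outside it. This makes the images of the two charts disjoint.\<close>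
 define T where "T = (%w. 1 / (w - q)) ` (I - {q})"
 have "connected T" unfolding T_def by (intro connected_continuous_image continuous_intros connected_open_delete I_props) auto
 moreover have "T \<inter> c'.G = {}" unfolding T_def G' using I_props(6) by auto
 moreover have unb: "\<not> bounded T"
 proof
  assume "bounded T"
  then obtain B where B: "!!t. t \<in> T ==> cmod t <= B" by (auto simp: bounded_iff)
  obtain e where e: "e > 0" "ball q e <= I" using I_props(2) q by (meson open_contains_ball)
  define d where "d = min (e / 2) (1 / (\<bar>B\<bar> + 1))"
  have d: "d > 0" "d < e" "d <= 1 / (\<bar>B\<bar> + 1)" using e by (auto simp: d_def)
  have "q + of_real d \<in> I - {q}" using d e by (auto simp: dist_norm)
  hence "1 / ((q + of_real d) - q) \<in> T" unfolding T_def by blast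
  hence "1 / of_real d \<in> T" by simp
  hence "1 / d <= B" using B[of "1 / of_real d"] d(1) by (simp add: norm_divide)
  moreover have "\<bar>B\<bar> + 1 <= 1 / d" using d(1,3) by (simp add: field_simps)
  ultimately show False by linarith
 qed
 ultimately have T: "connected T" "T <= - c'.G" "\<not> bounded T" by auto
 have TI: "u \<notin> c'.I" if "u \<in> T" for u
 proof
  assume "u \<in> c'.I"
  hence "bounded (connected_component_set (- c'.G) u)" by (simp add: c'.I_def inside_def)
  thus False using bounded_subset connected_component_maximal[OF that T(1,2)] T(3) by metis
 qed
 have "\<psi>1 ` \<H> \<inter> \<psi>2 ` \<H> = {}"
 proof (rule ccontr)
  assume "\<psi>1 ` \<H> \<inter> \<psi>2 ` \<H> ~= {}"
  then obtain z w where zw: "z \<in> \<H>" "w \<in> \<H>" "\<psi>1 z = \<psi>2 w" by auto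
  have zc: "z \<in> closed_half" "w \<in> closed_half" using zw upper_subset_closed by auto
  define u where "u = p' + 1 / \<xi> w"
  have uI: "u \<in> c'.I" using b(6)[OF zw(2)] by (simp add: u_def)
  have "u ~= 0"
  proof
   assume "u = 0"
   hence "1 / \<xi> w = - p'" by (simp add: u_def add_eq_0_iff)
   hence "p' * \<xi> w = - 1" using b(4)[OF zc(2)] by (metis minus_mult_left minus_minus nonzero_divide_eq_eq)
   hence "\<psi>2 w = 0" by (simp add: \<psi>2_def power2_eq_square mult.assoc)
   thus False using zw(3) a(4)[OF zc(1)] by simp
  qed
  hence "p + 1 / \<psi>1 z = q + 1 / u" using e2[OF zc(2) u_def] zw(3) by simp
  hence "q + 1 / u \<in> I - {q}" using a(6)[OF zw(1)] \<open>u ~= 0\<close> by auto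
  hence "1 / ((q + 1 / u) - q) \<in> T" unfolding T_def by blast
  thus False using uI TI by auto
 qed
 thus thesis using that he1 he2 same a(7) a(4) by auto
qed

end

section \<open>The chordal metric in homogeneous coordinates\<close>

text \<open>Inverse stereographic projection of u / v, with Npole for v = 0.\<close>
definition hom_sphere :: "complex => complex => real^3" where
 "hom_sphere u v = vector [2 * Re (u * cnj v) / ((cmod u)\<^sup>2 + (cmod v)\<^sup>2), 2 * Im (u * cnj v) / ((cmod u)\<^sup>2 + (cmod v)\<^sup>2),
   ((cmod u)\<^sup>2 - (cmod v)\<^sup>2) / ((cmod u)\<^sup>2 + (cmod v)\<^sup>2)]"

lemma inner_3: "(x::real^3) \<bullet> y = x$1*y$1 + x$2*y$2 + x$3*y$3" by (simp add: inner_vec_def sum_3)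

lemma hom_pos: "u ~= 0 \<or> v ~= 0 ==> (cmod u)\<^sup>2 + (cmod v)\<^sup>2 > 0" by (auto simp: add_pos_nonneg add_nonneg_pos)

text \<open>Lagrange's identity. In homogeneous coordinates chordal distances are governed by the
  determinant u v' - u' v, so the point at infinity needs no separate computation.\<close>

lemma hom_inner:
 assumes "u ~= 0 \<or> v ~= 0" "u' ~= 0 \<or> v' ~= 0"
 shows "hom_sphere u v \<bullet> hom_sphere u' v' = 1 - 2 * (cmod (u * v' - u' * v))\<^sup>2 / (((cmod u)\<^sup>2 + (cmod v)\<^sup>2) * ((cmod u')\<^sup>2 + (cmod v')\<^sup>2))"
proof -
 define A B where "A = (cmod u)\<^sup>2 + (cmod v)\<^sup>2" and "B = (cmod u')\<^sup>2 + (cmod v')\<^sup>2"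
 have AB: "A > 0" "B > 0" using assms hom_pos by (auto simp: A_def B_def)
 have "hom_sphere u v \<bullet> hom_sphere u' v' = (2 * Re (u * cnj v) * (2 * Re (u' * cnj v')) + 2 * Im (u * cnj v) * (2 * Im (u' * cnj v'))
   + ((cmod u)\<^sup>2 - (cmod v)\<^sup>2) * ((cmod u')\<^sup>2 - (cmod v')\<^sup>2)) / (A * B)"
  unfolding hom_sphere_def inner_3 A_def[symmetric] B_def[symmetric] by (simp only: vector_3 times_divide_times_eq add_divide_distrib)
 also have "2 * Re (u * cnj v) * (2 * Re (u' * cnj v')) + 2 * Im (u * cnj v) * (2 * Im (u' * cnj v'))
   + ((cmod u)\<^sup>2 - (cmod v)\<^sup>2) * ((cmod u')\<^sup>2 - (cmod v')\<^sup>2) = A * B - 2 * (cmod (u * v' - u' * v))\<^sup>2"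
  unfolding A_def B_def cmod_power2 by (simp, algebra)
 finally show ?thesis using AB unfolding A_def[symmetric] B_def[symmetric] by (simp add: diff_divide_distrib)
qed

lemma hom_norm: "u ~= 0 \<or> v ~= 0 ==> norm (hom_sphere u v) = 1" using hom_inner[of u v u v] by (simp add: norm_eq_sqrt_inner)

lemma hom_dist:
 assumes "u ~= 0 \<or> v ~= 0" "u' ~= 0 \<or> v' ~= 0"
 shows "dist (hom_sphere u v) (hom_sphere u' v') = 2 * cmod (u * v' - u' * v) / (sqrt ((cmod u)\<^sup>2 + (cmod v)\<^sup>2) * sqrt ((cmod u')\<^sup>2 + (cmod v')\<^sup>2))"
proof -
 let ?x = "hom_sphere u v" and ?y = "hom_sphere u' v'"
 have "(dist ?x ?y)\<^sup>2 = (norm ?x)\<^sup>2 + (norm ?y)\<^sup>2 - 2 * (?x \<bullet> ?y)"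
  unfolding dist_norm by (simp add: power2_norm_eq_inner inner_diff_left inner_diff_right inner_commute)
 also have "\<dots> = (2 * cmod (u * v' - u' * v) / (sqrt ((cmod u)\<^sup>2 + (cmod v)\<^sup>2) * sqrt ((cmod u')\<^sup>2 + (cmod v')\<^sup>2)))\<^sup>2"
  unfolding hom_norm[OF assms(1)] hom_norm[OF assms(2)] hom_inner[OF assms] by (simp add: power_divide power_mult_distrib)
 finally show ?thesis by (rule power2_eq_imp_eq) auto
qed

lemma stereo_hom: "stereo z = hom_sphere z 1" by (simp add: stereo_def hom_sphere_def add.commute)

lemma Npole_hom: "Npole = hom_sphere 1 0" by (simp add: Npole_def hom_sphere_def)

lemma hom_scale:
 assumes "v ~= 0"
 shows "hom_sphere u v = stereo (u / v)"
proof -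
 have "dist (hom_sphere u v) (hom_sphere (u / v) 1) = 0" using assms by (subst hom_dist) auto
 thus ?thesis by (simp add: stereo_hom)
qed

lemma hom_zero: "u ~= 0 ==> hom_sphere u 0 = Npole"
proof -
 assume "u ~= 0"
 hence "dist (hom_sphere u 0) (hom_sphere 1 0) = 0" by (subst hom_dist) auto
 thus ?thesis by (simp add: Npole_hom)
qed

abbreviation sroot :: "complex => real" where "sroot z \<equiv> sqrt ((cmod z)\<^sup>2 + 1)"

lemma sroot_ge: "1 <= sroot z" "cmod z <= sroot z" "sroot z > 0"
proof -
 show 1: "1 <= sroot z" by simp
 show "cmod z <= sroot z" by (rule real_le_rsqrt) simp
 show "sroot z > 0" using 1 by linarith
qed

lemma dist_stereo: "dist (stereo a) (stereo b) = 2 * cmod (a - b) / (sroot a * sroot b)" unfolding stereo_hom by (subst hom_dist) auto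

lemma dist_stereo_Npole: "dist (stereo a) Npole = 2 / sroot a" unfolding stereo_hom Npole_hom by (subst hom_dist) auto

lemma stereo_S2: "stereo z \<in> S2" and Npole_S2: "Npole \<in> S2" using hom_norm[of z 1] hom_norm[of 1 0] by (auto simp: S2_def stereo_hom Npole_hom)

lemma stereo_ne_Npole [simp]: "stereo z ~= Npole" using dist_stereo_Npole[of z] sroot_ge(3)[of z] by (metis dist_self divide_pos_pos less_irrefl zero_less_numeral)

lemma unstereo_stereo [simp]: "unstereo (stereo z) = z"
proof -
 have p: "1 + (cmod z)\<^sup>2 > 0" by (simp add: add_pos_nonneg)
 have "1 - ((cmod z)\<^sup>2 - 1) / ((cmod z)\<^sup>2 + 1) = 2 / (1 + (cmod z)\<^sup>2)" using p by (simp add: field_simps)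
 thus ?thesis using p by (simp add: unstereo_def stereo_def complex_eq_iff)
qed

lemma S2_coords: "x \<in> S2 ==> (x$1)\<^sup>2 + (x$2)\<^sup>2 + (x$3)\<^sup>2 = 1" by (simp add: S2_def norm_eq_1 inner_3 power2_eq_square)

lemma S2_Npole: "x \<in> S2 ==> x$3 = 1 ==> x = Npole" using S2_coords[of x] by (simp add: Npole_def vec_eq_iff forall_3)

lemma stereo_unstereo:
 assumes "x \<in> S2" "x ~= Npole"
 shows "stereo (unstereo x) = x"
proof -
 have n: "x$3 ~= 1" using assms S2_Npole by blast
 define d where "d = 1 - x$3"
 have d: "d ~= 0" "x$3 = 1 - d" using n by (auto simp: d_def)
 have c: "(x$1)\<^sup>2 + (x$2)\<^sup>2 = 2 * d - d\<^sup>2" using S2_coords[OF assms(1)] d(2) by (simp add: power2_eq_square algebra_simps)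
 have "(cmod (unstereo x))\<^sup>2 = ((x$1)\<^sup>2 + (x$2)\<^sup>2) / d\<^sup>2" by (simp add: unstereo_def cmod_power2 d_def power_divide add_divide_distrib)
 also have "\<dots> = (2 - d) / d" unfolding c using d by (simp add: power2_eq_square field_simps)
 finally have m: "(cmod (unstereo x))\<^sup>2 = (2 - d) / d" .
 have e: "1 + (cmod (unstereo x))\<^sup>2 = 2 / d" "(cmod (unstereo x))\<^sup>2 - 1 = (2 - 2 * d) / d" using d by (auto simp: m field_simps)
 show ?thesis unfolding stereo_def e using e(1) d by (simp add: vec_eq_iff forall_3 unstereo_def d_def[symmetric] add.commute[of _ 1])
qed

lemma S2_cases: "x \<in> S2 ==> x = Npole \<or> (\<exists>z. x = stereo z)" using stereo_unstereo by metis

lemma continuous_unstereo: "continuous_on (S2 - {Npole}) unstereo" unfolding unstereo_def Complex_eq using S2_Npole by (intro continuous_intros) auto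

lemma dist_stereo_le: "dist (stereo a) (stereo b) <= 2 * dist a b"
proof -
 have "1 <= sroot a * sroot b" using mult_mono[of 1 "sroot a" 1 "sroot b"] by simp
 hence "2 * cmod (a - b) / (sroot a * sroot b) <= 2 * cmod (a - b) / 1" by (intro divide_left_mono) auto
 thus ?thesis unfolding dist_stereo by (simp add: dist_norm)
qed

lemma continuous_stereo: "continuous_on A stereo" unfolding continuous_on_iff
proof (intro ballI allI impI)
 fix x e assume "(e::real) > 0"
 hence "\<forall>x'\<in>A. dist x' x < e / 2 --> dist (stereo x') (stereo x) < e" using dist_stereo_le by (smt (verit) field_sum_of_halves)
 thus "\<exists>d>0. \<forall>x'\<in>A. dist x' x < d --> dist (stereo x') (stereo x) < e" using \<open>e > 0\<close> half_gt_zero by blast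
qed

lemma sdist_bounds:
 assumes "x \<in> S2" "y \<in> S2"
 shows "dist x y <= sdist x y" "sdist x y <= 2 * dist x y"
proof -
 define t where "t = dist x y / 2"
 have "dist x y <= norm x + norm y" unfolding dist_norm by (rule norm_triangle_ineq4)
 hence t: "0 <= t" "t <= 1" using assms by (auto simp: t_def S2_def)
 have a: "0 <= arcsin t" "arcsin t <= pi / 2" "sin (arcsin t) = t" using t arcsin_bounded[of t] arcsin_nonneg[of t] by auto
 have "t <= arcsin t" using a sin_x_le_x[of "arcsin t"] by simp
 thus "dist x y <= sdist x y" by (simp add: sdist_def t_def)
 have "arcsin t <= 2 * t"
 proof (rule ccontr)
  assume n: "\<not> arcsin t <= 2 * t"
  \<comment> \<open>With s half the angle, sin(2 s) >= 2 s cos(s)^2 >= s for s <= pi / 4. The sharp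
    factor would be pi / 2.\<close>
  define s where "s = arcsin t / 2"
  have s: "0 <= s" "s <= pi / 4" using a by (auto simp: s_def)
  have "t = 2 * sin s * cos s" using a(3) sin_double[of s] by (simp add: s_def)
  moreover have c: "cos s >= 1/2"
  proof -
   have "cos s >= cos (pi / 3)" using s pi_gt_zero by (intro cos_monotone_0_pi_le) auto
   thus ?thesis by (simp add: cos_60)
  qed
  have "sin s >= s * cos s"
  proof -
   have "(%x. sin x - x * cos x) 0 <= (%x. sin x - x * cos x) s"
   proof (rule DERIV_nonneg_imp_nondecreasing[OF s(1)], intro exI conjI)
    fix x assume x: "0 <= x" "x <= s"
    show "((%x. sin x - x * cos x) has_real_derivative (x * sin x)) (at x)" by (auto intro!: derivative_eq_intros)
    show "0 <= x * sin x" using x s pi_gt_zero by (intro mult_nonneg_nonneg sin_ge_zero) auto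
   qed
   thus ?thesis by simp
  qed
  hence "2 * sin s * cos s >= 2 * (s * cos s) * cos s" using c by (intro mult_right_mono mult_left_mono) auto
  moreover have "2 * (s * cos s) * cos s >= s"
  proof -
   have "cos s >= cos (pi / 4)" using s pi_gt_zero by (intro cos_monotone_0_pi_le) auto
   hence "(cos s)\<^sup>2 >= (cos (pi / 4))\<^sup>2" by (intro power_mono) (auto simp: cos_45)
   hence "(cos s)\<^sup>2 >= 1/2" by (simp add: cos_45 power_divide)
   hence "s * (2 * (cos s)\<^sup>2) >= s * 1" using s by (intro mult_left_mono) auto
   thus ?thesis by (simp add: power2_eq_square mult_ac)
  qed
  ultimately have "s <= t" by linarith
  thus False using n by (simp add: s_def)
 qed
 thus "sdist x y <= 2 * dist x y" by (simp add: sdist_def t_def)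
qed

lemma sdist_eq_dist:
 assumes "x \<in> S2" "y \<in> S2" "z \<in> S2" "sdist y x = sdist z x"
 shows "dist y x = dist z x"
proof -
 have "dist y x <= 2" "dist z x <= 2" using assms norm_triangle_ineq4[of y x] norm_triangle_ineq4[of z x] by (auto simp: S2_def dist_norm)
 hence b: "-1 <= dist y x / 2" "dist y x / 2 <= 1" "-1 <= dist z x / 2" "dist z x / 2 <= 1" using zero_le_dist[of y x] zero_le_dist[of z x] by linarith+
 have "arcsin (dist y x / 2) = arcsin (dist z x / 2)" using assms(4) by (simp add: sdist_def)
 hence "sin (arcsin (dist y x / 2)) = sin (arcsin (dist z x / 2))" by simp
 thus ?thesis using b by simp
qed

text \<open>Equal spherical radii are equal chordal radii, so chordal estimates suffice; the factor
  2 is the loss when image distances are converted.\<close>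

lemma dilat_leI:
 assumes "x \<in> S2" "!!y. y \<in> S2 ==> \<phi> y \<in> S2" and "H >= 0" and "\<delta> > 0"
  and "!!y z. [|y \<in> S2; z \<in> S2; y ~= x; z ~= x; dist y x = dist z x; dist y x < \<delta>|] ==> dist (\<phi> y) (\<phi> x) <= H * dist (\<phi> z) (\<phi> x)"
 shows "dilat_le (2 * H) \<phi> x"
 unfolding dilat_le_def
proof (intro allI impI exI[of _ \<delta>] conjI)
 fix \<epsilon> r y z assume e: "(\<epsilon>::real) > 0" and a: "0 < r & r < \<delta> & y \<in> S2 & z \<in> S2 & sdist y x = r & sdist z x = r"
 have ne: "y ~= x" "z ~= x" using a by (auto simp: sdist_def)
 have d: "dist y x = dist z x" using a assms(1) by (intro sdist_eq_dist) auto
 have "dist y x < \<delta>" using a sdist_bounds(1)[of y x] assms(1) by linarith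
 hence "dist (\<phi> y) (\<phi> x) <= H * dist (\<phi> z) (\<phi> x)" using a ne d by (intro assms(5)) auto
 hence "sdist (\<phi> y) (\<phi> x) <= 2 * (H * dist (\<phi> z) (\<phi> x))" using sdist_bounds(2)[of "\<phi> y" "\<phi> x"] assms(1,2) a by fastforce
 also have "\<dots> <= 2 * (H * sdist (\<phi> z) (\<phi> x))" using sdist_bounds(1)[of "\<phi> z" "\<phi> x"] assms(1-3) a by (intro mult_left_mono) auto
 also have "\<dots> <= (2 * H + \<epsilon>) * sdist (\<phi> z) (\<phi> x)"
 proof -
  have "0 <= sdist (\<phi> z) (\<phi> x)" using sdist_bounds(1)[of "\<phi> z" "\<phi> x"] assms(1,2) a zero_le_dist order_trans by blast
  thus ?thesis using e by (simp add: algebra_simps)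
 qed
 finally show "sdist (\<phi> y) (\<phi> x) <= (2 * H + \<epsilon>) * sdist (\<phi> z) (\<phi> x)" .
qed (use assms in auto)

text \<open>The norm of the homogeneous coordinates (p \<xi> + 1, \<xi>) of p + 1 / \<xi>; it is the
  denominator in chordal distances between such points.\<close>

definition npair :: "complex => complex => real" where "npair p \<xi> = sqrt ((cmod (p * \<xi> + 1))\<^sup>2 + (cmod \<xi>)\<^sup>2)"

lemma npair_bounds: "npair p \<xi> <= sroot p * cmod \<xi> + 1" "sroot p * cmod \<xi> <= npair p \<xi> + 1" "1 <= sroot p * npair p \<xi>" "cmod \<xi> <= npair p \<xi>" "npair p \<xi> > 0"
proof -
 have n: "npair p \<xi> = norm (p * \<xi> + 1, \<xi>)" by (simp add: npair_def norm_Pair)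
 have "norm (p * \<xi>, \<xi>) = sqrt (((cmod p)\<^sup>2 + 1) * (cmod \<xi>)\<^sup>2)" by (simp add: norm_Pair norm_mult power_mult_distrib algebra_simps)
 hence m: "norm (p * \<xi>, \<xi>) = sroot p * cmod \<xi>" by (simp add: real_sqrt_mult)
 have d: "(p * \<xi> + 1, \<xi>) = (p * \<xi>, \<xi>) + (1, 0)" by simp
 show "npair p \<xi> <= sroot p * cmod \<xi> + 1" unfolding n m[symmetric] d using norm_triangle_ineq[of "(p * \<xi>, \<xi>)" "(1,0)"] by (simp add: norm_Pair)
 show "sroot p * cmod \<xi> <= npair p \<xi> + 1" unfolding n m[symmetric] d using norm_triangle_ineq4[of "(p * \<xi>, \<xi>) + (1,0)" "(1,0)"] by (simp add: norm_Pair)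
 have le: "cmod (p * \<xi> + 1) <= npair p \<xi>" unfolding npair_def by (rule real_le_rsqrt) simp
 show le2: "cmod \<xi> <= npair p \<xi>" unfolding npair_def by (rule real_le_rsqrt) simp
 show 3: "1 <= sroot p * npair p \<xi>"
 proof -
  have "1 = cmod ((p * \<xi> + 1) - p * \<xi>)" by simp
  also have "\<dots> <= cmod (p * \<xi> + 1) * 1 + cmod \<xi> * cmod p" using norm_triangle_ineq4[of "p * \<xi> + 1" "p * \<xi>"] by (simp add: norm_mult mult.commute)
  also have "\<dots> = (cmod (p * \<xi> + 1), cmod \<xi>) \<bullet> (1, cmod p)" by (simp add: inner_prod_def)
  also have "\<dots> <= norm (cmod (p * \<xi> + 1), cmod \<xi>) * norm (1::real, cmod p)" by (rule norm_cauchy_schwarz)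
  also have "\<dots> = npair p \<xi> * sroot p" by (simp add: norm_Pair npair_def add.commute)
  finally show ?thesis by (simp add: mult.commute)
 qed
 show "npair p \<xi> > 0"
 proof (rule ccontr)
  assume "\<not> npair p \<xi> > 0"
  hence "sroot p * npair p \<xi> <= 0" using sroot_ge(3)[of p] by (intro mult_nonneg_nonpos) auto
  thus False using 3 by linarith
 qed
qed

text \<open>Inverse stereographic projection of p + 1 / \<xi>, with Npole for \<xi> = 0.\<close>
definition Jmap :: "complex => complex => real^3" where "Jmap p \<xi> = hom_sphere (p * \<xi> + 1) \<xi>"

lemma Jmap_nz: "p * \<xi> + 1 ~= 0 \<or> \<xi> ~= 0" for p \<xi> :: complex by auto

lemma dist_Jmap: "dist (Jmap p \<xi>) (Jmap p \<xi>') = 2 * cmod (\<xi> - \<xi>') / (npair p \<xi> * npair p \<xi>')"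
proof -
 have "(p * \<xi> + 1) * \<xi>' - (p * \<xi>' + 1) * \<xi> = - (\<xi> - \<xi>')" by (simp add: algebra_simps)
 thus ?thesis unfolding Jmap_def by (subst hom_dist[OF Jmap_nz Jmap_nz]) (simp only: npair_def norm_minus_cancel)
qed

lemma dist_Jmap_stereo: "dist (Jmap p \<xi>) (stereo p) = 2 / (npair p \<xi> * sroot p)"
proof -
 have "(p * \<xi> + 1) * 1 - p * \<xi> = 1" by simp
 thus ?thesis unfolding Jmap_def stereo_hom by (subst hom_dist[OF Jmap_nz]) (simp_all only: npair_def norm_one one_neq_zero simp_thms mult_1_right power_one)
qed

lemma Jmap_S2: "Jmap p \<xi> \<in> S2" unfolding Jmap_def S2_def using hom_norm[OF Jmap_nz] by simp

lemma Jmap_eq: "Jmap p \<xi> = (if \<xi> = 0 then Npole else stereo (p + 1 / \<xi>))" unfolding Jmap_def by (simp add: hom_zero hom_scale add_divide_distrib)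

lemma Jmap_lipschitz: "dist (Jmap p \<xi>) (Jmap p \<xi>') <= 2 * (sroot p)\<^sup>2 * dist \<xi> \<xi>'"
proof -
 have "1 * 1 <= (sroot p * npair p \<xi>) * (sroot p * npair p \<xi>')" by (rule mult_mono[OF npair_bounds(3) npair_bounds(3)]) (use npair_bounds(3)[of p \<xi>] in auto)
 hence "1 <= (sroot p)\<^sup>2 * (npair p \<xi> * npair p \<xi>')" unfolding power2_eq_square by (simp only: mult_ac mult_1_right)
 hence "cmod (\<xi> - \<xi>') * 1 <= cmod (\<xi> - \<xi>') * ((sroot p)\<^sup>2 * (npair p \<xi> * npair p \<xi>'))" by (intro mult_left_mono) auto
 thus ?thesis unfolding dist_Jmap unfolding dist_norm using npair_bounds(5)[of p \<xi>] npair_bounds(5)[of p \<xi>']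
  by (simp add: divide_le_eq mult_ac del: real_sqrt_pow2)
qed

section \<open>The welded map on the sphere and its dilatation\<close>

locale sphere_map =
 fixes \<Phi> :: "complex => complex" and p :: complex and H :: real
 assumes cont: "continuous_on UNIV \<Phi>" and inj: "inj \<Phi>" and surj: "surj \<Phi>"
  and proper: "!!B. \<exists>R. \<forall>z. R <= cmod z --> B <= cmod (\<Phi> z)"
  and H1: "H >= 1" and qs: "!!z. qsat H \<Phi> z"
  and glob: "!!x y. cmod x <= 2 * cmod y ==> cmod (\<Phi> x - \<Phi> 0) <= H * cmod (\<Phi> y - \<Phi> 0)"
begin

text \<open>The welded plane map followed by \<xi> -> p + 1 / \<xi>, so infinity goes back to the
  chosen curve point p.\<close>

definition F :: "real^3 => real^3" where "F x = (if x = Npole then stereo p else Jmap p (\<Phi> (unstereo x)))"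

lemma F_simps [simp]: "F Npole = stereo p" "F (stereo z) = Jmap p (\<Phi> z)" by (auto simp: F_def)

lemma F_S2: "F x \<in> S2" by (auto simp: F_def Jmap_S2 stereo_S2)

lemma near_Npole: "\<exists>\<delta>>0. \<forall>a. dist (stereo a) Npole < \<delta> --> B <= cmod (\<Phi> a)"
proof -
 obtain R where R: "!!z. R <= cmod z ==> B <= cmod (\<Phi> z)" using proper by blast
 have "B <= cmod (\<Phi> a)" if "dist (stereo a) Npole < 2 / (\<bar>R\<bar> + 1)" for a
 proof -
  have "2 / sroot a < 2 / (\<bar>R\<bar> + 1)" using that by (simp only: dist_stereo_Npole)
  hence "\<bar>R\<bar> + 1 < sroot a" using sroot_ge(3)[of a] by (simp add: divide_less_cancel frac_less2 field_simps)
  also have "sroot a <= cmod a + 1" by (rule real_le_lsqrt) (auto simp: power2_eq_square algebra_simps)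
  finally show ?thesis by (intro R) linarith
 qed
 thus ?thesis by (intro exI[of _ "2 / (\<bar>R\<bar> + 1)"]) (auto simp: add_nonneg_pos)
qed

lemma continuous_finite: "continuous_on (S2 - {Npole}) (%x. Jmap p (\<Phi> (unstereo x)))"
proof -
 have "continuous_on UNIV (Jmap p)" unfolding continuous_on_iff
 proof (intro ballI allI impI)
  fix x e assume e: "(e::real) > 0"
  have s: "2 * (sroot p)\<^sup>2 > 0" using sroot_ge(3)[of p] by (simp del: real_sqrt_pow2)
  have "dist (Jmap p x') (Jmap p x) < e" if "dist x' x < e / (2 * (sroot p)\<^sup>2)" for x'
   using Jmap_lipschitz[of p x' x] that s by (simp add: field_simps del: real_sqrt_pow2)
  thus "\<exists>d>0. \<forall>x'\<in>UNIV. dist x' x < d --> dist (Jmap p x') (Jmap p x) < e" using e s by (meson divide_pos_pos)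
 qed
 hence "continuous_on UNIV (%z. Jmap p (\<Phi> z))" by (rule continuous_on_compose2[OF _ cont]) auto
 thus ?thesis by (rule continuous_on_compose2[OF _ continuous_unstereo]) auto
qed

lemma continuous_F: "continuous_on S2 F" unfolding continuous_on_iff
proof (intro ballI allI impI)
 fix x e assume x: "x \<in> S2" and e: "(e::real) > 0"
 show "\<exists>d>0. \<forall>x'\<in>S2. dist x' x < d --> dist (F x') (F x) < e"
 proof (cases "x = Npole")
  case True
  obtain \<delta> where d: "\<delta> > 0" "!!a. dist (stereo a) Npole < \<delta> ==> 2 / e + 1 <= cmod (\<Phi> a)" using near_Npole[of "2 / e + 1"] by blast
  have "dist (F y) (F x) < e" if y: "y \<in> S2" "dist y x < \<delta>" for y
  proof (cases "y = Npole")
   case True thus ?thesis using e \<open>x = Npole\<close> by simp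
  next
   case False
   then obtain a where a: "y = stereo a" using S2_cases[OF y(1)] by blast
   have "2 / e < cmod (\<Phi> a)" using d(2)[of a] y \<open>x = Npole\<close> a by simp
   also have "\<dots> <= npair p (\<Phi> a)" by (rule npair_bounds)
   also have "\<dots> <= npair p (\<Phi> a) * sroot p" using sroot_ge(1)[of p] npair_bounds(5)[of p "\<Phi> a"] by simp
   finally have "2 / (npair p (\<Phi> a) * sroot p) < e" using e npair_bounds(5)[of p "\<Phi> a"] sroot_ge(3)[of p] by (simp add: divide_less_eq less_divide_eq mult_ac del: mult_less_0_iff)
   thus ?thesis unfolding a True using dist_Jmap_stereo \<open>x = Npole\<close> by simp
  qed
  thus ?thesis using d(1) by blast
 next
  case False
  then obtain d where d: "d > 0" "!!y. y \<in> S2 - {Npole} ==> dist y x < d ==> dist (Jmap p (\<Phi> (unstereo y))) (Jmap p (\<Phi> (unstereo x))) < e"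
   using continuous_finite x e unfolding continuous_on_iff by (metis Diff_iff singletonD)
  have "dist (F y) (F x) < e" if "y \<in> S2" "dist y x < min d (dist Npole x)" for y using d(2)[of y] that False by (auto simp: F_def)
  thus ?thesis using d(1) False by (intro exI[of _ "min d (dist Npole x)"]) auto
 qed
qed

lemma inj_F: "inj_on F S2"
proof (rule inj_onI)
 fix x y assume xy: "x \<in> S2" "y \<in> S2" "F x = F y"
 have J: "Jmap p \<xi> ~= stereo p" for \<xi>
  using dist_Jmap_stereo[of p \<xi>] npair_bounds(5)[of p \<xi>] sroot_ge(3)[of p] by (metis dist_self divide_pos_pos less_irrefl mult_pos_pos zero_less_numeral)
 have Ji: "a = b" if "Jmap p (\<Phi> a) = Jmap p (\<Phi> b)" for a b
  using dist_Jmap[of p "\<Phi> a" "\<Phi> b"] npair_bounds(5)[of p "\<Phi> a"] npair_bounds(5)[of p "\<Phi> b"] that inj by (auto dest: injD)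
 show "x = y" using S2_cases[OF xy(1)] S2_cases[OF xy(2)] xy(3) J J[symmetric] Ji by (elim disjE exE) (simp_all, metis)
qed

lemma surj_F: "F ` S2 = S2"
proof
 show "F ` S2 <= S2" using F_S2 by auto
 show "S2 <= F ` S2"
 proof
  fix y assume y: "y \<in> S2"
  have ex: "Jmap p \<xi> \<in> F ` S2" for \<xi>
  proof -
   obtain z where "\<xi> = \<Phi> z" using surj by (metis surjD)
   hence "Jmap p \<xi> = F (stereo z)" by simp
   thus ?thesis using stereo_S2 by blast
  qed
  consider "y = Npole" | "y = stereo p" | w where "y = stereo w" "w ~= p" using S2_cases[OF y] by blast
  thus "y \<in> F ` S2"
  proof cases
   case 1 thus ?thesis using ex[of 0] by (simp add: Jmap_eq)
  next
   case 2 thus ?thesis using Npole_S2 F_simps(1) by (metis image_eqI)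
  next
   case 3
   have "Jmap p (1 / (w - p)) = stereo w" using 3(2) by (simp add: Jmap_eq)
   thus ?thesis using ex[of "1 / (w - p)"] 3 by simp
  qed
 qed
qed

text \<open>Points at equal chordal distance from a finite point have planar distances within a
  factor 2 when they are close to it, which is the tolerance built into \<open>qsat\<close>.\<close>

lemma dilat_finite:
 "\<exists>\<delta>>0. \<forall>y\<in>S2. \<forall>z\<in>S2. dist y (stereo \<zeta>) = dist z (stereo \<zeta>) --> dist y (stereo \<zeta>) < \<delta> -->
   dist (F y) (F (stereo \<zeta>)) <= (9 * H) * dist (F z) (F (stereo \<zeta>))"
proof -
 define n where "n = (%a. npair p (\<Phi> a))"
 have npos: "n a > 0" for a using npair_bounds(5) by (simp add: n_def)
 obtain d0 where d0: "d0 > 0" "!!x y. [|cmod (x - \<zeta>) < d0; cmod (y - \<zeta>) < d0; cmod (x - \<zeta>) <= 2 * cmod (y - \<zeta>)|] ==> cmod (\<Phi> x - \<Phi> \<zeta>) <= H * cmod (\<Phi> y - \<Phi> \<zeta>)"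
  using qs[of \<zeta>] unfolding qsat_def by blast
 have cn: "isCont n \<zeta>"
 proof -
  have "isCont \<Phi> \<zeta>" using cont by (simp add: continuous_on_eq_continuous_at)
  thus ?thesis unfolding n_def npair_def by (intro continuous_intros)
 qed
 have cs: "isCont (%a. sroot a) \<zeta>" by (intro continuous_intros)
 \<comment> \<open>The bounds 2/3 and 4/3 make any two nearby values comparable within a factor
   2.\<close>
 have near: "\<forall>\<^sub>F a in nhds \<zeta>. 2/3 * f \<zeta> < f a & f a < 4/3 * f \<zeta>" if "isCont f \<zeta>" "f \<zeta> > (0::real)" for f
 proof -
  have t: "(f \<longlongrightarrow> f \<zeta>) (nhds \<zeta>)" using that(1) by (simp add: isCont_def tendsto_at_iff_tendsto_nhds)
  show ?thesis using order_tendstoD(1)[OF t, of "2/3 * f \<zeta>"] order_tendstoD(2)[OF t, of "4/3 * f \<zeta>"] that(2) by (intro eventually_conj) auto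
 qed
 have "\<forall>\<^sub>F a in nhds \<zeta>. (2/3 * n \<zeta> < n a & n a < 4/3 * n \<zeta>) & (2/3 * sroot \<zeta> < sroot a & sroot a < 4/3 * sroot \<zeta>)"
  by (intro eventually_conj near cn cs npos sroot_ge)
 then obtain d1 where d1: "d1 > 0" "!!a. dist a \<zeta> < d1 ==> (2/3 * n \<zeta> < n a & n a < 4/3 * n \<zeta>) & (2/3 * sroot \<zeta> < sroot a & sroot a < 4/3 * sroot \<zeta>)"
  unfolding eventually_nhds_metric by blast
 have "stereo \<zeta> \<in> S2 - {Npole}" using stereo_S2 by auto
 then obtain d2 where d2: "d2 > 0" "!!y. y \<in> S2 - {Npole} ==> dist y (stereo \<zeta>) < d2 ==> dist (unstereo y) (unstereo (stereo \<zeta>)) < min d0 d1"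
  using continuous_unstereo d0(1) d1(1) unfolding continuous_on_iff by (metis min_less_iff_conj)
 define \<delta> where "\<delta> = min d2 (dist Npole (stereo \<zeta>))"
 have dpos: "\<delta> > 0" using d2(1) stereo_ne_Npole[of \<zeta>] unfolding \<delta>_def by (metis min_less_iff_conj zero_less_dist_iff)
 have main: "dist (F y) (F (stereo \<zeta>)) <= (9 * H) * dist (F z) (F (stereo \<zeta>))"
  if yz: "y \<in> S2" "z \<in> S2" and eq: "dist y (stereo \<zeta>) = dist z (stereo \<zeta>)" and small: "dist y (stereo \<zeta>) < \<delta>" for y z
 proof -
  have ne: "y ~= Npole" "z ~= Npole" using eq small by (auto simp: \<delta>_def)
  then obtain a b where ab: "y = stereo a" "z = stereo b" using S2_cases yz by metis
  have nb: "dist a \<zeta> < min d0 d1" "dist b \<zeta> < min d0 d1" using d2(2)[of y] d2(2)[of z] yz ne eq small by (auto simp: \<delta>_def ab)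
  have A: "2/3 * n \<zeta> < n b" "n a < 4/3 * n \<zeta>" "2/3 * n \<zeta> < n a" "2/3 * sroot \<zeta> < sroot b" "sroot a < 4/3 * sroot \<zeta>"
   using d1(2)[of a] d1(2)[of b] nb by auto
  have "cmod (a - \<zeta>) / sroot a = cmod (b - \<zeta>) / sroot b"
  proof -
   have "2 * cmod (a - \<zeta>) / (sroot a * sroot \<zeta>) = 2 * cmod (b - \<zeta>) / (sroot b * sroot \<zeta>)" using eq unfolding ab dist_stereo .
   hence "2 * (cmod (a - \<zeta>) / sroot a) / sroot \<zeta> = 2 * (cmod (b - \<zeta>) / sroot b) / sroot \<zeta>" by simp
   thus ?thesis using sroot_ge(3)[of \<zeta>] by (metis divide_cancel_right less_irrefl mult_cancel_left zero_neq_numeral)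
  qed
  hence "cmod (a - \<zeta>) = sroot a * (cmod (b - \<zeta>) / sroot b)" using sroot_ge(3)[of a] by (metis less_irrefl nonzero_mult_div_cancel_left times_divide_eq_right)
  also have "\<dots> <= (2 * sroot b) * (cmod (b - \<zeta>) / sroot b)" using A(4,5) sroot_ge(3)[of b] by (intro mult_right_mono) auto
  also have "\<dots> = 2 * cmod (b - \<zeta>)" using sroot_ge(3)[of b] by (metis less_irrefl mult.assoc nonzero_mult_div_cancel_left times_divide_eq_right)
  finally have "cmod (\<Phi> a - \<Phi> \<zeta>) <= H * cmod (\<Phi> b - \<Phi> \<zeta>)" using nb by (intro d0(2)) (auto simp: dist_norm)
  hence "2 * cmod (\<Phi> a - \<Phi> \<zeta>) / (n a * n \<zeta>) <= 2 * (H * cmod (\<Phi> b - \<Phi> \<zeta>)) / (n a * n \<zeta>)"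
   using npos[of a] npos[of \<zeta>] by (intro divide_right_mono) auto
  also have "\<dots> <= 2 * (H * cmod (\<Phi> b - \<Phi> \<zeta>)) / ((n b / 2) * n \<zeta>)"
  proof (rule divide_left_mono)
   have "n b < 4/3 * n \<zeta>" using d1(2)[of b] nb by auto
   hence "n b / 2 <= n a" using A(3) by linarith
   thus "n b / 2 * n \<zeta> <= n a * n \<zeta>" using npos[of \<zeta>] by (intro mult_right_mono) auto
  qed (use npos[of a] npos[of b] npos[of \<zeta>] H1 in auto)
  also have "\<dots> = 2 * H * (2 * cmod (\<Phi> b - \<Phi> \<zeta>) / (n b * n \<zeta>))" by simp
  finally have "dist (F y) (F (stereo \<zeta>)) <= 2 * H * dist (F z) (F (stereo \<zeta>))" unfolding ab F_simps dist_Jmap n_def .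
  also have "\<dots> <= 9 * H * dist (F z) (F (stereo \<zeta>))" using H1 by (intro mult_right_mono) auto
  finally show ?thesis .
 qed
 show ?thesis using dpos main by blast
qed

text \<open>Chordal circles about \<open>Npole\<close> are circles about 0, which
  \<open>glob\<close> controls at all radii. The factor 9 is 3 from removing \<Phi> 0, times 3/2 and
  2 from comparing \<open>npair\<close> with its leading term.\<close>

lemma dilat_Npole:
 "\<exists>\<delta>>0. \<forall>y\<in>S2. \<forall>z\<in>S2. dist y Npole = dist z Npole --> dist y Npole < \<delta> -->
   dist (F y) (F Npole) <= (9 * H) * dist (F z) (F Npole)"
proof -
 obtain \<delta> where d: "\<delta> > 0" "!!a. dist (stereo a) Npole < \<delta> ==> 2 + cmod (\<Phi> 0) <= cmod (\<Phi> a)" using near_Npole by blast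
 have main: "dist (F y) (F Npole) <= (9 * H) * dist (F z) (F Npole)"
  if yz: "y \<in> S2" "z \<in> S2" and eq: "dist y Npole = dist z Npole" and small: "dist y Npole < \<delta>" for y z
 proof (cases "y = Npole")
  case True
  thus ?thesis using H1 by simp
 next
  case False
  hence "z ~= Npole" using eq by auto
  then obtain a b where ab: "y = stereo a" "z = stereo b" using S2_cases yz False by metis
  have "2 / sroot a = 2 / sroot b" using eq unfolding ab dist_stereo_Npole .
  hence "sroot a = sroot b" by simp
  hence "cmod a = cmod b" by simp
  hence g: "cmod (\<Phi> b - \<Phi> 0) <= H * cmod (\<Phi> a - \<Phi> 0)" by (intro glob) simp
  have L: "2 + cmod (\<Phi> 0) <= cmod (\<Phi> a)" "2 + cmod (\<Phi> 0) <= cmod (\<Phi> b)" using d(2)[of a] d(2)[of b] eq small ab by auto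
  have "cmod (\<Phi> b) <= cmod (\<Phi> b - \<Phi> 0) + cmod (\<Phi> 0)" using norm_triangle_sub[of "\<Phi> b" "\<Phi> 0"] by simp
  also have "\<dots> <= H * cmod (\<Phi> a - \<Phi> 0) + 1 * cmod (\<Phi> a)" using g L by simp
  also have "\<dots> <= H * (2 * cmod (\<Phi> a)) + H * cmod (\<Phi> a)"
   using norm_triangle_ineq4[of "\<Phi> a" "\<Phi> 0"] L H1 by (intro add_mono mult_mono) (auto intro: order_trans)
  finally have B: "cmod (\<Phi> b) <= 3 * H * cmod (\<Phi> a)" by simp
  have s: "1 <= sroot p" by (rule sroot_ge)
  have c: "2 <= sroot p * cmod w" if "2 <= cmod w" for w using mult_mono[OF s that] by simp
  have "npair p (\<Phi> b) <= 3/2 * (sroot p * cmod (\<Phi> b))" using npair_bounds(1)[of p "\<Phi> b"] c[of "\<Phi> b"] L norm_ge_zero[of "\<Phi> 0"] by linarith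
  also have "\<dots> <= 3/2 * (sroot p * (3 * H * cmod (\<Phi> a)))" using B s by (intro mult_left_mono) auto
  also have "\<dots> = 9/2 * H * (sroot p * cmod (\<Phi> a))" by simp
  also have "\<dots> <= 9/2 * H * (2 * npair p (\<Phi> a))"
   using npair_bounds(2)[of p "\<Phi> a"] c[of "\<Phi> a"] L norm_ge_zero[of "\<Phi> 0"] H1 by (intro mult_left_mono) linarith+
  finally have N: "npair p (\<Phi> b) <= 9 * H * npair p (\<Phi> a)" by simp
  have "2 / (npair p (\<Phi> a) * sroot p) <= 9 * H * (2 / (npair p (\<Phi> b) * sroot p))"
  proof -
   have "1 / npair p (\<Phi> a) <= 9 * H / npair p (\<Phi> b)" using N npair_bounds(5)[of p "\<Phi> a"] npair_bounds(5)[of p "\<Phi> b"] by (simp add: field_simps)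
   hence "(1 / npair p (\<Phi> a)) * (2 / sroot p) <= (9 * H / npair p (\<Phi> b)) * (2 / sroot p)" using s by (intro mult_right_mono) auto
   thus ?thesis by (simp add: mult_ac)
  qed
  thus ?thesis unfolding ab F_simps dist_Jmap_stereo .
 qed
 show ?thesis using d(1) main by blast
qed

text \<open>A rotation that carries the unit circle to the extended real line, in the stereographic chart.\<close>
definition rot :: "real^3 => real^3" where "rot x = vector [x$1, - x$3, x$2]"

lemma dist_rot [simp]: "dist (rot x) (rot y) = dist x y"
proof -
 have "(dist (rot x) (rot y))\<^sup>2 = (dist x y)\<^sup>2" unfolding dist_norm power2_norm_eq_inner inner_3 by (simp add: rot_def algebra_simps)
 thus ?thesis by simp
qed

lemma rot_S2: "rot x \<in> S2 \<longleftrightarrow> x \<in> S2" by (simp add: S2_def norm_eq_1 inner_3 rot_def algebra_simps)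

lemma rot_image: "rot ` S2 = S2"
proof -
 have "y = rot (vector [y$1, y$3, - y$2])" for y by (simp add: rot_def vec_eq_iff forall_3)
 hence "y \<in> rot ` S2" if "y \<in> S2" for y using that rot_S2 by (metis image_eqI)
 thus ?thesis using rot_S2 by blast
qed

text \<open>The dilatation bound holds at every point of the sphere, so the exceptional set is
  empty; 18 is 9 times the factor 2 of \<open>dilat_leI\<close>.\<close>

lemma quasiconformal_F_rot: "quasiconformal (18 * H) (F \<circ> rot)"
proof -
 have dil: "dilat_le (18 * H) (F \<circ> rot) x" if x: "x \<in> S2" for x
 proof -
  have "\<exists>\<delta>>0. \<forall>y\<in>S2. \<forall>z\<in>S2. dist y (rot x) = dist z (rot x) --> dist y (rot x) < \<delta> -->
   dist (F y) (F (rot x)) <= (9 * H) * dist (F z) (F (rot x))" using S2_cases[of "rot x"] rot_S2[of x] x dilat_finite dilat_Npole by metis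
  then obtain \<delta> where d: "\<delta> > 0" "!!y z. [|y\<in>S2; z\<in>S2; dist y (rot x) = dist z (rot x); dist y (rot x) < \<delta>|] ==>
   dist (F y) (F (rot x)) <= (9 * H) * dist (F z) (F (rot x))" by blast
  have "dilat_le (2 * (9 * H)) (F \<circ> rot) x" by (rule dilat_leI[OF x _ _ d(1)]) (insert F_S2 H1 rot_S2 d(2), simp_all)
  thus ?thesis by simp
 qed
 have cr: "continuous_on S2 rot" unfolding continuous_on_iff by auto
 have "\<exists>g. homeomorphism S2 S2 (F \<circ> rot) g"
 proof (rule homeomorphism_compact)
  show "compact S2" by (simp add: S2_def)
  show "continuous_on S2 (F \<circ> rot)" by (rule continuous_on_compose[OF cr]) (simp add: rot_image continuous_F)
  show "(F \<circ> rot) ` S2 = S2" by (simp only: image_comp[symmetric] rot_image surj_F)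
  have "inj_on rot S2" by (rule inj_onI) (metis dist_rot dist_eq_0_iff)
  thus "inj_on (F \<circ> rot) S2" by (rule comp_inj_on) (simp add: rot_image inj_F)
 qed
 moreover have "{z. \<not> dilat_le (18 * H) (F \<circ> rot) (stereo z)} = {}" using dil stereo_S2 by blast
 ultimately show ?thesis unfolding quasiconformal_def by (intro conjI ballI exI[of _ "18 * H"]) (auto simp: dil)
qed

lemma rot_circle: "rot ` stereo ` sphere 0 1 = insert Npole (range (%x::real. stereo (of_real x)))"
proof
 have "rot (stereo z) = Npole \<or> (\<exists>x::real. rot (stereo z) = stereo (of_real x))" if "cmod z = 1" for z
 proof (cases "rot (stereo z) = Npole")
  case False
  have "(rot (stereo z))$2 = 0" using that by (simp add: rot_def stereo_def)
  hence "unstereo (rot (stereo z)) = of_real (Re (unstereo (rot (stereo z))))" by (simp add: unstereo_def complex_eq_iff)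
  thus ?thesis using stereo_unstereo[of "rot (stereo z)"] False rot_S2 stereo_S2 by metis
 qed simp
 thus "rot ` stereo ` sphere 0 1 <= insert Npole (range (%x::real. stereo (of_real x)))" by fastforce
 have "y \<in> rot ` stereo ` sphere 0 1" if y: "y \<in> S2" "y$2 = 0" for y :: "real^3"
 proof -
  obtain x where x: "x \<in> S2" "y = rot x" using y(1) rot_image by blast
  have x3: "x$3 = 0" using y(2) x(2) by (simp add: rot_def)
  hence "x ~= Npole" by (auto simp: Npole_def)
  hence e: "stereo (unstereo x) = x" using stereo_unstereo x(1) by blast
  define w where "w = unstereo x"
  have "(stereo w)$3 = 0" using x3 by (simp add: w_def e)
  hence "((cmod w)\<^sup>2 - 1) / ((cmod w)\<^sup>2 + 1) = 0" by (simp add: stereo_def)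
  moreover have "(cmod w)\<^sup>2 + 1 ~= 0" by (simp add: add_nonneg_eq_0_iff)
  ultimately have "(cmod w)\<^sup>2 = 1" by simp
  hence "cmod w = 1" using norm_ge_zero[of w] by (metis one_power2 power2_eq_iff_nonneg zero_le_one)
  hence "w \<in> sphere 0 1" by simp
  thus ?thesis using x(2) e w_def by (metis image_eqI)
 qed
 moreover have "Npole$2 = 0" "(stereo (of_real x))$2 = 0" for x :: real by (simp_all add: Npole_def stereo_def)
 ultimately show "insert Npole (range (%x::real. stereo (of_real x))) <= rot ` stereo ` sphere 0 1" using Npole_S2 stereo_S2 by blast
qed

end

theorem bounded_turning_quasicircle:
 assumes C0: "C0 >= 1"
 shows "\<exists>K\<ge>1. \<forall>c. simple_path c & pathfinish c = pathstart c & bounded_turning C0 (path_image c) -->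
   quasicircle K (stereo ` path_image c)"
proof (intro exI conjI allI impI)
 define H where "H = max 1 (weld_H (C0\<^sup>2 + C0))"
 show "18 * H >= 1" by (simp add: H_def)
 fix c assume c: "simple_path c & pathfinish c = pathstart c & bounded_turning C0 (path_image c)"
 interpret jordan_loop c using c by unfold_locales auto
 have bt: "bounded_turning C0 G" using c by (simp add: G_def)
 obtain p where p: "p \<in> G" using path_image_nonempty[of c] by (auto simp: G_def)
 obtain \<psi>1 \<psi>2 where P: "half_plane_embedding \<psi>1 (C0\<^sup>2 + C0)" "half_plane_embedding \<psi>2 (C0\<^sup>2 + C0)"
  "range (%x::real. \<psi>1 (of_real x)) = range (%x::real. \<psi>2 (of_real x))"
  "\<psi>1 ` \<H> \<inter> \<psi>2 ` \<H> = {}"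
  "range (%x::real. p + 1 / \<psi>1 (of_real x)) = G - {p}" "!!x::real. \<psi>1 (of_real x) ~= 0" using complementary_charts[OF C0 bt p] by blast
 obtain \<Phi> where \<Phi>: "continuous_on UNIV \<Phi>" "inj \<Phi>" "surj \<Phi>" "!!B. \<exists>R. \<forall>z. R <= cmod z --> B <= cmod (\<Phi> z)"
  "range (%x::real. \<Phi> (of_real x)) = range (%x::real. \<psi>1 (of_real x))"
  "!!z. qsat (weld_H (C0\<^sup>2 + C0)) \<Phi> z"
  "!!x y. cmod x <= 2 * cmod y ==> cmod (\<Phi> x - \<Phi> 0) <= weld_H (C0\<^sup>2 + C0) * cmod (\<Phi> y - \<Phi> 0)" using conformal_welding[OF P(1-4)] by blast
 interpret sphere_map \<Phi> p H
 proof
  show "qsat H \<Phi> z" for z by (rule qsat_mono[OF \<Phi>(6)]) (simp add: H_def)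
  show "cmod (\<Phi> x - \<Phi> 0) <= H * cmod (\<Phi> y - \<Phi> 0)" if "cmod x <= 2 * cmod y" for x y
   by (rule order_trans[OF \<Phi>(7)[OF that]]) (auto simp: H_def intro!: mult_right_mono)
 qed (insert \<Phi>, auto simp: H_def)
 have "F ` (insert Npole (range (%x::real. stereo (of_real x)))) = insert (stereo p) ((%w. Jmap p w) ` range (%x::real. \<Phi> (of_real x)))" by (simp add: image_image)
 also have "\<dots> = insert (stereo p) (stereo ` range (%x::real. p + 1 / \<psi>1 (of_real x)))" unfolding \<Phi>(5) by (simp only: image_image Jmap_eq P(6) if_False)
 also have "\<dots> = stereo ` G" unfolding P(5) using p by auto
 finally have "stereo ` path_image c = (F \<circ> rot) ` stereo ` sphere 0 1" by (simp only: image_comp[symmetric] rot_circle G_def)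
 thus "quasicircle (18 * H) (stereo ` path_image c)" unfolding quasicircle_def using quasiconformal_F_rot by blast
qed

section \<open>The map in the plane\<close>

locale singular_map =
 fixes l m :: nat and lam :: complex
 assumes l2: "l >= 2" and m2: "m >= 2" and lam0: "lam ~= 0"
begin

text \<open>Division by zero gives f 0 = 0, so an orbit that reaches the pole 0 stays there; the condition 0 \<notin> annulus excludes it from K.\<close>
definition f :: "complex => complex" where "f z = z ^ m + lam / z ^ l"
definition df :: "complex => complex" where "df z = of_nat m * z ^ (m - 1) - of_nat l * lam / z ^ (l + 1)"
text \<open>R is an escape radius: beyond it each step at least doubles the modulus. Symmetrically,
  points closer to the pole than \<open>\<epsilon> B\<close> are mapped beyond B.\<close>

definition R :: real where "R = 3 + cmod lam"
definition \<epsilon> :: "real => real" where "\<epsilon> B = min 1 (cmod lam / (\<bar>B\<bar> + 2))"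
definition annulus :: "complex set" where "annulus = {z. \<epsilon> R <= cmod z & cmod z <= R}"
text \<open>The non-escaping set. Its stereographic image is later identified with the Julia
  set.\<close>

definition K :: "complex set" where "K = {z. \<forall>n. (f ^^ n) z \<in> annulus}"
definition critical :: "complex set" where "critical = {z. z ^ (l + m) = lam * of_nat l / of_nat m}"

lemma R3: "R >= 3" by (simp add: R_def)

lemma eps_pos: "\<epsilon> B > 0" "\<epsilon> B <= 1" using lam0 by (auto simp: \<epsilon>_def)

lemma f_zero: "f 0 = 0" using l2 m2 by (simp add: f_def power_0_left)

lemma funpow_f_zero: "(f ^^ n) 0 = 0" by (induction n) (auto simp: f_zero)

lemma f_big:
 assumes "R <= cmod z" shows "2 * cmod z <= cmod (f z)"
proof -
 have z: "cmod z >= 3" "cmod z >= 3 + cmod lam" using assms R3 unfolding R_def by linarith+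
 have "cmod z ^ 2 <= cmod z ^ m" using z m2 by (intro power_increasing) auto
 moreover have "(3 + cmod lam) * cmod z <= cmod z ^ 2" unfolding power2_eq_square using z by (intro mult_right_mono) auto
 moreover have "cmod lam * 1 <= cmod lam * cmod z" using z by (intro mult_left_mono) auto
 ultimately have a: "3 * cmod z + cmod lam <= cmod (z ^ m)" by (simp add: norm_power algebra_simps)
 have "1 <= cmod z ^ l" using z by (intro one_le_power) auto
 hence "cmod (lam / z ^ l) <= cmod lam" by (simp add: norm_divide norm_power divide_le_eq mult_le_cancel_left1)
 thus ?thesis using a norm_diff_ineq[of "z ^ m" "lam / z ^ l"] z unfolding f_def by linarith
qed

lemma f_small:
 assumes "z ~= 0" "cmod z < \<epsilon> B" shows "B < cmod (f z)"
proof -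
 have z: "cmod z <= 1" "cmod z < cmod lam / (\<bar>B\<bar> + 2)" "cmod z > 0" using assms by (auto simp: \<epsilon>_def)
 have "cmod z ^ m <= 1" using z by (intro power_le_one) auto
 hence a: "cmod (z ^ m) <= 1" by (simp add: norm_power)
 have "cmod z ^ l <= cmod z ^ 1" using z l2 by (intro power_decreasing) auto
 hence "cmod lam / cmod z <= cmod lam / cmod z ^ l" using z by (intro divide_left_mono) auto
 moreover have "\<bar>B\<bar> + 2 < cmod lam / cmod z" using z by (simp add: field_simps)
 ultimately have "\<bar>B\<bar> + 2 < cmod (lam / z ^ l)" by (simp add: norm_divide norm_power)
 thus ?thesis using a norm_diff_ineq[of "lam / z ^ l" "z ^ m"] unfolding f_def by (simp add: add.commute)
qed

lemma iter_big: "R <= cmod z ==> 2 ^ n * cmod z <= cmod ((f ^^ n) z)"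
proof (induction n)
 case (Suc n)
 have "1 * cmod z <= 2 ^ n * cmod z" by (intro mult_right_mono) auto
 hence "R <= cmod ((f ^^ n) z)" using Suc by linarith
 from f_big[OF this] show ?case using Suc by simp
qed simp

lemma iter_big': "R <= cmod z ==> cmod z <= cmod ((f ^^ n) z)"
proof -
 assume "R <= cmod z"
 hence "2 ^ n * cmod z <= cmod ((f ^^ n) z)" by (rule iter_big)
 moreover have "1 * cmod z <= 2 ^ n * cmod z" by (intro mult_right_mono) auto
 ultimately show ?thesis by linarith
qed

lemma K_annulus: "z \<in> K ==> z \<in> annulus" unfolding K_def by (metis (mono_tags, lifting) funpow_0 mem_Collect_eq)

lemma annulus_props: "z \<in> annulus ==> z ~= 0" "z \<in> annulus ==> cmod z <= R" "z \<in> annulus ==> \<epsilon> R <= cmod z"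
 using eps_pos(1)[of R] by (auto simp: annulus_def)

lemmas K_props = annulus_props[OF K_annulus]

lemma K_forward: "z \<in> K ==> f z \<in> K" unfolding K_def mem_Collect_eq
proof
 fix n assume a: "\<forall>n. (f ^^ n) z \<in> annulus"
 show "(f ^^ n) (f z) \<in> annulus" using a[rule_format, of "Suc n"] by (simp only: funpow_Suc_right o_apply)
qed

lemma K_backward:
 assumes "f z \<in> K" "z ~= 0" shows "z \<in> K"
proof -
 have b: "cmod (f z) <= R" using K_props(2)[OF assms(1)] .
 have 1: "\<epsilon> R <= cmod z" using f_small[OF assms(2), of R] b by linarith
 have 2: "cmod z <= R"
 proof (rule ccontr)
  assume "\<not> cmod z <= R"
  thus False using f_big[of z] b R3 by linarith
 qed
 have "(f ^^ n) z \<in> annulus" for n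
 proof (cases n)
  case 0 thus ?thesis using 1 2 by (simp add: annulus_def)
 next
  case (Suc k)
  have "(f ^^ k) (f z) \<in> annulus" using assms(1) by (simp add: K_def)
  thus ?thesis unfolding Suc funpow_Suc_right by simp
 qed
 thus ?thesis by (simp add: K_def)
qed

lemma K_funpow: "z \<in> K ==> (f ^^ n) z \<in> K" by (induction n) (auto intro: K_forward)

lemma K_funpow_backward: "(f ^^ n) z \<in> K ==> z \<in> K"
proof (induction n)
 case (Suc n)
 have "(f ^^ n) z ~= 0"
 proof
  assume "(f ^^ n) z = 0"
  hence "(f ^^ Suc n) z = 0" by (simp add: f_zero)
  thus False using K_props(1)[OF Suc.prems] by simp
 qed
 thus ?case using Suc K_backward by simp
qed simp

lemma K_funpow_nz: "z \<in> K ==> (f ^^ n) z ~= 0" using K_funpow K_props(1) by blast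

lemma bounded_orbit_in_K:
 assumes "!!k. (f ^^ k) z ~= 0 & cmod ((f ^^ k) z) <= B" shows "z \<in> K"
proof -
 have le: "cmod ((f ^^ k) z) <= R" for k
 proof (rule ccontr)
  assume n: "\<not> cmod ((f ^^ k) z) <= R"
  define w where "w = (f ^^ k) z"
  have w: "R <= cmod w" using n by (simp add: w_def)
  obtain j :: nat where j: "B < 2 ^ j" using real_arch_pow[of 2 B] by auto
  have "B < 2 ^ j * 1" using j by simp
  also have "\<dots> <= 2 ^ j * cmod w" using w R3 by (intro mult_left_mono) auto
  also have "\<dots> <= cmod ((f ^^ j) w)" using iter_big[OF w] .
  also have "(f ^^ j) w = (f ^^ (j + k)) z" by (simp add: w_def funpow_add)
  finally show False using assms[of "j + k"] by linarith
 qed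
 have "\<epsilon> R <= cmod ((f ^^ k) z)" for k
 proof (rule ccontr)
  assume "\<not> \<epsilon> R <= cmod ((f ^^ k) z)"
  hence "R < cmod (f ((f ^^ k) z))" using assms[of k] by (intro f_small) auto
  thus False using le[of "Suc k"] by simp
 qed
 thus ?thesis using le by (simp add: K_def annulus_def)
qed

lemma f_has_derivative: "z ~= 0 ==> (f has_field_derivative df z) (at z)"
proof -
 assume z: "z ~= 0"
 have "((%z. z ^ m + lam / z ^ l) has_field_derivative (of_nat m * z ^ (m - 1) - lam * (of_nat l * z ^ (l - 1)) / (z ^ l * z ^ l))) (at z)"
  using z by (auto intro!: derivative_eq_intros)
 moreover have "lam * (of_nat l * z ^ (l - 1)) / (z ^ l * z ^ l) = of_nat l * lam / z ^ (l + 1)"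
 proof -
  have "z ^ l = z * z ^ (l - 1)" using l2 by (metis One_nat_def Suc_1 Suc_le_lessD less_eq_Suc_le less_imp_le_nat power_minus_mult mult.commute zero_less_Suc order_less_le_trans)
  hence "lam * (of_nat l * z ^ (l - 1)) / (z ^ l * z ^ l) = (z ^ (l - 1) * (of_nat l * lam)) / (z ^ (l - 1) * (z * z ^ l))" by (simp add: mult_ac)
  also have "\<dots> = of_nat l * lam / (z * z ^ l)" using z by (intro nonzero_mult_divide_mult_cancel_left) auto
  finally show ?thesis by simp
 qed
 ultimately show ?thesis unfolding f_def[abs_def] df_def by simp
qed

lemma f_holomorphic: "0 \<notin> S ==> f holomorphic_on S" unfolding f_def[abs_def] by (auto intro!: holomorphic_intros)

lemma f_continuous: "0 \<notin> S ==> continuous_on S f" using f_holomorphic holomorphic_on_imp_continuous_on by blast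

lemma df_zero: "z ~= 0 ==> df z = 0 \<longleftrightarrow> z \<in> critical"
proof -
 assume z: "z ~= 0"
 have "df z = 0 \<longleftrightarrow> of_nat m * z ^ (m - 1) = of_nat l * lam / z ^ (l + 1)" by (simp add: df_def)
 also have "\<dots> \<longleftrightarrow> of_nat m * (z ^ (m - 1) * z ^ (l + 1)) = of_nat l * lam" using z by (simp add: field_simps)
 also have "z ^ (m - 1) * z ^ (l + 1) = z ^ (l + m)" unfolding power_add[symmetric] using m2 by (intro arg_cong[where f = "%k. z ^ k"]) auto
 also have "of_nat m * z ^ (l + m) = of_nat l * lam \<longleftrightarrow> z ^ (l + m) = lam * of_nat l / of_nat m" using m2 by (simp add: field_simps)
 finally show ?thesis by (simp add: critical_def)
qed

lemma closed_annulus: "closed annulus" "compact annulus"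
proof -
 have e: "annulus = cball 0 R - ball 0 (\<epsilon> R)" by (auto simp: annulus_def)
 show "closed annulus" "compact annulus" unfolding e by (auto intro: compact_diff closed_Diff)
qed

lemma compact_K: "compact K"
proof -
 define A where "A n = {z. \<forall>k\<le>n. (f ^^ k) z \<in> annulus}" for n
 have "closed (A n)" for n
 proof (induction n)
  case 0
  have "A 0 = annulus" by (auto simp: A_def)
  thus ?case by (simp add: closed_annulus)
 next
  case (Suc n)
  \<comment> \<open>The map is discontinuous at the pole 0, so closedness is obtained one step at a
    time, inside the annulus.\<close>
  have "A (Suc n) = annulus \<inter> f -` A n"
  proof -
   have "(\<forall>k\<le>Suc n. (f ^^ k) z \<in> annulus) \<longleftrightarrow> z \<in> annulus & (\<forall>k\<le>n. (f ^^ k) (f z) \<in> annulus)" for z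
    by (auto simp: funpow_swap1[symmetric] le_Suc_eq all_conj_distrib) (metis (no_types, lifting) Suc_le_mono comp_apply funpow.simps(2) not0_implies_Suc funpow_0 funpow_swap1 le_Suc_eq)+
   thus ?thesis by (auto simp: A_def)
  qed
  moreover have "closed (annulus \<inter> f -` A n)" using annulus_props(1) by (intro continuous_closed_preimage f_continuous closed_annulus Suc) blast
  ultimately show ?case by simp
 qed
 hence "closed (\<Inter>n. A n)" by blast
 moreover have "K = (\<Inter>n. A n)" by (auto simp: K_def A_def)
 ultimately have "closed K" by simp
 moreover have "K <= annulus" using K_annulus by blast
 ultimately show ?thesis using closed_annulus(2) by (metis compact_Int_closed inf.absorb_iff2)
qed

text \<open>For k = l this is z^l (f z - w), which gives preimages; for k = l + 1 and w = 1 it is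
  z^l (f z - z), which gives fixed points.\<close>

lemma trinomial_root:
 assumes "0 < k" "k < l + m" shows "\<exists>z. z ~= 0 & z ^ (l + m) - w * z ^ k + lam = 0"
proof -
 define p where "p = monom 1 (l + m) - monom w k + [:lam:]"
 have pz: "poly p z = z ^ (l + m) - w * z ^ k + lam" for z by (simp add: p_def poly_monom)
 have "coeff p (l + m) = 1" using l2 m2 assms by (simp add: p_def coeff_pCons split: nat.splits)
 hence "l + m <= degree p" by (intro le_degree) simp
 hence "degree p ~= 0" using l2 by simp
 hence "\<not> constant (poly p)" by (simp add: constant_degree)
 then obtain z where z: "poly p z = 0" using fundamental_theorem_of_algebra by blast
 hence "z ~= 0" using lam0 l2 m2 assms by (auto simp: pz power_0_left)
 thus ?thesis using z pz by auto
qed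

lemma polynomial_root: "\<exists>z. z ~= 0 & f z = w"
proof -
 obtain z where z: "z ~= 0" "z ^ (l + m) - w * z ^ l + lam = 0" using trinomial_root[of l w] l2 m2 by auto
 hence "z ^ l * (z ^ m - w) + lam = 0" by (simp add: power_add algebra_simps)
 hence "f z = w" using z(1) by (simp add: f_def field_simps eq_neg_iff_add_eq_0)
 thus ?thesis using z(1) by blast
qed

section \<open>Covering property and inverse branches\<close>

lemma finite_fiber: "finite {z. z ~= 0 & f z = w}"
proof -
 define p where "p = monom 1 (l + m) - monom w l + [:lam:]"
 have pz: "poly p z = z ^ (l + m) - w * z ^ l + lam" for z by (simp add: p_def poly_monom)
 have "poly p 0 = lam" using l2 m2 by (simp add: pz power_0_left)
 hence "p ~= 0" using lam0 by auto
 hence "finite {z. poly p z = 0}" by (rule poly_roots_finite)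
 moreover have "poly p z = 0" if "z ~= 0" "f z = w" for z
 proof -
  have "z ^ m + lam / z ^ l - w = 0" using that by (simp add: f_def)
  moreover have "poly p z = z ^ l * (z ^ m + lam / z ^ l - w)" using that(1) by (simp add: pz power_add algebra_simps)
  ultimately show ?thesis by simp
 qed
 ultimately show ?thesis by (auto intro: finite_subset[of _ "{z. poly p z = 0}"])
qed

lemma finite_critical: "finite critical"
proof -
 have "finite {z. z ^ (l + m) = lam * of_nat l / of_nat m}" using l2 by (intro finite_nth_roots) simp
 thus ?thesis by (simp add: critical_def)
qed

text \<open>Values are large near 0 and near infinity, so preimages of points near w remain in a
  compact annulus. Hence they all lie near the finite fibre, on small discs where the map is
  injective.\<close>

lemma covering_f: "covering_space {z. z ~= 0 & f z \<notin> f ` critical} f (- (f ` critical))"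
proof
 show "continuous_on {z. z ~= 0 & f z \<notin> f ` critical} f" by (rule f_continuous) simp
 have opS: "open (- (f ` critical))" using finite_critical by (simp add: finite_imp_closed open_Compl)
 show "f ` {z. z ~= 0 & f z \<notin> f ` critical} = - (f ` critical)"
 proof (intro equalityI subsetI)
  fix w assume "w \<in> - (f ` critical)"
  thus "w \<in> f ` {z. z ~= 0 & f z \<notin> f ` critical}" using polynomial_root[of w] by auto
 qed auto
 fix w assume w: "w \<in> - (f ` critical)"
 define Fb where "Fb = {z. z ~= 0 & f z = w}"
 have fin: "finite Fb" unfolding Fb_def by (rule finite_fiber)
 have "\<exists>r>0. 0 \<notin> ball z r & inj_on f (ball z r)" if z: "z \<in> Fb" for z
 proof -
  have z0: "z ~= 0" "z \<notin> critical" using z w by (auto simp: Fb_def)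
  have "deriv f z = df z" using f_has_derivative[OF z0(1)] by (rule DERIV_imp_deriv)
  hence d: "deriv f z ~= 0" using df_zero[OF z0(1)] z0(2) by simp
  obtain r where "r > 0" "ball z r <= - {0}" "inj_on f (ball z r)" using has_complex_derivative_locally_injective[OF f_holomorphic[of "- {0}"] _ _ d] z0(1) by auto
  thus ?thesis by blast
 qed
 then obtain rr where rr: "!!z. z \<in> Fb ==> rr z > 0 & 0 \<notin> ball z (rr z) & inj_on f (ball z (rr z))" by metis
 \<comment> \<open>A radius below all injectivity radii and below half of all distances between
   fibre points gives disjoint discs.\<close>
 define ds where "ds = rr ` Fb \<union> (%(z,z'). dist z z' / 2) ` {(z,z'). z \<in> Fb & z' \<in> Fb & z ~= z'}"
 have "finite {(z,z'). z \<in> Fb & z' \<in> Fb & z ~= z'}" by (rule finite_subset[of _ "Fb \<times> Fb"]) (use fin in auto)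
 hence "finite ds" unfolding ds_def using fin by blast
 moreover have "\<forall>x\<in>ds. x > 0" using rr by (auto simp: ds_def)
 ultimately obtain r where r: "r > 0" "\<forall>x\<in>ds. r <= x"
  using finite_set_avoid[of "{}"] by (metis (no_types, opaque_lifting) Min_gr_iff Min_le empty_iff zero_less_one)
 have rb: "0 \<notin> ball z r" "inj_on f (ball z r)" if "z \<in> Fb" for z
 proof -
  have "ball z r <= ball z (rr z)" using r(2) that by (intro subset_ball) (auto simp: ds_def)
  thus "0 \<notin> ball z r" "inj_on f (ball z r)" using rr[OF that] inj_on_subset by blast+
 qed
 have disj: "ball z r \<inter> ball z' r = {}" if "z \<in> Fb" "z' \<in> Fb" "z ~= z'" for z z'
 proof -
  have "dist z z' / 2 \<in> ds" using that by (auto simp: ds_def)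
  hence "2 * r <= dist z z'" using r(2) by fastforce
  thus ?thesis by (intro disjoint_ballI) simp
 qed
 \<comment> \<open>The part of the compact annulus outside the discs. Its image is closed and misses
   w, so a neighbourhood T of w has no preimages there.\<close>
 define A where "A = (cball 0 (max R (cmod w + 2)) - ball 0 (\<epsilon> (cmod w + 1))) - (\<Union>z\<in>Fb. ball z r)"
 have A0: "0 \<notin> A" using eps_pos[of "cmod w + 1"] by (simp add: A_def)
 have "compact A" unfolding A_def by (intro compact_diff compact_cball open_ball open_UN) auto
 hence "compact (f ` A)" by (intro compact_continuous_image f_continuous A0)
 hence clA: "closed (f ` A)" by (rule compact_imp_closed)
 have wA: "w \<notin> f ` A"
 proof
  assume "w \<in> f ` A"
  then obtain z where z: "z \<in> A" "w = f z" by blast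
  hence "z \<in> Fb" using A0 by (auto simp: Fb_def)
  thus False using z(1) r(1) by (auto simp: A_def)
 qed
 define T where "T = (ball w 1 \<inter> - (f ` critical)) \<inter> (- (f ` A)) \<inter> (\<Inter>z\<in>Fb. f ` ball z r)"
 have opim: "open (f ` ball z r)" if "z \<in> Fb" for z using rb[OF that] by (intro invariance_of_domain f_continuous) auto
 have opT: "open T" unfolding T_def using opS clA opim fin by (intro open_Int open_ball open_INT) auto
 have wT: "w \<in> T" using w wA r(1) by (auto simp: T_def Fb_def)
 define v where "v = (%z. ball z r \<inter> f -` T) ` Fb"
 have opv: "open (ball z r \<inter> f -` T)" if "z \<in> Fb" for z by (rule continuous_open_preimage[OF f_continuous open_ball opT]) (use rb[OF that] in auto)
 have "\<Union>v = {z. z ~= 0 & f z \<notin> f ` critical} \<inter> f -` T"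
 proof (intro equalityI subsetI)
  fix z assume "z \<in> \<Union>v"
  thus "z \<in> {z. z ~= 0 & f z \<notin> f ` critical} \<inter> f -` T" using rb by (auto simp: v_def T_def)
 next
  fix z assume z: "z \<in> {z. z ~= 0 & f z \<notin> f ` critical} \<inter> f -` T"
  have fz: "cmod (f z) < cmod w + 1" using z norm_triangle_sub[of "f z" w] by (auto simp: T_def dist_norm norm_minus_commute)
  have 1: "\<epsilon> (cmod w + 1) <= cmod z" using f_small[of z "cmod w + 1"] z fz by force
  have 2: "cmod z <= max R (cmod w + 2)"
  proof (rule ccontr)
   assume "\<not> ?thesis"
   hence "R <= cmod z" "cmod w + 2 < cmod z" by auto
   thus False using f_big[of z] fz norm_ge_zero[of w] by linarith
  qed
  have "z \<notin> A" using z by (auto simp: T_def)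
  moreover have "z \<in> cball 0 (max R (cmod w + 2)) - ball 0 (\<epsilon> (cmod w + 1))" using 1 2 by (simp add: dist_norm)
  ultimately obtain z' where "z' \<in> Fb" "z \<in> ball z' r" unfolding A_def by blast
  thus "z \<in> \<Union>v" using z unfolding v_def by blast
 qed
 moreover have "openin (top_of_set {z. z ~= 0 & f z \<notin> f ` critical}) u" if "u \<in> v" for u
 proof -
  obtain z where z: "z \<in> Fb" "u = ball z r \<inter> f -` T" using \<open>u \<in> v\<close> by (auto simp: v_def)
  have "u <= {z. z ~= 0 & f z \<notin> f ` critical}" using rb[OF z(1)] by (auto simp: z(2) T_def)
  thus ?thesis using opv[OF z(1)] by (simp add: z(2) open_subset)
 qed
 moreover have "pairwise disjnt v" using disj by (auto simp: v_def pairwise_def disjnt_def)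
 moreover have "\<exists>q. homeomorphism u T f q" if "u \<in> v" for u
 proof -
  obtain z where z: "z \<in> Fb" "u = ball z r \<inter> f -` T" using \<open>u \<in> v\<close> by (auto simp: v_def)
  have "0 \<notin> u" "inj_on f u" using rb[OF z(1)] by (auto simp: z(2) inj_on_def)
  moreover have "f ` u = T"
  proof -
   have "T <= f ` ball z r" using z(1) by (auto simp: T_def)
   thus ?thesis unfolding z(2) by blast
  qed
  moreover have "open u" using opv[OF z(1)] by (simp add: z(2))
  ultimately have u: "open u" "continuous_on u f" "inj_on f u" "f ` u = T" using f_continuous[of u] by auto
  obtain q where "homeomorphism u (f ` u) f q" by (rule invariance_of_domain_homeomorphism[OF u(1,2) order_refl u(3)])
  thus ?thesis unfolding u(4) by blast
 qed
 ultimately show "\<exists>T. w \<in> T & openin (top_of_set (- (f ` critical))) T &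
    (\<exists>v. \<Union>v = {z. z ~= 0 & f z \<notin> f ` critical} \<inter> f -` T & (\<forall>u\<in>v. openin (top_of_set {z. z ~= 0 & f z \<notin> f ` critical}) u) &
     pairwise disjnt v & (\<forall>u\<in>v. \<exists>q. homeomorphism u T f q))"
  using wT opT by (intro exI[of _ T] conjI exI[of _ v]) (auto simp: T_def intro: open_subset)
qed

definition postcritical :: "complex set" where "postcritical = {(f ^^ Suc k) \<omega> |k \<omega>. \<omega> \<in> critical}"

lemma postcritical_not_critical_value: "(f ^^ n) x \<notin> postcritical ==> x \<notin> f ` critical"
proof
 assume a: "(f ^^ n) x \<notin> postcritical" "x \<in> f ` critical"
 then obtain \<omega> where "\<omega> \<in> critical" "x = f \<omega>" by blast
 hence "(f ^^ n) x = (f ^^ Suc n) \<omega>" by (simp add: funpow_swap1)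
 thus False using a(1) \<open>\<omega> \<in> critical\<close> unfolding postcritical_def by blast
qed

text \<open>The lift is made one step at a time: N avoids the postcritical set, so every
  intermediate branch avoids the critical values and lifts through the covering.\<close>

lemma inverse_branch_continuous:
 assumes N: "convex N" "N \<inter> postcritical = {}" "y \<in> N" and a: "(f ^^ n) a = y" "!!k. k < n ==> (f ^^ k) a ~= 0"
 shows "\<exists>g. continuous_on N g & g y = a & (\<forall>x\<in>N. (f ^^ n) (g x) = x & (\<forall>k<n. (f ^^ k) (g x) ~= 0))"
 using a
proof (induction n arbitrary: a)
 case 0
 thus ?case by (intro exI[of _ id]) auto
next
 case (Suc n)
 have "(f ^^ n) (f a) = y" "(f ^^ k) (f a) ~= 0" if "k < n" for k using Suc.prems(1) Suc.prems(2)[of "Suc k"] that by (simp_all add: funpow_swap1)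
 hence "\<exists>g. continuous_on N g & g y = f a & (\<forall>x\<in>N. (f ^^ n) (g x) = x & (\<forall>k<n. (f ^^ k) (g x) ~= 0))"
  using Suc.prems by (intro Suc.IH) (auto simp: funpow_swap1)
 then obtain g where g: "continuous_on N g" "g y = f a" "!!x. x \<in> N ==> (f ^^ n) (g x) = x"
   "!!x k. x \<in> N ==> k < n ==> (f ^^ k) (g x) ~= 0" by blast
 have cv: "g x \<notin> f ` critical" if "x \<in> N" for x using postcritical_not_critical_value[of n "g x"] g(3)[OF that] that N(2) by auto
 have a0: "a ~= 0" using Suc.prems(2)[of 0] by simp
 have "a \<in> {z. z ~= 0 & f z \<notin> f ` critical}" using a0 cv[OF N(3)] g(2) by auto
 from covering_space_lift_strong[OF covering_f this N(3) convex_imp_simply_connected[OF N(1)] convex_imp_locally_path_connected[OF N(1)] g(1) _ g(2)] cv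
 obtain h where h: "continuous_on N h" "h \<in> N \<rightarrow> {z. z ~= 0 & f z \<notin> f ` critical}" "h y = a" "!!x. x \<in> N ==> f (h x) = g x" by blast
 have "(f ^^ Suc n) (h x) = x & (\<forall>k<Suc n. (f ^^ k) (h x) ~= 0)" if "x \<in> N" for x
 proof
  show "(f ^^ Suc n) (h x) = x" using h(4) g(3) that by (simp add: funpow_swap1)
  have "h x ~= 0" using h(2) that by auto
  show "\<forall>k<Suc n. (f ^^ k) (h x) ~= 0"
  proof (intro allI impI)
   fix k assume "k < Suc n"
   thus "(f ^^ k) (h x) ~= 0" using \<open>h x ~= 0\<close> g(4)[OF that, of "k - 1"] h(4)[OF that] by (cases k) (auto simp: funpow_swap1)
  qed
 qed
 thus ?case using h by blast
qed

definition dn :: "nat => complex => complex" where "dn n z = (\<Prod>k<n. df ((f ^^ k) z))"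

lemma funpow_has_derivative:
 "(!!k. k < n ==> (f ^^ k) z ~= 0) ==> ((f ^^ n) has_field_derivative dn n z) (at z)"
proof (induction n)
 case 0 thus ?case by (simp add: dn_def id_def)
next
 case (Suc n)
 have "((f ^^ n) has_field_derivative dn n z) (at z)" using Suc by simp
 hence "((%x. f ((f ^^ n) x)) has_field_derivative (df ((f ^^ n) z) * dn n z)) (at z)" using Suc.prems by (intro DERIV_chain2[OF f_has_derivative]) auto
 thus ?case by (simp add: dn_def mult.commute o_def)
qed

lemma inverse_branch:
 assumes N: "convex N" "open N" "N \<inter> postcritical = {}" "y \<in> N" and a: "(f ^^ n) a = y" "!!k. k < n ==> (f ^^ k) a ~= 0"
 obtains g where "g holomorphic_on N" "g y = a" "!!x. x \<in> N ==> (f ^^ n) (g x) = x" "!!x k. x \<in> N ==> k < n ==> (f ^^ k) (g x) ~= 0"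
  "inj_on g N" "deriv g y = inverse (dn n a)" "dn n a ~= 0"
proof -
 obtain g where g: "continuous_on N g" "g y = a" "!!x. x \<in> N ==> (f ^^ n) (g x) = x"
   "!!x k. x \<in> N ==> k < n ==> (f ^^ k) (g x) ~= 0" using inverse_branch_continuous[OF N(1,3,4) a] by blast
 have nz: "dn n (g x) ~= 0" if x: "x \<in> N" for x
 proof
  assume "dn n (g x) = 0"
  then obtain k where k: "k < n" "df ((f ^^ k) (g x)) = 0" by (auto simp: dn_def)
  hence c: "(f ^^ k) (g x) \<in> critical" using df_zero g(4)[OF x] by blast
  have "x = (f ^^ n) (g x)" using g(3)[OF x] by simp
  also have "n = Suc (n - Suc k) + k" using k by simp
  also have "(f ^^ (Suc (n - Suc k) + k)) (g x) = (f ^^ Suc (n - Suc k)) ((f ^^ k) (g x))" by (simp only: funpow_add o_apply)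
  finally have "x \<in> postcritical" using c unfolding postcritical_def by blast
  thus False using x N(3) by blast
 qed
 have der: "(g has_field_derivative inverse (dn n (g x))) (at x)" if x: "x \<in> N" for x
 proof (rule has_field_derivative_inverse_basic[OF _ nz[OF x] _ N(2) x])
  show "((f ^^ n) has_field_derivative dn n (g x)) (at (g x))" using g(4)[OF x] by (rule funpow_has_derivative)
  show "isCont g x" using g(1) N(2) x by (simp add: continuous_on_eq_continuous_at)
 qed (use g(3) in auto)
 have "inj_on g N" by (rule inj_onI) (metis g(3))
 moreover have "g holomorphic_on N" using der N(2) holomorphic_on_open by blast
 ultimately show thesis using that g nz[OF N(4)] DERIV_imp_deriv[OF der[OF N(4)]] by blast
qed

end

lemma uniform_limit_moving:
 fixes h :: "'a::metric_space => 'b::metric_space"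
 assumes ul: "uniform_limit S F h sequentially" and c: "continuous_on S h" and x: "x \<longlonglongrightarrow> a" "!!n. x n \<in> S" "a \<in> S"
 shows "(%n. F n (x n)) \<longlonglongrightarrow> h a"
proof (rule tendstoI)
 fix e assume e: "(e::real) > 0"
 have "(%n. h (x n)) \<longlonglongrightarrow> h a" by (rule continuous_on_tendsto_compose[OF c x(1,3)]) (use x(2) in auto)
 hence "\<forall>\<^sub>F n in sequentially. dist (h (x n)) (h a) < e / 2" using e by (intro tendstoD) auto
 moreover have "\<forall>\<^sub>F n in sequentially. \<forall>y\<in>S. dist (F n y) (h y) < e / 2" by (rule uniform_limitD[OF ul]) (use e in auto)
 ultimately show "\<forall>\<^sub>F n in sequentially. dist (F n (x n)) (h a) < e"
 proof eventually_elim
  case (elim n)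
  have "dist (F n (x n)) (h (x n)) < e / 2" using elim(2) x(2) by blast
  thus ?case using elim(1) dist_triangle[of "F n (x n)" "h a" "h (x n)"] by linarith
 qed
qed

text \<open>An orbit that leaves the annulus near the pole is thrown beyond R in the next step and
  then stays there. The value 0 marks orbits that hit the pole, by the convention f 0 = 0.\<close>

lemma (in singular_map) exit:
 assumes "z \<notin> K" shows "\<exists>k. \<forall>j. (f ^^ (k + j)) z = 0 \<or> R < cmod ((f ^^ (k + j)) z)"
proof -
 obtain k where k: "(f ^^ k) z \<notin> annulus" using assms by (auto simp: K_def)
 define w where "w = (f ^^ k) z"
 have big: "R < cmod ((f ^^ j) u)" if "R < cmod u" for j u using iter_big'[of u j] that by linarith
 have it: "(f ^^ (Suc k + j)) z = (f ^^ j) (f w)" for j unfolding w_def by (simp only: add.commute[of "Suc k"] funpow_add o_apply funpow.simps)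
 have "f w = 0 \<or> R < cmod (f w)"
 proof (cases "w = 0")
  case False
  have "cmod w < \<epsilon> R \<or> R < cmod w" using k by (auto simp: annulus_def w_def)
  thus ?thesis using f_small[OF False] big[of w 1] by auto
 qed (simp add: f_zero)
 hence "(f ^^ j) (f w) = 0 \<or> R < cmod ((f ^^ j) (f w))" for j using big funpow_f_zero by metis
 thus ?thesis using it by (intro exI[of _ "Suc k"]) simp
qed

lemma (in singular_map) K_less: "z \<in> K ==> cmod z < R" using K_props(2)[of z] K_props(2)[OF K_forward, of z] f_big[of z] R3 by linarith

section \<open>Expansion on the non-escaping set\<close>

locale escaping_map = singular_map +
 assumes escape: "critical \<inter> K = {}"
begin

text \<open>Each of the finitely many critical orbits contributes finitely many points before it
  escapes. So the postcritical set lies in a closed set disjoint from the compact set K.\<close>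

lemma postcritical_away: "\<exists>\<delta>>0. \<delta> <= 1 & (\<forall>a\<in>K. \<forall>x. dist a x < \<delta> --> x \<notin> postcritical & x ~= 0)"
proof -
 have "\<forall>\<omega>\<in>critical. \<exists>k. \<forall>j. (f ^^ (k + j)) \<omega> = 0 \<or> R < cmod ((f ^^ (k + j)) \<omega>)" using exit escape by blast
 then obtain k where k: "!!\<omega> j. \<omega> \<in> critical ==> (f ^^ (k \<omega> + j)) \<omega> = 0 \<or> R < cmod ((f ^^ (k \<omega> + j)) \<omega>)" by metis
 define F where "F = (\<Union>\<omega>\<in>critical. (%j. (f ^^ j) \<omega>) ` {..k \<omega>})"
 define Q where "Q = insert 0 F \<union> {x. R <= cmod x}"
 have "finite F" unfolding F_def using finite_critical by auto
 moreover have "closed {x. R <= cmod x}" by (intro closed_Collect_le continuous_intros)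
 ultimately have clQ: "closed Q" unfolding Q_def by (intro closed_Un closed_insert) (auto intro: finite_imp_closed)
 have "K \<inter> Q = {}"
 proof (rule ccontr)
  assume "K \<inter> Q ~= {}"
  then obtain x where x: "x \<in> K" "x \<in> Q" by blast
  \<comment> \<open>Strictness in \<open>K_less\<close> matters, since Q contains the circle of
    radius R.\<close>
  hence "x \<in> F" using K_less[OF x(1)] K_props(1)[OF x(1)] by (auto simp: Q_def)
  then obtain \<omega> j where "\<omega> \<in> critical" "x = (f ^^ j) \<omega>" by (auto simp: F_def)
  thus False using x(1) K_funpow_backward escape by blast
 qed
 then obtain d where d: "d > 0" "!!x y. x \<in> K ==> y \<in> Q ==> d <= dist x y" using separate_compact_closed[OF compact_K clQ] by blast
 have PQ: "postcritical <= Q"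
 proof
  fix x assume "x \<in> postcritical"
  then obtain j \<omega> where x: "\<omega> \<in> critical" "x = (f ^^ Suc j) \<omega>" unfolding postcritical_def by blast
  show "x \<in> Q"
  proof (cases "Suc j <= k \<omega>")
   case True hence "x \<in> F" unfolding F_def using x by blast
   thus ?thesis by (simp add: Q_def)
  next
   case False
   hence "x = (f ^^ (k \<omega> + (Suc j - k \<omega>))) \<omega>" using x(2) by simp
   thus ?thesis using k[OF x(1), of "Suc j - k \<omega>"] by (auto simp: Q_def)
  qed
 qed
 show ?thesis
 proof (intro exI[of _ "min d 1"] conjI ballI allI impI)
  fix a x assume a: "a \<in> K" "dist a x < min d 1"
  hence "x \<notin> Q" using d(2)[OF a(1), of x] by auto
  thus "x \<notin> postcritical" "x ~= 0" using PQ by (auto simp: Q_def)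
 qed (use d in auto)
qed

definition \<delta>0 :: real where "\<delta>0 = (SOME \<delta>. \<delta> > 0 & \<delta> <= 1 & (\<forall>a\<in>K. \<forall>x. dist a x < \<delta> --> x \<notin> postcritical & x ~= 0))"

lemma delta0: "\<delta>0 > 0" "\<delta>0 <= 1" "a \<in> K ==> dist a x < \<delta>0 ==> x \<notin> postcritical" "a \<in> K ==> dist a x < \<delta>0 ==> x ~= 0"
 using someI_ex[OF postcritical_away, folded \<delta>0_def] by blast+

lemma branch_orbit_bounded:
 assumes "(f ^^ n) z = x" "cmod x <= R + 1" "k <= n" shows "cmod ((f ^^ k) z) <= R + 1"
proof (rule ccontr)
 assume a: "\<not> cmod ((f ^^ k) z) <= R + 1"
 have "x = (f ^^ (n - k)) ((f ^^ k) z)" using assms(1,3) by (simp only: funpow_add[symmetric, THEN fun_cong, unfolded o_apply] le_add_diff_inverse2)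
 hence "cmod ((f ^^ k) z) <= cmod x" using a iter_big'[of "(f ^^ k) z" "n - k"] by simp
 thus False using a assms(2) by linarith
qed

text \<open>Orbit points of the branches are bounded, because moduli grow beyond R, and they stay
  away from 0, because their successors are bounded. Both properties pass to the limit.\<close>

lemma limit_branch_in_K:
 assumes g: "!!n x. x \<in> N ==> (f ^^ r n) (g n x) = x" "!!n x k. x \<in> N ==> k < r n ==> (f ^^ k) (g n x) ~= 0"
  and N: "!!x. x \<in> N ==> cmod x <= R + 1" and r: "filterlim r at_top sequentially"
  and lim: "!!x. x \<in> N ==> (%n. g n x) \<longlonglongrightarrow> h x" and x: "x \<in> N"
 shows "h x \<in> K"
proof (rule bounded_orbit_in_K)
 have ev: "\<forall>\<^sub>F n in sequentially. k + 1 < r n" for k using r unfolding filterlim_at_top by (metis (mono_tags, lifting) Suc_eq_plus1 Suc_le_eq eventually_mono)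
 have bounds: "(f ^^ k) (h x) ~= 0 & cmod ((f ^^ k) (h x)) <= R + 1" if L: "(%n. (f ^^ k) (g n x)) \<longlonglongrightarrow> (f ^^ k) (h x)" for k
 proof -
  have "\<forall>\<^sub>F n in sequentially. cmod ((f ^^ k) (g n x)) <= R + 1 & \<epsilon> (R + 1) <= cmod ((f ^^ k) (g n x))" using ev[of k]
  proof eventually_elim
   case (elim n)
   have "cmod ((f ^^ Suc k) (g n x)) <= R + 1" "cmod ((f ^^ k) (g n x)) <= R + 1" using elim by (intro branch_orbit_bounded[OF g(1)[OF x] N[OF x]], simp)+
   thus ?case using f_small[of "(f ^^ k) (g n x)" "R + 1"] g(2)[OF x, of k n] elim by force
  qed
  hence E: "\<forall>\<^sub>F n in sequentially. cmod ((f ^^ k) (g n x)) <= R + 1" "\<forall>\<^sub>F n in sequentially. \<epsilon> (R + 1) <= cmod ((f ^^ k) (g n x))"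
   by (auto elim: eventually_mono)
  show ?thesis using tendsto_upperbound[OF tendsto_norm[OF L] E(1)] tendsto_lowerbound[OF tendsto_norm[OF L] E(2)] eps_pos(1)[of "R + 1"] by auto
 qed
 have main: "(%n. (f ^^ k) (g n x)) \<longlonglongrightarrow> (f ^^ k) (h x)" for k
 proof (induction k)
  case 0
  thus ?case using lim[OF x] by simp
 next
  case (Suc k)
  have "isCont f ((f ^^ k) (h x))" using f_has_derivative bounds[OF Suc] by (blast intro: DERIV_isCont)
  thus ?case using Suc isCont_tendsto_compose by fastforce
 qed
 show "(f ^^ k) (h x) ~= 0 & cmod ((f ^^ k) (h x)) <= R + 1" for k by (rule bounds[OF main])
qed

text \<open>Otherwise the inverse branches, continued along a segment in K from a limit point of the orbit to a nearest frontier point of K, would have a nonconstant Montel limit with values in K; its image is open, but frontier points are mapped to frontier points.\<close>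
lemma dn_unbounded:
 assumes a: "a \<in> K" shows "\<exists>n. B < cmod (dn n a)"
proof (rule ccontr)
 assume "\<not> (\<exists>n. B < cmod (dn n a))"
 hence B: "cmod (dn n a) <= B" for n by (simp add: not_less)
 have B1: "B >= 1" using B[of 0] by (simp add: dn_def)
 define y where "y n = (f ^^ n) a" for n
 have yK: "y n \<in> K" for n using K_funpow[OF a] by (simp add: y_def)
 obtain q r where q: "q \<in> K" "strict_mono (r :: nat => nat)" "(y \<circ> r) \<longlonglongrightarrow> q"
  using seq_compactE[OF compact_imp_seq_compact[OF compact_K], of y] yK by blast
 have clF: "closed (frontier K)" by simp
 have "K ~= UNIV" using K_props(1) by blast
 hence "frontier K ~= {}" using q(1) frontier_eq_empty[of K] by auto
 then obtain p where p: "p \<in> frontier K" "!!x. x \<in> frontier K ==> dist q p <= dist q x" using distance_attains_inf[OF clF] by metis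
 have FK: "frontier K <= K" using compact_K by (simp add: compact_imp_closed frontier_subset_closed)
 \<comment> \<open>A point of the segment outside K would give a frontier point strictly closer to q
   than p.\<close>
 have seg: "closed_segment q p <= K"
 proof
  fix x assume x: "x \<in> closed_segment q p"
  show "x \<in> K"
  proof (cases "x = p")
   case True thus ?thesis using p(1) FK by blast
  next
   case False
   have "dist q x < dist q p"
   proof -
    have "dist q p = dist q x + dist x p" using x by (simp add: between_mem_segment[symmetric] between)
    thus ?thesis using False by simp
   qed
   hence xb: "x \<in> ball q (dist q p)" "q \<in> ball q (dist q p)" using le_less_trans[OF zero_le_dist] by auto
   show ?thesis
   proof (rule ccontr)
    assume "x \<notin> K"
    hence "ball q (dist q p) \<inter> frontier K ~= {}" using xb q(1) \<open>x \<notin> K\<close> by (intro connected_Int_frontier connected_ball) blast+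
    thus False using p(2) by fastforce
   qed
  qed
 qed
 \<comment> \<open>The \<delta>0-neighbourhood of the segment: convex, hence simply connected, and
   free of postcritical points.\<close>
 define N where "N = (\<Union>x\<in>closed_segment q p. \<Union>z\<in>ball 0 \<delta>0. {x + z})"
 have N1: "convex N" unfolding N_def by (intro convex_sums) auto
 have N2: "open N" unfolding N_def by (intro open_sums) auto
 have Nin: "x \<in> N" if "s \<in> closed_segment q p" "dist s x < \<delta>0" for s x
  unfolding N_def using that by (intro UN_I[of s] UN_I[of "x - s"]) (auto simp: dist_norm norm_minus_commute)
 have Nout: "\<exists>s\<in>closed_segment q p. dist s x < \<delta>0" if x: "x \<in> N" for x
 proof -
  obtain s z where "s \<in> closed_segment q p" "z \<in> ball 0 \<delta>0" "x = s + z" using x unfolding N_def by blast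
  thus ?thesis by (intro bexI[of _ s]) (auto simp: dist_norm)
 qed
 have N3: "N \<inter> postcritical = {}" using Nout delta0(3) seg by blast
 have NB: "cmod x <= R + 1" if xN: "x \<in> N" for x
 proof -
  obtain s where s: "s \<in> K" "dist s x < \<delta>0" using Nout[OF xN] seg by blast
  show ?thesis using s(2) K_props(2)[OF s(1)] delta0(2) norm_triangle_sub[of x s] by (simp add: dist_norm norm_minus_commute)
 qed
 have qN: "q \<in> N" "p \<in> N" using delta0(1) by (auto intro: Nin[of q] Nin[of p])
 have "\<forall>\<^sub>F n in sequentially. dist ((y \<circ> r) n) q < \<delta>0 / 2" by (rule tendstoD[OF q(3)]) (use delta0(1) in auto)
 then obtain n0 where n0: "!!n. n >= n0 ==> dist (y (r n)) q < \<delta>0 / 2" by (auto simp: eventually_sequentially)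
 define t where "t n = r (n + n0)" for n
 have t: "dist (y (t n)) q < \<delta>0 / 2" for n using n0 by (simp add: t_def)
 have tN: "ball (y (t n)) (\<delta>0 / 2) <= N" for n
 proof
  fix x assume "x \<in> ball (y (t n)) (\<delta>0 / 2)"
  hence "dist q x < \<delta>0" using t[of n] dist_triangle[of q x "y (t n)"] by (simp add: dist_commute)
  thus "x \<in> N" by (intro Nin[of q]) auto
 qed
 have yN: "y (t n) \<in> N" for n using tN[of n] delta0(1) by auto
 have tm: "strict_mono t" using q(2) by (auto simp: t_def strict_mono_def)
 have yt: "(%n. y (t n)) \<longlonglongrightarrow> q" using LIMSEQ_ignore_initial_segment[OF q(3), of n0] by (simp add: t_def)
 have "\<exists>g. g holomorphic_on N & g (y (t n)) = a & (\<forall>x\<in>N. (f ^^ t n) (g x) = x) & (\<forall>x\<in>N. \<forall>k<t n. (f ^^ k) (g x) ~= 0)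
  & inj_on g N & deriv g (y (t n)) = inverse (dn (t n) a)" for n by (rule inverse_branch[OF N1 N2 N3 yN y_def[symmetric] K_funpow_nz[OF a]]) blast
 then obtain g where g: "!!n. g n holomorphic_on N" "!!n. g n (y (t n)) = a" "!!n x. x \<in> N ==> (f ^^ t n) (g n x) = x"
  "!!n x k. x \<in> N ==> k < t n ==> (f ^^ k) (g n x) ~= 0" "!!n. inj_on (g n) N" "!!n. deriv (g n) (y (t n)) = inverse (dn (t n) a)" by metis
 have gB: "cmod (g n x) <= R + 1" if "x \<in> N" for n x using branch_orbit_bounded[OF g(3)[OF that] NB[OF that], of 0 n] by simp
 obtain h s where h: "h holomorphic_on N" "strict_mono (s :: nat => nat)" "!!x. x \<in> N ==> (%n. g (s n) x) \<longlonglongrightarrow> h x"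
   "!!K. compact K ==> K <= N ==> uniform_limit K (g \<circ> s) h sequentially"
 proof (rule Montel[OF N2, of "range g" g])
  show "\<exists>B. \<forall>h\<in>range g. \<forall>z\<in>C. cmod (h z) <= B" if "compact C" "C <= N" for C using gB that(2) by blast
 qed (use g(1) in auto)
 have ts: "filterlim (%n. t (s n)) at_top sequentially" using filterlim_subseq[OF strict_mono_o[OF tm h(2)]] by (simp add: o_def)
 have hK: "h x \<in> K" if "x \<in> N" for x by (rule limit_branch_in_K[of N "%n. t (s n)" "%n. g (s n)" h, OF g(3) g(4) NB ts h(3) that])
 obtain \<kappa> where \<kappa>: "\<kappa> >= 1" "!!g y \<delta> z. \<delta> > 0 ==> g holomorphic_on ball y \<delta> ==> inj_on g (ball y \<delta>) ==>
   cmod (z - y) <= \<delta> / 8 ==> cmod (z - y) * cmod (deriv g y) / \<kappa> <= cmod (g z - g y)" using koebe_distortion by metis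
 \<comment> \<open>A Koebe disc of radius \<delta>0 / 2 about y (t n) allows displacements up to one
   eighth of it.\<close>
 define e where "e = \<delta>0 / 16"
 have e: "e > 0" using delta0(1) by (simp add: e_def)
 \<comment> \<open>Bounded derivatives of the iterates mean inverse derivatives of modulus at least
   1 / B; Koebe turns this into a displacement that survives in the limit, so the limit is not
   constant.\<close>
 have low: "e / (B * \<kappa>) <= cmod (g n (y (t n) + of_real e) - a)" for n
 proof -
  have "cmod ((y (t n) + of_real e) - y (t n)) * cmod (deriv (g n) (y (t n))) / \<kappa> <= cmod (g n (y (t n) + of_real e) - g n (y (t n)))"
   by (rule \<kappa>(2)[of "\<delta>0 / 2"]) (insert delta0(1) holomorphic_on_subset[OF g(1) tN] inj_on_subset[OF g(5) tN] e, auto simp: e_def)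
  hence 1: "e * inverse (cmod (dn (t n) a)) / \<kappa> <= cmod (g n (y (t n) + of_real e) - a)" using g(2,6) e by (simp add: norm_inverse)
  have "dn (t n) a ~= 0" by (rule inverse_branch[OF N1 N2 N3 yN y_def[symmetric] K_funpow_nz[OF a]]) blast
  hence "inverse B <= inverse (cmod (dn (t n) a))" using B[of "t n"] by (intro le_imp_inverse_le) auto
  hence "e * inverse B / \<kappa> <= e * inverse (cmod (dn (t n) a)) / \<kappa>" using e \<kappa>(1) by (intro divide_right_mono mult_left_mono) auto
  thus ?thesis using 1 by (simp add: field_simps)
 qed
 have cq: "cball q (3 * \<delta>0 / 4) <= N"
 proof
  fix x assume "x \<in> cball q (3 * \<delta>0 / 4)"
  thus "x \<in> N" using delta0(1) by (intro Nin[of q]) auto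
 qed
 have ch: "continuous_on (cball q (3 * \<delta>0 / 4)) h" by (rule holomorphic_on_imp_continuous_on[OF holomorphic_on_subset[OF h(1) cq]])
 have ul: "uniform_limit (cball q (3 * \<delta>0 / 4)) (g \<circ> s) h sequentially" by (rule h(4)) (use cq in auto)
 have ys: "(%n. y (t (s n))) \<longlonglongrightarrow> q" using LIMSEQ_subseq_LIMSEQ[OF yt h(2)] by (simp add: o_def)
 have yc: "y (t (s n)) \<in> cball q (3 * \<delta>0 / 4)" for n using t[of "s n"] delta0(1) by (simp add: dist_commute)
 have "(%n. (g \<circ> s) n (y (t (s n)))) \<longlonglongrightarrow> h q" by (rule uniform_limit_moving[OF ul ch ys yc]) (use delta0(1) in auto)
 hence "(%n. a) \<longlonglongrightarrow> h q" using g(2) by simp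
 hence hq: "h q = a" by (simp add: LIMSEQ_const_iff)
 have "(%n. (g \<circ> s) n (y (t (s n)) + of_real e)) \<longlonglongrightarrow> h (q + of_real e)"
 proof (rule uniform_limit_moving[OF ul ch])
  show "(%n. y (t (s n)) + of_real e) \<longlonglongrightarrow> q + of_real e" by (intro tendsto_intros ys)
  show "q + of_real e \<in> cball q (3 * \<delta>0 / 4)" using delta0(1) by (simp add: e_def dist_norm)
  show "y (t (s n)) + of_real e \<in> cball q (3 * \<delta>0 / 4)" for n
  proof -
   have "dist q (y (t (s n)) + of_real e) <= dist q (y (t (s n))) + dist (y (t (s n))) (y (t (s n)) + of_real e)" by (rule dist_triangle)
   also have "dist (y (t (s n))) (y (t (s n)) + of_real e) = e" using e by (simp add: dist_norm)
   finally show ?thesis using t[of "s n"] delta0(1) by (simp add: dist_commute e_def)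
  qed
 qed
 hence "(%n. cmod (g (s n) (y (t (s n)) + of_real e) - a)) \<longlonglongrightarrow> cmod (h (q + of_real e) - a)" by (auto intro!: tendsto_intros)
 hence "e / (B * \<kappa>) <= cmod (h (q + of_real e) - a)" using low by (intro LIMSEQ_le_const) auto
 moreover have "e / (B * \<kappa>) > 0" using e B1 \<kappa>(1) by simp
 ultimately have ne: "h (q + of_real e) ~= h q" using hq by auto
 have "q + of_real e \<in> N" using e delta0(1) by (intro Nin[of q]) (auto simp: e_def dist_norm)
 hence "\<not> h constant_on N" using ne qN(1) unfolding constant_on_def by metis
 hence oh: "open (h ` N)" using open_mapping_thm[OF h(1) N2 convex_connected[OF N1] N2 order_refl] by blast
 have "h ` N <= K" using hK by blast
 hence hpi: "h p \<in> interior K" using qN(2) by (intro interiorI[OF oh]) auto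
 have "\<forall>\<^sub>F n in sequentially. g (s n) p \<in> interior K" by (rule topological_tendstoD[OF h(3)[OF qN(2)] open_interior hpi])
 then obtain n where n: "g (s n) p \<in> interior K" by (auto dest: eventually_happens)
 have cg: "continuous_on N (g (s n))" by (rule holomorphic_on_imp_continuous_on[OF g(1)])
 have op: "open (N \<inter> g (s n) -` interior K)" by (rule continuous_open_preimage[OF cg N2 open_interior])
 \<comment> \<open>A point that the branch sends into K is the image of a point of K under an
   iterate, hence lies in K.\<close>
 have "N \<inter> g (s n) -` interior K <= K"
 proof
  fix x assume x: "x \<in> N \<inter> g (s n) -` interior K"
  hence "g (s n) x \<in> K" using interior_subset by blast
  thus "x \<in> K" using K_funpow[of "g (s n) x" "t (s n)"] g(3)[of x "s n"] x by simp
 qed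
 hence "p \<in> interior K" using n qN(2) by (intro interiorI[OF op]) auto
 thus False using p(1) by (simp add: frontier_def)
qed

text \<open>On a disc of radius d inside K all iterates are bounded by R, so Cauchy's estimate
  bounds their derivatives at the centre by R / d, against \<open>dn_unbounded\<close>.\<close>

lemma interior_K: "interior K = {}"
proof (rule ccontr)
 assume "interior K ~= {}"
 then obtain a d where a: "d > 0" "cball a d <= K" by (meson ex_in_conv mem_interior_cball)
 have aK: "a \<in> K" using a by auto
 obtain n where n: "R / d < cmod (dn n a)" using dn_unbounded[OF aK] by blast
 have der: "((f ^^ n) has_field_derivative dn n z) (at z)" if "z \<in> cball a d" for z using funpow_has_derivative K_funpow_nz a(2) that by blast
 have "cmod ((deriv ^^ 1) (f ^^ n) a) <= fact 1 * R / d ^ 1"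
 proof (rule Cauchy_inequality)
  show "(f ^^ n) holomorphic_on ball a d" unfolding holomorphic_on_open[OF open_ball] using der by (meson ball_subset_cball subsetD)
  show "continuous_on (cball a d) (f ^^ n)" using der DERIV_isCont by (blast intro: continuous_at_imp_continuous_on)
  show "cmod ((f ^^ n) x) <= R" if "cmod (a - x) = d" for x using that a(2) K_props(2)[OF K_funpow[of x n]] by (auto simp: dist_norm)
 qed (rule a(1))
 moreover have "deriv (f ^^ n) a = dn n a" using der[of a] a(1) by (intro DERIV_imp_deriv) auto
 ultimately show False using n by simp
qed

text \<open>The conformal elevator: at every scale \<rho> below \<rho>0 some iterate carries the
  \<rho>-disc about a point of K to unit scale, with bi-Lipschitz constant L after rescaling. Its
  inverse g lives on a disc of fixed radius e.\<close>

definition elevates :: "real => real => real => bool" where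
 "elevates \<rho>0 L e \<longleftrightarrow> (\<forall>a\<in>K. \<forall>\<rho>. 0 < \<rho> & \<rho> < \<rho>0 --> (\<exists>n g. continuous_on (ball ((f ^^ n) a) e) g &
   (\<forall>x\<in>ball ((f ^^ n) a) e. (f ^^ n) (g x) = x & cmod (g x - a) <= L * \<rho> * cmod (x - (f ^^ n) a)) &
   (\<forall>w. cmod (w - a) < \<rho> --> (f ^^ n) w \<in> ball ((f ^^ n) a) e & g ((f ^^ n) w) = w &
    cmod (w - a) / (L * \<rho>) <= cmod ((f ^^ n) w - (f ^^ n) a) & cmod ((f ^^ n) w - (f ^^ n) a) <= L * cmod (w - a) / \<rho>)))"

text \<open>Stop at the first n at which the derivative reaches c / \<rho>. It exceeds this by at
  most the bound M of a single step, so it is comparable to 1 / \<rho>, and Koebe distortion does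
  the rest.\<close>

theorem elevator: "\<exists>\<rho>0 L e. \<rho>0 > 0 & L >= 1 & e > 0 & elevates \<rho>0 L e"
proof -
 obtain \<kappa> where \<kappa>: "\<kappa> >= 1" and ko: "\<forall>g y \<delta>. \<delta> > 0 --> g holomorphic_on ball y \<delta> --> inj_on g (ball y \<delta>) -->
   ball (g y) (\<delta> * cmod (deriv g y) / \<kappa>) <= g ` ball y \<delta> &
   (\<forall>z. cmod (z - y) <= \<delta> / 8 --> cmod (z - y) * cmod (deriv g y) / \<kappa> <= cmod (g z - g y) &
     cmod (g z - g y) <= \<kappa> * cmod (z - y) * cmod (deriv g y))" using koebe_distortion by blast
 have cdf: "continuous_on annulus df" unfolding df_def using annulus_props(1) by (intro continuous_intros) auto
 obtain M0 where M0: "!!z. z \<in> annulus ==> cmod (df z) <= M0"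
  using compact_imp_bounded[OF compact_continuous_image[OF cdf closed_annulus(2)]] by (auto simp: bounded_iff)
 define M where "M = max 1 M0"
 have M: "M >= 1" "!!z. z \<in> annulus ==> cmod (df z) <= M" using M0 by (auto simp: M_def le_max_iff_disj)
 \<comment> \<open>Chosen so that c M = e / \<kappa>; then the Koebe disc in the image of the
   inverse branch contains the whole \<rho>-disc.\<close>
 define c where "c = \<delta>0 / (8 * \<kappa> * M)"
 have c: "c > 0" using delta0(1) \<kappa> M(1) by (simp add: c_def)
 define L where "L = max 1 (max (\<kappa> * M * c) (\<kappa> / c))"
 have L: "L >= 1" "\<kappa> * M * c <= L" "\<kappa> / c <= L" by (auto simp: L_def)
 define e where "e = \<delta>0 / 8"
 have e: "e > 0" using delta0(1) by (simp add: e_def)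
 show ?thesis
 proof (rule exI[of _ c], rule exI[of _ L], rule exI[of _ e], unfold elevates_def, intro conjI ballI allI impI)
  fix a \<rho> assume a: "a \<in> K" and \<rho>: "0 < \<rho> & \<rho> < c"
  define n where "n = (LEAST n. c / \<rho> <= cmod (dn n a))"
  have ex: "\<exists>n. c / \<rho> <= cmod (dn n a)" using dn_unbounded[OF a] less_imp_le by blast
  define \<mu> where "\<mu> = cmod (dn n a)"
  have mu1: "c / \<rho> <= \<mu>" unfolding \<mu>_def n_def using ex by (rule LeastI_ex)
  have "dn 0 a = 1" by (simp add: dn_def)
  hence "n ~= 0" using mu1 \<rho> by (intro notI) (simp add: \<mu>_def field_simps)
  then obtain k where k: "n = Suc k" by (cases n) auto
  have "\<not> c / \<rho> <= cmod (dn k a)" using not_less_Least[of k "%n. c / \<rho> <= cmod (dn n a)"] k by (simp add: n_def[symmetric])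
  moreover have "\<mu> = cmod (dn k a) * cmod (df ((f ^^ k) a))" by (simp add: \<mu>_def k dn_def norm_mult)
  moreover have "cmod (df ((f ^^ k) a)) <= M" using M(2) K_annulus[OF K_funpow[OF a]] by blast
  ultimately have mu2: "\<mu> <= (c / \<rho>) * M" using c \<rho> by (simp only:) (intro mult_mono; simp)
  have mu0: "\<mu> > 0" using mu1 c \<rho> by (meson divide_pos_pos less_le_trans)
  define y where "y = (f ^^ n) a"
  have yK: "y \<in> K" using K_funpow[OF a] by (simp add: y_def)
  have "ball y \<delta>0 \<inter> postcritical = {}" using delta0(3)[OF yK] by auto
  then obtain g where g: "g holomorphic_on ball y \<delta>0" "g y = a" "!!x. x \<in> ball y \<delta>0 ==> (f ^^ n) (g x) = x"
    "inj_on g (ball y \<delta>0)" "deriv g y = inverse (dn n a)"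
   using inverse_branch[of "ball y \<delta>0" y n a] delta0(1) y_def K_funpow_nz[OF a] by (metis centre_in_ball convex_ball open_ball)
  have dg: "cmod (deriv g y) = 1 / \<mu>" using g(5) by (simp add: \<mu>_def norm_inverse divide_inverse)
  have sub: "ball y e <= ball y \<delta>0" using delta0(1) by (intro subset_ball) (simp add: e_def)
  have ge: "g holomorphic_on ball y e" "inj_on g (ball y e)" using g(1,4) sub holomorphic_on_subset inj_on_subset by blast+
  have dist1: "cmod (x - y) * (1 / \<mu>) / \<kappa> <= cmod (g x - a)" "cmod (g x - a) <= \<kappa> * cmod (x - y) * (1 / \<mu>)" if "x \<in> ball y e" for x
  proof -
   have "cmod (x - y) <= \<delta>0 / 8" using that by (simp add: e_def dist_norm norm_minus_commute)
   thus "cmod (x - y) * (1 / \<mu>) / \<kappa> <= cmod (g x - a)" "cmod (g x - a) <= \<kappa> * cmod (x - y) * (1 / \<mu>)"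
    using ko[rule_format, OF delta0(1) g(1,4)] unfolding dg g(2) by blast+
  qed
  have b: "ball a (e * (1 / \<mu>) / \<kappa>) <= g ` ball y e" using ko[rule_format, OF e ge] unfolding dg g(2) by blast
  have "\<rho> <= e * (1 / \<mu>) / \<kappa>"
  proof -
   have "\<rho> * \<mu> <= c * M" using mu2 \<rho> by (simp add: field_simps)
   also have "c * M = e / \<kappa>" using M(1) by (simp add: c_def e_def)
   finally have "\<rho> <= (e / \<kappa>) / \<mu>" unfolding pos_le_divide_eq[OF mu0] .
   thus ?thesis by (simp add: mult.commute)
  qed
  hence b': "ball a \<rho> <= g ` ball y e" using b subset_ball by blast
  have mi: "1 / \<mu> <= \<rho> / c" using mu1 mu0 c \<rho> by (simp add: field_simps)
  show "\<exists>n g. continuous_on (ball ((f ^^ n) a) e) g &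
   (\<forall>x\<in>ball ((f ^^ n) a) e. (f ^^ n) (g x) = x & cmod (g x - a) <= L * \<rho> * cmod (x - (f ^^ n) a)) &
   (\<forall>w. cmod (w - a) < \<rho> --> (f ^^ n) w \<in> ball ((f ^^ n) a) e & g ((f ^^ n) w) = w &
    cmod (w - a) / (L * \<rho>) <= cmod ((f ^^ n) w - (f ^^ n) a) & cmod ((f ^^ n) w - (f ^^ n) a) <= L * cmod (w - a) / \<rho>)"
  proof (intro exI[of _ n] exI[of _ g], unfold y_def[symmetric], intro conjI ballI allI impI)
   show "continuous_on (ball y e) g" using ge(1) holomorphic_on_imp_continuous_on by blast
   fix x assume x: "x \<in> ball y e"
   show "(f ^^ n) (g x) = x" using g(3) x sub by blast
   have "cmod (g x - a) <= \<kappa> * cmod (x - y) * (1 / \<mu>)" by (rule dist1(2)[OF x])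
   also have "\<dots> <= \<kappa> * cmod (x - y) * (\<rho> / c)" using mi \<kappa> by (intro mult_left_mono) auto
   also have "\<dots> = (\<kappa> / c) * \<rho> * cmod (x - y)" by simp
   also have "\<dots> <= L * \<rho> * cmod (x - y)" using L(3) \<rho> by (intro mult_right_mono) auto
   finally show "cmod (g x - a) <= L * \<rho> * cmod (x - y)" .
  next
   fix w assume w: "cmod (w - a) < \<rho>"
   then obtain x where x: "x \<in> ball y e" "w = g x" using b' by (metis dist_commute dist_norm imageE mem_ball subsetD)
   have fw: "(f ^^ n) w = x" using g(3) x sub by blast
   show "(f ^^ n) w \<in> ball y e" "g ((f ^^ n) w) = w" using fw x by auto
   have "cmod (x - y) <= \<kappa> * \<mu> * cmod (w - a)" using dist1(1)[OF x(1)] mu0 \<kappa> by (simp add: x(2) field_simps)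
   also have "\<dots> <= \<kappa> * ((c / \<rho>) * M) * cmod (w - a)" using mu2 \<kappa> by (intro mult_right_mono mult_left_mono) auto
   also have "\<dots> = (\<kappa> * M * c) * (cmod (w - a) / \<rho>)" by simp
   also have "\<dots> <= L * (cmod (w - a) / \<rho>)" using L(2) \<rho> by (intro mult_right_mono) auto
   finally show "cmod ((f ^^ n) w - y) <= L * cmod (w - a) / \<rho>" by (simp add: fw)
   have "cmod (w - a) <= \<kappa> * cmod (x - y) * (1 / \<mu>)" using dist1(2)[OF x(1)] x(2) by simp
   also have "\<dots> <= \<kappa> * cmod (x - y) * (\<rho> / c)" using mi \<kappa> by (intro mult_left_mono) auto
   also have "\<dots> = (\<kappa> / c) * (\<rho> * cmod (x - y))" by simp
   also have "\<dots> <= L * (\<rho> * cmod (x - y))" using L(3) \<rho> by (intro mult_right_mono) auto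
   finally show "cmod (w - a) / (L * \<rho>) <= cmod ((f ^^ n) w - y)" using \<rho> L(1) by (simp add: fw field_simps)
  qed
 qed (use c L e in auto)
qed

end

section \<open>Sierpinski carpets in the sphere\<close>

lemma compact_S2: "compact S2" by (simp add: S2_def)

lemma closed_S2: "closed S2" using compact_S2 compact_imp_closed by blast

lemma punctured_sphere_plane:
 assumes q: "q \<in> S2"
 obtains h k where "continuous_on (S2 - {q}) h" "continuous_on UNIV k" "!!x. x \<in> S2 - {q} ==> k (h x) = x"
  "!!z::complex. h (k z) = z" "!!z. k z \<in> S2 - {q}"
proof -
 have "norm q = 1" "norm Npole = 1" using q Npole_S2 by (auto simp: S2_def)
 then obtain \<psi> where \<psi>: "orthogonal_transformation \<psi>" "\<psi> q = Npole" by (metis orthogonal_transformation_exists_1)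
 have bij: "bij \<psi>" using \<psi>(1) by (rule orthogonal_transformation_bij)
 have iso: "dist (\<psi> x) (\<psi> y) = dist x y" for x y
  using orthogonal_transformation_norm[OF \<psi>(1), of "x - y"] linear_diff[OF orthogonal_transformation_linear[OF \<psi>(1)], of x y] by (simp add: dist_norm)
 have S: "\<psi> x \<in> S2 \<longleftrightarrow> x \<in> S2" for x using orthogonal_transformation_norm[OF \<psi>(1)] by (simp add: S2_def)
 have iv: "\<psi> (inv \<psi> x) = x" "inv \<psi> (\<psi> x) = x" for x using bij by (auto simp: bij_is_surj surj_f_inv_f bij_is_inj)
 have iiso: "dist (inv \<psi> x) (inv \<psi> y) = dist x y" for x y using iso[of "inv \<psi> x" "inv \<psi> y"] by (simp add: iv)
 have c1: "continuous_on A \<psi>" for A unfolding continuous_on_iff by (auto simp: iso)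
 have c2: "continuous_on A (inv \<psi>)" for A unfolding continuous_on_iff by (auto simp: iiso)
 have ne: "\<psi> x = Npole \<longleftrightarrow> x = q" for x using \<psi>(2) bij by (metis iv(2))
 show thesis
 proof (rule that[of "%x. unstereo (\<psi> x)" "%z. inv \<psi> (stereo z)"])
  show "continuous_on (S2 - {q}) (%x. unstereo (\<psi> x))" by (rule continuous_on_compose2[OF continuous_unstereo c1]) (auto simp: S ne)
  show "continuous_on UNIV (%z. inv \<psi> (stereo z))" by (rule continuous_on_compose2[OF c2[of UNIV] continuous_stereo]) auto
  show "inv \<psi> (stereo (unstereo (\<psi> x))) = x" if "x \<in> S2 - {q}" for x using that S[of x] ne[of x] by (simp add: stereo_unstereo iv)
  show "unstereo (\<psi> (inv \<psi> (stereo z))) = z" for z by (simp add: iv)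
  show "inv \<psi> (stereo z) \<in> S2 - {q}" for z using S[of "inv \<psi> (stereo z)"] ne[of "inv \<psi> (stereo z)"] stereo_S2[of z] by (simp add: iv)
 qed
qed

lemma path_connected_punctured_S2: "q \<in> S2 ==> path_connected (S2 - {q})"
proof -
 assume q: "q \<in> S2"
 obtain h k where k: "continuous_on (S2 - {q}) h" "continuous_on UNIV k" "!!x. x \<in> S2 - {q} ==> k (h x) = x"
  "!!z::complex. h (k z) = z" "!!z. k z \<in> S2 - {q}" by (rule punctured_sphere_plane[OF q], rule that)
 have "x \<in> range k" if "x \<in> S2 - {q}" for x using k(3)[OF that] by (metis rangeI)
 hence "S2 - {q} = range k" using k(5) by blast
 thus ?thesis using path_connected_continuous_image[OF k(2) path_connected_UNIV] by simp
qed

lemma connected_open_S2_delete: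
 assumes "openin (top_of_set S2) V" "connected V" "V ~= S2"
 shows "connected (V - {x})"
proof -
 have VS: "V <= S2" using assms(1) by (rule openin_imp_subset)
 obtain q where q: "q \<in> S2" "q \<notin> V" using assms(3) VS by blast
 obtain h k where k: "continuous_on (S2 - {q}) h" "continuous_on UNIV k" "!!x. x \<in> S2 - {q} ==> k (h x) = x"
  "!!z::complex. h (k z) = z" "!!z. k z \<in> S2 - {q}" by (rule punctured_sphere_plane[OF q(1)], rule that)
 have VS': "V <= S2 - {q}" using VS q by auto
 have kh: "k (h x) = x" if "x \<in> V" for x using k(3) VS' that by blast
 obtain O' where O': "open O'" "V = S2 \<inter> O'" using assms(1) by (metis openin_open)
 have "k -` V = k -` O'" using O'(2) k(5) by auto
 hence op: "open (k -` V)" using open_vimage[OF O'(1) k(2)] by simp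
 have im: "k -` V = h ` V"
 proof (intro equalityI subsetI)
  fix z assume "z \<in> k -` V" hence "h (k z) \<in> h ` V" by blast
  thus "z \<in> h ` V" by (simp add: k(4))
 qed (auto simp: kh)
 have "connected (h ` V)" using connected_continuous_image[OF continuous_on_subset[OF k(1) VS'] assms(2)] .
 hence "connected (k -` V - {h x})" using op im by (intro connected_open_delete) auto
 hence "connected (k ` (k -` V - {h x}))" by (rule connected_continuous_image[OF continuous_on_subset[OF k(2)], rotated]) auto
 moreover have "k ` (k -` V - {h x}) = V - {x}" if "x \<in> V"
 proof (intro equalityI subsetI)
  fix y assume "y \<in> k ` (k -` V - {h x})"
  thus "y \<in> V - {x}" by (auto simp: k(4))
 next
  fix y assume y: "y \<in> V - {x}"
  hence "h y ~= h x" using kh that by (metis DiffD1 DiffD2 singletonI)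
  hence "h y \<in> k -` V - {h x}" using y kh by auto
  thus "y \<in> k ` (k -` V - {h x})" using kh y by (metis DiffD1 image_eqI)
 qed
 ultimately show ?thesis using assms(2) by (cases "x \<in> V") auto
qed

lemma component_openin_S2: "openin (top_of_set S2) A ==> U \<in> components A ==> openin (top_of_set S2) U"
proof -
 assume A: "openin (top_of_set S2) A" and U: "U \<in> components A"
 have "locally connected A" by (rule locally_open_subset[OF _ A]) (simp add: S2_def locally_connected_sphere)
 hence "openin (top_of_set A) U" using U by (rule openin_components_locally_connected)
 thus ?thesis using A by (rule openin_trans)
qed

lemma component_closure:
 assumes "U \<in> components A" "x \<in> closure U" "x \<in> A" shows "x \<in> U"
proof -
 have "connected (insert x U)" by (rule connected_intermediate_closure[OF in_components_connected[OF assms(1)]]) (use assms(2) closure_subset in auto)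
 hence "insert x U <= U" using assms(3) in_components_subset[OF assms(1)] in_components_nonempty[OF assms(1)] by (intro components_maximal[OF assms(1)]) auto
 thus ?thesis by blast
qed

lemma compact_jordan_curve: "jordan_curve C ==> compact C" and connected_jordan_curve: "jordan_curve C ==> connected C"
 and jordan_curve_nonempty: "jordan_curve C ==> C ~= {}" and jordan_curve_S2: "jordan_curve C ==> C <= S2"
 unfolding jordan_curve_def by (auto simp: compact_simple_path_image connected_simple_path_image)

text \<open>Move a point q of D to infinity. The region then contains the outside of a planar Jordan
  curve, and the frontier of that outside is the whole curve.\<close>

lemma jordan_region_boundary:
 assumes C: "jordan_curve C" and D: "D \<in> components (S2 - C)"
 shows "openin (top_of_set S2) D" "closure D = D \<union> C" "sbdry D = C"
proof -
 have "openin (top_of_set S2) (S2 - C)" using compact_jordan_curve[OF C] by (metis Diff_eq compact_imp_closed openin_open open_Compl)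
 thus "openin (top_of_set S2) D" using D by (rule component_openin_S2)
 have DS: "D <= S2 - C" using D by (rule in_components_subset)
 obtain q where q: "q \<in> D" using in_components_nonempty[OF D] by blast
 have qS: "q \<in> S2" using q DS by blast
 obtain h k where k: "continuous_on (S2 - {q}) h" "continuous_on UNIV k" "!!x. x \<in> S2 - {q} ==> k (h x) = x"
  "!!z::complex. h (k z) = z" "!!z. k z \<in> S2 - {q}" by (rule punctured_sphere_plane[OF qS], rule that)
 obtain c where c: "simple_path c" "pathfinish c = pathstart c" "path_image c = C" using C unfolding jordan_curve_def by blast
 have CS: "C <= S2 - {q}" using jordan_curve_S2[OF C] q DS by auto
 define c' where "c' = h \<circ> c"
 have "inj_on h (S2 - {q})" using k(3) by (metis inj_on_inverseI)
 hence sp: "simple_path c'" unfolding c'_def using c CS k(1) inj_on_subset continuous_on_subset by (intro simple_path_continuous_image) blast+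
 have im: "path_image c' = h ` C" unfolding c'_def by (simp add: path_image_compose c(3))
 have lp: "pathfinish c' = pathstart c'" using c(2) by (simp add: c'_def pathstart_compose pathfinish_compose)
 note J = Jordan_inside_outside[OF sp lp, unfolded im]
 define W where "W = k ` outside (h ` C)"
 have Wsub: "W <= S2 - C - {q}"
 proof
  fix x assume "x \<in> W"
  then obtain z where z: "z \<in> outside (h ` C)" "x = k z" by (auto simp: W_def)
  hence "z \<notin> h ` C" using outside_no_overlap[of "h ` C"] by blast
  hence "x \<notin> C" using z(2) k(4) by (metis image_eqI)
  thus "x \<in> S2 - C - {q}" using z(2) k(5) by auto
 qed
 have conW: "connected W" unfolding W_def using J by (intro connected_continuous_image continuous_on_subset[OF k(2)]) auto
 \<comment> \<open>Otherwise the outside of the curve would lie in the image of a compact set and be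
   bounded.\<close>
 have qW: "q \<in> closure W"
 proof (rule ccontr)
  assume "q \<notin> closure W"
  then obtain e where e0: "e > 0" "!!y. y \<in> W ==> \<not> dist y q < e" unfolding closure_approachable by blast
  hence e: "e > 0" "ball q e \<inter> W = {}" by (auto simp: dist_commute)
  have "compact (S2 - ball q e)" by (intro compact_diff compact_S2 open_ball)
  moreover have "continuous_on (S2 - ball q e) h" using e(1) by (intro continuous_on_subset[OF k(1)]) auto
  ultimately have "bounded (h ` (S2 - ball q e))" using compact_continuous_image compact_imp_bounded by blast
  moreover have "outside (h ` C) <= h ` (S2 - ball q e)"
  proof
   fix z assume "z \<in> outside (h ` C)"
   hence "k z \<in> S2 - ball q e" using e(2) Wsub by (auto simp: W_def)
   thus "z \<in> h ` (S2 - ball q e)" using k(4) by (metis image_eqI)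
  qed
  ultimately have "bounded (outside (h ` C))" by (rule bounded_subset)
  thus False using J by simp
 qed
 have "connected (insert q W)" by (rule connected_intermediate_closure[OF conW]) (use qW closure_subset in auto)
 hence WD: "insert q W <= D" using Wsub q DS by (intro components_maximal[OF D]) auto
 have "C <= closure D"
 proof
  fix x assume x: "x \<in> C"
  have "frontier (outside (h ` C)) = h ` C" using J by simp
  hence "h x \<in> closure (outside (h ` C))" using x unfolding frontier_def by blast
  hence "k (h x) \<in> closure W" unfolding W_def using continuous_image_closure_subset[OF k(2)] by blast
  hence "x \<in> closure W" using k(3) CS x by (metis subsetD)
  moreover have "closure W <= closure D" using WD by (intro closure_mono) auto
  ultimately show "x \<in> closure D" by blast
 qed
 moreover have "closure D <= S2" using closed_S2 DS by (metis Diff_subset closure_minimal order_trans)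
 ultimately show "closure D = D \<union> C" using component_closure[OF D] closure_subset[of D] by blast
 thus "sbdry D = C" using DS by (auto simp: sbdry_def)
qed

text \<open>It is the union of C and the closures of the other components, connected sets that all
  contain C.\<close>

lemma jordan_region_complement_connected:
 assumes C: "jordan_curve C" and D: "D \<in> components (S2 - C)"
 shows "connected (S2 - D)"
proof -
 define A where "A = {T. connected T & C <= T & T <= S2 - D}"
 have DS: "D <= S2 - C" using D by (rule in_components_subset)
 have "connected (\<Union>A)" by (rule connected_Union) (insert jordan_curve_nonempty[OF C], auto simp: A_def)
 moreover have "\<Union>A = S2 - D"
 proof (intro equalityI subsetI)
  fix x assume x: "x \<in> S2 - D"
  show "x \<in> \<Union>A"
  proof (cases "x \<in> C")
   case True
   hence "C \<in> A" using connected_jordan_curve[OF C] jordan_curve_S2[OF C] DS by (auto simp: A_def)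
   thus ?thesis using True by blast
  next
   case False
   then obtain W where W: "W \<in> components (S2 - C)" "x \<in> W" using x by (metis Diff_iff Union_components UnionE)
   have "W ~= D" using W x by blast
   hence "W \<inter> D = {}" using components_nonoverlap[OF W(1) D] by blast
   moreover have "closure W = W \<union> C" by (rule jordan_region_boundary(2)[OF C W(1)])
   moreover have "connected (closure W)" using in_components_connected[OF W(1)] by (rule connected_imp_connected_closure)
   ultimately have "closure W \<in> A" using in_components_subset[OF W(1)] jordan_curve_S2[OF C] DS unfolding A_def by auto
   thus ?thesis using W(2) closure_subset by blast
  qed
 qed (auto simp: A_def)
 ultimately show ?thesis by simp
qed

lemma sdist_le_4: "x \<in> S2 ==> y \<in> S2 ==> sdist x y <= 4"
proof -
 assume a: "x \<in> S2" "y \<in> S2"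
 have "dist x y <= norm x + norm y" unfolding dist_norm by (rule norm_triangle_ineq4)
 thus ?thesis using sdist_bounds(2)[OF a] a by (simp add: S2_def)
qed

lemma sdist_le_sdiam:
 assumes "A <= S2" "x \<in> A" "y \<in> A" shows "sdist x y <= sdiam A"
 unfolding sdiam_def using assms sdist_le_4 by (intro cSup_upper bdd_aboveI[of _ 4]) auto

lemma sdiam_le:
 assumes "A ~= {}" "!!x y. x \<in> A ==> y \<in> A ==> sdist x y <= B" shows "sdiam A <= B"
 unfolding sdiam_def by (rule cSup_least) (use assms in blast)+

text \<open>Only the boundaries are assumed disjoint, not the regions, so regions may be nested. The
  complementary components of J turn out to be the maximal ones.\<close>

locale carpet =
 fixes J :: "(real^3) set" and D :: "nat => (real^3) set"
 assumes region: "!!i. jordan_region (D i)" and J: "J = S2 - (\<Union>i. D i)"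
  and disj: "!!i j. i ~= j ==> sbdry (D i) \<inter> sbdry (D j) = {}"
  and small: "(%i. sdiam (sbdry (D i))) \<longlonglongrightarrow> 0"
  and two: "\<exists>a\<in>J. \<exists>b\<in>J. a ~= b"
begin

abbreviation "C i \<equiv> sbdry (D i)"

lemma region_props: "jordan_curve (C i)" "D i \<in> components (S2 - C i)"
proof -
 obtain c where "jordan_curve c" "D i \<in> components (S2 - c)" using region[of i] unfolding jordan_region_def by blast
 moreover have "C i = c" using jordan_region_boundary(3) calculation by blast
 ultimately show "jordan_curve (C i)" "D i \<in> components (S2 - C i)" by auto
qed

lemma D_props: "openin (top_of_set S2) (D i)" "closure (D i) = D i \<union> C i" "D i <= S2" "connected (D i)" "D i ~= {}" "C i ~= {}" "C i <= S2" "connected (C i)" "D i \<inter> C i = {}"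
 using jordan_region_boundary[OF region_props, of i] in_components_subset[OF region_props(2)[of i]] in_components_connected[OF region_props(2)[of i]]
  in_components_nonempty[OF region_props(2)[of i]] jordan_curve_nonempty[OF region_props(1)[of i]] jordan_curve_S2[OF region_props(1)[of i]]
  connected_jordan_curve[OF region_props(1)[of i]] by auto

text \<open>A region D j that contains a point of C i contains all of C i, since the two boundary
  curves are disjoint. If D i were not inside D j, it would contain the complement of D j, and J
  would be empty.\<close>

lemma absorb:
 assumes "\<not> C i <= J"
 shows "\<exists>j. D i <= D j & C i <= D j"
proof -
 obtain x j where x: "x \<in> C i" "x \<in> D j" using assms D_props(7)[of i] by (auto simp: J)
 have ij: "i ~= j" using x D_props(9) by blast
 have CD: "C i <= D j" using x disj[OF ij] D_props(7)[of i] by (intro components_maximal[OF region_props(2)[of j]] D_props(8)) auto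
 have E: "connected (S2 - D j)" by (rule jordan_region_complement_connected[OF region_props])
 have "(S2 - D j) \<inter> D i = {}"
 proof (rule ccontr)
  assume "(S2 - D j) \<inter> D i ~= {}"
  hence "S2 - D j <= D i" using CD by (intro components_maximal[OF region_props(2)[of i] E]) auto
  thus False using two by (auto simp: J)
 qed
 thus ?thesis using CD D_props(3)[of i] by blast
qed

lemma small_curve:
 assumes "e > 0" shows "finite {i. \<not> (\<forall>x\<in>C i. \<forall>y\<in>C i. dist x y < e)}"
proof -
 have "\<forall>\<^sub>F i in sequentially. sdiam (C i) < e" using small assms by (rule order_tendstoD)
 then obtain N where N: "!!i. i >= N ==> sdiam (C i) < e" by (auto simp: eventually_sequentially)
 have "\<forall>x\<in>C i. \<forall>y\<in>C i. dist x y < e" if "i >= N" for i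
  using N[OF that] sdist_le_sdiam[OF D_props(7)[of i]] sdist_bounds(1) D_props(7)[of i] by (meson order_le_less_trans subsetD)
 note le = this
 have "{i. \<not> (\<forall>x\<in>C i. \<forall>y\<in>C i. dist x y < e)} <= {..<N}"
 proof (intro subsetI, rule ccontr)
  fix i assume "i \<in> {i. \<not> (\<forall>x\<in>C i. \<forall>y\<in>C i. dist x y < e)}" "i \<notin> {..<N}"
  thus False using le[of i] by simp
 qed
 thus ?thesis using finite_subset by blast
qed

text \<open>In an infinite increasing chain of regions the boundary curves would shrink to a point x; a path that avoids x would then join a point of J to the first region without meeting a late boundary curve.\<close>
lemma maximal_region: "\<exists>i. D i0 <= D i & C i <= J"
proof (rule ccontr)
 assume none: "\<not> ?thesis"
 have "\<forall>i. D i0 <= D i --> (\<exists>j. D i <= D j & C i <= D j)" using none absorb by blast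
 then obtain nx where nx: "!!i. D i0 <= D i ==> D i <= D (nx i) & C i <= D (nx i)" by metis
 define s where "s k = (nx ^^ k) i0" for k
 have sB: "D i0 <= D (s k)" for k
 proof (induction k)
  case (Suc k) thus ?case using nx[of "s k"] by (simp add: s_def) blast
 qed (simp add: s_def)
 have sS: "D (s k) <= D (s (Suc k))" "C (s k) <= D (s (Suc k))" for k using nx[OF sB[of k]] by (simp_all add: s_def)
 have mono: "D (s k) <= D (s k')" if "k <= k'" for k k' by (rule lift_Suc_mono_le[of "%k. D (s k)", OF sS(1) that])
 \<comment> \<open>The chain never repeats, because each boundary curve lies inside the next region.
   Hence \<open>small_curve\<close>, which allows finitely many exceptions, applies along
   it.\<close>
 have ne: "s k ~= s k'" if "k < k'" for k k'
 proof
  assume e: "s k = s k'"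
  have "C (s k) <= D (s k)" using sS(2)[of k] mono[of "Suc k" k'] that e by auto
  thus False using D_props(6,9)[of "s k"] by blast
 qed
 hence injs: "inj s" by (metis injI linorder_neqE_nat)
 have "\<exists>k. \<forall>x\<in>C (s k). \<forall>y\<in>C (s k). dist x y < 1 / real (Suc n)" for n
 proof -
  have "finite (s -` {i. \<not> (\<forall>x\<in>C i. \<forall>y\<in>C i. dist x y < 1 / real (Suc n))})" by (intro finite_vimageI small_curve injs) auto
  hence "s -` {i. \<not> (\<forall>x\<in>C i. \<forall>y\<in>C i. dist x y < 1 / real (Suc n))} ~= UNIV" using infinite_UNIV_nat by metis
  thus ?thesis by blast
 qed
 then obtain kk where kk: "!!n. \<forall>x\<in>C (s (kk n)). \<forall>y\<in>C (s (kk n)). dist x y < 1 / real (Suc n)" by metis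
 have "\<exists>x. x \<in> C (s (kk n))" for n using D_props(6)[of "s (kk n)"] by blast
 then obtain c where c: "!!n. c n \<in> C (s (kk n))" by metis
 have cS: "\<forall>n. c n \<in> S2" using c D_props(7) by blast
 obtain x r where x: "x \<in> S2" "strict_mono (r :: nat => nat)" "(c \<circ> r) \<longlonglongrightarrow> x"
  using seq_compactE[OF compact_imp_seq_compact[OF compact_S2] cS] .
 obtain p where p: "p \<in> D i0" using D_props(5) by blast
 have "x \<notin> D i0"
 proof
  assume xD: "x \<in> D i0"
  obtain O' where O': "open O'" "D i0 = S2 \<inter> O'" using D_props(1)[of i0] by (metis openin_open)
  have "\<forall>\<^sub>F n in sequentially. (c \<circ> r) n \<in> O'" using x(3) by (rule topological_tendstoD) (use O' xD in auto)
  then obtain n where "c (r n) \<in> O'" by (auto dest: eventually_happens)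
  hence "c (r n) \<in> D i0" using O'(2) cS by blast
  thus False using c[of "r n"] sB D_props(9) by blast
 qed
 hence px: "p ~= x" using p by blast
 obtain a where a: "a \<in> J" "a ~= x" using two by blast
 have "p \<in> S2 - {x}" "a \<in> S2 - {x}" using p a px D_props(3) by (auto simp: J)
 then obtain g where g: "path g" "path_image g <= S2 - {x}" "pathstart g = p" "pathfinish g = a"
  using path_connected_punctured_S2[OF x(1)] unfolding path_connected_def by blast
 define Q where "Q = path_image g"
 have Q: "connected Q" "compact Q" "p \<in> Q" "a \<in> Q" "Q <= S2" "x \<notin> Q"
  using g pathstart_in_path_image[of g] pathfinish_in_path_image[of g] by (auto simp: Q_def connected_path_image compact_path_image)
 have "open (- Q)" using Q(2) by (simp add: compact_imp_closed open_Compl)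
 then obtain e where e: "e > 0" "ball x e <= - Q" using Q(6) by (meson ComplI open_contains_ball)
 obtain n1 :: nat where n1: "1 / real (Suc n1) < e / 2" using e(1) by (metis half_gt_zero nat_approx_posE)
 have "\<forall>\<^sub>F n in sequentially. dist ((c \<circ> r) n) x < e / 2" by (rule tendstoD[OF x(3)]) (use e in auto)
 moreover have "\<forall>\<^sub>F n in sequentially. n1 <= n" by (rule eventually_ge_at_top)
 ultimately have "\<forall>\<^sub>F n in sequentially. dist (c (r n)) x < e / 2 & n1 <= n" by eventually_elim simp
 then obtain n where n: "dist (c (r n)) x < e / 2" "n1 <= n" by (auto dest: eventually_happens)
 define k where "k = kk (r n)"
 have "C (s k) <= ball x e"
 proof
  fix y assume y: "y \<in> C (s k)"
  have "n <= r n" using x(2) by (rule seq_suble)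
  have "dist y (c (r n)) < 1 / real (Suc (r n))" using kk[of "r n"] c[of "r n"] y by (simp add: k_def)
  also have "\<dots> <= 1 / real (Suc n1)" using n(2) \<open>n <= r n\<close> by (intro divide_left_mono) auto
  finally have "dist y (c (r n)) < e / 2" using n1 by linarith
  thus "y \<in> ball x e" using n(1) dist_triangle[of y x "c (r n)"] by (simp add: dist_commute)
 qed
 hence "Q \<inter> C (s k) = {}" using e(2) by blast
 hence "Q <= D (s k)" using Q p sB[of k] by (intro components_maximal[OF region_props(2)]) auto
 thus False using Q(4) a(1) by (auto simp: J)
qed

text \<open>A maximal region around a point of U and U itself contain each other: the region avoids
  J, and U avoids the boundary curve of the region.\<close>

lemma component_is_region:
 assumes U: "U \<in> components (S2 - J)"
 shows "\<exists>i. U = D i & C i <= J"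
proof -
 have US: "U <= S2 - J" using U by (rule in_components_subset)
 obtain x where x: "x \<in> U" using in_components_nonempty[OF U] by blast
 have "x \<in> S2" "x \<notin> J" using x US by auto
 hence "x \<in> (\<Union>i. D i)" unfolding J by simp
 then obtain i0 where i0: "x \<in> D i0" by (elim UN_E)
 obtain i where i: "D i0 <= D i" "C i <= J" using maximal_region by blast
 have "D i <= U"
 proof (rule components_maximal[OF U D_props(4)])
  show "D i <= S2 - J" using D_props(3)[of i] unfolding J by blast
  show "U \<inter> D i ~= {}" using x i0 i(1) by blast
 qed
 moreover have "U <= D i"
 proof (rule components_maximal[OF region_props(2) in_components_connected[OF U]])
  show "U <= S2 - C i" using US i(2) by blast
  show "D i \<inter> U ~= {}" using x i0 i(1) by blast
 qed
 ultimately show ?thesis using i(2) by blast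
qed

end

section \<open>The Julia set\<close>

lemma dist_stereo_Npole_less:
 assumes "e > 0" "2 / e < cmod z" shows "dist (stereo z) Npole < e"
proof -
 have "2 / e < sroot z" using assms(2) sroot_ge(2)[of z] by linarith
 hence "2 < e * sroot z" using assms(1) by (simp add: divide_less_eq mult.commute)
 thus ?thesis unfolding dist_stereo_Npole using sroot_ge(3)[of z] by (simp only: pos_divide_less_eq)
qed

lemma near_Npole_large: "\<exists>\<delta>>0. \<forall>z. dist (stereo z) Npole < \<delta> --> B < cmod z"
proof (intro exI conjI allI impI)
 show "2 / (\<bar>B\<bar> + 1) > 0" by simp
 fix z assume "dist (stereo z) Npole < 2 / (\<bar>B\<bar> + 1)"
 hence "2 / sroot z < 2 / (\<bar>B\<bar> + 1)" by (simp only: dist_stereo_Npole)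
 hence "\<bar>B\<bar> + 1 < sroot z" using sroot_ge(3)[of z] by (simp add: divide_less_cancel frac_less2 field_simps)
 also have "sroot z <= cmod z + 1" by (rule real_le_lsqrt) (auto simp: power2_eq_square algebra_simps)
 finally show "B < cmod z" by linarith
qed

lemma near_stereo:
 assumes "e > 0" shows "\<exists>\<delta>>0. \<forall>y\<in>S2. dist y (stereo a) < \<delta> --> (\<exists>z. y = stereo z & dist z a < e)"
proof -
 have "stereo a \<in> S2 - {Npole}" using stereo_S2 by auto
 then obtain d where d: "d > 0" "!!y. y \<in> S2 - {Npole} ==> dist y (stereo a) < d ==> dist (unstereo y) (unstereo (stereo a)) < e"
  using continuous_unstereo assms unfolding continuous_on_iff by meson
 have "\<exists>z. y = stereo z & dist z a < e" if y: "y \<in> S2" "dist y (stereo a) < min d (dist Npole (stereo a))" for y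
 proof -
  have "y ~= Npole" using y by auto
  then obtain z where "y = stereo z" using S2_cases[OF y(1)] by blast
  thus ?thesis using d(2)[of y] y \<open>y ~= Npole\<close> by auto
 qed
 moreover have "min d (dist Npole (stereo a)) > 0" using d(1) stereo_ne_Npole[of a] by (metis min_less_iff_conj zero_less_dist_iff)
 ultimately show ?thesis by blast
qed

context escaping_map
begin

abbreviation "F \<equiv> flam lam l m"

lemma F_Npole [simp]: "F Npole = Npole" by (simp add: flam_def)
lemma F_stereo: "F (stereo z) = (if z = 0 then Npole else stereo (f z))" by (simp add: flam_def f_def)

lemma F_S2: "x \<in> S2 ==> F x \<in> S2" using S2_cases[of x] Npole_S2 stereo_S2 by (auto simp: F_stereo)

lemma F_funpow_Npole [simp]: "(F ^^ n) Npole = Npole" by (induction n) auto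

lemma F_funpow_S2: "x \<in> S2 ==> (F ^^ n) x \<in> S2" by (induction n) (auto intro: F_S2)

lemma F_funpow_stereo: "(F ^^ n) (stereo z) = (if \<exists>k<n. (f ^^ k) z = 0 then Npole else stereo ((f ^^ n) z))" by (induction n) (auto simp: F_stereo less_Suc_eq)

lemma continuous_F: "continuous_on S2 F" unfolding continuous_on_iff
proof (intro ballI allI impI)
 fix x e assume x: "x \<in> S2" and e: "(e::real) > 0"
 have near: "dist (F y) Npole < e" if "y = Npole \<or> (\<exists>z. y = stereo z & (z = 0 \<or> 2 / e < cmod (f z)))" for y
  using that e dist_stereo_Npole_less[OF e] by (auto simp: F_stereo)
 show "\<exists>d>0. \<forall>x'\<in>S2. dist x' x < d --> dist (F x') (F x) < e"
 proof (cases "x = Npole")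
  case True
  obtain d where d: "d > 0" "!!z. dist (stereo z) Npole < d ==> max R (2 / e) < cmod z" using near_Npole_large[of "max R (2 / e)"] by blast
  have "dist (F y) (F x) < e" if y: "y \<in> S2" "dist y x < d" for y
  proof -
   have "y = Npole \<or> (\<exists>z. y = stereo z & (z = 0 \<or> 2 / e < cmod (f z)))"
   proof (cases "y = Npole")
    case False
    then obtain z where z: "y = stereo z" using S2_cases[OF y(1)] by blast
    hence "max R (2 / e) < cmod z" using d(2) y(2) True by simp
    hence "R <= cmod z" "2 / e < cmod z" by auto
    hence "2 / e < cmod (f z)" using f_big[of z] R3 by linarith
    thus ?thesis using z by blast
   qed simp
   thus ?thesis using near[of y] True by simp
  qed
  thus ?thesis using d(1) by blast
 next
  case False
  then obtain a where a: "x = stereo a" using S2_cases[OF x] by blast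
  show ?thesis
  proof (cases "a = 0")
   case True
   obtain d where d: "d > 0" "\<forall>y\<in>S2. dist y (stereo 0) < d --> (\<exists>z. y = stereo z & dist z 0 < \<epsilon> (2 / e))"
    using near_stereo[OF eps_pos(1)] by blast
   have "dist (F y) (F x) < e" if y: "y \<in> S2" "dist y x < d" for y
   proof -
    obtain z where z: "y = stereo z" "cmod z < \<epsilon> (2 / e)" using d(2) y a True by auto
    hence "z = 0 \<or> 2 / e < cmod (f z)" using f_small by blast
    hence "dist (F y) Npole < e" using z(1) by (intro near) blast
    thus ?thesis using a True by (simp add: F_stereo)
   qed
   thus ?thesis using d(1) by blast
  next
   case False
   have "isCont f a" using f_has_derivative[OF False] by (rule DERIV_isCont)
   then obtain e1 where e1: "e1 > 0" "!!z. dist z a < e1 ==> dist (f z) (f a) < e / 2" unfolding continuous_at_eps_delta using e by (meson half_gt_zero)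
   have "min e1 (cmod a) > 0" using e1(1) False by simp
   from near_stereo[OF this] obtain d where d: "d > 0" "\<forall>y\<in>S2. dist y (stereo a) < d --> (\<exists>z. y = stereo z & dist z a < min e1 (cmod a))" by blast
   have "dist (F y) (F x) < e" if y: "y \<in> S2" "dist y x < d" for y
   proof -
    obtain z where z: "y = stereo z" "dist z a < min e1 (cmod a)" using d(2) y a by blast
    hence "z ~= 0" by (auto simp: dist_norm)
    hence "dist (F y) (F x) = dist (stereo (f z)) (stereo (f a))" using z a False by (simp add: F_stereo)
    also have "\<dots> <= 2 * dist (f z) (f a)" by (rule dist_stereo_le)
    also have "\<dots> < e" using e1(2)[of z] z(2) by simp
    finally show ?thesis .
   qed
   thus ?thesis using d(1) by blast
  qed
 qed
qed

lemma continuous_F_funpow: "continuous_on S2 (F ^^ n)"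
proof (induction n)
 case (Suc n)
 have "continuous_on S2 (%x. F ((F ^^ n) x))" by (rule continuous_on_compose2[OF continuous_F Suc]) (auto intro: F_funpow_S2)
 thus ?case by (simp add: o_def)
qed (simp add: id_def)

definition J :: "(real^3) set" where "J = stereo ` K"
definition E :: "(real^3) set" where "E = insert Npole (stereo ` {z. R < cmod z})"

lemma openin_E: "openin (top_of_set S2) E"
proof -
 have E_eq: "S2 - stereo ` cball 0 R = E"

 proof (intro equalityI subsetI)
  fix x assume x: "x \<in> S2 - stereo ` cball 0 R"
  show "x \<in> E"
  proof (cases "x = Npole")
   case False
   then obtain z where z: "x = stereo z" using x S2_cases by blast
   hence "z \<notin> cball 0 R" using x by blast
   thus ?thesis using z by (auto simp: E_def)
  qed (simp add: E_def)
 next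
  fix x assume x: "x \<in> E"
  have "x \<notin> stereo ` cball 0 R"
  proof
   assume "x \<in> stereo ` cball 0 R"
   then obtain z where z: "x = stereo z" "cmod z <= R" by auto
   hence "x \<in> stereo ` {z. R < cmod z}" using x stereo_ne_Npole[of z] by (simp add: E_def)
   then obtain w where w: "x = stereo w" "R < cmod w" by blast
   have "z = w" using z(1) w(1) unstereo_stereo by metis
   thus False using z(2) w(2) by simp
  qed
  thus "x \<in> S2 - stereo ` cball 0 R" using x stereo_S2 Npole_S2 by (auto simp: E_def)
 qed
 have "compact (stereo ` cball 0 R)" by (intro compact_continuous_image continuous_stereo compact_cball)
 hence op: "open (- (stereo ` cball 0 R))" by (intro open_Compl compact_imp_closed)
 have "E = S2 \<inter> - (stereo ` cball 0 R)" unfolding E_eq[symmetric] by (simp only: Diff_eq)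
 thus ?thesis using op openin_open by blast
qed

lemma E_attracted: "x \<in> E ==> dist ((F ^^ n) x) Npole <= 2 / 2 ^ n"
proof -
 assume x: "x \<in> E"
 show ?thesis
 proof (cases "x = Npole")
  case False
  then obtain z where z: "x = stereo z" "R < cmod z" using x by (auto simp: E_def)
  have b: "2 ^ k * cmod z <= cmod ((f ^^ k) z)" for k using iter_big[of z k] z by simp
  have z1: "1 <= cmod z" using z R3 by simp
  have b1: "2 ^ k <= cmod ((f ^^ k) z)" for k
  proof -
   have "(2::real) ^ k * 1 <= 2 ^ k * cmod z" by (rule mult_left_mono[OF z1]) simp
   thus ?thesis using b[of k] by linarith
  qed
  have "(f ^^ k) z ~= 0" for k
  proof
   assume "(f ^^ k) z = 0"
   thus False using b1[of k] by (metis norm_zero not_le zero_less_numeral zero_less_power)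
  qed
  hence "(F ^^ n) x = stereo ((f ^^ n) z)" using z by (simp add: F_funpow_stereo)
  moreover have "2 ^ n <= sroot ((f ^^ n) z)" using b1[of n] sroot_ge(2) order_trans by blast
  ultimately show ?thesis unfolding dist_stereo_Npole[symmetric] by (simp add: dist_stereo_Npole frac_le)
 qed simp
qed

lemma basin_enters: "x \<in> S2 - J ==> \<exists>n. (F ^^ n) x \<in> E"
proof -
 assume x: "x \<in> S2 - J"
 show ?thesis
 proof (cases "x = Npole")
  case True hence "(F ^^ 0) x \<in> E" by (simp add: E_def)
  thus ?thesis by blast
 next
  case False
  then obtain z where z: "x = stereo z" using x S2_cases by blast
  hence "z \<notin> K" using x by (auto simp: J_def)
  then obtain k where k: "!!j. (f ^^ (k + j)) z = 0 \<or> R < cmod ((f ^^ (k + j)) z)" using exit by blast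
  show ?thesis
  proof (cases "(f ^^ k) z = 0")
   case True
   hence "(F ^^ Suc k) x = Npole" unfolding z F_funpow_stereo by auto
   hence "(F ^^ Suc k) x \<in> E" by (simp add: E_def)
   thus ?thesis by blast
  next
   case False
   hence "(F ^^ k) x \<in> E" using k[of 0] unfolding z F_funpow_stereo by (auto simp: E_def)
   thus ?thesis by blast
  qed
 qed
qed

lemma J_props: "J <= S2" "compact J" "closed J" "Npole \<notin> J" "stereo z \<in> J \<longleftrightarrow> z \<in> K"
proof -
 show "J <= S2" using stereo_S2 by (auto simp: J_def)
 show c: "compact J" unfolding J_def by (intro compact_continuous_image continuous_stereo compact_K)
 show "closed J" using c by (rule compact_imp_closed)
 show "Npole \<notin> J" unfolding J_def using stereo_ne_Npole by (metis imageE)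
 show "stereo z \<in> J \<longleftrightarrow> z \<in> K" unfolding J_def by (metis image_iff unstereo_stereo)
qed

lemma J_forward: "x \<in> J ==> F x \<in> J" unfolding J_def using K_forward K_props(1) by (auto simp: F_stereo)

lemma J_backward: "x \<in> S2 ==> F x \<in> J ==> x \<in> J" using S2_cases[of x] J_props(4) K_backward by (auto simp: F_stereo J_props(5) split: if_splits)

lemma uniformly_attracted:
 assumes "(e::real) > 0" shows "\<exists>j. \<forall>k\<ge>n + j. \<forall>y. (F ^^ n) y \<in> E --> dist ((F ^^ k) y) Npole < e"
proof -
 obtain j :: nat where j: "(1/2) ^ j < e / 2" using assms real_arch_pow_inv[of "e / 2" "1/2"] by auto
 have "dist ((F ^^ k) y) Npole < e" if k: "n + j <= k" and y: "(F ^^ n) y \<in> E" for k y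
 proof -
  have "dist ((F ^^ (k - n)) ((F ^^ n) y)) Npole <= 2 / 2 ^ (k - n)" using y by (rule E_attracted)
  also have "(F ^^ (k - n)) ((F ^^ n) y) = (F ^^ k) y" using k by (metis add_leD1 comp_apply funpow_add le_add_diff_inverse2)
  also have "(2::real) / 2 ^ (k - n) <= 2 / 2 ^ j" using k by (intro divide_left_mono power_increasing) auto
  also have "\<dots> < e" using j by (simp add: power_one_over)
  finally show ?thesis .
 qed
 thus ?thesis by blast
qed

text \<open>The definition of normality admits arbitrary index sequences. One that takes a value
  infinitely often has a constant subsequence; any other tends to infinity and converges uniformly
  to \<open>Npole\<close>.\<close>

lemma basin_normal:
 assumes x: "x \<in> S2 - J"
 shows "x \<in> fatou_set F"
proof -
 obtain n where n: "(F ^^ n) x \<in> E" using basin_enters[OF x] by blast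
 define U where "U = S2 \<inter> (F ^^ n) -` E"
 have U: "openin (top_of_set S2) U" unfolding U_def by (rule continuous_openin_preimage[OF continuous_F_funpow _ openin_E]) (auto intro: F_funpow_S2)
 have lim: "uniform_limit C (%j. F ^^ (k j)) (%_. Npole) sequentially" if k: "filterlim k at_top sequentially" and C: "C <= U" for k C unfolding uniform_limit_iff
 proof (intro allI impI)
  fix e assume e: "(e::real) > 0"
  obtain j0 where j0: "\<forall>k\<ge>n + j0. \<forall>y. (F ^^ n) y \<in> E --> dist ((F ^^ k) y) Npole < e" using uniformly_attracted[OF e] by blast
  have "\<forall>\<^sub>F j in sequentially. n + j0 <= k j" using k by (simp add: filterlim_at_top)
  thus "\<forall>\<^sub>F j in sequentially. \<forall>y\<in>C. dist ((F ^^ k j) y) Npole < e" by eventually_elim (insert C j0, auto simp: U_def)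
 qed
 have "normal_family (%n. F ^^ n) U" unfolding normal_family_def
 proof
  fix k :: "nat => nat"
  show "\<exists>r g. strict_mono r & (\<forall>C. compact C & C <= U --> uniform_limit C (%j. F ^^ k (r j)) g sequentially)"
  proof (cases "\<exists>c. infinite {j. k j = c}")
   case True
   then obtain c where c: "infinite {j. k j = c}" by blast
   obtain r :: "nat => nat" where r: "strict_mono r" "!!j. r j \<in> {j. k j = c}" using infinite_enumerate[OF c] by blast
   hence "uniform_limit C (%j. F ^^ k (r j)) (F ^^ c) sequentially" for C by (simp add: uniform_limit_const)
   thus ?thesis using r(1) by blast
  next
   case False
   have "filterlim k at_top sequentially" unfolding filterlim_at_top
   proof
    fix Z
    have "{j. k j < Z} = (\<Union>c<Z. {j. k j = c})" by auto
    hence "finite {j. k j < Z}" using False by simp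
    hence "\<forall>\<^sub>F j in cofinite. \<not> k j < Z" by (simp add: eventually_cofinite)
    thus "\<forall>\<^sub>F j in sequentially. Z <= k j" by (simp add: cofinite_eq_sequentially not_less)
   qed
   thus ?thesis using lim by (intro exI[of _ id] exI[of _ "%_. Npole"]) (auto simp: strict_mono_id)
  qed
 qed
 thus ?thesis unfolding fatou_set_def using x n U by (auto simp: U_def intro!: exI[of _ U])
qed

text \<open>A limit g would be continuous with g x in J. But K has no interior, so arbitrarily close
  to x there are escaping points, where g is \<open>Npole\<close>, at positive distance from
  J.\<close>

lemma julia_not_normal:
 assumes x: "x \<in> J"
 shows "x \<notin> fatou_set F"
proof
 assume "x \<in> fatou_set F"
 then obtain U where U: "openin (top_of_set S2) U" "x \<in> U" "normal_family (%n. F ^^ n) U" unfolding fatou_set_def by blast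
 obtain r g where r: "strict_mono (r :: nat => nat)" "!!C. compact C ==> C <= U ==> uniform_limit C (%j. F ^^ (r j)) g sequentially"
  using U(3)[unfolded normal_family_def, rule_format, of "%j. j"] by blast
 obtain e where e: "e > 0" "cball x e \<inter> S2 <= U" using U(1,2) unfolding openin_contains_cball by blast
 define C where "C = cball x e \<inter> S2"
 have C: "compact C" unfolding C_def by (intro compact_Int_closed compact_cball closed_S2)
 have ul: "uniform_limit C (%j. F ^^ (r j)) g sequentially" using r(2)[OF C] e(2) by (simp add: C_def)
 have "continuous_on C (F ^^ r j)" for j by (rule continuous_on_subset[OF continuous_F_funpow]) (simp add: C_def)
 hence cg: "continuous_on C g" by (intro uniform_limit_theorem[OF _ ul]) auto
 have pw: "(%j. (F ^^ r j) y) \<longlonglongrightarrow> g y" if "y \<in> C" for y by (rule tendsto_uniform_limitI[OF ul that])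
 have xC: "x \<in> C" using e(1) x J_props(1) by (auto simp: C_def)
 have "(F ^^ j) x \<in> J" for j using x by (induction j) (auto intro: J_forward)
 hence "g x \<in> J" using Lim_in_closed_set[OF J_props(3) _ _ pw[OF xC]] by (simp add: eventually_sequentially)
 hence gx: "g x ~= Npole" using J_props(4) by metis
 hence "dist Npole (g x) > 0" by simp
 then obtain d where d: "d > 0" "!!y. y \<in> C ==> dist y x < d ==> dist (g y) (g x) < dist Npole (g x)" using cg xC unfolding continuous_on_iff by meson
 obtain a where a: "x = stereo a" "a \<in> K" using x by (auto simp: J_def)
 \<comment> \<open>Dividing by 3 leaves room for the Lipschitz constant 2 of
   \<open>stereo\<close>.\<close>
 define \<eta> where "\<eta> = min d e / 3"
 have eta: "\<eta> > 0" using d(1) e(1) by (simp add: \<eta>_def)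
 have "\<not> ball a \<eta> <= K" using interior_K eta by (metis centre_in_ball empty_iff interiorI open_ball)
 then obtain b where "b \<in> ball a \<eta>" and bK: "b \<notin> K" by blast
 hence b: "dist a b < \<eta>" "b \<notin> K" by auto
 have "dist (stereo b) x <= 2 * dist b a" unfolding a(1) by (rule dist_stereo_le)
 also have "\<dots> < min d e" using b(1) eta unfolding \<eta>_def by (simp add: dist_commute)
 finally have db: "dist (stereo b) x < d" "dist (stereo b) x < e" by auto
 have bC: "stereo b \<in> C" using db(2) stereo_S2 by (simp add: C_def dist_commute)
 have "stereo b \<in> S2 - J" using b(2) stereo_S2 J_props(5) by blast
 then obtain n where n: "(F ^^ n) (stereo b) \<in> E" using basin_enters by blast
 have "(%j. (F ^^ r j) (stereo b)) \<longlonglongrightarrow> Npole"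
 proof (rule tendstoI)
  fix e' assume e': "(e'::real) > 0"
  obtain j0 where j0: "\<forall>k\<ge>n + j0. \<forall>y. (F ^^ n) y \<in> E --> dist ((F ^^ k) y) Npole < e'" using uniformly_attracted[OF e'] by blast
  have "\<forall>\<^sub>F j in sequentially. n + j0 <= r j" using filterlim_subseq[OF r(1)] by (simp add: filterlim_at_top)
  thus "\<forall>\<^sub>F j in sequentially. dist ((F ^^ r j) (stereo b)) Npole < e'" by eventually_elim (use n j0 in auto)
 qed
 hence "g (stereo b) = Npole" using pw[OF bC] LIMSEQ_unique by blast
 thus False using d(2)[OF bC db(1)] by simp
qed

lemma fatou_set_F: "fatou_set F = S2 - J" and julia_set_F: "julia_set F = J"
proof -
 show 1: "fatou_set F = S2 - J"
 proof
  show "fatou_set F <= S2 - J" using julia_not_normal by (auto simp: fatou_set_def)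
  show "S2 - J <= fatou_set F" using basin_normal by blast
 qed
 show "julia_set F = J" unfolding julia_set_def 1 using J_props(1) by blast
qed

lemma K_nonempty: "K ~= {}"
proof -
 obtain z where z: "z ~= 0" "z ^ (l + m) - 1 * z ^ (l + 1) + lam = 0" using trinomial_root[of "l + 1" 1] m2 by auto
 note z0 = z(1)
 have "z ^ l * (z ^ m - z) + lam = 0" using z(2) by (simp add: power_add algebra_simps)
 hence fz: "f z = z" using z0 by (simp add: f_def field_simps eq_neg_iff_add_eq_0)
 have "(f ^^ k) z = z" for k by (induction k) (auto simp: fz)
 hence "z \<in> K" using z0 by (intro bounded_orbit_in_K[of z "cmod z"]) auto
 thus ?thesis by blast
qed

text \<open>If K were one point a, then a would be fixed and its whole fibre would be a. The fibre
  polynomial has degree at least 4, so a would be a multiple root, hence a critical point in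
  K.\<close>

lemma K_two_points: "\<exists>a\<in>K. \<exists>b\<in>K. a ~= b"
proof (rule ccontr)
 assume n: "\<not> ?thesis"
 obtain a where a: "a \<in> K" using K_nonempty by blast
 have only: "b = a" if "b \<in> K" for b using n a that by blast
 have fa: "f a = a" using only K_forward[OF a] by blast
 have a0: "a ~= 0" using K_props(1)[OF a] .
 define p where "p = monom 1 (l + m) - monom a l + [:lam:]"
 have pz: "poly p z = z ^ (l + m) - a * z ^ l + lam" for z by (simp add: p_def poly_monom)
 have pf: "poly p z = z ^ l * (f z - a)" if "z ~= 0" for z using that by (simp add: pz f_def power_add algebra_simps)
 have "poly p a = 0" using pf[OF a0] fa by simp
 then obtain q where q: "p = [:- a, 1:] * q" by (metis dvdE poly_eq_0_iff_dvd)
 have "coeff p (l + m) = 1" using l2 m2 by (simp add: p_def coeff_pCons split: nat.splits)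
 hence "l + m <= degree p" by (intro le_degree) simp
 moreover have "degree p <= degree [:- a, 1:] + degree q" unfolding q by (rule degree_mult_le)
 ultimately have "degree q ~= 0" using l2 m2 by simp
 hence "\<not> constant (poly q)" by (simp add: constant_degree)
 then obtain b where b: "poly q b = 0" using fundamental_theorem_of_algebra by blast
 have pb: "poly p b = 0" using b by (simp add: q)
 have b0: "b ~= 0" using pb lam0 l2 m2 by (auto simp: pz power_0_left)
 have "f b = a" using pf[OF b0] pb b0 by simp
 hence "b \<in> K" using K_backward[OF _ b0] a by simp
 hence ba: "b = a" by (rule only)
 have "poly p z = (z - a) * poly q z" for z by (simp add: q algebra_simps)
 hence e: "f z - f a = (poly q z / z ^ l) * (z - a)" if z: "z ~= 0" for z
 proof -
  have h: "z ^ l * (f z - a) = (z - a) * poly q z" using pf[OF z] \<open>poly p z = (z - a) * poly q z\<close> by simp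
  have "f z - a = (z ^ l * (f z - a)) / z ^ l" using z by simp
  thus ?thesis unfolding h fa by simp
 qed
 have "((%z. (f z - f a) / (z - a)) \<longlongrightarrow> poly q a / a ^ l) (at a)"
 proof (rule Lim_transform_within_open[of "%z. poly q z / z ^ l" _ _ _ "- {0}"])
  show "((%z. poly q z / z ^ l) \<longlongrightarrow> poly q a / a ^ l) (at a)" using a0 by (intro tendsto_intros) auto
 qed (use a0 e in auto)
 hence "(f has_field_derivative 0) (at a)" using b ba by (simp add: has_field_derivative_iff)
 hence "df a = 0" using f_has_derivative[OF a0] DERIV_unique by blast
 thus False using df_zero[OF a0] escape a by blast
qed

end

section \<open>Boundaries of the Fatou components\<close>

lemma finite_uniform:
 fixes P :: "'a => real => bool"
 assumes "finite A" "!!a. a \<in> A ==> \<exists>e>0. P a e" "!!a e e'. P a e ==> 0 < e' ==> e' <= e ==> P a e'"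
 shows "\<exists>e>0. \<forall>a\<in>A. P a e"
 using assms(1,2)
proof (induction A rule: finite_induct)
 case empty thus ?case by (intro exI[of _ 1]) auto
next
 case (insert a A)
 obtain e1 where e1: "e1 > 0" "\<forall>a\<in>A. P a e1" using insert by blast
 obtain e2 where e2: "e2 > 0" "P a e2" using insert(4)[of a] by blast
 have "P b (min e1 e2)" if "b \<in> insert a A" for b using that e1 e2 assms(3) by (metis insert_iff min.cobounded1 min.cobounded2 min_less_iff_conj)
 thus ?case using e1(1) e2(1) by (metis min_less_iff_conj)
qed

locale julia_carpet = escaping_map l m lam + crp: carpet "escaping_map.J l m lam" D for l m lam D
begin

definition comps :: "(real^3) set set" where "comps = components (S2 - J)"

lemma comp_region: "U \<in> comps ==> \<exists>i. U = D i & sbdry (D i) <= J" unfolding comps_def by (rule crp.component_is_region)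

lemma comp_props:
 assumes "U \<in> comps"
 shows "openin (top_of_set S2) U" "connected U" "U ~= {}" "jordan_curve (sbdry U)" "sbdry U <= J" "closure U = U \<union> sbdry U"
  "U <= S2" "U \<inter> J = {}" "sbdry U ~= {}" "closed (sbdry U)" "U ~= S2"
proof -
 obtain i where i: "U = D i" "sbdry (D i) <= J" using comp_region[OF assms] by blast
 show "openin (top_of_set S2) U" "connected U" "U ~= {}" "closure U = U \<union> sbdry U" "U <= S2" "sbdry U ~= {}" using crp.D_props[of i] unfolding i(1) by auto
 show jc: "jordan_curve (sbdry U)" unfolding i(1) by (rule crp.region_props)
 show sJ: "sbdry U <= J" using i by simp
 show UJ: "U \<inter> J = {}" using in_components_subset[of U "S2 - J"] assms unfolding comps_def by blast
 show "closed (sbdry U)" using compact_jordan_curve[OF jc] by (rule compact_imp_closed)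
 show "U ~= S2" using UJ J_props(1) crp.two by blast
qed

lemma bd_disj:
 assumes "U \<in> comps" "V \<in> comps" "U ~= V" shows "sbdry U \<inter> sbdry V = {}"
proof -
 obtain i j where "U = D i" "V = D j" using comp_region assms(1,2) by blast
 thus ?thesis using crp.disj[of i j] assms(3) by auto
qed

lemma bd_big_finite: "c > 0 ==> finite {U \<in> comps. \<exists>x\<in>sbdry U. \<exists>y\<in>sbdry U. c <= dist x y}"
proof (rule finite_subset)
 assume c: "c > 0"
 show "finite (D ` {i. \<not> (\<forall>x\<in>sbdry (D i). \<forall>y\<in>sbdry (D i). dist x y < c)})" using crp.small_curve[OF c] by simp
 show "{U \<in> comps. \<exists>x\<in>sbdry U. \<exists>y\<in>sbdry U. c <= dist x y} <= D ` {i. \<not> (\<forall>x\<in>sbdry (D i). \<forall>y\<in>sbdry (D i). dist x y < c)}"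
 proof
  fix U assume "U \<in> {U \<in> comps. \<exists>x\<in>sbdry U. \<exists>y\<in>sbdry U. c <= dist x y}"
  then obtain x y where U: "U \<in> comps" "x \<in> sbdry U" "y \<in> sbdry U" "c <= dist x y" by blast
  obtain i where i: "U = D i" using comp_region[OF U(1)] by blast
  have "\<not> (\<forall>x\<in>sbdry (D i). \<forall>y\<in>sbdry (D i). dist x y < c)" using U(2-4) unfolding i by (meson not_le)
  thus "U \<in> D ` {i. \<not> (\<forall>x\<in>sbdry (D i). \<forall>y\<in>sbdry (D i). dist x y < c)}" using i by blast
 qed
qed

lemma comp_exists: "connected T ==> T <= S2 - J ==> T ~= {} ==> \<exists>V\<in>comps. T <= V" using exists_component_superset[of T "S2 - J"] unfolding comps_def by blast

lemma comp_maximal: "V \<in> comps ==> connected T ==> T <= S2 - J ==> V \<inter> T ~= {} ==> T <= V" unfolding comps_def by (rule components_maximal)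

section \<open>Action of the map on the components\<close>

lemma F_image_connected: "connected T ==> T <= S2 ==> connected (F ` T)" using continuous_F continuous_on_subset connected_continuous_image by blast

lemma F_image_fatou: "T <= S2 - J ==> F ` T <= S2 - J" using F_S2 J_backward by blast

lemma comp_sub: "U \<in> comps ==> U <= S2 - J" using comp_props(7,8) by blast

lemma F_comp:
 assumes U: "U \<in> comps" shows "\<exists>V\<in>comps. F ` U <= V & F ` sbdry U <= sbdry V"
proof -
 obtain V where V: "V \<in> comps" "F ` U <= V"
  using comp_exists[OF F_image_connected[OF comp_props(2,7)[OF U]] F_image_fatou[OF comp_sub[OF U]]] comp_props(3)[OF U] by blast
 have "F ` closure U <= closure V"
 proof (rule image_closure_subset)
  show "continuous_on (closure U) F" using comp_props(4,6,7)[OF U] jordan_curve_S2 by (intro continuous_on_subset[OF continuous_F]) blast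
  show "F ` U <= closure V" using V(2) closure_subset by blast
 qed auto
 moreover have "F ` sbdry U <= J" using J_forward comp_props(5)[OF U] by blast
 ultimately have "F ` sbdry U <= sbdry V" using comp_props(8)[OF V(1)] comp_props(6)[OF U] comp_props(6)[OF V(1)] by blast
 thus ?thesis using V by blast
qed

lemma not_within_poles:
 assumes U: "U \<in> comps" and A: "finite A" "A \<inter> J = {}"
 shows "\<not> U <= A"
proof
 assume "U <= A"
 hence "closure U <= A" using A(1) by (intro closure_minimal finite_imp_closed)
 thus False using comp_props(5,6,9)[OF U] A(2) by blast
qed

lemma f_not_constant: "\<not> f constant_on - {0}"
proof
 assume "f constant_on - {0}"
 then obtain c where c: "!!z. z ~= 0 ==> f z = c" unfolding constant_on_def by blast
 thus False using polynomial_root[of "c + 1"] by (metis add_cancel_left_right one_neq_zero)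
qed

lemma f_open: "open W ==> 0 \<notin> W ==> open (f ` W)"
proof (rule open_mapping_thm[OF f_holomorphic[of "- {0}"] _ _ _ _ f_not_constant])
 show "connected (- {0::complex})" by (rule connected_punctured_universe) simp
qed auto

text \<open>The image is open by the open mapping theorem. It is closed relative to V because
  boundary points of W lie in J and are mapped into J. So it is clopen in the connected set V
  without \<open>Npole\<close>.\<close>

lemma F_surj:
 assumes W: "W \<in> comps" and V: "V \<in> comps" and FW: "F ` W <= V"
 shows "V - {Npole} <= F ` W"
proof -
 define X where "X = V - {Npole}"
 have conX: "connected X" unfolding X_def by (rule connected_open_S2_delete[OF comp_props(1,2,11)[OF V]])
 define W' where "W' = {z. z ~= 0 & stereo z \<in> W}"
 define Y where "Y = F ` W \<inter> X"
 obtain O' where O': "open O'" "W = S2 \<inter> O'" using comp_props(1)[OF W] openin_open by metis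
 have "W' = - {0} \<inter> stereo -` O'" using O'(2) stereo_S2 by (auto simp: W'_def)
 moreover have "open (stereo -` O')" by (rule open_vimage[OF O'(1) continuous_stereo])
 ultimately have "open W'" using open_Int[OF open_Compl[OF closed_singleton]] by simp
 hence op: "open (f ` W')" by (rule f_open) (simp add: W'_def)
 have XS: "X <= S2 - {Npole}" using comp_props(7)[OF V] by (auto simp: X_def)
 have Y1: "Y = X \<inter> unstereo -` (f ` W')"
 proof (intro equalityI subsetI)
  fix y assume "y \<in> Y"
  then obtain w where w: "w \<in> W" "y = F w" "y \<in> X" by (auto simp: Y_def)
  hence "w ~= Npole" by (auto simp: X_def)
  then obtain z where z: "w = stereo z" using w(1) comp_props(7)[OF W] S2_cases by blast
  hence "z ~= 0" "y = stereo (f z)" using w by (auto simp: F_stereo X_def split: if_splits)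
  thus "y \<in> X \<inter> unstereo -` (f ` W')" using w z by (auto simp: W'_def)
 next
  fix y assume y: "y \<in> X \<inter> unstereo -` (f ` W')"
  then obtain z where z: "z \<in> W'" "unstereo y = f z" by blast
  have "stereo (unstereo y) = y" using y XS by (intro stereo_unstereo) auto
  hence "y = F (stereo z)" using z by (simp add: F_stereo W'_def)
  thus "y \<in> Y" using z(1) y by (auto simp: Y_def W'_def)
 qed
 have opY: "openin (top_of_set X) Y" unfolding Y1 by (rule continuous_openin_preimage_gen[OF continuous_on_subset[OF continuous_unstereo XS] op])
 have clW: "closure W <= S2" using comp_props(7)[OF W] closed_S2 by (rule closure_minimal)
 have Y2: "Y = X \<inter> F ` closure W"
 proof (intro equalityI subsetI)
  fix y assume "y \<in> X \<inter> F ` closure W"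
  then obtain w where w: "w \<in> closure W" "y = F w" "y \<in> X" by blast
  have "y \<notin> J" using w(3) comp_props(8)[OF V] by (auto simp: X_def)
  hence "w \<notin> J" using w(2) J_forward by blast
  hence "w \<in> W" using w(1) comp_props(5,6)[OF W] by blast
  thus "y \<in> Y" using w by (auto simp: Y_def)
 qed (insert closure_subset, auto simp: Y_def)
 have "compact (closure W)" using compact_Int_closed[OF compact_S2 closed_closure[of W]] clW by (simp add: Int_absorb1)
 hence "compact (F ` closure W)" by (intro compact_continuous_image continuous_on_subset[OF continuous_F clW])
 hence clY: "closedin (top_of_set X) Y" unfolding Y2 by (intro closedin_closed_Int compact_imp_closed)
 have "Y ~= {}"
 proof -
  have "\<not> W <= {Npole, stereo 0}" by (rule not_within_poles[OF W]) (use J_props(4) J_props(5)[of 0] K_props(1) in auto)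
  then obtain w where w: "w \<in> W" "w ~= Npole" "w ~= stereo 0" by blast
  then obtain z where z: "w = stereo z" using comp_props(7)[OF W] S2_cases by blast
  hence "F w ~= Npole" using w by (auto simp: F_stereo)
  thus ?thesis using w(1) FW by (auto simp: Y_def X_def)
 qed
 hence "Y = X" using conX opY clY unfolding connected_clopen by blast
 thus ?thesis by (auto simp: Y_def X_def)
qed

text \<open>Every such component contains a preimage of one fixed finite point of V, and the fibre
  is finite.\<close>

lemma finite_preimages:
 assumes V: "V \<in> comps" shows "finite {W \<in> comps. F ` W <= V}"
proof -
 have "\<not> V <= {Npole}" by (rule not_within_poles[OF V]) (use J_props(4) in auto)
 then obtain v where v: "v \<in> V" "v ~= Npole" by blast
 then obtain b where b: "v = stereo b" using comp_props(7)[OF V] S2_cases by blast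
 have one: "finite {W \<in> comps. x \<in> W}" for x
 proof (cases "\<exists>W\<in>comps. x \<in> W")
  case True
  then obtain W where W: "W \<in> comps" "x \<in> W" by blast
  have "{W \<in> comps. x \<in> W} <= {W}" using components_nonoverlap[of W "S2 - J"] W unfolding comps_def by blast
  thus ?thesis by (rule finite_subset) simp
 next
  case False
  hence "{W \<in> comps. x \<in> W} = {}" by blast
  thus ?thesis by (simp only: finite.emptyI)
 qed
 have "{W \<in> comps. F ` W <= V} <= (\<Union>z\<in>{z. z ~= 0 & f z = b}. {W \<in> comps. stereo z \<in> W})"
 proof
  fix W assume W: "W \<in> {W \<in> comps. F ` W <= V}"
  hence "v \<in> F ` W" using F_surj[of W V] V v by blast
  then obtain w where w: "w \<in> W" "F w = stereo b" using b by auto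
  hence "w ~= Npole" using stereo_ne_Npole[of b] by (auto simp del: stereo_ne_Npole)
  then obtain z where z: "w = stereo z" using w(1) W comp_props(7) S2_cases by blast
  have "z ~= 0" using w(2) stereo_ne_Npole[of b] unfolding z F_stereo by metis
  moreover have "f z = b" using w(2) \<open>z ~= 0\<close> unfolding z F_stereo by (metis unstereo_stereo)
  ultimately show "W \<in> (\<Union>z\<in>{z. z ~= 0 & f z = b}. {W \<in> comps. stereo z \<in> W})" using w(1) W z by blast
 qed
 moreover have "finite (\<Union>z\<in>{z. z ~= 0 & f z = b}. {W \<in> comps. stereo z \<in> W})" using finite_fiber one by blast
 ultimately show ?thesis by (rule finite_subset)
qed

text \<open>The map is open near t, so points of V close to F t have preimages close to t. These lie
  in finitely many components, hence t is in the closure of one of them.\<close>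

lemma bd_pre:
 assumes t: "t \<in> J" and V: "V \<in> comps" and Ft: "F t \<in> sbdry V"
 shows "\<exists>W\<in>comps. F ` W <= V & t \<in> sbdry W"
proof -
 define P where "P = {W \<in> comps. F ` W <= V}"
 obtain z where z: "z \<in> K" "t = stereo z" using t by (auto simp: J_def)
 have z0: "z ~= 0" using K_props(1)[OF z(1)] .
 have "t \<in> closure (\<Union>P)" unfolding closure_approachable
 proof (intro allI impI)
  fix e assume e: "(e::real) > 0"
  define r where "r = min (e / 2) (cmod z)"
  have r: "r > 0" "0 \<notin> ball z r" using e z0 by (auto simp: r_def)
  have "open (f ` ball z r)" using r(2) by (intro f_open) auto
  then obtain e1 where e1: "e1 > 0" "ball (f z) e1 <= f ` ball z r" using r(1) by (meson centre_in_ball imageI open_contains_ball)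
  obtain d where d: "d > 0" "\<forall>y\<in>S2. dist y (stereo (f z)) < d --> (\<exists>w. y = stereo w & dist w (f z) < e1)" using near_stereo[OF e1(1)] by blast
  have "stereo (f z) \<in> closure V" using Ft z0 unfolding z(2) F_stereo sbdry_def by simp
  then obtain v where v: "v \<in> V" "dist v (stereo (f z)) < d" using d(1) unfolding closure_approachable by blast
  have vS: "v \<in> S2" "v \<notin> J" using v(1) comp_props(7,8)[OF V] by auto
  obtain w where w: "v = stereo w" "dist w (f z) < e1" using d(2) vS(1) v(2) by blast
  hence "w \<in> f ` ball z r" using e1(2) by (metis dist_commute mem_ball subsetD)
  then obtain z' where z': "z' \<in> ball z r" "w = f z'" by blast
  have "z' ~= 0" using z'(1) r(2) by blast
  hence Fz: "F (stereo z') = v" using z' w by (simp add: F_stereo)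
  have "stereo z' \<in> S2 - J" using stereo_S2[of z'] J_forward[of "stereo z'"] Fz vS(2) by blast
  then obtain W where W: "W \<in> comps" "stereo z' \<in> W" using comp_exists[of "{stereo z'}"] by auto
  have "F ` W <= V" using comp_maximal[OF V F_image_connected[OF comp_props(2,7)[OF W(1)]] F_image_fatou[OF comp_sub[OF W(1)]]] Fz W(2) v(1) by blast
  hence "stereo z' \<in> \<Union>P" using W by (auto simp: P_def)
  moreover have "dist (stereo z') t < e"
  proof -
   have "dist (stereo z') t <= 2 * dist z' z" unfolding z(2) by (rule dist_stereo_le)
   thus ?thesis using z'(1) by (simp add: r_def dist_commute)
  qed
  ultimately show "\<exists>y\<in>\<Union>P. dist y t < e" by blast
 qed
 moreover have "closure (\<Union>P) <= \<Union>(closure ` P)"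
 proof (rule closure_minimal)
  show "\<Union>P <= \<Union>(closure ` P)" using closure_subset by blast
  show "closed (\<Union>(closure ` P))" using finite_preimages[OF V] by (intro closed_Union) (auto simp: P_def)
 qed
 ultimately obtain W where W: "W \<in> P" "t \<in> closure W" by blast
 thus ?thesis using comp_props(6,8)[of W] t unfolding P_def by blast
qed

text \<open>T is covered by the boundaries of the finitely many components that are mapped into V, and these are closed and disjoint.\<close>
lemma lift_in_boundary_step:
 assumes T: "connected T" "T <= J" "F ` T <= sbdry V" "T \<inter> sbdry U ~= {}" and UV: "U \<in> comps" "V \<in> comps"
 shows "T <= sbdry U"
proof -
 define P where "P = {W \<in> comps. F ` W <= V}"
 define B where "B = \<Union>(sbdry ` (P - {U}))"
 have "closed B" unfolding B_def using finite_preimages[OF UV(2)] comp_props(10) by (intro closed_Union) (auto simp: P_def)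
 moreover have "T <= sbdry U \<union> B"
 proof
  fix t assume t: "t \<in> T"
  then obtain W where "W \<in> comps" "F ` W <= V" "t \<in> sbdry W" using bd_pre[of t V] T(2,3) UV(2) by blast
  thus "t \<in> sbdry U \<union> B" by (auto simp: B_def P_def)
 qed
 moreover have "sbdry U \<inter> B = {}" using bd_disj[OF UV(1)] by (auto simp: B_def P_def)
 ultimately have "\<not> B \<inter> T ~= {}" using T(1,4) comp_props(10)[OF UV(1)] unfolding connected_closed by blast
 thus ?thesis using \<open>T <= sbdry U \<union> B\<close> by blast
qed

lemma lift_in_boundary:
 assumes "connected T" "T <= J" "(F ^^ n) ` T <= sbdry V" "T \<inter> sbdry U ~= {}" "U \<in> comps" "V \<in> comps"
 shows "T <= sbdry U"
 using assms
proof (induction n arbitrary: T U)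
 case 0
 thus ?case using bd_disj[of U V] by (cases "U = V") auto
next
 case (Suc n)
 obtain U1 where U1: "U1 \<in> comps" "F ` sbdry U <= sbdry U1" using F_comp[OF Suc.prems(5)] by blast
 have "F ` T <= sbdry U1"
 proof (rule Suc.IH)
  show "connected (F ` T)" using Suc.prems(1,2) J_props(1) by (intro F_image_connected) auto
  show "F ` T <= J" using Suc.prems(2) J_forward by blast
  show "(F ^^ n) ` F ` T <= sbdry V" using Suc.prems(3) by (simp only: funpow_Suc_right image_comp)
  show "F ` T \<inter> sbdry U1 ~= {}" using Suc.prems(4) U1(2) by blast
 qed (use U1 Suc.prems in auto)
 thus ?case using Suc.prems U1(1) by (intro lift_in_boundary_step[of T U1 U]) auto
qed

section \<open>Boundary curves in the plane\<close>

definition \<Gamma> :: "(real^3) set => complex set" where "\<Gamma> U = unstereo ` sbdry U"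

lemma Gamma_props:
 assumes U: "U \<in> comps"
 shows "\<Gamma> U <= K" "stereo ` \<Gamma> U = sbdry U" "z \<in> \<Gamma> U \<longleftrightarrow> stereo z \<in> sbdry U"
  "\<exists>c. simple_path c & pathfinish c = pathstart c & path_image c = \<Gamma> U" "compact (\<Gamma> U)" "connected (\<Gamma> U)"
proof -
 have J: "sbdry U <= stereo ` K" using comp_props(5)[OF U] by (simp add: J_def)
 show 1: "\<Gamma> U <= K" using J by (auto simp: \<Gamma>_def)
 have su: "stereo (unstereo x) = x" if "x \<in> sbdry U" for x using J that by auto
 show "stereo ` \<Gamma> U = sbdry U" by (simp add: \<Gamma>_def image_image su)
 show "z \<in> \<Gamma> U \<longleftrightarrow> stereo z \<in> sbdry U" unfolding \<Gamma>_def using su by (metis image_iff unstereo_stereo)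
 obtain g where g: "simple_path g" "pathfinish g = pathstart g" "path_image g = sbdry U" using comp_props(4)[OF U] unfolding jordan_curve_def by blast
 have sub: "sbdry U <= S2 - {Npole}" using comp_props(5)[OF U] J_props(1,4) by blast
 have inj: "inj_on unstereo (sbdry U)" by (rule inj_on_inverseI[of _ stereo]) (rule su)
 have sp: "simple_path (unstereo \<circ> g)" by (rule simple_path_continuous_image[OF g(1)]) (use inj sub continuous_on_subset[OF continuous_unstereo] g(3) in auto)
 have im: "path_image (unstereo \<circ> g) = \<Gamma> U" by (simp add: path_image_compose g(3) \<Gamma>_def)
 have lp: "pathfinish (unstereo \<circ> g) = pathstart (unstereo \<circ> g)" using g(2) by (simp add: pathfinish_compose pathstart_compose)
 show "\<exists>c. simple_path c & pathfinish c = pathstart c & path_image c = \<Gamma> U" using sp im lp by blast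
 show "compact (\<Gamma> U)" "connected (\<Gamma> U)" using compact_simple_path_image[OF sp] connected_simple_path_image[OF sp] im by auto
qed

lemma Gamma_disj: "U \<in> comps ==> V \<in> comps ==> U ~= V ==> \<Gamma> U \<inter> \<Gamma> V = {}" using bd_disj Gamma_props(3) by blast

lemma F_funpow_K: "z \<in> K ==> (F ^^ n) (stereo z) = stereo ((f ^^ n) z)" using K_funpow_nz by (simp add: F_funpow_stereo)

lemma Gamma_forward: "U \<in> comps ==> \<exists>V\<in>comps. (f ^^ n) ` \<Gamma> U <= \<Gamma> V"
proof (induction n)
 case 0 thus ?case by auto
next
 case (Suc n)
 then obtain V where V: "V \<in> comps" "(f ^^ n) ` \<Gamma> U <= \<Gamma> V" by blast
 obtain V' where V': "V' \<in> comps" "F ` sbdry V <= sbdry V'" using F_comp[OF V(1)] by blast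
 have "f z \<in> \<Gamma> V'" if z: "z \<in> \<Gamma> V" for z
 proof -
  have "z ~= 0" using z Gamma_props(1)[OF V(1)] K_props(1) by blast
  hence "F (stereo z) = stereo (f z)" by (simp add: F_stereo)
  moreover have "F (stereo z) \<in> sbdry V'" using z Gamma_props(3)[OF V(1)] V'(2) by blast
  ultimately show ?thesis using Gamma_props(3)[OF V'(1)] by simp
 qed
 hence "(f ^^ Suc n) ` \<Gamma> U <= \<Gamma> V'" using V(2) by auto
 thus ?case using V'(1) by blast
qed

lemma Gamma_lift:
 assumes T: "connected T" "(f ^^ n) ` T <= \<Gamma> V" "T \<inter> \<Gamma> U ~= {}" and UV: "U \<in> comps" "V \<in> comps"
 shows "T <= \<Gamma> U"
proof -
 have TK: "T <= K" using T(2) Gamma_props(1)[OF UV(2)] K_funpow_backward by blast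
 have "stereo ` T <= sbdry U"
 proof (rule lift_in_boundary[of _ n V U])
  show "connected (stereo ` T)" by (intro connected_continuous_image continuous_stereo T(1))
  show "stereo ` T <= J" using TK by (auto simp: J_def)
  show "(F ^^ n) ` stereo ` T <= sbdry V"
  proof
   fix y assume "y \<in> (F ^^ n) ` stereo ` T"
   then obtain z where z: "z \<in> T" "y = (F ^^ n) (stereo z)" by blast
   have "y = stereo ((f ^^ n) z)" using z TK F_funpow_K by blast
   thus "y \<in> sbdry V" using z(1) T(2) Gamma_props(3)[OF UV(2)] by blast
  qed
  show "stereo ` T \<inter> sbdry U ~= {}" using T(3) Gamma_props(3)[OF UV(1)] by blast
 qed (use UV in auto)
 thus ?thesis using Gamma_props(3)[OF UV(1)] by blast
qed

lemma dist_stereo_K: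
 assumes "x \<in> K" "y \<in> K"
 shows "2 * dist x y <= (R\<^sup>2 + 1) * dist (stereo x) (stereo y)"
proof -
 have s: "sroot z <= sqrt (R\<^sup>2 + 1)" if "z \<in> K" for z using K_props(2)[OF that] by (intro real_sqrt_le_mono add_right_mono power_mono) auto
 have "sroot x * sroot y <= sqrt (R\<^sup>2 + 1) * sqrt (R\<^sup>2 + 1)" using s assms by (intro mult_mono) auto
 also have "\<dots> = R\<^sup>2 + 1" by simp
 finally have "dist (stereo x) (stereo y) * (sroot x * sroot y) <= dist (stereo x) (stereo y) * (R\<^sup>2 + 1)" by (intro mult_left_mono) auto
 moreover have "dist (stereo x) (stereo y) * (sroot x * sroot y) = 2 * dist x y" unfolding dist_stereo using sroot_ge(3)[of x] sroot_ge(3)[of y] by (simp add: dist_norm)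
 ultimately show ?thesis by (simp add: mult.commute)
qed

lemma Gamma_big_finite: "c > 0 ==> finite {U \<in> comps. \<exists>x\<in>\<Gamma> U. \<exists>y\<in>\<Gamma> U. c <= dist x y}"
proof (rule finite_subset)
 assume c: "c > 0"
 have R1: "R\<^sup>2 + 1 > 0" by (simp add: add_nonneg_pos)
 show "finite {U \<in> comps. \<exists>x\<in>sbdry U. \<exists>y\<in>sbdry U. 2 * c / (R\<^sup>2 + 1) <= dist x y}" using c R1 by (intro bd_big_finite) simp
 show "{U \<in> comps. \<exists>x\<in>\<Gamma> U. \<exists>y\<in>\<Gamma> U. c <= dist x y} <= {U \<in> comps. \<exists>x\<in>sbdry U. \<exists>y\<in>sbdry U. 2 * c / (R\<^sup>2 + 1) <= dist x y}"
 proof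
  fix U assume "U \<in> {U \<in> comps. \<exists>x\<in>\<Gamma> U. \<exists>y\<in>\<Gamma> U. c <= dist x y}"
  then obtain x y where U: "U \<in> comps" and xy: "x \<in> \<Gamma> U" "y \<in> \<Gamma> U" "c <= dist x y" by blast
  have "2 * dist x y <= (R\<^sup>2 + 1) * dist (stereo x) (stereo y)" using xy Gamma_props(1)[OF U] by (intro dist_stereo_K) auto
  hence "2 * c / (R\<^sup>2 + 1) <= dist (stereo x) (stereo y)" using xy(3) R1 by (simp add: pos_divide_le_eq mult.commute)
  thus "U \<in> {U \<in> comps. \<exists>x\<in>sbdry U. \<exists>y\<in>sbdry U. 2 * c / (R\<^sup>2 + 1) <= dist x y}" using U xy Gamma_props(3)[OF U] by blast
 qed
qed

text \<open>Only finitely many curves have diameter at least e, and each of these has its own \<eta>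
  by \<open>small_arc\<close>; for all others the whole curve serves as the connected part.\<close>

lemma uniformly_locally_connected:
 assumes e: "e > 0"
 shows "\<exists>\<eta>>0. \<forall>V\<in>comps. \<forall>x\<in>\<Gamma> V. \<forall>y\<in>\<Gamma> V. dist x y <= \<eta> --> (\<exists>s\<subseteq>\<Gamma> V. connected s & x \<in> s & y \<in> s & (\<forall>u\<in>s. dist x u < e))"
proof -
 define P where "P V \<eta> \<longleftrightarrow> (\<forall>x\<in>\<Gamma> V. \<forall>y\<in>\<Gamma> V. dist x y <= \<eta> --> (\<exists>s\<subseteq>\<Gamma> V. connected s & x \<in> s & y \<in> s & (\<forall>u\<in>s. dist x u < e)))" for V \<eta>
 define Q where "Q = {U \<in> comps. \<exists>x\<in>\<Gamma> U. \<exists>y\<in>\<Gamma> U. e <= dist x y}"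
 have "\<exists>\<eta>>0. \<forall>V\<in>Q. P V \<eta>"
 proof (rule finite_uniform)
  show "finite Q" unfolding Q_def by (rule Gamma_big_finite[OF e])
  fix V assume "V \<in> Q"
  hence V: "V \<in> comps" by (simp add: Q_def)
  obtain c where c: "simple_path c" "pathfinish c = pathstart c" "path_image c = \<Gamma> V" using Gamma_props(4)[OF V] by blast
  interpret jl: jordan_loop c using c by unfold_locales
  have G: "jl.G = \<Gamma> V" by (simp add: jl.G_def c(3))
  from jl.small_arc[OF e, unfolded G] obtain \<eta> where eta: "\<eta> > 0" "\<forall>T\<subseteq>\<Gamma> V. T ~= {} --> (\<forall>x\<in>T. \<forall>y\<in>T. dist x y <= \<eta>) -->
    (\<exists>b\<subseteq>\<Gamma> V. connected b & compact b & T <= b & (\<forall>x\<in>b. \<forall>y\<in>b. dist x y < e))" by (elim exE conjE)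
  have "P V \<eta>" unfolding P_def
  proof (intro ballI impI)
   fix x y assume xy: "x \<in> \<Gamma> V" "y \<in> \<Gamma> V" "dist x y <= \<eta>"
   have a: "{x, y} <= \<Gamma> V" "{x, y} ~= {}" "\<forall>u\<in>{x,y}. \<forall>v\<in>{x,y}. dist u v <= \<eta>" using xy eta(1) by (auto simp: dist_commute)
   obtain b where b: "b <= \<Gamma> V" "connected b" "{x, y} <= b" "\<forall>x\<in>b. \<forall>y\<in>b. dist x y < e" using eta(2)[THEN spec, THEN mp, OF a(1), THEN mp, OF a(2), THEN mp, OF a(3)] by (elim exE conjE)
   thus "\<exists>s\<subseteq>\<Gamma> V. connected s & x \<in> s & y \<in> s & (\<forall>u\<in>s. dist x u < e)" by (intro exI[of _ b]) auto
  qed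
  thus "\<exists>\<eta>>0. P V \<eta>" using eta(1) by blast
 next
  fix V \<eta> \<eta>' assume "P V \<eta>" "\<eta>' <= \<eta>"
  thus "P V \<eta>'" unfolding P_def by (meson order_trans)
 qed
 then obtain \<eta> where eta: "\<eta> > 0" "\<forall>V\<in>Q. P V \<eta>" by blast
 have "P V \<eta>" if V: "V \<in> comps" for V
 proof (cases "V \<in> Q")
  case False
  hence "\<forall>x\<in>\<Gamma> V. \<forall>y\<in>\<Gamma> V. dist x y < e" using V unfolding Q_def by (simp add: not_le)
  thus ?thesis unfolding P_def using Gamma_props(6)[OF V] by (intro ballI impI exI[of _ "\<Gamma> V"]) auto
 qed (use eta in blast)
 thus ?thesis using eta(1) unfolding P_def by blast
qed

text \<open>The inverse branch carries a connected part of the image curve to a connected set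
  through x, which \<open>Gamma_lift\<close> confines to the curve of x.\<close>

lemma elevates_arc:
 assumes U: "U \<in> comps" and V: "V \<in> comps" and xy: "x \<in> \<Gamma> U"
  and g: "continuous_on (ball ((f ^^ n) x) e) g" "!!u. u \<in> ball ((f ^^ n) x) e ==> (f ^^ n) (g u) = u" "g ((f ^^ n) x) = x" "g ((f ^^ n) y) = y"
  and s: "connected s" "s <= \<Gamma> V" "(f ^^ n) x \<in> s" "(f ^^ n) y \<in> s" "!!u. u \<in> s ==> dist ((f ^^ n) x) u < e"
 shows "connected (g ` s)" "g ` s <= \<Gamma> U" "x \<in> g ` s" "y \<in> g ` s"
proof -
 have sb: "s <= ball ((f ^^ n) x) e" using s(5) by auto
 show con: "connected (g ` s)" by (rule connected_continuous_image[OF continuous_on_subset[OF g(1) sb] s(1)])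
 show xs: "x \<in> g ` s" using s(3) g(3) by (metis image_eqI)
 show "y \<in> g ` s" using s(4) g(4) by (metis image_eqI)
 have "(f ^^ n) (g u) = u" if "u \<in> s" for u using g(2) sb that by blast
 hence "(f ^^ n) ` g ` s <= \<Gamma> V" using s(2) by auto
 thus "g ` s <= \<Gamma> U" using xs xy by (intro Gamma_lift[OF con _ _ U V]) auto
qed

text \<open>For x and y close together, elevate at scale \<rho> = A |x - y|, take a connected part
  of diameter comparable to e in the image curve and pull it back. Its diameter is comparable to |x
  - y|. For distant points the whole curve suffices.\<close>

theorem uniform_bounded_turning: "\<exists>C0\<ge>1. \<forall>U\<in>comps. bounded_turning C0 (\<Gamma> U)"
proof -
 obtain \<rho>0 L e where el: "\<rho>0 > 0" "L >= 1" "e > 0" "elevates \<rho>0 L e" using elevator by blast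
 obtain \<eta> where eta: "\<eta> > 0" "!!V x y. V \<in> comps ==> x \<in> \<Gamma> V ==> y \<in> \<Gamma> V ==> dist x y <= \<eta> ==>
   (\<exists>s\<subseteq>\<Gamma> V. connected s & x \<in> s & y \<in> s & (\<forall>u\<in>s. dist x u < e))" using uniformly_locally_connected[OF el(3)] by blast
 \<comment> \<open>The images of x and y are at distance at most L / A, and A is so large that this
   is at most \<eta>.\<close>
 define A where "A = 2 + L / \<eta>"
 have A: "A > 1" "L / A <= \<eta>"
 proof -
  have "L / \<eta> > 0" using el(2) eta(1) by simp
  thus A1: "A > 1" by (simp add: A_def)
  have "L = (L / \<eta>) * \<eta>" using eta(1) by simp
  also have "\<dots> <= A * \<eta>" using eta(1) by (intro mult_right_mono) (auto simp: A_def)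
  finally show "L / A <= \<eta>" using A1 by (simp add: pos_divide_le_eq mult.commute)
 qed
 \<comment> \<open>The second term is for elevated pairs; the third is for \<rho> >= \<rho>0, where
   the diameter bound 2 R of K is used.\<close>
 define C0 where "C0 = max 1 (max (2 * (L * A * e)) (2 * R * A / \<rho>0))"
 have C0: "C0 >= 1" "2 * (L * A * e) <= C0" "2 * R * A / \<rho>0 <= C0" by (auto simp: C0_def)
 have "bounded_turning C0 (\<Gamma> U)" if U: "U \<in> comps" for U unfolding bounded_turning_def
 proof (intro ballI)
  fix x y assume xy: "x \<in> \<Gamma> U" "y \<in> \<Gamma> U"
  have xK: "x \<in> K" using xy Gamma_props(1)[OF U] by blast
  show "\<exists>S. connected S & S <= \<Gamma> U & x \<in> S & y \<in> S & (\<forall>u\<in>S. \<forall>v\<in>S. dist u v <= C0 * dist x y)"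
  proof (cases "x = y")
   case True
   thus ?thesis using xy by (intro exI[of _ "{x}"]) auto
  next
   case False
   define d where "d = dist x y"
   have d: "d > 0" using False by (simp add: d_def)
   define \<rho> where "\<rho> = A * d"
   have \<rho>: "\<rho> > 0" "d < \<rho>" using d A(1) by (auto simp: \<rho>_def)
   show ?thesis
   proof (cases "\<rho> < \<rho>0")
    case True
    then obtain n g where g: "continuous_on (ball ((f ^^ n) x) e) g"
     "!!u. u \<in> ball ((f ^^ n) x) e ==> (f ^^ n) (g u) = u" "!!u. u \<in> ball ((f ^^ n) x) e ==> cmod (g u - x) <= L * \<rho> * cmod (u - (f ^^ n) x)"
     "!!w. cmod (w - x) < \<rho> ==> g ((f ^^ n) w) = w" "!!w. cmod (w - x) < \<rho> ==> cmod ((f ^^ n) w - (f ^^ n) x) <= L * cmod (w - x) / \<rho>"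
     using el(4) xK \<rho>(1) unfolding elevates_def by blast
    obtain V where V: "V \<in> comps" "(f ^^ n) ` \<Gamma> U <= \<Gamma> V" using Gamma_forward[OF U] by blast
    have yx: "cmod (y - x) = d" by (simp add: d_def dist_norm norm_minus_commute)
    have "L * d / \<rho> = L / A" using d by (simp add: \<rho>_def)
    hence le: "dist ((f ^^ n) x) ((f ^^ n) y) <= \<eta>" using g(5)[of y] yx \<rho>(2) A(2) by (simp add: dist_norm norm_minus_commute)
    have inV: "(f ^^ n) x \<in> \<Gamma> V" "(f ^^ n) y \<in> \<Gamma> V" using V(2) xy by auto
    obtain s where s: "s <= \<Gamma> V" "connected s" "(f ^^ n) x \<in> s" "(f ^^ n) y \<in> s" "!!u. u \<in> s ==> dist ((f ^^ n) x) u < e"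
     using eta(2)[OF V(1) inV le] by (elim exE conjE) blast
    have gx: "g ((f ^^ n) x) = x" "g ((f ^^ n) y) = y" using g(4)[of x] g(4)[of y] yx \<rho> by auto
    note E = elevates_arc[OF U V(1) xy(1) g(1,2) gx s(2,1,3,4,5)]
    have near: "dist (g u) x <= L * A * e * d" if "u \<in> s" for u
    proof -
     have u: "dist ((f ^^ n) x) u < e" using s(5)[OF that] .
     have "dist (g u) x <= L * \<rho> * cmod (u - (f ^^ n) x)" using g(3)[of u] u by (simp add: dist_norm)
     also have "\<dots> <= L * \<rho> * e" using u el(2) \<rho>(1) by (intro mult_left_mono) (auto simp: dist_norm norm_minus_commute)
     finally show ?thesis by (simp add: \<rho>_def mult_ac)
    qed
    have "dist u v <= C0 * dist x y" if "u \<in> g ` s" "v \<in> g ` s" for u v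
    proof -
     have "dist u x <= L * A * e * d" "dist v x <= L * A * e * d" using that near by auto
     hence "dist u v <= 2 * (L * A * e) * d" using dist_triangle2[of u v x] by linarith
     also have "\<dots> <= C0 * d" using C0(2) d by (intro mult_right_mono) auto
     finally show ?thesis by (simp add: d_def)
    qed
    thus ?thesis using E by blast
   next
    case False
    have "dist u v <= C0 * dist x y" if "u \<in> \<Gamma> U" "v \<in> \<Gamma> U" for u v
    proof -
     have "u \<in> K" "v \<in> K" using that Gamma_props(1)[OF U] by auto
     hence "dist u v <= 2 * R" using K_props(2)[of u] K_props(2)[of v] norm_triangle_ineq4[of u v] by (simp add: dist_norm)
     also have "\<dots> = (2 * R / \<rho>0) * \<rho>0" using el(1) by simp
     also have "\<dots> <= (2 * R / \<rho>0) * \<rho>" using False el(1) R3 by (intro mult_left_mono) auto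
     also have "\<dots> = (2 * R * A / \<rho>0) * d" by (simp add: \<rho>_def)
     also have "\<dots> <= C0 * d" using C0(3) d by (intro mult_right_mono) auto
     finally show ?thesis by (simp add: d_def)
    qed
    thus ?thesis using xy Gamma_props(6)[OF U] by blast
   qed
  qed
 qed
 thus ?thesis using C0(1) by blast
qed

text \<open>If both curves are large compared with |x - y|, each has a point at distance \<rho> / 2
  from x. After elevation their images lie on large curves that come close, and as only finitely
  many curves are large these coincide. An arc of that curve, pulled back, puts y on the curve of
  x.\<close>

theorem uniform_separation:
 "\<exists>s>0. \<forall>U\<in>comps. \<forall>V\<in>comps. U ~= V --> (\<forall>x\<in>\<Gamma> U. \<forall>y\<in>\<Gamma> V.
   (\<forall>u\<in>\<Gamma> U. \<forall>v\<in>\<Gamma> U. s * dist u v <= dist x y) \<or> (\<forall>u\<in>\<Gamma> V. \<forall>v\<in>\<Gamma> V. s * dist u v <= dist x y))"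
proof -
 obtain \<rho>0 L e where el: "\<rho>0 > 0" "L >= 1" "e > 0" "elevates \<rho>0 L e" using elevator by blast
 obtain \<eta> where eta: "\<eta> > 0" "!!V x y. V \<in> comps ==> x \<in> \<Gamma> V ==> y \<in> \<Gamma> V ==> dist x y <= \<eta> ==>
   (\<exists>s\<subseteq>\<Gamma> V. connected s & x \<in> s & y \<in> s & (\<forall>u\<in>s. dist x u < e))" using uniformly_locally_connected[OF el(3)] by blast
 define Q where "Q = {U \<in> comps. \<exists>x\<in>\<Gamma> U. \<exists>y\<in>\<Gamma> U. 1 / (4 * L) <= dist x y}"
 have fQ: "finite Q" unfolding Q_def using el(2) by (intro Gamma_big_finite) simp
 define P where "P = (%(U, V) \<eta>. \<forall>x\<in>\<Gamma> U. \<forall>y\<in>\<Gamma> V. (\<eta>::real) < dist x y)"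
 have "\<exists>\<eta>>0. \<forall>p\<in>{(U, V). U \<in> Q & V \<in> Q & U ~= V}. P p \<eta>"
 proof (rule finite_uniform)
  show "finite {(U, V). U \<in> Q & V \<in> Q & U ~= V}" by (rule finite_subset[of _ "Q \<times> Q"]) (use fQ in auto)
  fix p assume "p \<in> {(U, V). U \<in> Q & V \<in> Q & U ~= V}"
  then obtain U V where p: "p = (U, V)" "U \<in> comps" "V \<in> comps" "U ~= V" by (auto simp: Q_def)
  obtain d where d: "d > 0" "!!x y. x \<in> \<Gamma> U ==> y \<in> \<Gamma> V ==> d <= dist x y"
   using separate_compact_closed[OF Gamma_props(5)[OF p(2)] compact_imp_closed[OF Gamma_props(5)[OF p(3)]] Gamma_disj[OF p(2-4)]] by blast
  have "P p (d / 2)" unfolding P_def p(1) prod.case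
  proof (intro ballI)
   fix x y assume "x \<in> \<Gamma> U" "y \<in> \<Gamma> V"
   thus "d / 2 < dist x y" using d(1) d(2)[of x y] by linarith
  qed
  thus "\<exists>\<eta>>0. P p \<eta>" using d(1) half_gt_zero by blast
 next
  fix p \<eta> \<eta>' assume "P p \<eta>" "\<eta>' <= \<eta>"
  thus "P p \<eta>'" unfolding P_def by (cases p) (auto intro: le_less_trans)
 qed
 then obtain \<eta>1 where eta1: "\<eta>1 > 0" "!!U V x y. [|U \<in> Q; V \<in> Q; U ~= V; x \<in> \<Gamma> U; y \<in> \<Gamma> V|] ==> \<eta>1 < dist x y"
  unfolding P_def by auto
 \<comment> \<open>Below \<eta> there is a connecting arc, below \<eta>1 two large curves must
   coincide, and 1 / (4 L) keeps the second curve large when its diameter is measured from the image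
   of y instead of x.\<close>
 define \<eta>2 where "\<eta>2 = min \<eta> (min \<eta>1 (1 / (4 * L)))"
 have eta2: "\<eta>2 > 0" "\<eta>2 <= \<eta>" "\<eta>2 <= \<eta>1" "\<eta>2 <= 1 / (4 * L)" using eta(1) eta1(1) el(2) by (auto simp: \<eta>2_def)
 define A where "A = 2 + L / \<eta>2"
 have A: "A > 2" "L / A <= \<eta>2"
 proof -
  have "L / \<eta>2 > 0" using el(2) eta2(1) by simp
  thus A1: "A > 2" by (simp add: A_def)
  have "L = (L / \<eta>2) * \<eta>2" using eta2(1) by simp
  also have "\<dots> <= A * \<eta>2" using eta2(1) by (intro mult_right_mono) (auto simp: A_def)
  finally show "L / A <= \<eta>2" using A1 by (simp add: pos_divide_le_eq mult.commute)
 qed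
 \<comment> \<open>The first bound is for a curve within distance \<rho> / 2 of x, so of diameter at
   most A |x - y|; the second is for \<rho> >= \<rho>0, where the diameter is at most 2 R.\<close>
 define s where "s = min (1 / (4 * A)) (\<rho>0 / (2 * R * A))"
 have s: "s > 0" "s <= 1 / (4 * A)" "s <= \<rho>0 / (2 * R * A)" using A(1) el(1) R3 by (auto simp: s_def)
 show ?thesis
 proof (intro exI[of _ s] conjI ballI impI s(1))
  fix U V x y assume U: "U \<in> comps" and V: "V \<in> comps" and UV: "U ~= V" and x: "x \<in> \<Gamma> U" and y: "y \<in> \<Gamma> V"
  have xK: "x \<in> K" using x Gamma_props(1)[OF U] by blast
  define d where "d = dist x y"
  have "x ~= y" using x y Gamma_disj[OF U V UV] by blast
  hence d: "d > 0" by (simp add: d_def)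
  define \<rho> where "\<rho> = A * d"
  have \<rho>: "\<rho> > 0" "2 * d < \<rho>" using d A(1) by (auto simp: \<rho>_def)
  show "(\<forall>u\<in>\<Gamma> U. \<forall>v\<in>\<Gamma> U. s * dist u v <= dist x y) \<or> (\<forall>u\<in>\<Gamma> V. \<forall>v\<in>\<Gamma> V. s * dist u v <= dist x y)"
  proof (cases "\<rho> < \<rho>0")
   case False
   have "s * dist u v <= dist x y" if "u \<in> \<Gamma> U" "v \<in> \<Gamma> U" for u v
   proof -
    have "u \<in> K" "v \<in> K" using that Gamma_props(1)[OF U] by auto
    hence "dist u v <= 2 * R" using K_props(2)[of u] K_props(2)[of v] norm_triangle_ineq4[of u v] by (simp add: dist_norm)
    hence "s * dist u v <= (\<rho>0 / (2 * R * A)) * (2 * R)" using s(1,3) el(1) A(1) R3 by (intro mult_mono) auto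
    also have "\<dots> = \<rho>0 / A" using R3 by simp
    also have "\<dots> <= d" using False A(1) by (simp add: \<rho>_def pos_divide_le_eq mult.commute)
    finally show ?thesis by (simp add: d_def)
   qed
   thus ?thesis by blast
  next
   case True
   then obtain n g where g: "continuous_on (ball ((f ^^ n) x) e) g"
    "!!u. u \<in> ball ((f ^^ n) x) e ==> (f ^^ n) (g u) = u"
    "!!w. cmod (w - x) < \<rho> ==> g ((f ^^ n) w) = w" "!!w. cmod (w - x) < \<rho> ==> cmod ((f ^^ n) w - (f ^^ n) x) <= L * cmod (w - x) / \<rho>"
    "!!w. cmod (w - x) < \<rho> ==> cmod (w - x) / (L * \<rho>) <= cmod ((f ^^ n) w - (f ^^ n) x)" using el(4) xK \<rho>(1) unfolding elevates_def by blast
   obtain U' where U': "U' \<in> comps" "(f ^^ n) ` \<Gamma> U <= \<Gamma> U'" using Gamma_forward[OF U] by blast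
   obtain V' where V': "V' \<in> comps" "(f ^^ n) ` \<Gamma> V <= \<Gamma> V'" using Gamma_forward[OF V] by blast
   have yx: "cmod (y - x) = d" by (simp add: d_def dist_norm norm_minus_commute)
   have "L * d / \<rho> = L / A" using d by (simp add: \<rho>_def)
   hence xy': "dist ((f ^^ n) x) ((f ^^ n) y) <= \<eta>2" using g(4)[of y] yx \<rho> A(2) by (simp add: dist_norm norm_minus_commute)
   have far: "1 / (2 * L) <= dist ((f ^^ n) x) ((f ^^ n) w)" if "dist x w = \<rho> / 2" for w
   proof -
    have w: "cmod (w - x) = \<rho> / 2" using that by (simp add: dist_norm norm_minus_commute)
    have "1 / (2 * L) = cmod (w - x) / (L * \<rho>)" unfolding w using \<rho>(1) el(2) by simp
    also have "\<dots> <= cmod ((f ^^ n) w - (f ^^ n) x)" using w \<rho>(1) by (intro g(5)) simp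
    finally show ?thesis by (simp add: dist_norm norm_minus_commute)
   qed
   have big: "s * dist u v <= dist x y" if "\<not> (\<exists>w\<in>\<Gamma> X. dist x w = \<rho> / 2)" "X \<in> comps" "z \<in> \<Gamma> X" "dist x z <= d" "u \<in> \<Gamma> X" "v \<in> \<Gamma> X" for X z u v
   proof -
    have "dist x w <= \<rho> / 2" if "w \<in> \<Gamma> X" for w
     using connected_at_distance[OF Gamma_props(6)[OF \<open>X \<in> comps\<close>] continuous_on_id \<open>z \<in> \<Gamma> X\<close> that, of x "\<rho> / 2"] \<open>\<not> (\<exists>w\<in>\<Gamma> X. dist x w = \<rho> / 2)\<close> \<open>dist x z <= d\<close> \<rho> by fastforce
    hence "dist x u <= \<rho> / 2" "dist x v <= \<rho> / 2" using that by auto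
    hence "dist u v <= \<rho>" using dist_triangle3[of u v x] by linarith
    hence "s * dist u v <= 1 / (4 * A) * \<rho>" using s(1,2) A(1) by (intro mult_mono) auto
    also have "\<dots> <= d" using A(1) d by (simp add: \<rho>_def)
    finally show ?thesis by (simp add: d_def)
   qed
   show ?thesis
   proof (rule ccontr)
    assume neg: "\<not> ?thesis"
    obtain w1 where w1: "w1 \<in> \<Gamma> U" "dist x w1 = \<rho> / 2" using neg big[OF _ U x] d by fastforce
    obtain w2 where w2: "w2 \<in> \<Gamma> V" "dist x w2 = \<rho> / 2" using neg big[OF _ V y] by (fastforce simp: d_def)
    have L0: "1 / (4 * L) <= 1 / (2 * L)" "1 / (2 * L) = 1 / (4 * L) + 1 / (4 * L)" using el(2) by (auto simp: field_simps)
    have in': "(f ^^ n) x \<in> \<Gamma> U'" "(f ^^ n) w1 \<in> \<Gamma> U'" "(f ^^ n) y \<in> \<Gamma> V'" "(f ^^ n) w2 \<in> \<Gamma> V'" using U'(2) V'(2) x y w1 w2 by auto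
    have "U' \<in> Q" unfolding Q_def using U'(1) in'(1,2) far[OF w1(2)] L0(1) order_trans by blast
    moreover have "V' \<in> Q"
    proof -
     have "1 / (4 * L) <= dist ((f ^^ n) y) ((f ^^ n) w2)" using far[OF w2(2)] xy' eta2(4) L0(2) dist_triangle[of "(f ^^ n) x" "(f ^^ n) w2" "(f ^^ n) y"] by linarith
     thus ?thesis unfolding Q_def using V'(1) in'(3,4) by blast
    qed
    ultimately have eq: "U' = V'" using eta1(2)[of U' V' "(f ^^ n) x" "(f ^^ n) y"] in' xy' eta2(3) by fastforce
    have le: "dist ((f ^^ n) x) ((f ^^ n) y) <= \<eta>" using xy' eta2(2) by linarith
    have iny: "(f ^^ n) y \<in> \<Gamma> U'" using in'(3) eq by simp
    obtain t where t: "t <= \<Gamma> U'" "connected t" "(f ^^ n) x \<in> t" "(f ^^ n) y \<in> t" "!!u. u \<in> t ==> dist ((f ^^ n) x) u < e"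
     using eta(2)[OF U'(1) in'(1) iny le] by (elim exE conjE) blast
    have gx: "g ((f ^^ n) x) = x" "g ((f ^^ n) y) = y" using g(3)[of x] g(3)[of y] yx \<rho> d by auto
    have "y \<in> \<Gamma> U" using elevates_arc[OF U U'(1) x g(1,2) gx t(2,1,3,4,5)] by blast
    thus False using y Gamma_disj[OF U V UV] by blast
   qed
  qed
 qed
qed

end

theorem theorem2p11:
  fixes l m :: nat and lam :: complex
  assumes "l \<ge> 2" and "m \<ge> 2"
    and "1 / real l + 1 / real m < 1"
    and "lam \<noteq> 0"
    and escaping: "\<And>\<omega>. \<omega> ^ (l + m) = lam * of_nat l / of_nat m \<Longrightarrow>
                 (\<lambda>n. (flam lam l m ^^ n) (stereo \<omega>)) \<longlonglongrightarrow> Npole"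
    and carpet: "sierpinski_carpet (julia_set (flam lam l m))"
  shows "\<exists>K\<ge>1.
           (\<forall>U\<in>fatou_components (flam lam l m). quasicircle K (sbdry U)) \<and>
           (\<exists>s>0. \<forall>U\<in>fatou_components (flam lam l m). \<forall>V\<in>fatou_components (flam lam l m).
              U \<noteq> V \<longrightarrow>
              (\<forall>x\<in>sbdry U. \<forall>y\<in>sbdry V.
                 sdist x y \<ge> s * min (sdiam (sbdry U)) (sdiam (sbdry V))))"
proof -
 interpret s: singular_map l m lam using assms by unfold_locales
 interpret e: escaping_map l m lam
 proof
  \<comment> \<open>Orbits in K stay within modulus R, so they cannot converge to
    \<open>Npole\<close>.\<close>
  have False if w: "\<omega> \<in> s.critical" "\<omega> \<in> s.K" for \<omega>
  proof -
   have lim0: "(%n. (flam lam l m ^^ n) (stereo \<omega>)) \<longlonglongrightarrow> Npole" using w(1) by (intro escaping) (simp add: s.critical_def)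
   have st: "flam lam l m (stereo z) = stereo (s.f z)" if "z ~= 0" for z using that by (simp add: flam_def s.f_def)
   have "(flam lam l m ^^ n) (stereo \<omega>) = stereo ((s.f ^^ n) \<omega>)" for n
   proof (induction n)
    case (Suc n)
    have "(s.f ^^ n) \<omega> ~= 0" using s.K_funpow_nz[OF w(2)] .
    thus ?case using Suc st by simp
   qed simp
   hence lim: "(%n. stereo ((s.f ^^ n) \<omega>)) \<longlonglongrightarrow> Npole" using lim0 by simp
   obtain \<delta> where d: "\<delta> > 0" "!!z. dist (stereo z) Npole < \<delta> ==> s.R < cmod z" using near_Npole_large by blast
   have "\<forall>\<^sub>F n in sequentially. dist (stereo ((s.f ^^ n) \<omega>)) Npole < \<delta>" by (rule tendstoD[OF lim d(1)])
   then obtain n where "dist (stereo ((s.f ^^ n) \<omega>)) Npole < \<delta>" by (auto dest: eventually_happens)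
   thus False using d(2) s.K_props(2)[OF s.K_funpow[OF w(2)], of n] by fastforce
  qed
  thus "s.critical \<inter> s.K = {}" by blast
 qed
 obtain D :: "nat => (real^3) set" where D: "!!i. jordan_region (D i)" "e.J = S2 - (\<Union>i. D i)"
   "!!i j. i ~= j ==> sbdry (D i) \<inter> sbdry (D j) = {}" "(%i. sdiam (sbdry (D i))) \<longlonglongrightarrow> 0"
  using carpet unfolding sierpinski_carpet_def e.julia_set_F by (elim conjE exE) blast
 interpret c: julia_carpet l m lam D
 proof
  obtain a b where "a \<in> s.K" "b \<in> s.K" "a ~= b" using e.K_two_points by blast
  thus "\<exists>a\<in>e.J. \<exists>b\<in>e.J. a ~= b" using e.J_props(5) unstereo_stereo by metis
 qed (use D in auto)
 have comps: "fatou_components (flam lam l m) = c.comps" by (simp add: fatou_components_def c.comps_def e.fatou_set_F)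
 obtain C0 where C0: "C0 >= 1" "!!U. U \<in> c.comps ==> bounded_turning C0 (c.\<Gamma> U)" using c.uniform_bounded_turning by blast
 obtain K where K: "K >= 1" "!!c. [|simple_path c; pathfinish c = pathstart c; bounded_turning C0 (path_image c)|] ==> quasicircle K (stereo ` path_image c)"
  using bounded_turning_quasicircle[OF C0(1)] by blast
 have quasi: "quasicircle K (sbdry U)" if U: "U \<in> c.comps" for U
 proof -
  obtain \<gamma> where "simple_path \<gamma>" "pathfinish \<gamma> = pathstart \<gamma>" "path_image \<gamma> = c.\<Gamma> U" using c.Gamma_props(4)[OF U] by blast
  thus ?thesis using K(2)[of \<gamma>] C0(2)[OF U] c.Gamma_props(2)[OF U] by simp
 qed
 obtain s where s: "s > 0" "!!U V x y. [|U \<in> c.comps; V \<in> c.comps; U ~= V; x \<in> c.\<Gamma> U; y \<in> c.\<Gamma> V|] ==>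
   (\<forall>u\<in>c.\<Gamma> U. \<forall>v\<in>c.\<Gamma> U. s * dist u v <= dist x y) \<or> (\<forall>u\<in>c.\<Gamma> V. \<forall>v\<in>c.\<Gamma> V. s * dist u v <= dist x y)"
  using c.uniform_separation by meson
 \<comment> \<open>Conversion to the spherical metric: a spherical distance is at most 4 times the
   planar one, and on K at least 2 / (R^2 + 1) times it.\<close>
 define t where "t = s / (2 * (s.R\<^sup>2 + 1))"
 have R1: "s.R\<^sup>2 + 1 > 0" by (simp add: add_nonneg_pos)
 have t: "t > 0" using s(1) R1 by (simp add: t_def)
 have scale: "t * sdiam (sbdry W) <= B" if W: "W \<in> c.comps" and b: "!!u v. u \<in> c.\<Gamma> W ==> v \<in> c.\<Gamma> W ==> s * dist u v <= dist x y"
  and xy: "x \<in> s.K" "y \<in> s.K" and B: "B = sdist (stereo x) (stereo y)" for W x y B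
 proof -
  have "sdiam (sbdry W) <= B / t"
  proof (rule sdiam_le)
   show "sbdry W ~= {}" by (rule c.comp_props(9)[OF W])
   fix p q assume pq: "p \<in> sbdry W" "q \<in> sbdry W"
   then obtain u v where uv: "u \<in> c.\<Gamma> W" "p = stereo u" "v \<in> c.\<Gamma> W" "q = stereo v" using c.Gamma_props(2)[OF W] by blast
   have "sdist p q <= 2 * dist p q" unfolding uv by (rule sdist_bounds(2)[OF stereo_S2 stereo_S2])
   also have "\<dots> <= 4 * dist u v" using dist_stereo_le[of u v] by (simp add: uv)
   finally have "t * sdist p q <= t * (4 * dist u v)" using t by (intro mult_left_mono) auto
   also have "\<dots> = 2 / (s.R\<^sup>2 + 1) * (s * dist u v)" unfolding t_def using R1 by (simp add: field_simps)
   also have "\<dots> <= 2 / (s.R\<^sup>2 + 1) * dist x y" using b[OF uv(1,3)] R1 by (intro mult_left_mono) auto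
   also have "\<dots> <= dist (stereo x) (stereo y)" using c.dist_stereo_K[OF xy] R1 by (simp add: divide_le_eq mult.commute)
   also have "\<dots> <= B" unfolding B by (rule sdist_bounds(1)[OF stereo_S2 stereo_S2])
   finally show "sdist p q <= B / t" using t by (simp add: pos_le_divide_eq mult.commute)
  qed
  thus ?thesis using t by (simp add: pos_le_divide_eq mult.commute)
 qed
 have sep: "t * min (sdiam (sbdry U)) (sdiam (sbdry V)) <= sdist x y"
  if UV: "U \<in> c.comps" "V \<in> c.comps" "U ~= V" and x: "x \<in> sbdry U" and y: "y \<in> sbdry V" for U V x y
 proof -
  obtain u where u: "u \<in> c.\<Gamma> U" "x = stereo u" using x c.Gamma_props(2)[OF UV(1)] by blast
  obtain v where v: "v \<in> c.\<Gamma> V" "y = stereo v" using y c.Gamma_props(2)[OF UV(2)] by blast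
  have uvK: "u \<in> s.K" "v \<in> s.K" using u v c.Gamma_props(1) UV by blast+
  have m: "t * min a b <= t * a" "t * min a b <= t * b" for a b using t by (auto intro: mult_left_mono)
  from s(2)[OF UV u(1) v(1)] show ?thesis
  proof
   assume "\<forall>u'\<in>c.\<Gamma> U. \<forall>v'\<in>c.\<Gamma> U. s * dist u' v' <= dist u v"
   hence "t * sdiam (sbdry U) <= sdist x y" by (intro scale[OF UV(1) _ uvK]) (use u v in auto)
   thus ?thesis using m(1) order_trans by blast
  next
   assume "\<forall>u'\<in>c.\<Gamma> V. \<forall>v'\<in>c.\<Gamma> V. s * dist u' v' <= dist u v"
   hence "t * sdiam (sbdry V) <= sdist x y" by (intro scale[OF UV(2) _ uvK]) (use u v in auto)
   thus ?thesis using m(2) order_trans by blast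
  qed
 qed
 show ?thesis unfolding comps using K(1) quasi t sep by blast
qed

end
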